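(* Let $\mathcal V$ be a finite-dimensional real vector space with a nondegenerate bilinear form $(p,q)\mapsto p\cdot q$, let $G=\mathbb H_{\mathcal V}$ be the corresponding Heisenberg group with its Schrödinger representation $\pi_{\mathcal V}\colon\mathbb H_{\mathcal V}\to\mathcal B(L^2(\mathcal V))$ and coadjoint orbit $\mathcal O$, and let $A\colon\mathcal V\times\mathcal V\to\mathcal O$ be the affine isomorphism $A(V)=\xi_0+\xi_0\circ\mathrm{ad}_{\mathfrak g}V$. Let $\pi_{\mathcal V\times\mathcal V}$ be the Schrödinger representation on $L^2(\mathcal V\times\mathcal V)$ of the Heisenberg group $\mathbb H_{\mathcal V\times\mathcal V}$ constructed from the nondegenerate bilinear form $(V,W)\mapsto-\omega_{\xi_0}(V,W)=-\langle\xi_0,[V,W]\rangle$ on $\mathcal V\times\mathcal V$. Then for all $r,s\in[1,\infty]$ the operator $f\mapsto f\circ A^{-1}$ induces an isomorphism from the modulation space $M^{r,s}(\pi_{\mathcal V\times\mathcal V})$ (which is the classical modulation space $M^{r,s}(\mathcal V\times\mathcal V)$ of time-frequency analysis) onto the modulation space of symbols $M^{r,s}(\pi_{\mathcal V}^{\#})$.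
   Context: **Heisenberg groups.** For a finite-dimensional real vector space $\mathcal V$ with nondegenerate bilinear form $p\cdot q$, $\mathfrak h_{\mathcal V}=\mathcal V\times\mathcal V\times\mathbb R$ with bracket $[(q,p,t),(q',p',t')]=(0,0,p'\cdot q-p\cdot q')$, and $\mathbb H_{\mathcal V}$ is $\mathfrak h_{\mathcal V}$ with multiplication $X\ast Y=X+Y+\frac12[X,Y]$ (so $\exp$ is the identity map). The Schrödinger representation is $(\pi_{\mathcal V}(q,p,t)f)(x)=e^{i(p\cdot x+\frac12p\cdot q+t)}f(x+q)$ on $L^2(\mathcal V)$; its smooth vectors form $\mathcal S(\mathcal V)$. Write $G=\mathbb H_{\mathcal V}$, $\mathfrak g=\mathfrak h_{\mathcal V}$. The coadjoint orbit of $\pi_{\mathcal V}$ is $\mathcal O=\{\xi\in\mathfrak g^*\mid\xi(0,0,1)=1\}$; $\xi_0\in\mathcal O$ is the functional with $\xi_0(q,p,0)=0$ for all $q,p$. The predual is $\mathfrak g_e=\mathcal V\times\mathcal V\times\{0\}$, identified with $\mathcal V\times\mathcal V$. $\mathcal S(\mathcal O)$, $\mathcal S'(\mathcal O)$ are the Schwartz space and tempered distributions on the affine space $\mathcal O$. **Modulation spaces for $\pi_{\mathcal V\times\mathcal V}$.** For $f\in\mathcal S'(\mathcal V\times\mathcal V)$ and a window $\phi\in\mathcal S(\mathcal V\times\mathcal V)\setminus\{0\}$, $(\mathcal A_\phi f)(X,Y)=(f\mid\pi_{\mathcal V\times\mathcal V}(X,Y,0)\phi)$ for $X,Y\in\mathcal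 V\times\mathcal V$, and $f\in M^{r,s}(\pi_{\mathcal V\times\mathcal V})$ iff $\bigl(\int(\int|(\mathcal A_\phi f)(X,Y)|^r\,dX)^{s/r}\,dY\bigr)^{1/s}<\infty$ (integrals over $\mathcal V\times\mathcal V$, usual conventions if $r$ or $s$ is $\infty$). **Modulation spaces of symbols.** For $a\in\mathcal S(\mathcal O)$, $\mathrm{Op}(a)=\int_{\mathfrak g_e}\widehat a(X)\pi_{\mathcal V}(\exp_GX)\,dX$ with $\widehat a(X)=\int_{\mathcal O}e^{-i\langle\xi,X\rangle}a(\xi)\,d\xi$, where $\mathcal O$ carries its canonical Liouville measure (normalized as in Kirillov's character formula) and $\mathfrak g_e$ the Lebesgue measure making $a\mapsto\widehat a$ unitary $L^2(\mathcal O)\to L^2(\mathfrak g_e)$; $\mathrm{Op}$ extends to a unitary operator from $L^2(\mathcal O)$ onto the Hilbert-Schmidt operators on $L^2(\mathcal V)$. $G\ltimes G$ is $G\times G$ with product $(g_1,g_2)(h_1,h_2)=(g_1h_1,h_1^{-1}g_2h_1h_2)$, and $\pi_{\mathcal V}^{\#}$ is its unitary irreducible representation on $L^2(\mathcal O)$ with $\mathrm{Op}(\pi_{\mathcal V}^{\#}(g,h)f)=\pi_{\mathcal V}(gh)\mathrm{Op}(f)\pi_{\mathcal V}(g)^{-1}$. For $X,Y\in\mathfrak g_e$, $\pi_{\mathcal V}^{\#}(\exp_{G\ltimes G}(X,Y))\Phi$ is the symbol of $\pi_{\mathcal V}(\exp_G(X+Y))\mathrm{Op}(\Phi)\pi_{\mathcal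 V}(\exp_GX)^{-1}$. For $F\in\mathcal S'(\mathcal O)$ and a window $\Phi\in\mathcal S(\mathcal O)\setminus\{0\}$, $(\mathcal A^{\#}_\Phi F)(X,Y)=\langle F,\overline{\pi_{\mathcal V}^{\#}(\exp_{G\ltimes G}(X,Y))\Phi}\rangle$, $X,Y\in\mathfrak g_e$, and $F\in M^{r,s}(\pi_{\mathcal V}^{\#})$ iff $\bigl(\int_{\mathfrak g_e}(\int_{\mathfrak g_e}|(\mathcal A^{\#}_\Phi F)(X,Y)|^r\,dX)^{s/r}\,dY\bigr)^{1/s}<\infty$. All these representations are square integrable modulo the center; the modulation spaces do not depend on the window (up to equivalence of norms), which is omitted from the notation. "Isomorphism" means isomorphism of normed spaces with respect to these norms, up to equivalence. *)

theory Defs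
  imports
    "HOL-Analysis.Analysis"
    "HOL-Probability.Essential_Supremum"
    "HOL-Combinatorics.Permutations"
    "HOL-Algebra.Group"
begin

section \<open>Schwartz functions and tempered distributions\<close>

definition dir_deriv :: "'a::euclidean_space \<Rightarrow> ('a \<Rightarrow> complex) \<Rightarrow> 'a \<Rightarrow> complex" where
  "dir_deriv v f = (\<lambda>x. frechet_derivative f (at x) v)"

definition iter_deriv :: "'a::euclidean_space list \<Rightarrow> ('a \<Rightarrow> complex) \<Rightarrow> 'a \<Rightarrow> complex" where
  "iter_deriv vs f = foldr dir_deriv vs f"

definition schwartz_space :: "('a::euclidean_space \<Rightarrow> complex) set" where
  "schwartz_space = {f. \<forall>vs \<in> lists Basis.
      (\<forall>x. iter_deriv vs f differentiable (at x)) \<and>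
      (\<forall>k::nat. bounded (range (\<lambda>x. (1 + norm x) ^ k *\<^sub>R iter_deriv vs f x)))}"

definition schwartz_seminorm ::
    "nat \<Rightarrow> 'a::euclidean_space list \<Rightarrow> ('a \<Rightarrow> complex) \<Rightarrow> real" where
  "schwartz_seminorm k vs f = (SUP x. (1 + norm x) ^ k * norm (iter_deriv vs f x))"

text \<open>
  A tempered distribution is a continuous complex linear functional on the Schwartz space. It is
  represented by a functional on all functions that vanishes off the Schwartz space, so that
  equality of distributions is equality in HOL.
\<close>

definition tempered_distributions ::
    "(('a::euclidean_space \<Rightarrow> complex) \<Rightarrow> complex) set" where
  "tempered_distributions = {u.
      (\<forall>f. f \<notin> schwartz_space \<longrightarrow> u f = 0) \<and>
      (\<forall>f \<in> schwartz_space. \<forall>g \<in> schwartz_space. u (\<lambda>x. f x + g x) = u f + u g) \<and>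
      (\<forall>c. \<forall>f \<in> schwartz_space. u (\<lambda>x. c * f x) = c * u f) \<and>
      (\<exists>C m. \<forall>f \<in> schwartz_space. norm (u f) \<le>
         C * (\<Sum>vs | set vs \<subseteq> Basis \<and> length vs \<le> m. schwartz_seminorm m vs f))}"


section \<open>Mixed norms and isomorphisms of normed spaces\<close>

definition ennreal_power :: "ennreal \<Rightarrow> real \<Rightarrow> ennreal" where
  "ennreal_power x a = (if x = \<infinity> then \<infinity> else ennreal (enn2real x powr a))"

definition Lp_norm :: "ennreal \<Rightarrow> 'a measure \<Rightarrow> ('a \<Rightarrow> ennreal) \<Rightarrow> ennreal" where
  "Lp_norm r M g =
     (if r = \<infinity> then esssup M g
      else ennreal_power (\<integral>\<^sup>+ x. ennreal_power (g x) (enn2real r) \<partial>M) (1 / enn2real r))"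

text \<open>The inner norm, with exponent \<open>r\<close>, is taken in the first variable.\<close>

definition mixed_norm ::
    "ennreal \<Rightarrow> ennreal \<Rightarrow> 'a measure \<Rightarrow> ('a \<Rightarrow> 'a \<Rightarrow> complex) \<Rightarrow> ennreal" where
  "mixed_norm r s M F = Lp_norm s M (\<lambda>Y. Lp_norm r M (\<lambda>X. ennreal (norm (F X Y))))"

text \<open>Isomorphism, up to equivalence of norms, between spaces of functionals.\<close>

definition normed_space_iso ::
    "((('a \<Rightarrow> complex) \<Rightarrow> complex) \<Rightarrow> (('b \<Rightarrow> complex) \<Rightarrow> complex)) \<Rightarrow>
     (('a \<Rightarrow> complex) \<Rightarrow> complex) set \<Rightarrow> ((('a \<Rightarrow> complex) \<Rightarrow> complex) \<Rightarrow> ennreal) \<Rightarrow>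
     (('b \<Rightarrow> complex) \<Rightarrow> complex) set \<Rightarrow> ((('b \<Rightarrow> complex) \<Rightarrow> complex) \<Rightarrow> ennreal) \<Rightarrow> bool" where
  "normed_space_iso T S N S' N' \<longleftrightarrow>
     bij_betw T S S' \<and>
     (\<forall>f \<in> S. \<forall>g \<in> S. T (\<lambda>\<psi>. f \<psi> + g \<psi>) = (\<lambda>\<psi>. T f \<psi> + T g \<psi>)) \<and>
     (\<forall>c. \<forall>f \<in> S. T (\<lambda>\<psi>. c * f \<psi>) = (\<lambda>\<psi>. c * T f \<psi>)) \<and>
     (\<exists>C::real. \<forall>f \<in> S. N' (T f) \<le> ennreal C * N f \<and> N f \<le> ennreal C * N' (T f))"


section \<open>Heisenberg groups and Schroedinger representations\<close>

definition nondegenerate :: "('v::real_vector \<Rightarrow> 'v \<Rightarrow> real) \<Rightarrow> bool" where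
  "nondegenerate B \<longleftrightarrow>
     (\<forall>p. (\<forall>q. B p q = 0) \<longrightarrow> p = 0) \<and> (\<forall>q. (\<forall>p. B p q = 0) \<longrightarrow> q = 0)"

text \<open>\<open>B p q\<close> is \<open>p \<cdot> q\<close>; it need not be symmetric.\<close>

type_synonym 'v heis = "'v \<times> 'v \<times> real"

definition heis_bracket ::
    "('v::real_vector \<Rightarrow> 'v \<Rightarrow> real) \<Rightarrow> 'v heis \<Rightarrow> 'v heis \<Rightarrow> 'v heis" where
  "heis_bracket B = (\<lambda>(q, p, t) (q', p', t'). (0, 0, B p' q - B p q'))"

text \<open>The exponential map of this group is the identity map.\<close>

definition heis_group :: "('v::real_vector \<Rightarrow> 'v \<Rightarrow> real) \<Rightarrow> 'v heis monoid" where
  "heis_group B = \<lparr>carrier = UNIV,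
     monoid.mult = (\<lambda>X Y. X + Y + (1/2) *\<^sub>R heis_bracket B X Y), one = (0, 0, 0)\<rparr>"

definition schroedinger ::
    "('v::real_vector \<Rightarrow> 'v \<Rightarrow> real) \<Rightarrow> 'v heis \<Rightarrow> ('v \<Rightarrow> complex) \<Rightarrow> 'v \<Rightarrow> complex" where
  "schroedinger B = (\<lambda>(q, p, t) f x. cis (B p x + B p q / 2 + t) * f (x + q))"


section \<open>Modulation spaces for Schroedinger representations\<close>

text \<open>The antiduality pairing is \<open>(f | \<psi>) = f (cnj \<psi>)\<close>.\<close>

definition ambiguity ::
    "('w::euclidean_space \<Rightarrow> 'w \<Rightarrow> real) \<Rightarrow> ('w \<Rightarrow> complex) \<Rightarrow>
     (('w \<Rightarrow> complex) \<Rightarrow> complex) \<Rightarrow> 'w \<Rightarrow> 'w \<Rightarrow> complex" where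
  "ambiguity B \<phi> f X Y = f (\<lambda>x. cnj (schroedinger B (X, Y, 0) \<phi> x))"

definition modulation_norm ::
    "('w::euclidean_space \<Rightarrow> 'w \<Rightarrow> real) \<Rightarrow> ('w \<Rightarrow> complex) \<Rightarrow> ennreal \<Rightarrow> ennreal \<Rightarrow>
     (('w \<Rightarrow> complex) \<Rightarrow> complex) \<Rightarrow> ennreal" where
  "modulation_norm B \<phi> r s f = mixed_norm r s lborel (ambiguity B \<phi> f)"

definition modulation_space ::
    "('w::euclidean_space \<Rightarrow> 'w \<Rightarrow> real) \<Rightarrow> ('w \<Rightarrow> complex) \<Rightarrow> ennreal \<Rightarrow> ennreal \<Rightarrow>
     (('w \<Rightarrow> complex) \<Rightarrow> complex) set" where
  "modulation_space B \<phi> r s = {f \<in> tempered_distributions. modulation_norm B \<phi> r s f < \<infinity>}"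

text \<open>The classical modulation spaces, defined by the short-time Fourier transform
  \<open>V\<^sub>\<psi> f (x, w) = (f | M\<^sub>w T\<^sub>x \<psi>)\<close>.\<close>

definition stft ::
    "('w::euclidean_space \<Rightarrow> complex) \<Rightarrow> (('w \<Rightarrow> complex) \<Rightarrow> complex) \<Rightarrow> 'w \<Rightarrow> 'w \<Rightarrow> complex" where
  "stft \<psi> f x w = f (\<lambda>t. cnj (cis (2 * pi * (w \<bullet> t)) * \<psi> (t - x)))"

definition classical_modulation_norm ::
    "('w::euclidean_space \<Rightarrow> complex) \<Rightarrow> ennreal \<Rightarrow> ennreal \<Rightarrow>
     (('w \<Rightarrow> complex) \<Rightarrow> complex) \<Rightarrow> ennreal" where
  "classical_modulation_norm \<psi> r s f = mixed_norm r s lborel (stft \<psi> f)"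

definition classical_modulation_space ::
    "('w::euclidean_space \<Rightarrow> complex) \<Rightarrow> ennreal \<Rightarrow> ennreal \<Rightarrow>
     (('w \<Rightarrow> complex) \<Rightarrow> complex) set" where
  "classical_modulation_space \<psi> r s =
     {f \<in> tempered_distributions. classical_modulation_norm \<psi> r s f < \<infinity>}"


section \<open>The coadjoint orbit\<close>

typedef (overloaded) 'v orbit =
  "{\<xi> :: ('v::euclidean_space heis) \<Rightarrow>\<^sub>L real. blinfun_apply \<xi> (0, 0, 1) = 1}"
  morphisms functional_of Abs_orbit
proof
  have "bounded_linear (\<lambda>X::'v heis. snd (snd X))"
    by (intro bounded_linear_compose[OF bounded_linear_snd bounded_linear_snd])
  then show "Blinfun (\<lambda>X::'v heis. snd (snd X)) \<in>
      {\<xi>. blinfun_apply \<xi> (0, 0, 1) = 1}"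
    by (simp add: bounded_linear_Blinfun_apply)
qed

text \<open>The predual consists of the vectors \<open>(q, p, 0)\<close> and is identified with pairs \<open>(q, p)\<close>.\<close>

definition predual_vec :: "'v::real_vector \<times> 'v \<Rightarrow> 'v heis" where
  "predual_vec V = (fst V, snd V, 0)"

definition pairing :: "'v::euclidean_space orbit \<Rightarrow> 'v heis \<Rightarrow> real" where
  "pairing \<xi> X = blinfun_apply (functional_of \<xi>) X"

definition xi0 :: "'v::euclidean_space orbit" where
  "xi0 = Abs_orbit (Blinfun (\<lambda>X. snd (snd X)))"

definition omega ::
    "('v::euclidean_space \<Rightarrow> 'v \<Rightarrow> real) \<Rightarrow> 'v \<times> 'v \<Rightarrow> 'v \<times> 'v \<Rightarrow> real" where
  "omega B V W = pairing xi0 (heis_bracket B (predual_vec V) (predual_vec W))"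

text \<open>\<open>A(V) = \<xi>\<^sub>0 + \<xi>\<^sub>0 \<circ> ad V\<close>.\<close>

definition orbit_map :: "('v::euclidean_space \<Rightarrow> 'v \<Rightarrow> real) \<Rightarrow> 'v \<times> 'v \<Rightarrow> 'v orbit" where
  "orbit_map B V = Abs_orbit (functional_of xi0 +
     Blinfun (\<lambda>Z. pairing xi0 (heis_bracket B (predual_vec V) Z)))"

text \<open>
  Affine coordinates on the orbit: \<open>y\<close> corresponds to the functional
  \<open>(q, p, t) \<mapsto> y \<bullet> (q, p) + t\<close>. The Schwartz space and the tempered distributions
  do not depend on the choice of affine coordinates.
\<close>

definition covector :: "'v::euclidean_space \<times> 'v \<Rightarrow> 'v heis \<Rightarrow>\<^sub>L real" where
  "covector y = Blinfun (\<lambda>(q, p, t). y \<bullet> (q, p))"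

definition chart :: "'v::euclidean_space \<times> 'v \<Rightarrow> 'v orbit" where
  "chart y = Abs_orbit (functional_of xi0 + covector y)"

definition schwartz_orbit :: "('v::euclidean_space orbit \<Rightarrow> complex) set" where
  "schwartz_orbit = {a. a \<circ> chart \<in> schwartz_space}"

definition tempered_orbit :: "(('v::euclidean_space orbit \<Rightarrow> complex) \<Rightarrow> complex) set" where
  "tempered_orbit = {F. (\<lambda>\<psi>. F (\<psi> \<circ> inv_into UNIV chart)) \<in> tempered_distributions}"

text \<open>
  The Kirillov-Kostant-Souriau form. The tangent space of the orbit at \<open>\<xi>\<close> consists of the
  functionals \<open>\<xi> \<circ> ad X\<close>, and the form takes the value \<open>\<langle>\<xi>, [X, Y]\<rangle>\<close> on
  \<open>\<xi> \<circ> ad X\<close> and \<open>\<xi> \<circ> ad Y\<close>.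
\<close>

definition kks_form ::
    "('v::euclidean_space \<Rightarrow> 'v \<Rightarrow> real) \<Rightarrow> 'v orbit \<Rightarrow>
     ('v heis \<Rightarrow>\<^sub>L real) \<Rightarrow> ('v heis \<Rightarrow>\<^sub>L real) \<Rightarrow> real" where
  "kks_form B \<xi> \<alpha> \<beta> = (THE c. \<exists>X Y.
      (\<forall>Z. blinfun_apply \<alpha> Z = pairing \<xi> (heis_bracket B X Z)) \<and>
      (\<forall>Z. blinfun_apply \<beta> Z = pairing \<xi> (heis_bracket B Y Z)) \<and>
      c = pairing \<xi> (heis_bracket B X Y))"

text \<open>Determinant of the matrix of a bilinear form in the standard basis (Leibniz formula).\<close>

definition form_det :: "('a::euclidean_space \<Rightarrow> 'a \<Rightarrow> real) \<Rightarrow> real" where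
  "form_det \<beta> = (\<Sum>\<sigma> | \<sigma> permutes Basis. of_int (sign \<sigma>) * (\<Prod>b\<in>Basis. \<beta> b (\<sigma> b)))"

text \<open>
  With \<open>d = dim \<V>\<close>, so that the orbit has dimension \<open>2 d\<close>, the Liouville measure in Kirillov's
  normalization is given by the volume form \<open>\<Omega>\<^sup>d / ((2 \<pi>)\<^sup>d d!)\<close>, whose density in linear
  coordinates is \<open>(2 \<pi>)\<^sup>-\<^sup>d\<close> times the absolute value of the Pfaffian of the matrix of \<open>\<Omega>\<close>.
\<close>

definition liouville ::
    "('v::euclidean_space \<Rightarrow> 'v \<Rightarrow> real) \<Rightarrow> 'v orbit measure" where
  "liouville B = embed_measure
     (density lborel (\<lambda>y::'v \<times> 'v. ennreal (
        sqrt \<bar>form_det (\<lambda>u v. kks_form B (chart y) (covector u) (covector v))\<bar>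
          / (2 * pi) ^ DIM('v))))
     chart"

definition orbit_fourier ::
    "('v::euclidean_space \<Rightarrow> 'v \<Rightarrow> real) \<Rightarrow> ('v orbit \<Rightarrow> complex) \<Rightarrow> 'v \<times> 'v \<Rightarrow> complex" where
  "orbit_fourier B a X = (LINT \<xi>|liouville B. cis (- pairing \<xi> (predual_vec X)) * a \<xi>)"

text \<open>The Lebesgue measure on the predual for which \<open>a \<mapsto> \<hat>a\<close> is unitary; Schwartz functions
  are dense, so they determine the normalization.\<close>

definition predual_measure ::
    "('v::euclidean_space \<Rightarrow> 'v \<Rightarrow> real) \<Rightarrow> ('v \<times> 'v) measure" where
  "predual_measure B = scale_measure
     (ennreal (THE k. 0 < k \<and> (\<forall>a \<in> schwartz_orbit.
        (LINT \<xi>|liouville B. (norm (a \<xi>))\<^sup>2) = k * (LINT X|lborel. (norm (orbit_fourier B a X))\<^sup>2))))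
     lborel"


section \<open>The Weyl calculus\<close>

definition L2_functions :: "('v::euclidean_space \<Rightarrow> complex) set" where
  "L2_functions = {f \<in> borel_measurable lborel. integrable lborel (\<lambda>x. (norm (f x))\<^sup>2)}"

definition L2_inner :: "('v::euclidean_space \<Rightarrow> complex) \<Rightarrow> ('v \<Rightarrow> complex) \<Rightarrow> complex" where
  "L2_inner f g = (LINT x|lborel. f x * cnj (g x))"

text \<open>
  \<open>is_Op B a T\<close> says that \<open>T = Op(a) = \<integral> \<hat>a(X) \<pi>(exp X) dX\<close> as a weak integral
  of operators on \<open>L\<^sup>2\<close>. Operators act on representatives; \<open>T f\<close> is determined by \<open>a\<close>
  and \<open>f\<close> up to equality almost everywhere.
\<close>

definition is_Op ::
    "('v::euclidean_space \<Rightarrow> 'v \<Rightarrow> real) \<Rightarrow> ('v orbit \<Rightarrow> complex) \<Rightarrow>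
     (('v \<Rightarrow> complex) \<Rightarrow> ('v \<Rightarrow> complex)) \<Rightarrow> bool" where
  "is_Op B a T \<longleftrightarrow>
     (\<forall>f \<in> L2_functions. T f \<in> L2_functions) \<and>
     (\<forall>f \<in> L2_functions. \<forall>g \<in> L2_functions.
        L2_inner (T f) g =
        (LINT X|predual_measure B.
           orbit_fourier B a X * L2_inner (schroedinger B (predual_vec X) f) g))"

text \<open>
  \<open>\<pi>\<^sup>#(g, h) \<Phi>\<close> is the symbol of \<open>\<pi>(g h) Op(\<Phi>) \<pi>(g)\<^sup>-\<^sup>1\<close>. On Schwartz symbols, which the
  representation leaves invariant, it is characterized among Schwartz symbols, on which \<open>Op\<close>
  is injective.
\<close>

definition pi_sharp ::
    "('v::euclidean_space \<Rightarrow> 'v \<Rightarrow> real) \<Rightarrow> 'v heis \<times> 'v heis \<Rightarrow>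
     ('v orbit \<Rightarrow> complex) \<Rightarrow> 'v orbit \<Rightarrow> complex" where
  "pi_sharp B = (\<lambda>(g, h) \<Phi>. THE \<Psi>. \<Psi> \<in> schwartz_orbit \<and>
     (\<exists>T. is_Op B \<Phi> T \<and>
        is_Op B \<Psi> (\<lambda>f. schroedinger B (g \<otimes>\<^bsub>heis_group B\<^esub> h)
                        (T (schroedinger B (inv\<^bsub>heis_group B\<^esub> g) f)))))"

text \<open>
  The exponential map of the semidirect product \<open>G \<ltimes> G\<close>. The map \<open>(g, h) \<mapsto> (g, g h)\<close> is an
  isomorphism of \<open>G \<ltimes> G\<close> onto the direct product with differential
  \<open>(X, Y) \<mapsto> (X, X + Y)\<close>; hence \<open>exp (X, Y) = (g, h)\<close> with \<open>g = exp X\<close> and \<open>g h = exp (X + Y)\<close>.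
\<close>

definition exp_semidirect ::
    "('v::euclidean_space \<Rightarrow> 'v \<Rightarrow> real) \<Rightarrow> 'v heis \<Rightarrow> 'v heis \<Rightarrow> 'v heis \<times> 'v heis" where
  "exp_semidirect B X Y = (X, inv\<^bsub>heis_group B\<^esub> X \<otimes>\<^bsub>heis_group B\<^esub> (X + Y))"


section \<open>Modulation spaces of symbols\<close>

definition ambiguity_sharp ::
    "('v::euclidean_space \<Rightarrow> 'v \<Rightarrow> real) \<Rightarrow> ('v orbit \<Rightarrow> complex) \<Rightarrow>
     (('v orbit \<Rightarrow> complex) \<Rightarrow> complex) \<Rightarrow> 'v \<times> 'v \<Rightarrow> 'v \<times> 'v \<Rightarrow> complex" where
  "ambiguity_sharp B \<Phi> F X Y =
     F (\<lambda>\<xi>. cnj (pi_sharp B (exp_semidirect B (predual_vec X) (predual_vec Y)) \<Phi> \<xi>))"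

definition modulation_norm_sharp ::
    "('v::euclidean_space \<Rightarrow> 'v \<Rightarrow> real) \<Rightarrow> ('v orbit \<Rightarrow> complex) \<Rightarrow> ennreal \<Rightarrow> ennreal \<Rightarrow>
     (('v orbit \<Rightarrow> complex) \<Rightarrow> complex) \<Rightarrow> ennreal" where
  "modulation_norm_sharp B \<Phi> r s F = mixed_norm r s (predual_measure B) (ambiguity_sharp B \<Phi> F)"

definition modulation_space_sharp ::
    "('v::euclidean_space \<Rightarrow> 'v \<Rightarrow> real) \<Rightarrow> ('v orbit \<Rightarrow> complex) \<Rightarrow> ennreal \<Rightarrow> ennreal \<Rightarrow>
     (('v orbit \<Rightarrow> complex) \<Rightarrow> complex) set" where
  "modulation_space_sharp B \<Phi> r s = {F \<in> tempered_orbit. modulation_norm_sharp B \<Phi> r s F < \<infinity>}"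

text \<open>
  The distribution \<open>f \<circ> A\<^sup>-\<^sup>1\<close>, given by \<open>\<langle>f \<circ> A\<^sup>-\<^sup>1, \<Psi>\<rangle> = \<langle>f, \<Psi> \<circ> A\<rangle>\<close>. There is no Jacobian:
  \<open>A\<close> carries the measure on the predual to the Liouville measure.
\<close>

definition comp_orbit_map_inverse ::
    "('v::euclidean_space \<Rightarrow> 'v \<Rightarrow> real) \<Rightarrow> (('v \<times> 'v \<Rightarrow> complex) \<Rightarrow> complex) \<Rightarrow>
     ('v orbit \<Rightarrow> complex) \<Rightarrow> complex" where
  "comp_orbit_map_inverse B f = (\<lambda>\<Psi>. f (\<Psi> \<circ> orbit_map B))"

end

theory Submission
  imports Defs "HOL-Probability.Probability"
begin

text \<open>
  In linear coordinates on the orbit, \<open>A\<close> is the linear isomorphism \<open>symp\<close> with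
  \<open>symp V \<bullet> W = \<langle>\<xi>\<^sub>0, [V, W]\<rangle>\<close>. Computing \<open>\<pi>(X + Y) \<pi>(Z) \<pi>(X)\<^sup>-\<^sup>1\<close> and using that \<open>Op\<close> is injective
  identifies the symbol \<open>\<pi>\<^sup>#(exp (X, Y)) \<Phi>\<close>: pulled back by \<open>A\<close> it is, up to a phase, the image of \<open>\<Phi> \<circ> A\<close>
  under the Schroedinger operator of \<open>(X + Y/2, Y)\<close>. Hence all three ambiguity functions are, up to phases and
  linear changes of variables, short-time Fourier transforms of the same distribution with three
  different windows, and the shift of \<open>X\<close> by \<open>Y/2\<close> is not seen by the inner norm.

  Windows are exchanged with the reproducing formula \<open>\<kappa> \<psi> = \<integral> \<langle>\<psi>, \<phi>\<^sub>z\<rangle> \<phi>\<^sub>z dz\<close> over all time-frequency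
  shifts \<open>\<phi>\<^sub>z\<close> of a window \<open>\<phi>\<close>. The integral converges in the Schwartz space, so distributions can be
  applied under it; this bounds one transform by the convolution of the other one with an integrable
  function, and Minkowski's integral inequality bounds the mixed norms.
\<close>

section \<open>Lebesgue measure under linear maps\<close>

text \<open>On the symbol side the basic objects are descriptions: the Kirillov-Kostant-Souriau
  form, the normalization of the predual measure and \<open>pi_sharp\<close> are \<open>THE\<close>
  terms. Each needs existence and uniqueness before anything can be computed: invertibility of
  \<open>symp\<close> for the form, the Plancherel theorem for the measure, and for the symbol a
  concrete operator realizing the weak integral together with injectivity of \<open>Op\<close>. The
  constants, by contrast, are never evaluated. The Liouville density, the predual normalization and
  the factors by which linear maps scale Lebesgue measure only multiply a reference norm
  \<open>tf_norm\<close>, so positivity suffices.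

  The other obstacle is to apply a distribution under the integral of the reproducing formula.
  Distributions are functionals bounded by finitely many seminorms, so the integral is approximated
  in these seminorms by finite Riemann sums, on which linearity acts. The constant \<kappa> is the
  squared L^2 norm of the window times a power of 2 pi, the latter because characters are written
  e^(i \<eta> t) without 2 pi.\<close>

lemma nn_integral_lborel_translate:
  fixes f :: "'a::euclidean_space \<Rightarrow> ennreal"
  assumes [measurable]: "f \<in> borel_measurable borel"
  shows "(\<integral>\<^sup>+x. f (x + a) \<partial>lborel) = (\<integral>\<^sup>+x. f x \<partial>lborel)"
proof -
  have "(\<integral>\<^sup>+x. f x \<partial>lborel) = (\<integral>\<^sup>+x. f x \<partial>distr lborel borel ((+) a))"
    by (simp add: lborel_distr_plus)
  also have "\<dots> = (\<integral>\<^sup>+x. f (x + a) \<partial>lborel)"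
    by (subst nn_integral_distr) (auto simp: add.commute)
  finally show ?thesis by simp
qed

lemma integral_lborel_translate:
  fixes f :: "'a::euclidean_space \<Rightarrow> 'b::{banach, second_countable_topology}"
  assumes [measurable]: "f \<in> borel_measurable borel"
  shows "(LINT x|lborel. f (x + a)) = (LINT x|lborel. f x)"
proof -
  have "(LINT x|lborel. f x) = (LINT x|distr lborel borel ((+) a). f x)"
    by (simp add: lborel_distr_plus)
  also have "\<dots> = (LINT x|lborel. f (x + a))"
    by (subst integral_distr) (auto simp: add.commute)
  finally show ?thesis by simp
qed

lemma integrable_lborel_translate:
  fixes f :: "'a::euclidean_space \<Rightarrow> 'b::{banach, second_countable_topology}"
  assumes "integrable lborel f"
  shows "integrable lborel (\<lambda>x. f (x + a))"
proof -
  have "integrable (distr lborel borel ((+) a)) f"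
    using assms by (simp add: lborel_distr_plus)
  then show ?thesis
    by (subst (asm) integrable_distr_eq) (use assms in \<open>auto simp: add.commute\<close>)
qed

lemma linear_borel_measurable:
  fixes L :: "'a::euclidean_space \<Rightarrow> 'b::euclidean_space"
  assumes "linear L" shows "L \<in> borel_measurable borel"
  by (intro borel_measurable_continuous_onI linear_continuous_on linear_linear[THEN iffD2] assms)

lemma fst_snd_borel [measurable]:
  "fst \<in> borel_measurable (borel :: ('a::euclidean_space \<times> 'b::euclidean_space) measure)"
  "snd \<in> borel_measurable (borel :: ('a::euclidean_space \<times> 'b::euclidean_space) measure)"
  by (auto intro!: borel_measurable_continuous_onI continuous_intros)

lemma open_emeasure_lborel_pos:
  assumes "open U" "U \<noteq> {}" shows "emeasure lborel U > 0"
proof (rule ccontr)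
  assume "\<not> ?thesis"
  then have "U \<in> null_sets lborel" using assms(1) by auto
  then have "negligible U" by (simp add: negligible_iff_null_sets null_sets_completionI)
  then show False using open_not_negligible assms by blast
qed

text \<open>Uniqueness of Haar measure in disguise: both sides of
  \<open>\<integral> f(L x) dx \<cdot> \<integral> g = \<integral> f \<cdot> \<integral> g(- L x) dx\<close> are the integral of
  \<open>f(L x + y) g(y)\<close>, up to translations.\<close>

lemma nn_integral_lborel_linear:
  fixes L :: "'a::euclidean_space \<Rightarrow> 'a"
  assumes "linear L" "bij L"
  obtains c :: real where "c > 0"
    "\<And>f. f \<in> borel_measurable borel \<Longrightarrow> (\<integral>\<^sup>+x. f (L x) \<partial>lborel) = ennreal c * (\<integral>\<^sup>+x. f x \<partial>lborel)"
proof -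
  note [measurable] = linear_borel_measurable[OF assms(1)]
  define L' where "L' = inv_into UNIV L"
  have LL': "L (L' y) = y" for y
    unfolding L'_def using assms(2) by (simp add: bij_is_surj surj_f_inv_f)
  have L'L: "L' (L y) = y" for y
    unfolding L'_def using assms(2) by (simp add: bij_is_inj)
  have linL': "linear L'"
    unfolding L'_def using assms by (simp add: inj_linear_imp_inv_linear bij_is_inj)
  have Ladd: "L (x + L' y) = L x + y" for x y
    using assms(1) by (simp add: linear_add LL')
  let ?D = "{x. L x \<in> ball 0 1}"
  \<comment> \<open>The test function of the identity. Its integral is \<open>k\<close>, and since
    the ball is symmetric the integral of \<open>g (- L x)\<close> is \<open>d\<close>, the measure
    of \<open>?D\<close>. Both are finite and positive, so the constant is
    \<open>d / k\<close>.\<close>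
  define g :: "'a \<Rightarrow> ennreal" where "g = indicator (ball 0 1)"
  have g[measurable]: "g \<in> borel_measurable borel"
    unfolding g_def by (intro borel_measurable_indicator) auto
  have fin: "emeasure lborel ?D < \<infinity>"
  proof -
    have "?D \<subseteq> L' ` ball 0 1" using L'L by (metis (mono_tags) image_eqI mem_Collect_eq subsetI)
    moreover have "bounded (L' ` ball 0 1)"
      using linL' by (intro bounded_linear_image bounded_ball) (simp add: linear_conv_bounded_linear)
    ultimately have "bounded ?D" by (rule bounded_subset[rotated])
    then show ?thesis by (rule emeasure_bounded_finite)
  qed
  have "open (L -` ball 0 1)"
    using assms(1) by (intro open_vimage open_ball linear_continuous_on) (simp add: linear_conv_bounded_linear)
  then have op: "open ?D" by (simp add: vimage_def)
  have pos: "emeasure lborel ?D > 0"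
    using op linear_0[OF assms(1)] by (intro open_emeasure_lborel_pos) (auto intro: exI[of _ 0])
  have K: "emeasure lborel (ball (0::'a) 1) < \<infinity>" by (rule emeasure_lborel_ball_finite)
  have Kpos: "emeasure lborel (ball (0::'a) 1) > 0"
    by (intro open_emeasure_lborel_pos) auto
  define k where "k = measure lborel (ball (0::'a) 1)"
  define d where "d = measure lborel ?D"
  have k: "k > 0" "emeasure lborel (ball (0::'a) 1) = ennreal k"
    using K Kpos unfolding k_def
    by (simp add: measure_def enn2real_positive_iff, intro emeasure_eq_ennreal_measure) auto
  have Ig: "(\<integral>\<^sup>+y. g y \<partial>lborel) = ennreal k"
    unfolding g_def by (simp add: k(2))
  have d: "d > 0" "emeasure lborel ?D = ennreal d"
    using fin pos unfolding d_def
    by (simp add: measure_def enn2real_positive_iff, intro emeasure_eq_ennreal_measure) auto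
  have "(\<integral>\<^sup>+x. f (L x) \<partial>lborel) = ennreal (d / k) * (\<integral>\<^sup>+x. f x \<partial>lborel)"
    if f[measurable]: "f \<in> borel_measurable borel" for f
  proof -
    have "(\<integral>\<^sup>+x. f (L x) \<partial>lborel) * ennreal k = (\<integral>\<^sup>+y. (\<integral>\<^sup>+x. f (L x) \<partial>lborel) * g y \<partial>lborel)"
      by (subst nn_integral_cmult) (simp_all add: Ig)
    also have "\<dots> = (\<integral>\<^sup>+y. (\<integral>\<^sup>+x. f (L x + y) * g y \<partial>lborel) \<partial>lborel)"
    proof (rule nn_integral_cong)
      fix y
      have "(\<integral>\<^sup>+x. f (L x) \<partial>lborel) = (\<integral>\<^sup>+x. f (L (x + L' y)) \<partial>lborel)"
        by (subst nn_integral_lborel_translate[of "\<lambda>x. f (L x)"]) auto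
      then show "(\<integral>\<^sup>+x. f (L x) \<partial>lborel) * g y = (\<integral>\<^sup>+x. f (L x + y) * g y \<partial>lborel)"
        by (simp add: Ladd nn_integral_multc)
    qed
    also have "\<dots> = (\<integral>\<^sup>+x. (\<integral>\<^sup>+y. f (L x + y) * g y \<partial>lborel) \<partial>lborel)"
      by (rule lborel_pair.Fubini') simp
    also have "\<dots> = (\<integral>\<^sup>+x. (\<integral>\<^sup>+y. f y * g (y - L x) \<partial>lborel) \<partial>lborel)"
    proof (rule nn_integral_cong)
      fix x
      show "(\<integral>\<^sup>+y. f (L x + y) * g y \<partial>lborel) = (\<integral>\<^sup>+y. f y * g (y - L x) \<partial>lborel)"
        using nn_integral_lborel_translate[of "\<lambda>y. f y * g (y - L x)" "L x"]
        by (simp add: add.commute)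
    qed
    also have "\<dots> = (\<integral>\<^sup>+y. (\<integral>\<^sup>+x. f y * g (y - L x) \<partial>lborel) \<partial>lborel)"
      by (rule lborel_pair.Fubini') simp
    also have "\<dots> = (\<integral>\<^sup>+y. f y * ennreal d \<partial>lborel)"
    proof (rule nn_integral_cong)
      fix y
      have "(\<integral>\<^sup>+x. g (y - L x) \<partial>lborel) = (\<integral>\<^sup>+x. g (y - L (x + L' y)) \<partial>lborel)"
        by (subst nn_integral_lborel_translate[of "\<lambda>x. g (y - L x)"]) auto
      also have "\<dots> = (\<integral>\<^sup>+x. indicator ?D x \<partial>lborel)"
        by (intro nn_integral_cong) (auto simp: Ladd g_def indicator_def)
      also have "\<dots> = ennreal d" using op by (subst nn_integral_indicator) (auto simp: d(2)[symmetric])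
      finally show "(\<integral>\<^sup>+x. f y * g (y - L x) \<partial>lborel) = f y * ennreal d"
        by (simp add: nn_integral_cmult)
    qed
    also have "\<dots> = ennreal d * (\<integral>\<^sup>+x. f x \<partial>lborel)"
      by (subst nn_integral_multc) (auto simp: mult.commute)
    finally have "ennreal (1/k) * ennreal k * (\<integral>\<^sup>+x. f (L x) \<partial>lborel) = ennreal (1/k) * ennreal d * (\<integral>\<^sup>+x. f x \<partial>lborel)"
      by (simp add: mult.assoc) (simp add: mult.commute mult.left_commute)
    moreover have "ennreal (1/k) * ennreal k = 1" "ennreal (1/k) * ennreal d = ennreal (d/k)"
      using k d by (auto simp flip: ennreal_mult'')
    ultimately show ?thesis by simp
  qed
  then show ?thesis using that[of "d/k"] d k by auto
qed

lemma lborel_distr_linear: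
  fixes L :: "'a::euclidean_space \<Rightarrow> 'a"
  assumes "linear L" "bij L"
  obtains c :: real where "c > 0" "distr lborel borel L = scale_measure (ennreal c) lborel"
proof -
  note [measurable] = linear_borel_measurable[OF assms(1)]
  obtain c where c: "c > 0"
    "\<And>f. f \<in> borel_measurable borel \<Longrightarrow> (\<integral>\<^sup>+x. f (L x) \<partial>lborel) = ennreal c * (\<integral>\<^sup>+x. f x \<partial>lborel)"
    using nn_integral_lborel_linear[OF assms] by metis
  have "distr lborel borel L = scale_measure (ennreal c) lborel"
  proof (rule measure_eqI)
    fix A assume "A \<in> sets (distr lborel borel L)"
    then have [measurable]: "A \<in> sets borel" by simp
    have "emeasure (distr lborel borel L) A = (\<integral>\<^sup>+x. indicator A x \<partial>distr lborel borel L)"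
      by simp
    also have "\<dots> = (\<integral>\<^sup>+x. indicator A (L x) \<partial>lborel)"
      by (rule nn_integral_distr) auto
    also have "\<dots> = ennreal c * emeasure lborel A" by (subst c(2)) auto
    finally show "emeasure (distr lborel borel L) A = emeasure (scale_measure (ennreal c) lborel) A"
      by simp
  qed simp
  then show ?thesis using c(1) that by blast
qed

section \<open>Mixed norms\<close>

lemma ennreal_power_measurable [measurable]:
  assumes [measurable]: "f \<in> borel_measurable M"
  shows "(\<lambda>x. ennreal_power (f x) a) \<in> borel_measurable M"
  unfolding ennreal_power_def by measurable

lemma ennreal_power_ennreal: "0 \<le> x \<Longrightarrow> ennreal_power (ennreal x) a = ennreal (x powr a)"
  by (simp add: ennreal_power_def)

lemma ennreal_power_top [simp]: "ennreal_power \<top> a = \<top>"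
  by (simp add: ennreal_power_def)

lemma ennreal_power_zero [simp]: "ennreal_power 0 a = 0"
  by (simp add: ennreal_power_def)

lemma ennreal_power_one [simp]: "ennreal_power x 1 = x"
  by (cases x) (auto simp: ennreal_power_ennreal)

lemma ennreal_power_mono: "x \<le> y \<Longrightarrow> 0 \<le> a \<Longrightarrow> ennreal_power x a \<le> ennreal_power y a"
  by (cases x; cases y) (auto simp: ennreal_power_ennreal top_unique intro!: ennreal_leI powr_mono2)

lemma ennreal_power_power:
  "ennreal_power (ennreal_power x a) b = ennreal_power x (a * b)"
  by (cases x) (auto simp: ennreal_power_ennreal powr_powr)

lemma ennreal_power_mult:
  "0 < a \<Longrightarrow> ennreal_power (x * y) a = ennreal_power x a * ennreal_power y a"
  by (cases x; cases y)
     (auto simp: ennreal_power_ennreal powr_mult ennreal_mult_top ennreal_top_mult simp flip: ennreal_mult ennreal_mult'')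

lemma ennreal_power_eq_0_iff: "ennreal_power x a = 0 \<longleftrightarrow> x = 0"
  by (cases x) (auto simp: ennreal_power_ennreal)

text \<open>The tangent at \<open>m\<close> lies below the convex function \<open>t powr r\<close>.
  For \<open>r > 1\<close> this is Young's inequality with the exponents \<open>r\<close> and
  \<open>r / (r - 1)\<close>.\<close>

lemma ennreal_power_tangent:
  assumes r: "1 \<le> r" and m: "0 < m"
  shows "ennreal (r * m powr (r - 1)) * x \<le> ennreal_power x r + ennreal ((r - 1) * m powr r)"
proof (cases x)
  case (real t)
  have "r * m powr (r - 1) * t \<le> t powr r + (r - 1) * m powr r"
  proof (cases "r = 1")
    case True then show ?thesis using m real by simp
  next
    case False
    define q where "q = r / (r - 1)"
    have r1: "r > 1" using False r by simp
    have q: "q > 1" "1 / r + 1 / q = 1" using r1 by (auto simp: q_def field_simps)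
    have "t * m powr (r - 1) \<le> t powr r / r + (m powr (r - 1)) powr q / q"
      by (rule Youngs_inequality) (use r1 q real in auto)
    also have "(m powr (r - 1)) powr q = m powr r" using r1 by (simp add: powr_powr q_def)
    finally have "r * (t * m powr (r - 1)) \<le> r * (t powr r / r + m powr r / q)"
      using r1 by (intro mult_left_mono) auto
    also have "\<dots> = t powr r + (r - 1) * m powr r" using r1 by (simp add: q_def field_simps)
    finally show ?thesis by (simp add: mult_ac)
  qed
  then show ?thesis using real r m
    by (auto simp: ennreal_power_ennreal simp flip: ennreal_mult'' ennreal_plus intro!: ennreal_leI)
qed simp

text \<open>Jensen's inequality for a weight of arbitrary finite mass, which explains the power
  \<open>r - 1\<close> of the mass. The tangent inequality is integrated against \<open>N\<close>,
  and the point of tangency is then chosen optimally.\<close>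

lemma ennreal_power_jensen:
  assumes [measurable]: "N \<in> borel_measurable K" "g \<in> borel_measurable K"
    and r: "1 \<le> r" and fin: "(\<integral>\<^sup>+z. N z \<partial>K) < \<infinity>"
  shows "ennreal_power (\<integral>\<^sup>+z. N z * g z \<partial>K) r
    \<le> ennreal_power (\<integral>\<^sup>+z. N z \<partial>K) (r - 1) * (\<integral>\<^sup>+z. N z * ennreal_power (g z) r \<partial>K)"
proof -
  define R where "R = (\<integral>\<^sup>+z. N z * ennreal_power (g z) r \<partial>K)"
  obtain k where k: "0 \<le> k" "(\<integral>\<^sup>+z. N z \<partial>K) = ennreal k"
    using fin by (cases "\<integral>\<^sup>+z. N z \<partial>K") auto
  have tang: "ennreal (r * m powr (r - 1)) * (\<integral>\<^sup>+z. N z * g z \<partial>K) \<le> R + ennreal ((r - 1) * m powr r) * ennreal k"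
    if "m > 0" for m
  proof -
    have "ennreal (r * m powr (r - 1)) * (\<integral>\<^sup>+z. N z * g z \<partial>K)
        = (\<integral>\<^sup>+z. N z * (ennreal (r * m powr (r - 1)) * g z) \<partial>K)"
      by (subst nn_integral_cmult[symmetric]) (auto simp: mult_ac)
    also have "\<dots> \<le> (\<integral>\<^sup>+z. N z * ennreal_power (g z) r + ennreal ((r - 1) * m powr r) * N z \<partial>K)"
      by (intro nn_integral_mono)
        (metis ennreal_power_tangent[OF r that] distrib_left mult.commute mult_left_mono zero_le)
    also have "\<dots> = R + ennreal ((r - 1) * m powr r) * ennreal k"
      by (simp add: nn_integral_add nn_integral_cmult R_def k)
    finally show ?thesis .
  qed
  show ?thesis
  proof (cases "R = \<infinity> \<or> k = 0")
    case True
    show ?thesis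
    proof (cases "k = 0")
      case True
      then have "AE z in K. N z = 0" using k by (simp add: nn_integral_0_iff_AE)
      then have "(\<integral>\<^sup>+z. N z * g z \<partial>K) = 0" by (auto simp: nn_integral_0_iff_AE)
      then show ?thesis by simp
    next
      case False
      then show ?thesis using True k by (simp add: R_def[symmetric] ennreal_power_ennreal ennreal_mult_top)
    qed
  next
    case False
    then have k0: "k > 0" and R: "R < \<infinity>" using k by (auto simp: less_top)
    \<comment> \<open>The tangent at \<open>m = 1\<close> already makes the integral of
      \<open>N * g\<close> finite, so that it can be written as a real number
      \<open>h\<close>.\<close>
    have "ennreal r * (\<integral>\<^sup>+z. N z * g z \<partial>K) < \<infinity>"
    proof -
      have "R + ennreal (r - 1) * ennreal k < \<infinity>"
        using R by (simp add: ennreal_mult_less_top)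
      moreover have "ennreal r * (\<integral>\<^sup>+z. N z * g z \<partial>K) \<le> R + ennreal (r - 1) * ennreal k"
        using tang[of 1] by simp
      ultimately show ?thesis by (rule le_less_trans[rotated])
    qed
    then have "(\<integral>\<^sup>+z. N z * g z \<partial>K) < \<infinity>" using r by (auto simp: ennreal_mult_less_top)
    then obtain h where h: "0 \<le> h" "(\<integral>\<^sup>+z. N z * g z \<partial>K) = ennreal h"
      by (cases "\<integral>\<^sup>+z. N z * g z \<partial>K") auto
    obtain \<rho> where \<rho>: "0 \<le> \<rho>" "R = ennreal \<rho>" using R by (cases R) auto
    have "h powr r \<le> k powr (r - 1) * \<rho>"
    proof (cases "h = 0")
      case True then show ?thesis using \<rho> by simp
    next
      case False
      \<comment> \<open>The mean of \<open>g\<close> under the normalized weight, which is the point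
        of tangency that yields Jensen's inequality.\<close>
      define m where "m = h / k"
      have m: "m > 0" using False h k0 by (simp add: m_def)
      have hk: "h = m * k" using k0 by (simp add: m_def)
      have powm: "m powr (r - 1) * m = m powr r" using m by (simp add: powr_diff)
      have powk: "k powr (r - 1) * k = k powr r" using k0 by (simp add: powr_diff)
      have "ennreal (r * m powr (r - 1) * h) = ennreal (r * m powr (r - 1)) * ennreal h"
        by (rule ennreal_mult'') (rule h)
      also have "\<dots> \<le> ennreal \<rho> + ennreal ((r - 1) * m powr r) * ennreal k"
        using tang[OF m] unfolding h(2) \<rho>(2) .
      also have "\<dots> = ennreal (\<rho> + (r - 1) * m powr r * k)"
        using r \<rho>(1) k(1) by (subst ennreal_mult''[symmetric]) (auto intro!: ennreal_plus[symmetric])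
      finally have "ennreal (r * m powr (r - 1) * h) \<le> ennreal (\<rho> + (r - 1) * m powr r * k)" .
      then have "r * m powr (r - 1) * h \<le> \<rho> + (r - 1) * m powr r * k"
        using r k \<rho> by (subst (asm) ennreal_le_iff) auto
      moreover have "m powr (r - 1) * h = m powr r * k"
        using powm by (simp only: hk mult.assoc[symmetric])
      ultimately have "r * (m powr r * k) \<le> \<rho> + (r - 1) * (m powr r * k)"
        by (simp only: mult.assoc)
      then have "m powr r * k \<le> \<rho>" unfolding left_diff_distrib by linarith
      then have "k powr (r - 1) * (m powr r * k) \<le> k powr (r - 1) * \<rho>"
        by (intro mult_left_mono) auto
      moreover have "k powr (r - 1) * (m powr r * k) = (k powr (r - 1) * k) * m powr r"
        by (simp only: mult_ac)
      moreover have "\<dots> = h powr r"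
        unfolding powk hk using m k0 by (simp only: powr_mult mult.commute)
      ultimately show ?thesis by (simp only:)
    qed
    then have "ennreal (h powr r) \<le> ennreal (k powr (r - 1)) * ennreal \<rho>"
      using \<rho>(1) by (subst ennreal_mult''[symmetric]) (auto intro: ennreal_leI)
    then show ?thesis unfolding R_def[symmetric] k(2) h(2) \<rho>(2) ennreal_power_ennreal[OF h(1)] ennreal_power_ennreal[OF k(1)] .
  qed
qed

section \<open>Norms with exponent between one and infinity\<close>

lemma Lp_norm_top: "Lp_norm \<top> M g = esssup M g"
  by (simp add: Lp_norm_def)

lemma Lp_norm_finite:
  assumes "r \<noteq> \<infinity>"
  shows "Lp_norm r M g =
    ennreal_power (\<integral>\<^sup>+ x. ennreal_power (g x) (enn2real r) \<partial>M) (1 / enn2real r)"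
  using assms by (simp add: Lp_norm_def)

lemma enn2real_ge_1: "1 \<le> r \<Longrightarrow> r \<noteq> \<infinity> \<Longrightarrow> 1 \<le> enn2real r"
  by (cases r) (auto simp: ennreal_le_iff simp flip: ennreal_1)

lemma Lp_norm_mono:
  assumes [measurable]: "g \<in> borel_measurable M" and "AE x in M. g x \<le> h x" and "1 \<le> r"
  shows "Lp_norm r M g \<le> Lp_norm r M h"
proof (cases "r = \<infinity>")
  case True
  then show ?thesis using assms by (simp add: Lp_norm_top esssup_AE_mono)
next
  case False
  then have r: "1 \<le> enn2real r" using assms(3) enn2real_ge_1 by blast
  show ?thesis unfolding Lp_norm_finite[OF False]
    using assms(2) r by (intro ennreal_power_mono nn_integral_mono_AE) (auto elim!: eventually_mono intro: ennreal_power_mono)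
qed

lemma Lp_norm_distr:
  assumes [measurable]: "T \<in> measurable M N" "g \<in> borel_measurable N"
  shows "Lp_norm r (distr M N T) g = Lp_norm r M (\<lambda>x. g (T x))"
proof (cases "r = \<infinity>")
  case True
  have "esssup (distr M N T) g = esssup M (\<lambda>x. g (T x))"
    by (subst (1 2) esssup_eq_AE) (auto simp: AE_distr_iff)
  then show ?thesis using True by (simp add: Lp_norm_top)
next
  case False
  then show ?thesis unfolding Lp_norm_finite[OF False] by (subst nn_integral_distr) auto
qed

text \<open>Read as \<open>c^(1/r)\<close> with value 1 at infinity: the essential supremum only
  depends on the null sets, which scaling preserves.\<close>

definition scale_factor :: "ennreal \<Rightarrow> real \<Rightarrow> real" where
  "scale_factor r c = (if r = \<infinity> then 1 else c powr (1 / enn2real r))"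

lemma scale_factor_pos: "c > 0 \<Longrightarrow> scale_factor r c > 0"
  by (simp add: scale_factor_def)

lemma Lp_norm_scale_measure:
  assumes [measurable]: "g \<in> borel_measurable M" and c: "c > 0" and r: "1 \<le> r"
  shows "Lp_norm r (scale_measure (ennreal c) M) g = ennreal (scale_factor r c) * Lp_norm r M g"
proof (cases "r = \<infinity>")
  case True
  have "esssup (scale_measure (ennreal c) M) g = esssup M g"
    using c by (subst (1 2) esssup_eq) (auto simp: measurable_def space_scale_measure)
  then show ?thesis using True by (simp add: Lp_norm_top scale_factor_def)
next
  case False
  then have r: "1 \<le> enn2real r" using assms(3) enn2real_ge_1 by blast
  then show ?thesis using False c unfolding Lp_norm_finite[OF False]
    by (subst nn_integral_scale_measure) (auto simp: ennreal_power_mult ennreal_power_ennreal scale_factor_def)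
qed

lemma Lp_norm_cmult:
  assumes [measurable]: "g \<in> borel_measurable M" and c: "c > 0" and r: "1 \<le> r"
  shows "Lp_norm r M (\<lambda>x. ennreal c * g x) = ennreal c * Lp_norm r M g"
proof (cases "r = \<infinity>")
  case True
  \<comment> \<open>One inequality suffices: it is used for \<open>c\<close> and, applied to
    \<open>c * g\<close>, for \<open>1/c\<close>.\<close>
  have up: "esssup M (\<lambda>x. ennreal d * h x) \<le> ennreal d * esssup M h"
    if [measurable]: "h \<in> borel_measurable M" for d h
    using esssup_AE[of h M] by (intro esssup_I) (auto elim!: eventually_mono intro: mult_left_mono)
  have "ennreal c * esssup M g = ennreal c * esssup M (\<lambda>x. ennreal (1/c) * (ennreal c * g x))"
    using c by (simp add: mult.assoc[symmetric] flip: ennreal_mult'')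
  also have "\<dots> \<le> ennreal c * (ennreal (1/c) * esssup M (\<lambda>x. ennreal c * g x))"
    by (intro mult_left_mono up) auto
  also have "\<dots> = esssup M (\<lambda>x. ennreal c * g x)"
    using c by (simp add: mult.assoc[symmetric] flip: ennreal_mult'')
  finally show ?thesis using True up[of g c] by (auto simp: Lp_norm_top intro: antisym)
next
  case False
  then have r: "1 \<le> enn2real r" using assms(3) enn2real_ge_1 by blast
  then have "(\<integral>\<^sup>+ x. ennreal_power (ennreal c * g x) (enn2real r) \<partial>M)
     = ennreal (c powr enn2real r) * (\<integral>\<^sup>+ x. ennreal_power (g x) (enn2real r) \<partial>M)"
    using c by (subst nn_integral_cmult[symmetric]) (auto simp: ennreal_power_mult ennreal_power_ennreal)
  then show ?thesis using False c r unfolding Lp_norm_finite[OF False]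
    by (simp add: ennreal_power_mult ennreal_power_ennreal powr_powr)
qed

text \<open>The essential supremum of a slice exceeds \<open>y\<close> exactly when the slice
  exceeds \<open>y\<close> on a set of positive measure, and by sigma-finiteness the measure of that
  set depends measurably on the parameter.\<close>

lemma borel_measurable_esssup:
  fixes f :: "'a \<times> 'b \<Rightarrow> ennreal"
  assumes "sigma_finite_measure M" and f: "f \<in> borel_measurable (M \<Otimes>\<^sub>M K)"
  shows "(\<lambda>z. esssup M (\<lambda>x. f (x, z))) \<in> borel_measurable K"
proof (rule borel_measurableI_greater)
  interpret sigma_finite_measure M by fact
  note [measurable] = f
  fix y
  have "{z \<in> space K. y < esssup M (\<lambda>x. f (x, z))}
      = {z \<in> space K. emeasure M {x \<in> space M. y < f (x, z)} \<noteq> 0}"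
  proof (safe)
    fix z assume z: "z \<in> space K" "y < esssup M (\<lambda>x. f (x, z))"
      and 0: "emeasure M {x \<in> space M. y < f (x, z)} = 0"
    have "(\<lambda>x. f (x, z)) \<in> borel_measurable M" using z by measurable
    from esssup_pos_measure[OF this z(2)] 0 show False by simp
  next
    fix z assume z: "z \<in> space K" and ne: "emeasure M {x \<in> space M. y < f (x, z)} \<noteq> 0"
    have [measurable]: "(\<lambda>x. f (x, z)) \<in> borel_measurable M" using z by measurable
    show "y < esssup M (\<lambda>x. f (x, z))"
    proof (rule ccontr)
      assume "\<not> ?thesis"
      then have "AE x in M. f (x, z) \<le> y"
        using esssup_AE[of "\<lambda>x. f (x, z)" M] by (auto elim!: eventually_mono)
      then have "emeasure M {x \<in> space M. \<not> f (x, z) \<le> y} = 0"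
        by (subst (asm) AE_iff_measurable[OF _ refl]) auto
      then show False using ne by (simp add: not_le)
    qed
  qed
  moreover have "(\<lambda>z. emeasure M {x \<in> space M. y < f (x, z)}) \<in> borel_measurable K"
  proof -
    have "{p \<in> space (K \<Otimes>\<^sub>M M). y < f (snd p, fst p)} \<in> sets (K \<Otimes>\<^sub>M M)" by measurable
    from measurable_emeasure_Pair[OF this]
    show ?thesis
      by (rule measurable_cong[THEN iffD1, rotated]) (auto intro!: arg_cong[where f="emeasure M"] simp: space_pair_measure)
  qed
  ultimately show "{z \<in> space K. y < esssup M (\<lambda>x. f (x, z))} \<in> sets K"
    by (simp add: measurable_def)
qed

lemma borel_measurable_Lp_norm:
  fixes f :: "'a \<times> 'b \<Rightarrow> ennreal"
  assumes M: "sigma_finite_measure M" and f [measurable]: "f \<in> borel_measurable (M \<Otimes>\<^sub>M K)"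
  shows "(\<lambda>z. Lp_norm r M (\<lambda>x. f (x, z))) \<in> borel_measurable K"
proof (cases "r = \<infinity>")
  case True
  then show ?thesis using borel_measurable_esssup[OF assms] by (simp add: Lp_norm_top)
next
  case False
  interpret sigma_finite_measure M by fact
  show ?thesis unfolding Lp_norm_finite[OF False] by measurable
qed

text \<open>For finite \<open>r\<close> this is the weighted Jensen inequality: with \<open>n(z)\<close> the norm of
  \<open>f(\<cdot>, z)\<close>, write \<open>f = n \<cdot> (f / n)\<close> and use \<open>n\<close> as the weight.\<close>

lemma Lp_norm_nn_integral_le:
  fixes f :: "'a \<times> 'b \<Rightarrow> ennreal"
  assumes M: "sigma_finite_measure M" and K: "sigma_finite_measure K"
    and f [measurable]: "f \<in> borel_measurable (M \<Otimes>\<^sub>M K)" and r: "1 \<le> r"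
  shows "Lp_norm r M (\<lambda>x. \<integral>\<^sup>+z. f (x, z) \<partial>K) \<le> (\<integral>\<^sup>+z. Lp_norm r M (\<lambda>x. f (x, z)) \<partial>K)"
proof -
  interpret M: sigma_finite_measure M by fact
  interpret K: sigma_finite_measure K by fact
  interpret P: pair_sigma_finite M K ..
  define n where "n = (\<lambda>z. Lp_norm r M (\<lambda>x. f (x, z)))"
  have n[measurable]: "n \<in> borel_measurable K"
    unfolding n_def by (rule borel_measurable_Lp_norm[OF M f])
  show ?thesis
  proof (cases "r = \<infinity>")
    case True
    have "AE z in K. AE x in M. f (x, z) \<le> n z"
      unfolding n_def using True by (simp add: Lp_norm_top esssup_AE)
    then have "AE x in M. AE z in K. f (x, z) \<le> n z"
      by (subst P.AE_commute) auto
    then have "AE x in M. (\<integral>\<^sup>+z. f (x, z) \<partial>K) \<le> (\<integral>\<^sup>+z. n z \<partial>K)"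
      by (auto elim!: eventually_mono intro: nn_integral_mono_AE)
    then show ?thesis using True unfolding n_def[symmetric] by (auto simp: Lp_norm_top intro!: esssup_I)
  next
    case False
    define \<rho> where "\<rho> = enn2real r"
    have \<rho>: "1 \<le> \<rho>" using False r unfolding \<rho>_def by (rule_tac enn2real_ge_1)
    show ?thesis
    proof (cases "(\<integral>\<^sup>+z. n z \<partial>K) = \<infinity>")
      case True
      then show ?thesis unfolding n_def by simp
    next
      case fin: False
      have nr: "(\<integral>\<^sup>+x. ennreal_power (f (x, z)) \<rho> \<partial>M) = ennreal_power (n z) \<rho>" for z
        using \<rho> unfolding n_def Lp_norm_finite[OF False] \<rho>_def[symmetric] by (simp add: ennreal_power_power)
      define g where "g = (\<lambda>p. f p / n (snd p))"
      have g[measurable]: "g \<in> borel_measurable (M \<Otimes>\<^sub>M K)" unfolding g_def by measurable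
      have powr_m: "t powr (\<rho> - 1) * t = t powr \<rho>" if "0 \<le> t" for t :: real
        using that \<rho> by (cases "t = 0") (auto simp: powr_diff)
      have nfin: "AE z in K. n z \<noteq> \<infinity>" using fin by (intro nn_integral_PInf_AE) auto
      \<comment> \<open>The factorization can fail only where \<open>n z\<close> is infinite, which
        is a null set of \<open>z\<close> here. Where \<open>n z = 0\<close>, the slice of
        \<open>f\<close> vanishes almost everywhere, so both sides do.\<close>
      have "AE z in K. AE x in M. f (x, z) = n z * g (x, z)"
        using nfin AE_space
      proof eventually_elim
        case (elim z)
        note zK = elim(2)
          show ?case
          proof (cases "n z = 0")
            case True
            have [measurable]: "(\<lambda>x. f (x, z)) \<in> borel_measurable M" using zK by measurable
            have "AE x in M. ennreal_power (f (x, z)) \<rho> = 0"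
              using nr[of z] True by (subst nn_integral_0_iff_AE[symmetric]) auto
            then show ?thesis using True by (simp add: ennreal_power_eq_0_iff)
          next
            case False
            then have "inverse (n z) * n z = 1"
              using elim by (metis divide_ennreal_def ennreal_divide_self infinity_ennreal_def less_top mult.commute)
            then have "n z * (t / n z) = t" for t
              by (simp add: divide_ennreal_def mult.left_commute mult.commute)
            then show ?thesis by (simp add: g_def)
          qed
      qed
      then have "AE x in M. AE z in K. f (x, z) = n z * g (x, z)"
        by (subst P.AE_commute) auto
      then have eq: "AE x in M. (\<integral>\<^sup>+z. f (x, z) \<partial>K) = (\<integral>\<^sup>+z. n z * g (x, z) \<partial>K)"
        by (auto elim!: eventually_mono intro: nn_integral_cong_AE)
      have "(\<integral>\<^sup>+x. ennreal_power (\<integral>\<^sup>+z. f (x, z) \<partial>K) \<rho> \<partial>M)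
          = (\<integral>\<^sup>+x. ennreal_power (\<integral>\<^sup>+z. n z * g (x, z) \<partial>K) \<rho> \<partial>M)"
        using eq by (intro nn_integral_cong_AE) (auto elim!: eventually_mono)
      also have "\<dots> \<le> (\<integral>\<^sup>+x. ennreal_power (\<integral>\<^sup>+z. n z \<partial>K) (\<rho> - 1) * (\<integral>\<^sup>+z. n z * ennreal_power (g (x, z)) \<rho> \<partial>K) \<partial>M)"
        using fin \<rho> by (intro nn_integral_mono ennreal_power_jensen) (auto simp: less_top)
      also have "\<dots> = ennreal_power (\<integral>\<^sup>+z. n z \<partial>K) (\<rho> - 1) * (\<integral>\<^sup>+x. (\<integral>\<^sup>+z. n z * ennreal_power (g (x, z)) \<rho> \<partial>K) \<partial>M)"
        by (rule nn_integral_cmult) measurable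
      also have "(\<integral>\<^sup>+x. (\<integral>\<^sup>+z. n z * ennreal_power (g (x, z)) \<rho> \<partial>K) \<partial>M) = (\<integral>\<^sup>+z. (\<integral>\<^sup>+x. n z * ennreal_power (g (x, z)) \<rho> \<partial>M) \<partial>K)"
        by (rule P.Fubini'[symmetric]) measurable
      \<comment> \<open>Division by \<open>n z\<close> makes every slice of \<open>g\<close> with
        finite nonzero \<open>n z\<close> a function of norm one.\<close>
      also have "\<dots> \<le> (\<integral>\<^sup>+z. n z \<partial>K)"
      proof (rule nn_integral_mono_AE, use nfin AE_space in eventually_elim)
        case (elim z)
        show ?case
        proof (cases "n z = 0")
          case False
          have "(\<integral>\<^sup>+x. n z * ennreal_power (g (x, z)) \<rho> \<partial>M)
              = (\<integral>\<^sup>+x. (n z * ennreal_power (inverse (n z)) \<rho>) * ennreal_power (f (x, z)) \<rho> \<partial>M)"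
            using \<rho> by (simp add: g_def divide_ennreal_def ennreal_power_mult mult_ac)
          also have "\<dots> \<le> (n z * ennreal_power (inverse (n z)) \<rho>) * (\<integral>\<^sup>+x. ennreal_power (f (x, z)) \<rho> \<partial>M)"
            using elim(2) by (subst nn_integral_cmult) auto
          also have "\<dots> = n z * ennreal_power (inverse (n z) * n z) \<rho>"
            using \<rho> by (simp add: nr ennreal_power_mult mult_ac)
          also have "inverse (n z) * n z = 1"
            using False elim by (metis divide_ennreal_def ennreal_divide_self infinity_ennreal_def less_top mult.commute)
          finally show ?thesis using \<rho> by (simp add: ennreal_power_def)
        qed simp
      qed
      also have "ennreal_power (\<integral>\<^sup>+z. n z \<partial>K) (\<rho> - 1) * (\<integral>\<^sup>+z. n z \<partial>K) = ennreal_power (\<integral>\<^sup>+z. n z \<partial>K) \<rho>"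
        using \<rho> by (cases "\<integral>\<^sup>+z. n z \<partial>K")
          (auto simp: ennreal_power_ennreal powr_m simp flip: ennreal_mult'')
      finally have "(\<integral>\<^sup>+x. ennreal_power (\<integral>\<^sup>+z. f (x, z) \<partial>K) \<rho> \<partial>M) \<le> ennreal_power (\<integral>\<^sup>+z. n z \<partial>K) \<rho>"
        by (simp add: mult_left_mono)
      then have "ennreal_power (\<integral>\<^sup>+x. ennreal_power (\<integral>\<^sup>+z. f (x, z) \<partial>K) \<rho> \<partial>M) (1 / \<rho>)
          \<le> ennreal_power (ennreal_power (\<integral>\<^sup>+z. n z \<partial>K) \<rho>) (1 / \<rho>)"
        using \<rho> by (intro ennreal_power_mono) auto
      then show ?thesis using \<rho> unfolding n_def Lp_norm_finite[OF False] \<rho>_def[symmetric]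
        by (simp add: ennreal_power_power)
    qed
  qed
qed

lemma Lp_norm_cmult_le:
  assumes [measurable]: "g \<in> borel_measurable M" and c: "c \<ge> 0" and r: "1 \<le> r"
  shows "Lp_norm r M (\<lambda>x. ennreal c * g x) \<le> ennreal c * Lp_norm r M g"
proof (cases "c = 0")
  case True
  have "Lp_norm r M (\<lambda>x. 0) = 0"
  proof (cases "r = \<infinity>")
    case True
    have "esssup M (\<lambda>x. 0::ennreal) \<le> 0" by (rule esssup_I) auto
    then show ?thesis using True by (simp add: Lp_norm_top)
  qed (simp add: Lp_norm_finite)
  then show ?thesis using True by simp
next
  case False
  then show ?thesis using assms by (simp add: Lp_norm_cmult)
qed

lemma Lp_norm_lborel_translate:
  fixes g :: "'a::euclidean_space \<Rightarrow> ennreal"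
  assumes [measurable]: "g \<in> borel_measurable borel"
  shows "Lp_norm r lborel (\<lambda>x. g (x + a)) = Lp_norm r lborel g"
  using Lp_norm_distr[of "(+) a" lborel borel g r] by (simp add: lborel_distr_plus add.commute)

section \<open>Mixed norms of functions of two variables\<close>

lemma slice_measurable:
  fixes F :: "'a::euclidean_space \<Rightarrow> 'a \<Rightarrow> complex"
  assumes F: "(\<lambda>p. F (fst p) (snd p)) \<in> borel_measurable borel"
    and [measurable]: "f \<in> borel_measurable M" "g \<in> borel_measurable M"
  shows "(\<lambda>x. F (f x) (g x)) \<in> borel_measurable M"
proof -
  have "(\<lambda>x. (f x, g x)) \<in> measurable M (borel \<Otimes>\<^sub>M borel)" by measurable
  then have "(\<lambda>x. (f x, g x)) \<in> borel_measurable M" by (simp add: borel_prod)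
  from measurable_compose[OF this F] show ?thesis by simp
qed

lemma inner_norm_measurable:
  fixes F :: "'a::euclidean_space \<Rightarrow> 'a \<Rightarrow> complex"
  assumes F: "(\<lambda>p. F (fst p) (snd p)) \<in> borel_measurable borel"
  shows "(\<lambda>Y. Lp_norm r lborel (\<lambda>X. ennreal (norm (F X Y)))) \<in> borel_measurable borel"
proof -
  note [measurable] = slice_measurable[OF F]
  have "(\<lambda>Y. Lp_norm r lborel (\<lambda>X. ennreal (norm (F (fst (X, Y)) (snd (X, Y)))))) \<in> borel_measurable borel"
    by (rule borel_measurable_Lp_norm) (auto intro: sigma_finite_lborel)
  then show ?thesis by simp
qed

lemma mixed_norm_scale_measure:
  fixes F :: "'a::euclidean_space \<Rightarrow> 'a \<Rightarrow> complex"
  assumes F: "(\<lambda>p. F (fst p) (snd p)) \<in> borel_measurable borel"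
    and c: "c > 0" and r: "1 \<le> r" and s: "1 \<le> s"
  shows "mixed_norm r s (scale_measure (ennreal c) lborel) F
    = ennreal (scale_factor r c * scale_factor s c) * mixed_norm r s lborel F"
proof -
  note [measurable] = slice_measurable[OF F] inner_norm_measurable[OF F]
  have "mixed_norm r s (scale_measure (ennreal c) lborel) F
    = Lp_norm s (scale_measure (ennreal c) lborel)
        (\<lambda>Y. ennreal (scale_factor r c) * Lp_norm r lborel (\<lambda>X. ennreal (norm (F X Y))))"
    unfolding mixed_norm_def using c r by (simp add: Lp_norm_scale_measure)
  also have "\<dots> = ennreal (scale_factor s c) * (ennreal (scale_factor r c) * mixed_norm r s lborel F)"
    unfolding mixed_norm_def using c s
    by (subst Lp_norm_scale_measure) (auto simp: Lp_norm_cmult scale_factor_pos)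
  also have "\<dots> = ennreal (scale_factor r c * scale_factor s c) * mixed_norm r s lborel F"
    using scale_factor_pos[OF c, of s] by (subst ennreal_mult'') (auto simp: mult_ac)
  finally show ?thesis .
qed

text \<open>For fixed \<open>Y\<close> the term \<open>a Y\<close> is one translation of the inner
  variable, to which the inner norm is blind; this is why \<open>a\<close> may be any function. One
  \<open>K\<close> serves all \<open>F\<close> and \<open>a\<close>, so it can be shared by
  modulation norms whose arguments differ only in the shift.\<close>

lemma mixed_norm_linear:
  fixes L\<^sub>1 L\<^sub>2 :: "'a::euclidean_space \<Rightarrow> 'a"
  assumes "linear L\<^sub>1" "bij L\<^sub>1" "linear L\<^sub>2" "bij L\<^sub>2" and r: "1 \<le> r" and s: "1 \<le> s"
  obtains K :: real where "K > 0"
    "\<And>F a. (\<lambda>p. F (fst p) (snd p)) \<in> borel_measurable borel \<Longrightarrow>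
      mixed_norm r s lborel (\<lambda>X Y. F (L\<^sub>1 X + a Y) (L\<^sub>2 Y)) = ennreal K * mixed_norm r s lborel F"
proof -
  note [measurable] = linear_borel_measurable[OF assms(1)] linear_borel_measurable[OF assms(3)]
  obtain c where c: "c > 0" "distr lborel borel L\<^sub>1 = scale_measure (ennreal c) lborel"
    using lborel_distr_linear[OF assms(1,2)] .
  obtain d where d: "d > 0" "distr lborel borel L\<^sub>2 = scale_measure (ennreal d) lborel"
    using lborel_distr_linear[OF assms(3,4)] .
  define K where "K = scale_factor r c * scale_factor s d"
  have "mixed_norm r s lborel (\<lambda>X Y. F (L\<^sub>1 X + a Y) (L\<^sub>2 Y)) = ennreal K * mixed_norm r s lborel F"
    if F: "(\<lambda>p. F (fst p) (snd p)) \<in> borel_measurable borel" for F :: "'a \<Rightarrow> 'a \<Rightarrow> complex" and a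
  proof -
    note [measurable] = slice_measurable[OF F] inner_norm_measurable[OF F]
    define G where "G = (\<lambda>Y. Lp_norm r lborel (\<lambda>X. ennreal (norm (F X Y))))"
    have [measurable]: "G \<in> borel_measurable borel" unfolding G_def by measurable
    have "Lp_norm r lborel (\<lambda>X. ennreal (norm (F (L\<^sub>1 X + a Y) Z))) = ennreal (scale_factor r c) * G Z" for Y Z
      using Lp_norm_distr[of L\<^sub>1 lborel borel "\<lambda>X. ennreal (norm (F (X + a Y) Z))" r]
        Lp_norm_lborel_translate[of "\<lambda>X. ennreal (norm (F X Z))" r "a Y"] c r
      by (simp add: Lp_norm_scale_measure G_def)
    then have "mixed_norm r s lborel (\<lambda>X Y. F (L\<^sub>1 X + a Y) (L\<^sub>2 Y))
        = ennreal (scale_factor r c) * Lp_norm s lborel (\<lambda>Y. G (L\<^sub>2 Y))"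
      unfolding mixed_norm_def using c s by (simp add: Lp_norm_cmult scale_factor_pos)
    also have "Lp_norm s lborel (\<lambda>Y. G (L\<^sub>2 Y)) = ennreal (scale_factor s d) * mixed_norm r s lborel F"
      using Lp_norm_distr[of L\<^sub>2 lborel borel G s] d s
      by (simp add: Lp_norm_scale_measure mixed_norm_def G_def[symmetric])
    finally show ?thesis
      using scale_factor_pos[OF d(1), of s] unfolding K_def by (subst ennreal_mult'') (auto simp: mult_ac)
  qed
  moreover have "K > 0" using c d by (simp add: K_def scale_factor_pos)
  ultimately show ?thesis using that by blast
qed

text \<open>Young's inequality with an integrable factor. Minkowski's integral inequality is applied
  to the inner norm and then to the outer one, and translates of \<open>F\<close> have the same norm
  as \<open>F\<close>. Only a pointwise bound on \<open>H\<close> is assumed, because absolute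
  values of a twisted convolution are to be estimated.\<close>

lemma mixed_norm_convolution_le:
  fixes F H :: "'a::euclidean_space \<Rightarrow> 'a \<Rightarrow> complex" and \<theta> :: "'a \<times> 'a \<Rightarrow> real"
  assumes F: "(\<lambda>p. F (fst p) (snd p)) \<in> borel_measurable borel"
    and H: "(\<lambda>p. H (fst p) (snd p)) \<in> borel_measurable borel"
    and \<theta> [measurable]: "\<theta> \<in> borel_measurable borel" and nn: "\<And>z. \<theta> z \<ge> 0"
    and r: "1 \<le> r" and s: "1 \<le> s"
    and le: "\<And>X Y. ennreal (norm (H X Y)) \<le>
      (\<integral>\<^sup>+z. ennreal (\<theta> z) * ennreal (norm (F (X + fst z) (Y + snd z))) \<partial>lborel)"
  shows "mixed_norm r s lborel H \<le> (\<integral>\<^sup>+z. ennreal (\<theta> z) \<partial>lborel) * mixed_norm r s lborel F"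
proof -
  note [measurable] = slice_measurable[OF F] slice_measurable[OF H] inner_norm_measurable[OF F]
    inner_norm_measurable[OF H]
  define G where "G = (\<lambda>Y. Lp_norm r lborel (\<lambda>X. ennreal (norm (F X Y))))"
  have [measurable]: "G \<in> borel_measurable borel" unfolding G_def by measurable
  have inner: "Lp_norm r lborel (\<lambda>X. ennreal (norm (H X Y))) \<le> (\<integral>\<^sup>+z. ennreal (\<theta> z) * G (Y + snd z) \<partial>lborel)" for Y
  proof -
    have "Lp_norm r lborel (\<lambda>X. ennreal (norm (H X Y)))
        \<le> Lp_norm r lborel (\<lambda>X. \<integral>\<^sup>+z. ennreal (\<theta> z) * ennreal (norm (F (X + fst z) (Y + snd z))) \<partial>lborel)"
      using le r by (intro Lp_norm_mono) auto
    also have "\<dots> \<le> (\<integral>\<^sup>+z. Lp_norm r lborel (\<lambda>X. ennreal (\<theta> z) * ennreal (norm (F (X + fst z) (Y + snd z)))) \<partial>lborel)"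
      using Lp_norm_nn_integral_le[of lborel lborel "\<lambda>(X, z). ennreal (\<theta> z) * ennreal (norm (F (X + fst z) (Y + snd z)))" r] r
      by (simp add: sigma_finite_lborel)
    also have "\<dots> \<le> (\<integral>\<^sup>+z. ennreal (\<theta> z) * G (Y + snd z) \<partial>lborel)"
    proof (rule nn_integral_mono)
      fix z
      have "Lp_norm r lborel (\<lambda>X. ennreal (\<theta> z) * ennreal (norm (F (X + fst z) (Y + snd z))))
          \<le> ennreal (\<theta> z) * Lp_norm r lborel (\<lambda>X. ennreal (norm (F (X + fst z) (Y + snd z))))"
        using nn r by (intro Lp_norm_cmult_le) auto
      also have "Lp_norm r lborel (\<lambda>X. ennreal (norm (F (X + fst z) (Y + snd z)))) = G (Y + snd z)"
        unfolding G_def by (rule Lp_norm_lborel_translate) measurable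
      finally show "Lp_norm r lborel (\<lambda>X. ennreal (\<theta> z) * ennreal (norm (F (X + fst z) (Y + snd z))))
          \<le> ennreal (\<theta> z) * G (Y + snd z)" .
    qed
    finally show ?thesis .
  qed
  have "mixed_norm r s lborel H \<le> Lp_norm s lborel (\<lambda>Y. \<integral>\<^sup>+z. ennreal (\<theta> z) * G (Y + snd z) \<partial>lborel)"
    unfolding mixed_norm_def using inner s by (intro Lp_norm_mono) auto
  also have "\<dots> \<le> (\<integral>\<^sup>+z. Lp_norm s lborel (\<lambda>Y. ennreal (\<theta> z) * G (Y + snd z)) \<partial>lborel)"
    using Lp_norm_nn_integral_le[of lborel lborel "\<lambda>(Y, z). ennreal (\<theta> z) * G (Y + snd z)" s] s
    by (simp add: sigma_finite_lborel)
  also have "\<dots> \<le> (\<integral>\<^sup>+z. ennreal (\<theta> z) * mixed_norm r s lborel F \<partial>lborel)"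
  proof (rule nn_integral_mono)
    fix z
    have "Lp_norm s lborel (\<lambda>Y. ennreal (\<theta> z) * G (Y + snd z)) \<le> ennreal (\<theta> z) * Lp_norm s lborel (\<lambda>Y. G (Y + snd z))"
      using nn s by (intro Lp_norm_cmult_le) auto
    also have "Lp_norm s lborel (\<lambda>Y. G (Y + snd z)) = mixed_norm r s lborel F"
      unfolding mixed_norm_def G_def[symmetric] by (rule Lp_norm_lborel_translate) measurable
    finally show "Lp_norm s lborel (\<lambda>Y. ennreal (\<theta> z) * G (Y + snd z)) \<le> ennreal (\<theta> z) * mixed_norm r s lborel F" .
  qed
  also have "\<dots> = (\<integral>\<^sup>+z. ennreal (\<theta> z) \<partial>lborel) * mixed_norm r s lborel F"
    by (rule nn_integral_multc) measurable
  finally show ?thesis .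
qed

section \<open>Schwartz functions\<close>

lemma dir_deriv_eq: "(f has_derivative D) (at x) \<Longrightarrow> dir_deriv v f x = D v"
  unfolding dir_deriv_def using frechet_derivative_at by metis

lemma iter_deriv_Nil [simp]: "iter_deriv [] f = f"
  by (simp add: iter_deriv_def)

lemma iter_deriv_Cons [simp]: "iter_deriv (v # vs) f = dir_deriv v (iter_deriv vs f)"
  by (simp add: iter_deriv_def)

lemma iter_deriv_snoc: "iter_deriv (vs @ [v]) f = iter_deriv vs (dir_deriv v f)"
  by (simp add: iter_deriv_def)

text \<open>Membership speaks about all iterated derivatives at once. A class of differentiable
  functions of rapid decay that is closed under partial derivatives satisfies this without any
  formula for the iterated derivatives.\<close>

lemma schwartz_coinduct:
  assumes "P f"
    and "\<And>f x. P f \<Longrightarrow> f differentiable (at x)"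
    and "\<And>f k. P f \<Longrightarrow> bounded (range (\<lambda>x. (1 + norm x) ^ k *\<^sub>R f x))"
    and "\<And>f b. P f \<Longrightarrow> b \<in> Basis \<Longrightarrow> P (dir_deriv b f)"
  shows "f \<in> schwartz_space"
proof -
  have "P (iter_deriv vs f)" if "vs \<in> lists Basis" for vs
    using that by (induction vs) (auto intro: assms(1,4))
  then show ?thesis unfolding schwartz_space_def using assms(2,3) by blast
qed

lemma schwartz_differentiable: "f \<in> schwartz_space \<Longrightarrow> f differentiable (at x)"
  unfolding schwartz_space_def by (auto dest!: bspec[of _ _ "[]"])

lemma schwartz_bounded: "f \<in> schwartz_space \<Longrightarrow> bounded (range (\<lambda>x. (1 + norm x) ^ k *\<^sub>R f x))"
  unfolding schwartz_space_def by (auto dest!: bspec[of _ _ "[]"])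

lemma schwartz_dir_deriv:
  assumes "f \<in> schwartz_space" "b \<in> Basis" shows "dir_deriv b f \<in> schwartz_space"
proof -
  have "iter_deriv vs (dir_deriv b f) = iter_deriv (vs @ [b]) f" for vs
    by (simp add: iter_deriv_snoc)
  then show ?thesis using assms unfolding schwartz_space_def by auto
qed

lemma schwartz_iter_deriv:
  "f \<in> schwartz_space \<Longrightarrow> vs \<in> lists Basis \<Longrightarrow> iter_deriv vs f \<in> schwartz_space"
  by (induction vs) (auto intro: schwartz_dir_deriv)

lemma schwartz_has_derivative:
  fixes f :: "'a::euclidean_space \<Rightarrow> complex"
  assumes "f \<in> schwartz_space"
  shows "(f has_derivative (\<lambda>h. dir_deriv h f x)) (at x)"
  using schwartz_differentiable[OF assms, of x] unfolding dir_deriv_def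
  by (simp add: frechet_derivative_works)

lemma schwartz_dir_deriv_expand:
  fixes f :: "'a::euclidean_space \<Rightarrow> complex"
  assumes "f \<in> schwartz_space"
  shows "dir_deriv h f x = (\<Sum>b\<in>Basis. of_real (h \<bullet> b) * dir_deriv b f x)"
proof -
  have "linear (\<lambda>h. dir_deriv h f x)"
    using schwartz_has_derivative[OF assms] by (rule has_derivative_linear)
  then have "dir_deriv (\<Sum>b\<in>Basis. (h \<bullet> b) *\<^sub>R b) f x = (\<Sum>b\<in>Basis. (h \<bullet> b) *\<^sub>R dir_deriv b f x)"
    using linear_sum[of "\<lambda>h. dir_deriv h f x" "\<lambda>b. (h \<bullet> b) *\<^sub>R b" Basis]
      linear_scale[of "\<lambda>h. dir_deriv h f x"] by simp
  then show ?thesis by (simp add: euclidean_representation scaleR_conv_of_real)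
qed

lemma schwartz_continuous:
  fixes f :: "'a::euclidean_space \<Rightarrow> complex"
  assumes "f \<in> schwartz_space" shows "continuous_on UNIV f"
  by (intro continuous_at_imp_continuous_on ballI differentiable_imp_continuous_within schwartz_differentiable assms)

lemma schwartz_measurable:
  fixes f :: "'a::euclidean_space \<Rightarrow> complex"
  assumes "f \<in> schwartz_space" shows "f \<in> borel_measurable borel"
  using schwartz_continuous[OF assms] by (rule borel_measurable_continuous_onI)

text \<open>Products and modulated functions are not closed under differentiation as a class, since
  the product rule produces sums. Their linear combinations are.\<close>

inductive_set fspan :: "('a \<Rightarrow> complex) set \<Rightarrow> ('a \<Rightarrow> complex) set" for G where
  gen: "g \<in> G \<Longrightarrow> g \<in> fspan G"
| add: "f \<in> fspan G \<Longrightarrow> g \<in> fspan G \<Longrightarrow> (\<lambda>x. f x + g x) \<in> fspan G"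
| scale: "f \<in> fspan G \<Longrightarrow> (\<lambda>x. c * f x) \<in> fspan G"

lemma dir_deriv_add:
  assumes "f differentiable (at x)" "g differentiable (at x)"
  shows "dir_deriv v (\<lambda>x. f x + g x) x = dir_deriv v f x + dir_deriv v g x"
  using assms by (intro dir_deriv_eq) (auto simp: dir_deriv_def frechet_derivative_works intro!: derivative_eq_intros)

lemma dir_deriv_cmult:
  assumes "f differentiable (at x)"
  shows "dir_deriv v (\<lambda>x. c * f x) x = c * dir_deriv v f x"
  using assms by (intro dir_deriv_eq) (auto simp: dir_deriv_def frechet_derivative_works intro!: derivative_eq_intros)

text \<open>Coinduction up to linear combinations.\<close>

lemma fspan_subset_schwartz:
  fixes G :: "('a::euclidean_space \<Rightarrow> complex) set"
  assumes "\<And>g x. g \<in> G \<Longrightarrow> g differentiable (at x)"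
    and "\<And>g k. g \<in> G \<Longrightarrow> bounded (range (\<lambda>x. (1 + norm x) ^ k *\<^sub>R g x))"
    and "\<And>g b. g \<in> G \<Longrightarrow> b \<in> Basis \<Longrightarrow> dir_deriv b g \<in> fspan G"
    and f: "f \<in> fspan G"
  shows "f \<in> schwartz_space"
proof (rule schwartz_coinduct[of "\<lambda>f. f \<in> fspan G", OF f])
  show d: "f differentiable (at x)" if "f \<in> fspan G" for f x
    using that by induction (auto intro!: assms(1) differentiable_add differentiable_cmult_left_iff[THEN iffD2] derivative_intros)
  show "bounded (range (\<lambda>x. (1 + norm x) ^ k *\<^sub>R f x))" if "f \<in> fspan G" for f k
    using that
  proof induction
    case (gen g) then show ?case by (rule assms(2))
  next
    case (add f g)
    then show ?case using bounded_plus_comp[OF add.IH] by (simp add: scaleR_add_right)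
  next
    case (scale f c)
    have "bounded (range (\<lambda>x. c * ((1 + norm x) ^ k *\<^sub>R f x)))"
      using scale.IH bounded_linear_image[OF _ bounded_linear_mult_right[of c], of "range (\<lambda>x. (1 + norm x) ^ k *\<^sub>R f x)"]
      by (simp add: image_image)
    then show ?case by simp
  qed
  show "dir_deriv b f \<in> fspan G" if "f \<in> fspan G" "b \<in> Basis" for f b
    using that
  proof induction
    case (gen g) then show ?case by (auto intro: assms(3))
  next
    case (add f g)
    have "dir_deriv b (\<lambda>x. f x + g x) = (\<lambda>x. dir_deriv b f x + dir_deriv b g x)"
      using add.hyps by (auto intro!: dir_deriv_add d)
    then show ?case using add by (auto intro: fspan.add)
  next
    case (scale f c)
    have "dir_deriv b (\<lambda>x. c * f x) = (\<lambda>x. c * dir_deriv b f x)"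
      using scale.hyps by (auto intro!: dir_deriv_cmult d)
    then show ?case using scale by (auto intro: fspan.scale)
  qed
qed

lemma fspan_schwartz:
  fixes f :: "'a::euclidean_space \<Rightarrow> complex"
  assumes "f \<in> fspan schwartz_space" shows "f \<in> schwartz_space"
  by (rule fspan_subset_schwartz[OF _ _ _ assms])
    (auto intro: schwartz_differentiable schwartz_bounded schwartz_dir_deriv fspan.gen)

lemma schwartz_add:
  fixes f :: "'a::euclidean_space \<Rightarrow> complex"
  shows "f \<in> schwartz_space \<Longrightarrow> g \<in> schwartz_space \<Longrightarrow> (\<lambda>x. f x + g x) \<in> schwartz_space"
  by (rule fspan_schwartz, rule fspan.add; rule fspan.gen)

lemma schwartz_cmult:
  fixes f :: "'a::euclidean_space \<Rightarrow> complex"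
  shows "f \<in> schwartz_space \<Longrightarrow> (\<lambda>x. c * f x) \<in> schwartz_space"
  by (rule fspan_schwartz, rule fspan.scale, rule fspan.gen)

lemma schwartz_zero: "(\<lambda>x. 0) \<in> schwartz_space"
proof (rule schwartz_coinduct[of "\<lambda>f. f = (\<lambda>x. 0)"])
  show "dir_deriv b f = (\<lambda>x. 0)" if "f = (\<lambda>x. 0)" for f :: "'a \<Rightarrow> complex" and b
    using that by (auto intro!: dir_deriv_eq derivative_eq_intros)
qed auto

lemma schwartz_diff:
  fixes f :: "'a::euclidean_space \<Rightarrow> complex"
  shows "f \<in> schwartz_space \<Longrightarrow> g \<in> schwartz_space \<Longrightarrow> (\<lambda>x. f x - g x) \<in> schwartz_space"
  using schwartz_add[of f "\<lambda>x. -1 * g x"] schwartz_cmult[of g "-1"] by simp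

lemma schwartz_sum:
  fixes f :: "'i \<Rightarrow> 'a::euclidean_space \<Rightarrow> complex"
  assumes "finite I" "\<And>i. i \<in> I \<Longrightarrow> f i \<in> schwartz_space"
  shows "(\<lambda>x. \<Sum>i\<in>I. f i x) \<in> schwartz_space"
  using assms by (induction I) (auto intro: schwartz_zero schwartz_add)

lemma iter_deriv_add:
  fixes f :: "'a::euclidean_space \<Rightarrow> complex"
  assumes "f \<in> schwartz_space" "g \<in> schwartz_space" "vs \<in> lists Basis"
  shows "iter_deriv vs (\<lambda>x. f x + g x) = (\<lambda>x. iter_deriv vs f x + iter_deriv vs g x)"
  using assms(3)
  by (induction vs) (auto intro!: dir_deriv_add schwartz_differentiable schwartz_iter_deriv assms)

lemma iter_deriv_cmult:
  fixes f :: "'a::euclidean_space \<Rightarrow> complex"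
  assumes "f \<in> schwartz_space" "vs \<in> lists Basis"
  shows "iter_deriv vs (\<lambda>x. c * f x) = (\<lambda>x. c * iter_deriv vs f x)"
  using assms(2)
  by (induction vs) (auto intro!: dir_deriv_cmult schwartz_differentiable schwartz_iter_deriv assms)

lemma schwartz_fspanI:
  fixes G :: "('a::euclidean_space \<Rightarrow> complex) set"
  assumes "\<And>g. g \<in> G \<Longrightarrow> (\<forall>x. g differentiable (at x)) \<and>
      (\<forall>k. bounded (range (\<lambda>x. (1 + norm x) ^ k *\<^sub>R g x))) \<and>
      (\<forall>b\<in>Basis. dir_deriv b g \<in> fspan G)"
    and "f \<in> G"
  shows "f \<in> schwartz_space"
proof (rule fspan_subset_schwartz[OF _ _ _ fspan.gen[OF assms(2)]])
  fix g assume g: "g \<in> G"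
  show "g differentiable (at x)" for x using assms(1)[OF g] by blast
  show "bounded (range (\<lambda>x. (1 + norm x) ^ k *\<^sub>R g x))" for k using assms(1)[OF g] by (elim conjE allE)
  show "dir_deriv b g \<in> fspan G" if "b \<in> Basis" for b using assms(1)[OF g] that by blast
qed

text \<open>A bound on all seminorms up to order \<open>m\<close> at once. Being an inequality it
  avoids suprema, and \<open>sbd_Suc\<close> makes it inductive in \<open>m\<close> by splitting off
  the derivative that is applied first; inductions along it therefore generalize over the
  function.\<close>

definition sbd :: "nat \<Rightarrow> nat \<Rightarrow> real \<Rightarrow> ('a::euclidean_space \<Rightarrow> complex) \<Rightarrow> bool" where
  "sbd k m K f \<longleftrightarrow> (\<forall>vs\<in>lists Basis. length vs \<le> m \<longrightarrow>
     (\<forall>x. (1 + norm x) ^ k * norm (iter_deriv vs f x) \<le> K))"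

lemma sbd_0: "sbd k 0 K f \<longleftrightarrow> (\<forall>x. (1 + norm x) ^ k * norm (f x) \<le> K)"
  by (auto simp: sbd_def)

lemma sbd_Suc: "sbd k (Suc m) K f \<longleftrightarrow> sbd k 0 K f \<and> (\<forall>b\<in>Basis. sbd k m K (dir_deriv b f))"
proof (intro iffI conjI ballI)
  assume a: "sbd k (Suc m) K f"
  show "sbd k 0 K f" using a unfolding sbd_def by (auto dest: bspec[of _ _ "[]"])
  fix b :: 'a assume b: "b \<in> Basis"
  show "sbd k m K (dir_deriv b f)"
    unfolding sbd_def
  proof (intro ballI impI allI)
    fix vs :: "'a list" and x assume vs: "vs \<in> lists Basis" "length vs \<le> m"
    have "vs @ [b] \<in> lists Basis" "length (vs @ [b]) \<le> Suc m" using vs b by auto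
    then have "(1 + norm x) ^ k * norm (iter_deriv (vs @ [b]) f x) \<le> K"
      using a unfolding sbd_def by blast
    then show "(1 + norm x) ^ k * norm (iter_deriv vs (dir_deriv b f) x) \<le> K"
      by (simp add: iter_deriv_snoc)
  qed
next
  assume a: "sbd k 0 K f \<and> (\<forall>b\<in>Basis. sbd k m K (dir_deriv b f))"
  show "sbd k (Suc m) K f"
    unfolding sbd_def
  proof (intro ballI impI allI)
    fix vs :: "'a list" and x assume vs: "vs \<in> lists Basis" "length vs \<le> Suc m"
    show "(1 + norm x) ^ k * norm (iter_deriv vs f x) \<le> K"
    proof (cases vs rule: rev_cases)
      case Nil then show ?thesis using a by (auto simp: sbd_0)
    next
      case (snoc ws b)
      then have "ws \<in> lists Basis" "length ws \<le> m" "b \<in> Basis" using vs by auto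
      then show ?thesis using a unfolding sbd_def snoc iter_deriv_snoc by blast
    qed
  qed
qed

lemma sbd_le: "sbd k m K f \<Longrightarrow> K \<le> K' \<Longrightarrow> sbd k m K' f"
  unfolding sbd_def by (meson order_trans)

lemma sbd_less: "sbd k m K f \<Longrightarrow> k' \<le> k \<Longrightarrow> m' \<le> m \<Longrightarrow> sbd k' m' K f"
proof -
  assume a: "sbd k m K f" "k' \<le> k" "m' \<le> m"
  have "(1 + norm x) ^ k' * t \<le> (1 + norm x) ^ k * t" if "t \<ge> 0" for x :: 'a and t :: real
    using a(2) that by (intro mult_right_mono power_increasing) auto
  then show ?thesis using a unfolding sbd_def by (meson norm_ge_zero order_trans)
qed

lemma sbd_nonneg: "sbd k m K f \<Longrightarrow> 0 \<le> K"
proof -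
  assume "sbd k m K f"
  then have "sbd k 0 K f" using sbd_less[of k m K f k 0] by simp
  then have "(1 + norm x) ^ k * norm (f x) \<le> K" for x by (simp add: sbd_0)
  moreover have "0 \<le> (1 + norm x) ^ k * norm (f x)" for x
    by (intro mult_nonneg_nonneg zero_le_power) auto
  ultimately show "0 \<le> K" using order_trans by blast
qed

lemma sbd_iter: "sbd k m K f \<Longrightarrow> vs \<in> lists Basis \<Longrightarrow> length vs \<le> m \<Longrightarrow>
    (1 + norm x) ^ k * norm (iter_deriv vs f x) \<le> K"
  by (simp add: sbd_def)

lemma sbd_D:
  assumes "sbd k m K f" shows "norm (f x) \<le> K / (1 + norm x) ^ k"
proof -
  have "(1 + norm x) ^ k * norm (f x) \<le> K" using sbd_iter[OF assms, of "[]"] by simp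
  moreover have "(1 + norm x) ^ k > 0" by (intro zero_less_power add_pos_nonneg) auto
  ultimately show ?thesis by (simp add: pos_le_divide_eq mult.commute)
qed

lemma sbd_add:
  fixes f :: "'a::euclidean_space \<Rightarrow> complex"
  assumes "f \<in> schwartz_space" "g \<in> schwartz_space" "sbd k m K f" "sbd k m K' g"
  shows "sbd k m (K + K') (\<lambda>x. f x + g x)"
  unfolding sbd_def
proof (intro ballI impI allI)
  fix vs :: "'a list" and x assume vs: "vs \<in> lists Basis" "length vs \<le> m"
  have "(1 + norm x) ^ k * norm (iter_deriv vs f x + iter_deriv vs g x)
     \<le> (1 + norm x) ^ k * (norm (iter_deriv vs f x) + norm (iter_deriv vs g x))"
    by (intro mult_left_mono norm_triangle_ineq) auto
  also have "\<dots> \<le> K + K'"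
    using sbd_iter[OF assms(3) vs, of x] sbd_iter[OF assms(4) vs, of x] by (simp add: distrib_left)
  finally show "(1 + norm x) ^ k * norm (iter_deriv vs (\<lambda>x. f x + g x) x) \<le> K + K'"
    by (simp add: iter_deriv_add assms vs)
qed

lemma sbd_cmult:
  fixes f :: "'a::euclidean_space \<Rightarrow> complex"
  assumes "f \<in> schwartz_space" "sbd k m K f"
  shows "sbd k m (norm c * K) (\<lambda>x. c * f x)"
  unfolding sbd_def
proof (intro ballI impI allI)
  fix vs :: "'a list" and x assume vs: "vs \<in> lists Basis" "length vs \<le> m"
  have "(1 + norm x) ^ k * norm (c * iter_deriv vs f x) = norm c * ((1 + norm x) ^ k * norm (iter_deriv vs f x))"
    by (simp add: norm_mult)
  also have "\<dots> \<le> norm c * K"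
    using sbd_iter[OF assms(2) vs, of x] by (intro mult_left_mono) auto
  finally show "(1 + norm x) ^ k * norm (iter_deriv vs (\<lambda>x. c * f x) x) \<le> norm c * K"
    by (simp add: iter_deriv_cmult assms vs)
qed

lemma sbd_zero: "K \<ge> 0 \<Longrightarrow> sbd k m K (\<lambda>x. 0)"
proof (induction m)
  case (Suc m)
  have "dir_deriv b (\<lambda>x. 0) = (\<lambda>x. 0)" for b :: 'a
    by (auto intro!: dir_deriv_eq derivative_eq_intros)
  then show ?case using Suc by (simp add: sbd_Suc sbd_0)
qed (simp add: sbd_0)

lemma sbd_sum:
  fixes f :: "'i \<Rightarrow> 'a::euclidean_space \<Rightarrow> complex"
  assumes "finite I" "\<And>i. i \<in> I \<Longrightarrow> f i \<in> schwartz_space" "\<And>i. i \<in> I \<Longrightarrow> sbd k m (K i) (f i)"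
  shows "sbd k m (\<Sum>i\<in>I. K i) (\<lambda>x. \<Sum>i\<in>I. f i x)"
  using assms by (induction I) (auto intro!: sbd_zero sbd_add schwartz_sum)

lemma schwartz_sbd:
  fixes f :: "'a::euclidean_space \<Rightarrow> complex"
  assumes "f \<in> schwartz_space"
  obtains K where "K > 0" "sbd k m K f"
proof -
  have "\<exists>K>0. sbd k m K f"
    using assms
  proof (induction m arbitrary: f)
    case 0
    obtain B where B: "B > 0" "\<And>x. norm ((1 + norm x) ^ k *\<^sub>R f x) \<le> B"
      using schwartz_bounded[OF 0, of k] unfolding bounded_pos by auto
    then have "sbd k 0 B f" unfolding sbd_0 by (auto simp: norm_power)
    then show ?case using B by blast
  next
    case (Suc m)
    obtain B where B: "B > 0" "\<And>x. norm ((1 + norm x) ^ k *\<^sub>R f x) \<le> B"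
      using schwartz_bounded[OF Suc.prems, of k] unfolding bounded_pos by auto
    then have 0: "sbd k 0 B f" unfolding sbd_0 by (auto simp: norm_power)
    have "\<forall>b\<in>Basis. \<exists>K>0. sbd k m K (dir_deriv b f)"
      using Suc by (auto intro: schwartz_dir_deriv)
    then obtain K where K: "\<And>b. b \<in> Basis \<Longrightarrow> K b > 0 \<and> sbd k m (K b) (dir_deriv b f)" by metis
    have "K b \<le> sum K Basis" if "b \<in> Basis" for b
      using that K by (intro member_le_sum) (auto intro: less_imp_le)
    then have "\<forall>b\<in>Basis. sbd k m (B + sum K Basis) (dir_deriv b f)"
      using K B by (smt (verit) sbd_le)
    moreover have "0 \<le> sum K Basis" using K by (intro sum_nonneg) (auto intro: less_imp_le)
    ultimately have "sbd k (Suc m) (B + sum K Basis) f"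
      unfolding sbd_Suc using 0 by (auto intro: sbd_le)
    then show ?case using B \<open>0 \<le> sum K Basis\<close> by (intro exI[of _ "B + sum K Basis"]) auto
  qed
  then show ?thesis using that by blast
qed

text \<open>The Peetre-type inequality: the weight \<open>1 + norm\<close> is submultiplicative, so
  that a translation by \<open>y\<close> costs at most a factor depending on
  \<open>y\<close>.\<close>

lemma one_plus_norm_le: "1 + norm (x :: 'a::real_normed_vector) \<le> (1 + norm y) * (1 + norm (x - y))"
proof -
  have "norm x \<le> norm y + norm (x - y)" by (metis add.commute diff_add_cancel norm_triangle_ineq)
  moreover have "(1 + norm y) * (1 + norm (x - y)) = 1 + norm y + norm (x - y) + norm y * norm (x - y)"
    by (simp add: algebra_simps)
  ultimately show ?thesis by (smt (verit) mult_nonneg_nonneg norm_ge_zero)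
qed

lemma one_plus_norm_power_le:
  "(1 + norm (x :: 'a::real_normed_vector)) ^ k \<le> (1 + norm y) ^ k * (1 + norm (x - y)) ^ k"
  unfolding power_mult_distrib[symmetric] by (intro power_mono one_plus_norm_le) auto

lemma schwartz_mult:
  fixes f g :: "'a::euclidean_space \<Rightarrow> complex"
  assumes "f \<in> schwartz_space" "g \<in> schwartz_space"
  shows "(\<lambda>x. f x * g x) \<in> schwartz_space"
proof (rule schwartz_fspanI[of "{\<lambda>x. f x * g x | f g :: 'a \<Rightarrow> complex. f \<in> schwartz_space \<and> g \<in> schwartz_space}"])
  let ?G = "{\<lambda>x. f x * g x | f g :: 'a \<Rightarrow> complex. f \<in> schwartz_space \<and> g \<in> schwartz_space}"
  fix h assume "h \<in> ?G"
  then obtain f g where h: "h = (\<lambda>x. f x * g x)" and f: "f \<in> schwartz_space" and g: "g \<in> schwartz_space"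
    by blast
  have d: "h differentiable (at x)" for x
    unfolding h by (intro differentiable_mult schwartz_differentiable f g)
  have "bounded (range (\<lambda>x. (1 + norm x) ^ k *\<^sub>R h x))" for k
  proof -
    obtain K1 where K1: "sbd k 0 K1 f" using schwartz_sbd[OF f] by blast
    obtain K2 where K2: "sbd 0 0 K2 g" using schwartz_sbd[OF g] by blast
    have "norm ((1 + norm x) ^ k *\<^sub>R h x) \<le> K1 * K2" for x
    proof -
      have "norm ((1 + norm x) ^ k *\<^sub>R h x) = ((1 + norm x) ^ k * norm (f x)) * norm (g x)"
        by (simp add: h norm_mult)
      also have "\<dots> \<le> K1 * K2"
        using K1 K2 sbd_nonneg[OF K1] unfolding sbd_0 by (intro mult_mono) auto
      finally show ?thesis .
    qed
    then show ?thesis by (auto simp: bounded_iff)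
  qed
  moreover have "dir_deriv b h \<in> fspan ?G" if b: "b \<in> Basis" for b
  proof -
    have "dir_deriv b h = (\<lambda>x. dir_deriv b f x * g x + f x * dir_deriv b g x)"
      unfolding h by (rule ext, rule dir_deriv_eq)
        (auto intro!: derivative_eq_intros schwartz_has_derivative f g)
    moreover have "\<dots> \<in> fspan ?G"
      using f g b by (intro fspan.add fspan.gen) (auto intro: schwartz_dir_deriv)
    ultimately show ?thesis by simp
  qed
  ultimately show "(\<forall>x. h differentiable (at x)) \<and> (\<forall>k. bounded (range (\<lambda>x. (1 + norm x) ^ k *\<^sub>R h x))) \<and>
      (\<forall>b\<in>Basis. dir_deriv b h \<in> fspan ?G)" using d by blast
qed (use assms in blast)

lemma dir_deriv_cnj:
  assumes "f \<in> schwartz_space"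
  shows "dir_deriv b (\<lambda>x. cnj (f x)) = (\<lambda>x. cnj (dir_deriv b f x))"
  by (rule ext, rule dir_deriv_eq) (intro has_derivative_cnj schwartz_has_derivative assms)

lemma schwartz_cnj:
  fixes f :: "'a::euclidean_space \<Rightarrow> complex"
  assumes "f \<in> schwartz_space" shows "(\<lambda>x. cnj (f x)) \<in> schwartz_space"
proof (rule schwartz_coinduct[of "\<lambda>h. \<exists>f\<in>schwartz_space. h = (\<lambda>x. cnj (f x))"])
  show "\<exists>g\<in>schwartz_space. (\<lambda>x. cnj (f x)) = (\<lambda>x. cnj (g x))" using assms by blast
next
  fix h :: "'a \<Rightarrow> complex" and x assume "\<exists>f\<in>schwartz_space. h = (\<lambda>x. cnj (f x))"
  then show "h differentiable (at x)"
    by (auto simp: differentiable_def intro!: has_derivative_cnj dest!: schwartz_has_derivative[where x=x])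
next
  fix h :: "'a \<Rightarrow> complex" and k assume "\<exists>f\<in>schwartz_space. h = (\<lambda>x. cnj (f x))"
  then show "bounded (range (\<lambda>x. (1 + norm x) ^ k *\<^sub>R h x))"
    using schwartz_bounded by (auto simp: bounded_iff)
next
  fix h :: "'a \<Rightarrow> complex" and b :: 'a assume "\<exists>f\<in>schwartz_space. h = (\<lambda>x. cnj (f x))" "b \<in> Basis"
  then show "\<exists>f\<in>schwartz_space. dir_deriv b h = (\<lambda>x. cnj (f x))"
    by (auto simp: dir_deriv_cnj intro!: schwartz_dir_deriv)
qed

section \<open>Tempered distributions\<close>

lemma tempered_zero: "u \<in> tempered_distributions \<Longrightarrow> f \<notin> schwartz_space \<Longrightarrow> u f = 0"
  by (simp add: tempered_distributions_def)

lemma tempered_add: "u \<in> tempered_distributions \<Longrightarrow> f \<in> schwartz_space \<Longrightarrow> g \<in> schwartz_space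
    \<Longrightarrow> u (\<lambda>x. f x + g x) = u f + u g"
  by (simp add: tempered_distributions_def)

lemma tempered_cmult: "u \<in> tempered_distributions \<Longrightarrow> f \<in> schwartz_space \<Longrightarrow> u (\<lambda>x. c * f x) = c * u f"
  by (simp add: tempered_distributions_def)

lemma tempered_diff:
  fixes f :: "'a::euclidean_space \<Rightarrow> complex"
  assumes "u \<in> tempered_distributions" "f \<in> schwartz_space" "g \<in> schwartz_space"
  shows "u (\<lambda>x. f x - g x) = u f - u g"
  using tempered_add[OF assms(1,2) schwartz_cmult[OF assms(3)], of "-1"] tempered_cmult[OF assms(1,3), of "-1"]
  by simp

lemma tempered_sum:
  fixes f :: "'i \<Rightarrow> 'a::euclidean_space \<Rightarrow> complex"
  assumes "u \<in> tempered_distributions" "finite I" "\<And>i. i \<in> I \<Longrightarrow> f i \<in> schwartz_space"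
  shows "u (\<lambda>x. \<Sum>i\<in>I. f i x) = (\<Sum>i\<in>I. u (f i))"
  using assms(2,3)
proof (induction I)
  case empty
  show ?case using tempered_cmult[OF assms(1) schwartz_zero, of 0] by simp
next
  case (insert i I)
  then show ?case using tempered_add[OF assms(1), of "f i" "\<lambda>x. \<Sum>i\<in>I. f i x"]
    by (simp add: schwartz_sum)
qed

lemma finite_multi_indices: "finite {vs :: 'a::euclidean_space list. set vs \<subseteq> Basis \<and> length vs \<le> m}"
  by (rule finite_lists_length_le) simp

text \<open>The continuity estimate in terms of \<open>sbd\<close>, with one number \<open>m\<close>
  for the weight and for the order of derivatives. The factor is the number of multi-indices, and
  the absolute value of \<open>C\<close> is taken because the definition leaves its sign
  open.\<close>

lemma tempered_bound:
  fixes u :: "('a::euclidean_space \<Rightarrow> complex) \<Rightarrow> complex"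
  assumes "u \<in> tempered_distributions"
  obtains C m where "C \<ge> 0" "\<And>f K. f \<in> schwartz_space \<Longrightarrow> sbd m m K f \<Longrightarrow> norm (u f) \<le> C * K"
proof -
  obtain C m where C: "\<And>f. f \<in> schwartz_space \<Longrightarrow> norm (u f) \<le>
      C * (\<Sum>vs | set vs \<subseteq> Basis \<and> length vs \<le> m. schwartz_seminorm m vs f)"
    using assms unfolding tempered_distributions_def by blast
  let ?I = "{vs :: 'a list. set vs \<subseteq> Basis \<and> length vs \<le> m}"
  have "norm (u f) \<le> \<bar>C\<bar> * real (card ?I) * K" if f: "f \<in> schwartz_space" and K: "sbd m m K f" for f K
  proof -
    have le: "schwartz_seminorm m vs f \<le> K" and ge: "0 \<le> schwartz_seminorm m vs f" if "vs \<in> ?I" for vs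
    proof -
      have vs: "vs \<in> lists Basis" "length vs \<le> m" using that by auto
      show "schwartz_seminorm m vs f \<le> K"
        unfolding schwartz_seminorm_def by (rule cSUP_least) (auto intro: sbd_iter[OF K vs])
      have "0 \<le> (1 + norm (0::'a)) ^ m * norm (iter_deriv vs f 0)" by simp
      also have "\<dots> \<le> schwartz_seminorm m vs f"
        unfolding schwartz_seminorm_def
        by (rule cSUP_upper) (auto intro!: bdd_aboveI2[where M=K] sbd_iter[OF K vs])
      finally show "0 \<le> schwartz_seminorm m vs f" .
    qed
    have "norm (u f) \<le> \<bar>C\<bar> * (\<Sum>vs\<in>?I. schwartz_seminorm m vs f)"
      using ge by (intro order_trans[OF C[OF f]] mult_right_mono sum_nonneg) auto
    also have "\<dots> \<le> \<bar>C\<bar> * (\<Sum>vs\<in>?I. K)"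
      using le by (intro mult_left_mono sum_mono) auto
    finally show ?thesis by simp
  qed
  then show ?thesis using that[of "\<bar>C\<bar> * real (card ?I)" m] by auto
qed

text \<open>The converse of \<open>tempered_bound\<close>: the sum of all seminorms up to order
  \<open>m\<close> is itself an admissible \<open>K\<close>.\<close>

lemma temperedI:
  fixes u :: "('a::euclidean_space \<Rightarrow> complex) \<Rightarrow> complex"
  assumes "\<And>f. f \<notin> schwartz_space \<Longrightarrow> u f = 0"
    and "\<And>f g. f \<in> schwartz_space \<Longrightarrow> g \<in> schwartz_space \<Longrightarrow> u (\<lambda>x. f x + g x) = u f + u g"
    and "\<And>c f. f \<in> schwartz_space \<Longrightarrow> u (\<lambda>x. c * f x) = c * u f"
    and "C \<ge> 0" and bd: "\<And>f K. f \<in> schwartz_space \<Longrightarrow> sbd m m K f \<Longrightarrow> norm (u f) \<le> C * K"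
  shows "u \<in> tempered_distributions"
proof -
  let ?I = "{vs :: 'a list. set vs \<subseteq> Basis \<and> length vs \<le> m}"
  have "norm (u f) \<le> C * (\<Sum>vs\<in>?I. schwartz_seminorm m vs f)" if f: "f \<in> schwartz_space" for f
  proof (rule bd[OF f])
    obtain K where K: "sbd m m K f" using schwartz_sbd[OF f] by blast
    have up: "(1 + norm x) ^ m * norm (iter_deriv vs f x) \<le> schwartz_seminorm m vs f" if "vs \<in> ?I" for vs x
    proof -
      have vs: "vs \<in> lists Basis" "length vs \<le> m" using that by auto
      show ?thesis unfolding schwartz_seminorm_def
        by (rule cSUP_upper) (auto intro!: bdd_aboveI2[where M=K] sbd_iter[OF K vs])
    qed
    have ge: "0 \<le> schwartz_seminorm m vs f" if "vs \<in> ?I" for vs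
      using up[OF that, of 0] by (meson mult_nonneg_nonneg norm_ge_zero order_trans zero_le_power add_nonneg_nonneg zero_le_one)
    show "sbd m m (\<Sum>vs\<in>?I. schwartz_seminorm m vs f) f"
      unfolding sbd_def
    proof (intro ballI impI allI)
      fix vs :: "'a list" and x assume "vs \<in> lists Basis" "length vs \<le> m"
      then have vs: "vs \<in> ?I" by auto
      have "schwartz_seminorm m vs f \<le> (\<Sum>vs\<in>?I. schwartz_seminorm m vs f)"
        using vs ge finite_multi_indices by (intro member_le_sum) auto
      then show "(1 + norm x) ^ m * norm (iter_deriv vs f x) \<le> (\<Sum>vs\<in>?I. schwartz_seminorm m vs f)"
        using up[OF vs, of x] by linarith
    qed
  qed
  then show ?thesis unfolding tempered_distributions_def using assms(1-3) by blast
qed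

section \<open>Time-frequency shifts\<close>

text \<open>Translation followed by modulation, with frequencies in radians. After conjugation of
  the window, the classical shift with frequency \<open>w\<close> is \<open>tf\<close> with
  frequency \<open>- 2 pi w\<close>.\<close>

definition tf :: "'a::euclidean_space \<Rightarrow> 'a \<Rightarrow> ('a \<Rightarrow> complex) \<Rightarrow> 'a \<Rightarrow> complex" where
  "tf y \<eta> \<phi> = (\<lambda>t. cis (\<eta> \<bullet> t) * \<phi> (t - y))"

lemma has_derivative_cis_inner:
  "((\<lambda>t. cis (\<eta> \<bullet> t)) has_derivative (\<lambda>h. \<i> * of_real (\<eta> \<bullet> h) * cis (\<eta> \<bullet> x))) (at x)"
proof -
  have "((\<lambda>t. \<i> * complex_of_real (\<eta> \<bullet> t)) has_derivative (\<lambda>h. \<i> * of_real (\<eta> \<bullet> h))) (at x)"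
    by (auto intro!: derivative_eq_intros)
  from has_derivative_compose[OF this DERIV_exp[unfolded has_field_derivative_def]]
  show ?thesis unfolding cis_conv_exp by (simp add: mult.commute)
qed

lemma has_derivative_translate:
  fixes \<phi> :: "'a::euclidean_space \<Rightarrow> complex"
  assumes "\<phi> \<in> schwartz_space"
  shows "((\<lambda>t. \<phi> (t - y)) has_derivative (\<lambda>h. dir_deriv h \<phi> (x - y))) (at x)"
proof -
  have "((\<lambda>t. t - y) has_derivative (\<lambda>h. h)) (at x)" by (auto intro!: derivative_eq_intros)
  from has_derivative_compose[OF this schwartz_has_derivative[OF assms]] show ?thesis .
qed

lemma has_derivative_tf:
  assumes "\<phi> \<in> schwartz_space"
  shows "(tf y \<eta> \<phi> has_derivative (\<lambda>h. cis (\<eta> \<bullet> x) * dir_deriv h \<phi> (x - y)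
      + \<i> * of_real (\<eta> \<bullet> h) * cis (\<eta> \<bullet> x) * \<phi> (x - y))) (at x)"
  unfolding tf_def by (rule has_derivative_mult[OF has_derivative_cis_inner has_derivative_translate[OF assms]])

lemma dir_deriv_tf:
  assumes "\<phi> \<in> schwartz_space"
  shows "dir_deriv h (tf y \<eta> \<phi>) = (\<lambda>x. tf y \<eta> (dir_deriv h \<phi>) x + \<i> * of_real (\<eta> \<bullet> h) * tf y \<eta> \<phi> x)"
  by (rule ext, subst dir_deriv_eq[OF has_derivative_tf[OF assms]]) (simp add: tf_def mult_ac)

lemma norm_tf: "norm (tf y \<eta> \<phi> t) = norm (\<phi> (t - y))"
  by (simp add: tf_def norm_mult)

lemma norm_tf_weight:
  assumes "sbd k 0 K \<phi>"
  shows "(1 + norm t) ^ k * norm (tf y \<eta> \<phi> t) \<le> K * (1 + norm y) ^ k"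
proof -
  have "(1 + norm t) ^ k * norm (tf y \<eta> \<phi> t) \<le> ((1 + norm y) ^ k * (1 + norm (t - y)) ^ k) * norm (\<phi> (t - y))"
    unfolding norm_tf by (intro mult_right_mono one_plus_norm_power_le) auto
  also have "\<dots> = (1 + norm y) ^ k * ((1 + norm (t - y)) ^ k * norm (\<phi> (t - y)))" by simp
  also have "\<dots> \<le> (1 + norm y) ^ k * K"
    using assms unfolding sbd_0 by (intro mult_left_mono) auto
  finally show ?thesis by (simp add: mult.commute)
qed

lemma schwartz_tf:
  fixes \<phi> :: "'a::euclidean_space \<Rightarrow> complex"
  assumes "\<phi> \<in> schwartz_space" shows "tf y \<eta> \<phi> \<in> schwartz_space"
proof (rule schwartz_fspanI[of "tf y \<eta> ` schwartz_space"])
  fix g assume "g \<in> tf y \<eta> ` schwartz_space"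
  then obtain \<phi> where g: "g = tf y \<eta> \<phi>" and \<phi>: "\<phi> \<in> schwartz_space" by blast
  have "g differentiable (at x)" for x
    unfolding g differentiable_def using has_derivative_tf[OF \<phi>] by blast
  moreover have "bounded (range (\<lambda>x. (1 + norm x) ^ k *\<^sub>R g x))" for k
  proof -
    obtain K where "sbd k 0 K \<phi>" using schwartz_sbd[OF \<phi>] by blast
    from norm_tf_weight[OF this] show ?thesis
      unfolding bounded_iff g by (intro exI[of _ "K * (1 + norm y) ^ k"]) (auto simp: norm_power)
  qed
  moreover have "dir_deriv b g \<in> fspan (tf y \<eta> ` schwartz_space)" if "b \<in> Basis" for b
    unfolding g dir_deriv_tf[OF \<phi>] using \<phi> that
    by (intro fspan.add fspan.scale[of _ _ "\<i> * of_real (\<eta> \<bullet> b)"] fspan.gen imageI schwartz_dir_deriv) auto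
  ultimately show "(\<forall>x. g differentiable (at x)) \<and> (\<forall>k. bounded (range (\<lambda>x. (1 + norm x) ^ k *\<^sub>R g x))) \<and>
      (\<forall>b\<in>Basis. dir_deriv b g \<in> fspan (tf y \<eta> ` schwartz_space))" by blast
qed (use assms in blast)

text \<open>Translation costs \<open>(1 + norm y)^k\<close> by the Peetre inequality, and each
  derivative that falls on the character costs one factor of the size of \<eta>. Seminorms of
  time-frequency shifts thus grow only polynomially, which the rapid decay of the coefficients will
  compensate.\<close>

lemma sbd_tf:
  fixes \<phi> :: "'a::euclidean_space \<Rightarrow> complex"
  assumes "\<phi> \<in> schwartz_space"
  obtains C where "C \<ge> 0" "\<And>y \<eta>. sbd k m (C * (1 + norm y) ^ k * (1 + norm \<eta>) ^ m) (tf y \<eta> \<phi>)"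
proof -
  have "\<exists>C\<ge>0. \<forall>y \<eta>. sbd k m (C * (1 + norm y) ^ k * (1 + norm \<eta>) ^ m) (tf y \<eta> \<phi>)"
    using assms
  proof (induction m arbitrary: \<phi>)
    case 0
    obtain K where K: "K > 0" "sbd k 0 K \<phi>" using schwartz_sbd[OF 0] by blast
    show ?case using norm_tf_weight[OF K(2)] K(1) by (intro exI[of _ K]) (auto simp: sbd_0)
  next
    case (Suc m)
    let ?w = "\<lambda>y \<eta>. (1 + norm y) ^ k * (1 + norm \<eta>) ^ m"
    obtain K where K: "K > 0" "sbd k 0 K \<phi>" using schwartz_sbd[OF Suc.prems] by blast
    obtain C1 where C1: "C1 \<ge> 0" "\<And>y \<eta>. sbd k m (C1 * (1 + norm y) ^ k * (1 + norm \<eta>) ^ m) (tf y \<eta> \<phi>)"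
      using Suc.IH[OF Suc.prems] by blast
    have "\<forall>b\<in>Basis. \<exists>C\<ge>0. \<forall>y \<eta>. sbd k m (C * (1 + norm y) ^ k * (1 + norm \<eta>) ^ m) (tf y \<eta> (dir_deriv b \<phi>))"
      using Suc by (auto intro: schwartz_dir_deriv)
    then obtain C where C: "\<And>b. b \<in> Basis \<Longrightarrow> C b \<ge> 0"
        "\<And>b y \<eta>. b \<in> Basis \<Longrightarrow> sbd k m (C b * (1 + norm y) ^ k * (1 + norm \<eta>) ^ m) (tf y \<eta> (dir_deriv b \<phi>))"
      by metis
    define D where "D = K + C1 + sum C Basis"
    have sC: "0 \<le> sum C Basis" using C by (intro sum_nonneg) auto
    have "sbd k (Suc m) (D * (1 + norm y) ^ k * (1 + norm \<eta>) ^ Suc m) (tf y \<eta> \<phi>)" for y \<eta>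
      unfolding sbd_Suc
    proof
      have 1: "1 \<le> (1 + norm \<eta>) ^ Suc m" by (rule one_le_power) simp
      have "K * (1 + norm y) ^ k \<le> D * (1 + norm y) ^ k"
        using K C1 sC unfolding D_def by (intro mult_right_mono) auto
      also have "\<dots> \<le> D * (1 + norm y) ^ k * (1 + norm \<eta>) ^ Suc m"
        using mult_left_mono[OF 1, of "D * (1 + norm y) ^ k"] K C1 sC unfolding D_def by simp
      finally show "sbd k 0 (D * (1 + norm y) ^ k * (1 + norm \<eta>) ^ Suc m) (tf y \<eta> \<phi>)"
        unfolding sbd_0 using norm_tf_weight[OF K(2)] order_trans by blast
      show "\<forall>b\<in>Basis. sbd k m (D * (1 + norm y) ^ k * (1 + norm \<eta>) ^ Suc m) (dir_deriv b (tf y \<eta> \<phi>))"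
      proof
        fix b :: 'a assume b: "b \<in> Basis"
        have nb: "norm (\<i> * complex_of_real (\<eta> \<bullet> b)) \<le> norm \<eta>"
          using Basis_le_norm[OF b, of \<eta>] by (simp add: norm_mult)
        have "sbd k m (C b * (1 + norm y) ^ k * (1 + norm \<eta>) ^ m
            + norm (\<i> * complex_of_real (\<eta> \<bullet> b)) * (C1 * (1 + norm y) ^ k * (1 + norm \<eta>) ^ m))
          (\<lambda>x. tf y \<eta> (dir_deriv b \<phi>) x + (\<i> * of_real (\<eta> \<bullet> b)) * tf y \<eta> \<phi> x)"
          by (intro sbd_add sbd_cmult schwartz_cmult schwartz_tf schwartz_dir_deriv Suc.prems b C C1)
        moreover have "C b * (1 + norm y) ^ k * (1 + norm \<eta>) ^ m
            + norm (\<i> * complex_of_real (\<eta> \<bullet> b)) * (C1 * (1 + norm y) ^ k * (1 + norm \<eta>) ^ m)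
          \<le> D * (1 + norm y) ^ k * (1 + norm \<eta>) ^ Suc m"
        proof -
          have "C b \<le> sum C Basis" using b C by (intro member_le_sum) auto
          then have "C b + norm (\<i> * complex_of_real (\<eta> \<bullet> b)) * C1 \<le> D + norm \<eta> * D"
            using nb C1 sC K unfolding D_def by (intro add_mono mult_mono) auto
          then have "(C b + norm (\<i> * complex_of_real (\<eta> \<bullet> b)) * C1) * ?w y \<eta> \<le> (D + norm \<eta> * D) * ?w y \<eta>"
            by (intro mult_right_mono) auto
          then show ?thesis by (simp add: algebra_simps)
        qed
        ultimately show "sbd k m (D * (1 + norm y) ^ k * (1 + norm \<eta>) ^ Suc m) (dir_deriv b (tf y \<eta> \<phi>))"
          unfolding dir_deriv_tf[OF Suc.prems] by (rule sbd_le)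
      qed
    qed
    moreover have "D \<ge> 0" using K C1 sC by (simp add: D_def)
    ultimately show ?case by blast
  qed
  then show ?thesis using that by blast
qed

section \<open>Continuous dependence on the time-frequency parameters\<close>

lemma norm_cis_diff: "norm (cis a - cis b) \<le> \<bar>a - b\<bar>"
proof -
  have "norm (cis a - cis b) = norm (cis b * (cis (a - b) - 1))"
    by (simp add: right_diff_distrib cis_mult)
  also have "\<dots> = norm (exp (\<i> * of_real (a - b)) - 1)" by (simp add: norm_mult cis_conv_exp)
  also have "\<dots> \<le> \<bar>a - b\<bar>" using iexp_approx1[of "a - b" 0] by simp
  finally show ?thesis .
qed

lemma norm_dir_deriv_le:
  fixes \<phi> :: "'a::euclidean_space \<Rightarrow> complex"
  assumes \<phi>: "\<phi> \<in> schwartz_space" and K: "sbd k 1 K \<phi>"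
  shows "norm (dir_deriv h \<phi> x) \<le> (real DIM('a) * K / (1 + norm x) ^ k) * norm h"
proof -
  have "norm (dir_deriv h \<phi> x) \<le> (\<Sum>b\<in>Basis. norm (of_real (h \<bullet> b) * dir_deriv b \<phi> x))"
    unfolding schwartz_dir_deriv_expand[OF \<phi>, of h] by (rule norm_sum)
  also have "\<dots> \<le> (\<Sum>b\<in>(Basis::'a set). norm h * (K / (1 + norm x) ^ k))"
  proof (rule sum_mono)
    fix b :: 'a assume b: "b \<in> Basis"
    have "sbd k 0 K (dir_deriv b \<phi>)" using K b unfolding One_nat_def sbd_Suc by blast
    then have "norm (dir_deriv b \<phi> x) \<le> K / (1 + norm x) ^ k" by (rule sbd_D)
    then show "norm (of_real (h \<bullet> b) * dir_deriv b \<phi> x) \<le> norm h * (K / (1 + norm x) ^ k)"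
      unfolding norm_mult using Basis_le_norm[OF b, of h] by (intro mult_mono) auto
  qed
  finally show ?thesis by (simp add: mult_ac)
qed

text \<open>The mean value inequality on the unit ball around \<open>t - y0\<close>. For
  \<open>x\<close> in this ball the distance from \<open>t\<close> is at most
  \<open>1 + norm y0\<close>, so the weights at \<open>x\<close> and \<open>t\<close> differ by at
  most the factor \<open>(2 + norm y0)^k\<close>.\<close>

lemma translate_lipschitz:
  fixes \<phi> :: "'a::euclidean_space \<Rightarrow> complex"
  assumes \<phi>: "\<phi> \<in> schwartz_space" and K: "sbd k 1 K \<phi>" and y: "norm (y - y0) \<le> 1"
  shows "(1 + norm t) ^ k * norm (\<phi> (t - y) - \<phi> (t - y0)) \<le> real DIM('a) * K * (2 + norm y0) ^ k * norm (y - y0)"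
proof -
  have K0: "K \<ge> 0" using sbd_nonneg[OF K] .
  define B where "B = real DIM('a) * K * (2 + norm y0) ^ k / (1 + norm t) ^ k"
  have tp: "(1 + norm t) ^ k > 0" by (intro zero_less_power add_pos_nonneg) auto
  have "norm (\<phi> (t - y) - \<phi> (t - y0)) \<le> B * norm ((t - y) - (t - y0))"
  proof (rule differentiable_bound[of "cball (t - y0) 1"])
    fix x assume x: "x \<in> cball (t - y0) 1"
    show "(\<phi> has_derivative (\<lambda>h. dir_deriv h \<phi> x)) (at x within cball (t - y0) 1)"
      using schwartz_has_derivative[OF \<phi>] has_derivative_at_withinI by blast
    have "norm (t - x) \<le> norm (t - y0 - x) + norm y0"
      using norm_triangle_ineq[of "t - y0 - x" y0] by simp
    then have "norm (t - x) \<le> 1 + norm y0" using x by (simp add: dist_norm)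
    then have "(1 + norm t) ^ k \<le> (1 + norm x) ^ k * (2 + norm y0) ^ k"
      using one_plus_norm_power_le[of t k x] by (smt (verit) mult_left_mono norm_ge_zero power_mono zero_le_power)
    moreover have xp: "(1 + norm x) ^ k > 0" by (intro zero_less_power add_pos_nonneg) auto
    ultimately have "1 / (1 + norm x) ^ k \<le> (2 + norm y0) ^ k / (1 + norm t) ^ k"
      using tp by (simp add: field_simps)
    then have "real DIM('a) * K * (1 / (1 + norm x) ^ k) \<le> real DIM('a) * K * ((2 + norm y0) ^ k / (1 + norm t) ^ k)"
      using K0 by (intro mult_left_mono) auto
    then have le: "real DIM('a) * K / (1 + norm x) ^ k \<le> B" by (simp add: B_def)
    have "onorm (\<lambda>h. dir_deriv h \<phi> x) \<le> real DIM('a) * K / (1 + norm x) ^ k"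
      using norm_dir_deriv_le[OF \<phi> K] K0 by (intro onorm_bound) auto
    then show "onorm (\<lambda>h. dir_deriv h \<phi> x) \<le> B" using le by simp
  qed (use y in \<open>auto simp: dist_norm norm_minus_commute\<close>)
  then have "(1 + norm t) ^ k * norm (\<phi> (t - y) - \<phi> (t - y0)) \<le> (1 + norm t) ^ k * (B * norm (y - y0))"
    using tp by (intro mult_left_mono) (auto simp: norm_minus_commute)
  moreover have "1 + norm t \<noteq> 0" using norm_ge_zero[of t] by linarith
  ultimately show ?thesis by (simp add: B_def mult.assoc)
qed

text \<open>The characters with frequencies \<eta> and \<eta>0 differ by up to
  \<open>norm (\<eta> - \<eta>0) * norm t\<close>, which grows in \<open>t\<close>. One spare power
  of the weight, hence \<open>Suc k\<close> in the proof, absorbs this growth.\<close>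

lemma tf_diff_weight:
  fixes \<phi> :: "'a::euclidean_space \<Rightarrow> complex"
  assumes \<phi>: "\<phi> \<in> schwartz_space"
  obtains C where "C \<ge> 0" "\<And>y \<eta> t. norm (y - y0) \<le> 1 \<Longrightarrow>
    (1 + norm t) ^ k * norm (tf y \<eta> \<phi> t - tf y0 \<eta>0 \<phi> t) \<le> C * (norm (y - y0) + norm (\<eta> - \<eta>0))"
proof -
  obtain K where K: "K > 0" "sbd (Suc k) 1 K \<phi>" using schwartz_sbd[OF \<phi>] by blast
  have K1: "sbd k 1 K \<phi>" and K2: "sbd (Suc k) 0 K \<phi>" using sbd_less[OF K(2)] by auto
  define C1 where "C1 = real DIM('a) * K * (2 + norm y0) ^ k"
  define C2 where "C2 = K * (1 + norm y0) ^ Suc k"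
  have C: "C1 \<ge> 0" "C2 \<ge> 0" using K by (auto simp: C1_def C2_def)
  have "(1 + norm t) ^ k * norm (tf y \<eta> \<phi> t - tf y0 \<eta>0 \<phi> t) \<le> (C1 + C2) * (norm (y - y0) + norm (\<eta> - \<eta>0))"
    if y: "norm (y - y0) \<le> 1" for y \<eta> t
  proof -
    have "tf y \<eta> \<phi> t - tf y0 \<eta>0 \<phi> t
        = cis (\<eta> \<bullet> t) * (\<phi> (t - y) - \<phi> (t - y0)) + (cis (\<eta> \<bullet> t) - cis (\<eta>0 \<bullet> t)) * \<phi> (t - y0)"
      by (simp add: tf_def algebra_simps)
    then have "norm (tf y \<eta> \<phi> t - tf y0 \<eta>0 \<phi> t)
        \<le> norm (\<phi> (t - y) - \<phi> (t - y0)) + norm (cis (\<eta> \<bullet> t) - cis (\<eta>0 \<bullet> t)) * norm (\<phi> (t - y0))"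
      by (metis norm_triangle_ineq norm_mult norm_cis mult_1)
    also have "norm (cis (\<eta> \<bullet> t) - cis (\<eta>0 \<bullet> t)) \<le> norm (\<eta> - \<eta>0) * (1 + norm t)"
    proof -
      have "norm (cis (\<eta> \<bullet> t) - cis (\<eta>0 \<bullet> t)) \<le> \<bar>(\<eta> - \<eta>0) \<bullet> t\<bar>"
        using norm_cis_diff by (simp add: inner_diff_left)
      also have "\<dots> \<le> norm (\<eta> - \<eta>0) * norm t" by (rule Cauchy_Schwarz_ineq2)
      also have "\<dots> \<le> norm (\<eta> - \<eta>0) * (1 + norm t)" by (intro mult_left_mono) auto
      finally show ?thesis .
    qed
    finally have "norm (tf y \<eta> \<phi> t - tf y0 \<eta>0 \<phi> t)
        \<le> norm (\<phi> (t - y) - \<phi> (t - y0)) + norm (\<eta> - \<eta>0) * (1 + norm t) * norm (tf y0 0 \<phi> t)"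
      by (simp add: mult_right_mono norm_tf)
    then have "(1 + norm t) ^ k * norm (tf y \<eta> \<phi> t - tf y0 \<eta>0 \<phi> t)
        \<le> (1 + norm t) ^ k * (norm (\<phi> (t - y) - \<phi> (t - y0)) + norm (\<eta> - \<eta>0) * (1 + norm t) * norm (tf y0 0 \<phi> t))"
      by (intro mult_left_mono) auto
    also have "\<dots> = (1 + norm t) ^ k * norm (\<phi> (t - y) - \<phi> (t - y0))
        + norm (\<eta> - \<eta>0) * ((1 + norm t) ^ Suc k * norm (tf y0 0 \<phi> t))"
      by (simp add: algebra_simps)
    also have "\<dots> \<le> C1 * norm (y - y0) + norm (\<eta> - \<eta>0) * C2"
      using translate_lipschitz[OF \<phi> K1 y, of t] norm_tf_weight[OF K2, of t y0 0] unfolding C1_def C2_def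
      by (intro add_mono mult_left_mono) auto
    also have "\<dots> \<le> (C1 + C2) * (norm (y - y0) + norm (\<eta> - \<eta>0))"
      using C by (simp add: algebra_simps)
    finally show ?thesis .
  qed
  then show ?thesis using that[of "C1 + C2"] C by auto
qed

lemma sbd_tf_diff:
  fixes \<phi> :: "'a::euclidean_space \<Rightarrow> complex"
  assumes "\<phi> \<in> schwartz_space"
  obtains C where "C \<ge> 0" "\<And>y \<eta>. norm (y - y0) \<le> 1 \<Longrightarrow> norm (\<eta> - \<eta>0) \<le> 1 \<Longrightarrow>
    sbd k m (C * (norm (y - y0) + norm (\<eta> - \<eta>0))) (\<lambda>t. tf y \<eta> \<phi> t - tf y0 \<eta>0 \<phi> t)"
proof -
  have "\<exists>C\<ge>0. \<forall>y \<eta>. norm (y - y0) \<le> 1 \<longrightarrow> norm (\<eta> - \<eta>0) \<le> 1 \<longrightarrow>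
    sbd k m (C * (norm (y - y0) + norm (\<eta> - \<eta>0))) (\<lambda>t. tf y \<eta> \<phi> t - tf y0 \<eta>0 \<phi> t)"
    using assms
  proof (induction m arbitrary: \<phi>)
    case 0
    show ?case using tf_diff_weight[OF 0, of y0 k \<eta>0] unfolding sbd_0 by metis
  next
    case (Suc m)
    let ?d = "\<lambda>y \<eta>. norm (y - y0) + norm (\<eta> - \<eta>0)"
    obtain C0 where C0: "C0 \<ge> 0" "\<And>y \<eta> t. norm (y - y0) \<le> 1 \<Longrightarrow>
        (1 + norm t) ^ k * norm (tf y \<eta> \<phi> t - tf y0 \<eta>0 \<phi> t) \<le> C0 * ?d y \<eta>"
      using tf_diff_weight[OF Suc.prems, of y0 k \<eta>0] by metis
    obtain C1 where C1: "C1 \<ge> 0" "\<And>y \<eta>. norm (y - y0) \<le> 1 \<Longrightarrow> norm (\<eta> - \<eta>0) \<le> 1 \<Longrightarrow>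
        sbd k m (C1 * ?d y \<eta>) (\<lambda>t. tf y \<eta> \<phi> t - tf y0 \<eta>0 \<phi> t)"
      using Suc.IH[OF Suc.prems] by blast
    have "\<forall>b\<in>Basis. \<exists>C\<ge>0. \<forall>y \<eta>. norm (y - y0) \<le> 1 \<longrightarrow> norm (\<eta> - \<eta>0) \<le> 1 \<longrightarrow>
        sbd k m (C * ?d y \<eta>) (\<lambda>t. tf y \<eta> (dir_deriv b \<phi>) t - tf y0 \<eta>0 (dir_deriv b \<phi>) t)"
      using Suc.IH[OF schwartz_dir_deriv[OF Suc.prems]] by blast
    then obtain C where C: "\<And>b. b \<in> Basis \<Longrightarrow> C b \<ge> 0"
        "\<And>b y \<eta>. b \<in> Basis \<Longrightarrow> norm (y - y0) \<le> 1 \<Longrightarrow> norm (\<eta> - \<eta>0) \<le> 1 \<Longrightarrow>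
          sbd k m (C b * ?d y \<eta>) (\<lambda>t. tf y \<eta> (dir_deriv b \<phi>) t - tf y0 \<eta>0 (dir_deriv b \<phi>) t)"
      by metis
    obtain C2 where C2: "C2 > 0" "sbd k m C2 (tf y0 \<eta>0 \<phi>)"
      using schwartz_sbd[OF schwartz_tf[OF Suc.prems]] by blast
    define D where "D = C0 + sum C Basis + (1 + norm \<eta>0) * C1 + C2"
    have sC: "0 \<le> sum C Basis" using C by (intro sum_nonneg) auto
    have D: "D \<ge> 0" using C0 C1 C2 sC by (simp add: D_def)
    have "sbd k (Suc m) (D * ?d y \<eta>) (\<lambda>t. tf y \<eta> \<phi> t - tf y0 \<eta>0 \<phi> t)"
      if y: "norm (y - y0) \<le> 1" and \<eta>: "norm (\<eta> - \<eta>0) \<le> 1" for y \<eta>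
      unfolding sbd_Suc
    proof
      have "C0 * ?d y \<eta> \<le> D * ?d y \<eta>" using C0 C1 C2 sC unfolding D_def by (intro mult_right_mono) auto
      then show "sbd k 0 (D * ?d y \<eta>) (\<lambda>t. tf y \<eta> \<phi> t - tf y0 \<eta>0 \<phi> t)"
        unfolding sbd_0 using C0(2)[OF y] order_trans by blast
      show "\<forall>b\<in>Basis. sbd k m (D * ?d y \<eta>) (dir_deriv b (\<lambda>t. tf y \<eta> \<phi> t - tf y0 \<eta>0 \<phi> t))"
      proof
        fix b :: 'a assume b: "b \<in> Basis"
        let ?u = "\<lambda>t. tf y \<eta> (dir_deriv b \<phi>) t - tf y0 \<eta>0 (dir_deriv b \<phi>) t"
        let ?v = "\<lambda>t. tf y \<eta> \<phi> t - tf y0 \<eta>0 \<phi> t"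
        note S = schwartz_tf schwartz_diff schwartz_cmult schwartz_dir_deriv Suc.prems b
        \<comment> \<open>The product rule for both shifts, regrouped so that each summand contains
          something small: a difference of shifts, or the factor \<eta> - \<eta>0.\<close>
        have eq: "dir_deriv b ?v = (\<lambda>t. ?u t + ((\<i> * of_real (\<eta> \<bullet> b)) * ?v t + (\<i> * of_real ((\<eta> - \<eta>0) \<bullet> b)) * tf y0 \<eta>0 \<phi> t))"
        proof
          fix t
          have "(?v has_derivative (\<lambda>h. dir_deriv h (tf y \<eta> \<phi>) t - dir_deriv h (tf y0 \<eta>0 \<phi>) t)) (at t)"
            by (intro has_derivative_diff schwartz_has_derivative S)
          then show "dir_deriv b ?v t = ?u t + ((\<i> * of_real (\<eta> \<bullet> b)) * ?v t + (\<i> * of_real ((\<eta> - \<eta>0) \<bullet> b)) * tf y0 \<eta>0 \<phi> t)"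
            by (simp add: dir_deriv_eq dir_deriv_tf[OF Suc.prems] algebra_simps)
        qed
        have "norm \<eta> \<le> norm \<eta>0 + norm (\<eta> - \<eta>0)" by (metis add.commute diff_add_cancel norm_triangle_ineq)
        then have n1: "norm (\<i> * complex_of_real (\<eta> \<bullet> b)) \<le> 1 + norm \<eta>0"
          using Basis_le_norm[OF b, of \<eta>] \<eta> by (simp add: norm_mult)
        have n2: "norm (\<i> * complex_of_real ((\<eta> - \<eta>0) \<bullet> b)) \<le> ?d y \<eta>"
          using Basis_le_norm[OF b, of "\<eta> - \<eta>0"] unfolding norm_mult by (simp add: add_increasing)
        have "sbd k m (C b * ?d y \<eta> + (norm (\<i> * complex_of_real (\<eta> \<bullet> b)) * (C1 * ?d y \<eta>)
            + norm (\<i> * complex_of_real ((\<eta> - \<eta>0) \<bullet> b)) * C2)) (dir_deriv b ?v)"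
          unfolding eq by (intro sbd_add sbd_cmult schwartz_add S C C1 C2 y \<eta>)
        moreover have "C b * ?d y \<eta> + (norm (\<i> * complex_of_real (\<eta> \<bullet> b)) * (C1 * ?d y \<eta>)
            + norm (\<i> * complex_of_real ((\<eta> - \<eta>0) \<bullet> b)) * C2) \<le> D * ?d y \<eta>"
        proof -
          have "C b \<le> sum C Basis" using b C by (intro member_le_sum) auto
          then have "C b * ?d y \<eta> \<le> (C0 + sum C Basis) * ?d y \<eta>" using C0 by (intro mult_right_mono) auto
          moreover have "norm (\<i> * complex_of_real (\<eta> \<bullet> b)) * (C1 * ?d y \<eta>) \<le> (1 + norm \<eta>0) * (C1 * ?d y \<eta>)"
            using n1 C1 by (intro mult_right_mono) auto
          moreover have "norm (\<i> * complex_of_real ((\<eta> - \<eta>0) \<bullet> b)) * C2 \<le> ?d y \<eta> * C2"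
            using n2 C2 by (intro mult_right_mono) auto
          moreover have "D * ?d y \<eta> = (C0 + sum C Basis) * ?d y \<eta> + (1 + norm \<eta>0) * (C1 * ?d y \<eta>) + ?d y \<eta> * C2"
            by (simp add: D_def algebra_simps)
          ultimately show ?thesis by linarith
        qed
        ultimately show "sbd k m (D * ?d y \<eta>) (dir_deriv b ?v)" by (rule sbd_le)
      qed
    qed
    then show ?case using D by blast
  qed
  then show ?thesis using that by blast
qed

text \<open>If \<open>y\<close> is large then \<open>s\<close> or \<open>s - y\<close> is large, and
  one of the two factors is small. Quantitatively, the weight of \<open>y\<close> is at most the
  product of those of \<open>s\<close> and \<open>s - y\<close>, and each is absorbed by one
  function. This is the source of the decay of \<open>tf_coeff\<close> in the translation
  variable.\<close>

lemma sbd_mult_translate: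
  fixes f g :: "'a::euclidean_space \<Rightarrow> complex"
  assumes "f \<in> schwartz_space" "g \<in> schwartz_space"
  obtains C where "C \<ge> 0" "\<And>y. sbd k m (C / (1 + norm y) ^ N) (\<lambda>s. f s * g (s - y))"
proof -
  have base: "\<exists>C\<ge>0. \<forall>y. sbd k 0 (C / (1 + norm y) ^ N) (\<lambda>s. f s * g (s - y))"
    if f: "f \<in> schwartz_space" and g: "g \<in> schwartz_space" for f g :: "'a \<Rightarrow> complex"
  proof -
    obtain K1 where K1: "K1 > 0" "sbd (k + N) 0 K1 f" using schwartz_sbd[OF f] by blast
    obtain K2 where K2: "K2 > 0" "sbd N 0 K2 g" using schwartz_sbd[OF g] by blast
    have "(1 + norm s) ^ k * norm (f s * g (s - y)) \<le> (K1 * K2) / (1 + norm y) ^ N" for s y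
    proof -
      have yp: "(1 + norm y) ^ N > 0" by (intro zero_less_power add_pos_nonneg) auto
      have "(1 + norm s) ^ k * norm (f s * g (s - y)) * (1 + norm y) ^ N
          \<le> (1 + norm s) ^ k * norm (f s * g (s - y)) * ((1 + norm s) ^ N * (1 + norm (s - y)) ^ N)"
        using one_plus_norm_power_le[of y N s] by (intro mult_left_mono) (auto simp: norm_minus_commute)
      also have "\<dots> = ((1 + norm s) ^ (k + N) * norm (f s)) * ((1 + norm (s - y)) ^ N * norm (g (s - y)))"
        by (simp add: norm_mult power_add)
      also have "\<dots> \<le> K1 * K2"
        using K1 K2 unfolding sbd_0 by (intro mult_mono) auto
      finally show ?thesis using yp by (simp add: pos_le_divide_eq)
    qed
    then show ?thesis using K1 K2 by (intro exI[of _ "K1 * K2"]) (auto simp: sbd_0)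
  qed
  have "\<exists>C\<ge>0. \<forall>y. sbd k m (C / (1 + norm y) ^ N) (\<lambda>s. f s * g (s - y))"
    using assms
  proof (induction m arbitrary: f g)
    case 0
    show ?case using base[OF 0] .
  next
    case (Suc m)
    obtain C0 where C0: "C0 \<ge> 0" "\<And>y. sbd k 0 (C0 / (1 + norm y) ^ N) (\<lambda>s. f s * g (s - y))"
      using base[OF Suc.prems] by blast
    have "\<forall>b\<in>Basis. \<exists>C\<ge>0. \<forall>y. sbd k m (C / (1 + norm y) ^ N) (\<lambda>s. dir_deriv b f s * g (s - y))"
      using Suc.IH[OF schwartz_dir_deriv[OF Suc.prems(1)] Suc.prems(2)] by blast
    then obtain C1 where C1: "\<And>b. b \<in> Basis \<Longrightarrow> C1 b \<ge> 0"
      "\<And>b y. b \<in> Basis \<Longrightarrow> sbd k m (C1 b / (1 + norm y) ^ N) (\<lambda>s. dir_deriv b f s * g (s - y))" by metis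
    have "\<forall>b\<in>Basis. \<exists>C\<ge>0. \<forall>y. sbd k m (C / (1 + norm y) ^ N) (\<lambda>s. f s * dir_deriv b g (s - y))"
      using Suc.IH[OF Suc.prems(1) schwartz_dir_deriv[OF Suc.prems(2)]] by blast
    then obtain C2 where C2: "\<And>b. b \<in> Basis \<Longrightarrow> C2 b \<ge> 0"
      "\<And>b y. b \<in> Basis \<Longrightarrow> sbd k m (C2 b / (1 + norm y) ^ N) (\<lambda>s. f s * dir_deriv b g (s - y))" by metis
    define D where "D = C0 + sum C1 Basis + sum C2 Basis"
    have s1: "0 \<le> sum C1 Basis" and s2: "0 \<le> sum C2 Basis" using C1 C2 by (auto intro: sum_nonneg)
    have tr: "(\<lambda>s. h (s - y)) \<in> schwartz_space" if "h \<in> schwartz_space" for h :: "'a \<Rightarrow> complex" and y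
      using schwartz_tf[OF that, of y 0] by (simp add: tf_def)
    have "sbd k (Suc m) (D / (1 + norm y) ^ N) (\<lambda>s. f s * g (s - y))" for y
      unfolding sbd_Suc
    proof (intro conjI ballI)
      show "sbd k 0 (D / (1 + norm y) ^ N) (\<lambda>s. f s * g (s - y))"
        by (rule sbd_le[OF C0(2)]) (use s1 s2 in \<open>auto simp: D_def intro!: divide_right_mono\<close>)
      fix b :: 'a assume b: "b \<in> Basis"
      have "dir_deriv b (\<lambda>s. f s * g (s - y)) = (\<lambda>s. dir_deriv b f s * g (s - y) + f s * dir_deriv b g (s - y))"
      proof
        fix s
        show "dir_deriv b (\<lambda>s. f s * g (s - y)) s = dir_deriv b f s * g (s - y) + f s * dir_deriv b g (s - y)"
          using dir_deriv_eq[OF has_derivative_mult[OF schwartz_has_derivative[OF Suc.prems(1)]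
            has_derivative_translate[OF Suc.prems(2)]], of b y s] by (simp add: add.commute)
      qed
      moreover have "sbd k m (C1 b / (1 + norm y) ^ N + C2 b / (1 + norm y) ^ N)
          (\<lambda>s. dir_deriv b f s * g (s - y) + f s * dir_deriv b g (s - y))"
        by (intro sbd_add schwartz_mult tr schwartz_dir_deriv Suc.prems C1 C2 b)
      moreover have "C1 b / (1 + norm y) ^ N + C2 b / (1 + norm y) ^ N \<le> D / (1 + norm y) ^ N"
      proof -
        have "C1 b \<le> sum C1 Basis" "C2 b \<le> sum C2 Basis" using b C1 C2 by (auto intro!: member_le_sum)
        then show ?thesis using C0 unfolding add_divide_distrib[symmetric] D_def by (intro divide_right_mono) auto
      qed
      ultimately show "sbd k m (D / (1 + norm y) ^ N) (dir_deriv b (\<lambda>s. f s * g (s - y)))"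
        by (simp only:) (rule sbd_le)
    qed
    moreover have "D \<ge> 0" using C0 s1 s2 by (simp add: D_def)
    ultimately show ?case by blast
  qed
  then show ?thesis using that by blast
qed

section \<open>Composition with linear isomorphisms\<close>

lemma dir_deriv_linear:
  fixes L :: "'a::euclidean_space \<Rightarrow> 'a"
  assumes "linear L" "f \<in> schwartz_space"
  shows "dir_deriv b (\<lambda>x. f (L x)) = (\<lambda>x. \<Sum>b'\<in>Basis. of_real (L b \<bullet> b') * dir_deriv b' f (L x))"
proof
  fix x
  have "(L has_derivative L) (at x)"
    using assms(1) by (simp add: linear_imp_has_derivative)
  from has_derivative_compose[OF this schwartz_has_derivative[OF assms(2)]]
  have "dir_deriv b (\<lambda>x. f (L x)) x = dir_deriv (L b) f (L x)" by (rule dir_deriv_eq)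
  then show "dir_deriv b (\<lambda>x. f (L x)) x = (\<Sum>b'\<in>Basis. of_real (L b \<bullet> b') * dir_deriv b' f (L x))"
    by (simp add: schwartz_dir_deriv_expand[OF assms(2), of "L b"])
qed

lemma linear_bij_weight:
  fixes L :: "'a::euclidean_space \<Rightarrow> 'a"
  assumes "linear L" "bij L"
  obtains c where "c \<ge> 1" "\<And>x. (1 + norm x) \<le> c * (1 + norm (L x))"
proof -
  define L' where "L' = inv_into UNIV L"
  have L'L: "L' (L y) = y" for y
    unfolding L'_def using assms(2) by (simp add: bij_is_inj)
  have "linear L'"
    unfolding L'_def using assms by (simp add: inj_linear_imp_inv_linear bij_is_inj)
  then obtain B where B: "B > 0" "\<And>x. norm (L' x) \<le> B * norm x"
    using linear_bounded_pos by blast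
  have "1 + norm x \<le> (1 + B) * (1 + norm (L x))" for x
  proof -
    have "(1 + B) * (1 + norm (L x)) = 1 + B + norm (L x) + B * norm (L x)"
      by (simp add: algebra_simps)
    moreover have "norm x \<le> B * norm (L x)" using B(2)[of "L x"] by (simp add: L'L)
    ultimately show ?thesis using B(1) norm_ge_zero[of "L x"] by (simp only:)
  qed
  then show ?thesis using that[of "1 + B"] B by auto
qed

text \<open>The constant in the second claim is uniform in \<open>f\<close>, which makes composition
  with \<open>L\<close> continuous on the Schwartz space; temperedness is transported along
  \<open>L\<close> by this. Expanding the derivative in direction \<open>L b\<close> in the basis
  leads to the double sum in \<open>D\<close>.\<close>

lemma schwartz_linear_sbd:
  fixes L :: "'a::euclidean_space \<Rightarrow> 'a"
  assumes L: "linear L" "bij L"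
  shows "f \<in> schwartz_space \<Longrightarrow> (\<lambda>x. f (L x)) \<in> schwartz_space"
    and "\<exists>C\<ge>0. \<forall>f\<in>schwartz_space. \<forall>K. sbd k m K f \<longrightarrow> sbd k m (C * K) (\<lambda>x. f (L x))"
proof -
  obtain c where c: "c \<ge> 1" "\<And>x. (1 + norm x) \<le> c * (1 + norm (L x))"
    using linear_bij_weight[OF L] by blast
  have base: "sbd k 0 (c ^ k * K) (\<lambda>x. f (L x))" if "sbd k 0 K f" for f :: "'a \<Rightarrow> complex" and K k
    unfolding sbd_0
  proof
    fix x
    have "(1 + norm x) ^ k * norm (f (L x)) \<le> (c * (1 + norm (L x))) ^ k * norm (f (L x))"
      using c(2) by (intro mult_right_mono power_mono) auto
    also have "\<dots> = c ^ k * ((1 + norm (L x)) ^ k * norm (f (L x)))" by (simp add: power_mult_distrib)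
    also have "\<dots> \<le> c ^ k * K" using that c(1) unfolding sbd_0 by (intro mult_left_mono) auto
    finally show "(1 + norm x) ^ k * norm (f (L x)) \<le> c ^ k * K" .
  qed
  \<comment> \<open>\<open>fspan\<close> has no rule for an empty sum, hence the nonempty index set;
    it is applied to \<open>Basis\<close>.\<close>
  have span_sum: "(\<lambda>x. \<Sum>i\<in>I. u i x) \<in> fspan G" if "finite I" "I \<noteq> {}" "\<And>i. i \<in> I \<Longrightarrow> u i \<in> fspan G"
    for I :: "'a set" and u and G :: "('a \<Rightarrow> complex) set"
    using that by (induction I rule: finite_ne_induct) (auto intro: fspan.add)
  show S: "(\<lambda>x. f (L x)) \<in> schwartz_space" if "f \<in> schwartz_space" for f
  proof (rule schwartz_fspanI[of "(\<lambda>f x. f (L x)) ` schwartz_space"])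
    fix g assume "g \<in> (\<lambda>f x. f (L x)) ` schwartz_space"
    then obtain f where g: "g = (\<lambda>x. f (L x))" and f: "f \<in> schwartz_space" by blast
    have "(L has_derivative L) (at x)" for x using L(1) by (simp add: linear_imp_has_derivative)
    from has_derivative_compose[OF this schwartz_has_derivative[OF f]]
    have "g differentiable (at x)" for x unfolding g differentiable_def by blast
    moreover have "bounded (range (\<lambda>x. (1 + norm x) ^ k *\<^sub>R g x))" for k
    proof -
      obtain K where "sbd k 0 K f" using schwartz_sbd[OF f] by blast
      from base[OF this] show ?thesis unfolding sbd_0 bounded_iff g
        by (intro exI[of _ "c ^ k * K"]) (auto simp: norm_power)
    qed
    moreover have "dir_deriv b g \<in> fspan ((\<lambda>f x. f (L x)) ` schwartz_space)" if "b \<in> Basis" for b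
      unfolding g dir_deriv_linear[OF L(1) f]
      by (intro span_sum fspan.scale fspan.gen) (auto intro!: schwartz_dir_deriv f imageI)
    ultimately show "(\<forall>x. g differentiable (at x)) \<and> (\<forall>k. bounded (range (\<lambda>x. (1 + norm x) ^ k *\<^sub>R g x))) \<and>
      (\<forall>b\<in>Basis. dir_deriv b g \<in> fspan ((\<lambda>f x. f (L x)) ` schwartz_space))" by blast
  qed (use that in blast)
  show "\<exists>C\<ge>0. \<forall>f\<in>schwartz_space. \<forall>K. sbd k m K f \<longrightarrow> sbd k m (C * K) (\<lambda>x. f (L x))"
  proof (induction m)
    case 0
    show ?case using base c(1) by (intro exI[of _ "c ^ k"]) auto
  next
    case (Suc m)
    then obtain C where C: "C \<ge> 0" "\<And>f K. f \<in> schwartz_space \<Longrightarrow> sbd k m K f \<Longrightarrow> sbd k m (C * K) (\<lambda>x. f (L x))"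
      by blast
    define D where "D = c ^ k + (\<Sum>b\<in>Basis. \<Sum>b'\<in>Basis. \<bar>L b \<bullet> b'\<bar> * C)"
    have D1: "D \<ge> c ^ k" and D2: "b \<in> Basis \<Longrightarrow> D \<ge> (\<Sum>b'\<in>Basis. \<bar>L b \<bullet> b'\<bar> * C)" for b
    proof -
      show "D \<ge> c ^ k" unfolding D_def using C(1) by (auto intro!: sum_nonneg)
      assume b: "b \<in> Basis"
      have "(\<Sum>b'\<in>Basis. \<bar>L b \<bullet> b'\<bar> * C) \<le> (\<Sum>b\<in>Basis. \<Sum>b'\<in>Basis. \<bar>L b \<bullet> b'\<bar> * C)"
        using b C(1) by (intro member_le_sum[of b Basis "\<lambda>b. \<Sum>b'\<in>Basis. \<bar>L b \<bullet> b'\<bar> * C"]) (auto intro!: sum_nonneg)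
      moreover have "c ^ k \<ge> 0" using c(1) by simp
      ultimately show "D \<ge> (\<Sum>b'\<in>Basis. \<bar>L b \<bullet> b'\<bar> * C)" unfolding D_def by linarith
    qed
    have "sbd k (Suc m) (D * K) (\<lambda>x. f (L x))" if f: "f \<in> schwartz_space" and K: "sbd k (Suc m) K f" for f K
    proof -
      have K0: "K \<ge> 0" using sbd_nonneg[OF K] .
      have K1: "sbd k 0 K f" and K2: "\<And>b. b \<in> Basis \<Longrightarrow> sbd k m K (dir_deriv b f)"
        using K unfolding sbd_Suc by auto
      have "sbd k 0 (D * K) (\<lambda>x. f (L x))"
        using D1 K0 by (intro sbd_le[OF base[OF K1]] mult_right_mono)
      moreover have "sbd k m (D * K) (dir_deriv b (\<lambda>x. f (L x)))" if b: "b \<in> Basis" for b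
      proof -
        have "sbd k m (\<Sum>b'\<in>Basis. norm (complex_of_real (L b \<bullet> b')) * (C * K)) (dir_deriv b (\<lambda>x. f (L x)))"
          unfolding dir_deriv_linear[OF L(1) f]
          by (intro sbd_sum schwartz_cmult S sbd_cmult C(2) K2) (auto intro: f schwartz_dir_deriv S)
        moreover have "(\<Sum>b'\<in>Basis. norm (complex_of_real (L b \<bullet> b')) * (C * K)) \<le> D * K"
          using mult_right_mono[OF D2[OF b] K0] by (simp add: sum_distrib_right mult.assoc)
        ultimately show ?thesis by (rule sbd_le)
      qed
      ultimately show ?thesis unfolding sbd_Suc by blast
    qed
    moreover have "D \<ge> 0" using D1 c(1) by (meson order_trans zero_le_power zero_le_one)
    ultimately show ?case by blast
  qed
qed

lemma tempered_linear:
  fixes L :: "'a::euclidean_space \<Rightarrow> 'a"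
  assumes L: "linear L" "bij L" and u: "u \<in> tempered_distributions"
  shows "(\<lambda>\<psi>. u (\<lambda>x. \<psi> (L x))) \<in> tempered_distributions"
proof -
  obtain C m where C: "C \<ge> 0" "\<And>f K. f \<in> schwartz_space \<Longrightarrow> sbd m m K f \<Longrightarrow> norm (u f) \<le> C * K"
    using tempered_bound[OF u] by blast
  obtain D where D: "D \<ge> 0" "\<And>f K. f \<in> schwartz_space \<Longrightarrow> sbd m m K f \<Longrightarrow> sbd m m (D * K) (\<lambda>x. f (L x))"
    using schwartz_linear_sbd(2)[OF L, of m m] by blast
  note S = schwartz_linear_sbd(1)[OF L]
  have inv: "linear (inv_into UNIV L)" "bij (inv_into UNIV L)"
    using L by (auto simp: inj_linear_imp_inv_linear bij_is_inj bij_imp_bij_inv)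
  have "L (inv_into UNIV L x) = x" for x using L(2) by (simp add: bij_is_surj surj_f_inv_f)
  \<comment> \<open>Invertibility is what keeps the convention that distributions vanish off the
    Schwartz space: composition with \<open>L\<close> cannot turn another function into a Schwartz
    function.\<close>
  then have S': "f \<in> schwartz_space" if "(\<lambda>x. f (L x)) \<in> schwartz_space" for f
    using schwartz_linear_sbd(1)[OF inv that] by simp
  show ?thesis
  proof (rule temperedI[where C = "C * D" and m = m])
    show "norm (u (\<lambda>x. f (L x))) \<le> C * D * K" if "f \<in> schwartz_space" "sbd m m K f" for f K
      using C(2)[OF S[OF that(1)] D(2)[OF that]] by (simp add: mult.assoc)
    show "u (\<lambda>x. f (L x)) = 0" if "f \<notin> schwartz_space" for f
      using tempered_zero[OF u] S' that by blast
    show "u (\<lambda>x. f (L x) + g (L x)) = u (\<lambda>x. f (L x)) + u (\<lambda>x. g (L x))"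
      if "f \<in> schwartz_space" "g \<in> schwartz_space" for f g
      by (rule tempered_add[OF u S[OF that(1)] S[OF that(2)]])
    show "u (\<lambda>x. c * f (L x)) = c * u (\<lambda>x. f (L x))" if "f \<in> schwartz_space" for f c
      by (rule tempered_cmult[OF u S[OF that]])
  qed (use C D in simp)
qed

section \<open>Fourier inversion\<close>

lemma integrable_inverse_1_plus_square_lborel: "integrable lborel (\<lambda>x::real. 1 / (1 + x\<^sup>2))"
  using integrable_inverse_1_plus_square by (simp add: set_integrable_def einterval_def inverse_eq_divide)

lemma
  fixes f :: "'a::euclidean_space \<Rightarrow> real \<Rightarrow> 'b::{real_normed_field, banach, second_countable_topology}"
  assumes f: "\<And>b. b \<in> Basis \<Longrightarrow> integrable lborel (f b)"
  shows integrable_lborel_prod: "integrable lborel (\<lambda>x. \<Prod>b\<in>Basis. f b (x \<bullet> b))"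
    and integral_lborel_prod: "(LINT x|lborel. (\<Prod>b\<in>Basis. f b (x \<bullet> b))) = (\<Prod>b\<in>Basis. LINT x|lborel. f b x)"
proof -
  interpret product_sigma_finite "\<lambda>_::'a. lborel :: real measure" by standard
  have [measurable]: "b \<in> Basis \<Longrightarrow> f b \<in> borel_measurable borel" for b
    using f[of b] by (auto dest: borel_measurable_integrable)
  have eq: "(\<Sum>b\<in>Basis. x b *\<^sub>R b) \<bullet> c = x c" if "c \<in> Basis" for x and c :: 'a
    using that by (simp add: inner_sum_left_Basis)
  have I: "integrable (\<Pi>\<^sub>M b\<in>Basis. lborel) (\<lambda>x. \<Prod>b\<in>Basis. f b (x b))"
    by (rule product_integrable_prod) (use f in auto)
  show "integrable lborel (\<lambda>x. \<Prod>b\<in>Basis. f b (x \<bullet> b))"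
    by (subst lborel_eq, subst integrable_distr_eq) (use I in \<open>auto simp: eq\<close>)
  have "(LINT x|lborel. (\<Prod>b\<in>Basis. f b (x \<bullet> b))) = (LINT x|(\<Pi>\<^sub>M b\<in>Basis. lborel). (\<Prod>b\<in>Basis. f b (x b)))"
    by (subst lborel_eq, subst integral_distr) (auto simp: eq)
  also have "\<dots> = (\<Prod>b\<in>Basis. LINT x|lborel. f b x)"
    by (rule product_integral_prod) (use f in auto)
  finally show "(LINT x|lborel. (\<Prod>b\<in>Basis. f b (x \<bullet> b))) = (\<Prod>b\<in>Basis. LINT x|lborel. f b x)" .
qed

lemma weight_pos: "(1 + norm x) ^ N > 0"
  by (intro zero_less_power add_pos_nonneg) auto

text \<open>Comparison with the product of the one-dimensional functions
  \<open>1 / (1 + x^2)\<close>: each of the \<open>DIM('a)\<close> factors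
  \<open>1 + (x \<bullet> b)^2\<close> is at most \<open>(1 + norm x)^2\<close>. This is where the
  exponent \<open>2 * DIM('a)\<close>, used throughout, comes from.\<close>

lemma integrable_weight:
  assumes "N \<ge> 2 * DIM('a::euclidean_space)"
  shows "integrable lborel (\<lambda>x::'a. 1 / (1 + norm x) ^ N)"
proof (rule Bochner_Integration.integrable_bound)
  show "integrable lborel (\<lambda>x::'a. \<Prod>b\<in>Basis. 1 / (1 + (x \<bullet> b)\<^sup>2))"
    by (rule integrable_lborel_prod[of "\<lambda>b x. 1 / (1 + x\<^sup>2)"]) (rule integrable_inverse_1_plus_square_lborel)
  show "AE x::'a in lborel. norm (1 / (1 + norm x) ^ N) \<le> norm (\<Prod>b\<in>Basis. 1 / (1 + (x \<bullet> b)\<^sup>2) :: real)"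
  proof (rule AE_I2)
    fix x :: 'a
    have "(\<Prod>b\<in>Basis. 1 + (x \<bullet> b)\<^sup>2) \<le> (\<Prod>b\<in>(Basis::'a set). (1 + norm x)\<^sup>2)"
    proof (rule prod_mono, safe)
      fix b :: 'a assume "b \<in> Basis"
      then have "\<bar>x \<bullet> b\<bar> \<le> norm x" by (rule Basis_le_norm)
      then have "(x \<bullet> b)\<^sup>2 \<le> (norm x)\<^sup>2" using abs_le_square_iff[of "x \<bullet> b" "norm x"] by simp
      then show "1 + (x \<bullet> b)\<^sup>2 \<le> (1 + norm x)\<^sup>2" by (simp add: power2_eq_square algebra_simps add_increasing2)
      show "0 \<le> 1 + (x \<bullet> b)\<^sup>2" by simp
    qed
    also have "\<dots> = (1 + norm x) ^ (2 * DIM('a))" by (simp add: power_mult)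
    also have "\<dots> \<le> (1 + norm x) ^ N" using assms by (intro power_increasing) auto
    finally have le: "(\<Prod>b\<in>Basis. 1 + (x \<bullet> b)\<^sup>2) \<le> (1 + norm x) ^ N" .
    have "(\<Prod>b\<in>Basis. 1 + (x \<bullet> b)\<^sup>2) > 0" by (intro prod_pos) (auto simp: add_pos_nonneg)
    then have "1 / (1 + norm x) ^ N \<le> 1 / (\<Prod>b\<in>Basis. 1 + (x \<bullet> b)\<^sup>2)"
      using le weight_pos by (intro divide_left_mono mult_pos_pos) auto
    also have "\<dots> = (\<Prod>b\<in>Basis. 1 / (1 + (x \<bullet> b)\<^sup>2))" by (simp add: prod_dividef)
    finally show "norm (1 / (1 + norm x) ^ N) \<le> norm (\<Prod>b\<in>Basis. 1 / (1 + (x \<bullet> b)\<^sup>2) :: real)"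
      by (simp add: abs_of_nonneg)
  qed
qed measurable

lemma integrable_weight_bound:
  fixes f :: "'a::euclidean_space \<Rightarrow> complex"
  assumes "f \<in> borel_measurable borel" "\<And>x. norm (f x) \<le> K / (1 + norm x) ^ N" "N \<ge> 2 * DIM('a)"
  shows "integrable lborel f"
proof (rule Bochner_Integration.integrable_bound)
  show "integrable lborel (\<lambda>x::'a. K * (1 / (1 + norm x) ^ N))"
    using integrable_weight[OF assms(3)] by (rule integrable_mult_right)
  show "AE x in lborel. norm (f x) \<le> norm (K * (1 / (1 + norm x) ^ N))"
    by (intro AE_I2 order_trans[OF assms(2)]) (auto intro: divide_right_mono)
qed (use assms in simp)

lemma schwartz_integrable:
  fixes f :: "'a::euclidean_space \<Rightarrow> complex"
  assumes "f \<in> schwartz_space" shows "integrable lborel f"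
proof -
  obtain K where "sbd (2 * DIM('a)) 0 K f" using schwartz_sbd[OF assms] by blast
  from integrable_weight_bound[OF schwartz_measurable[OF assms] sbd_D[OF this]] show ?thesis by simp
qed

lemma integrable_product_bound:
  fixes F :: "'a::euclidean_space \<times> 'b::euclidean_space \<Rightarrow> complex"
  assumes F[measurable]: "F \<in> borel_measurable (borel \<Otimes>\<^sub>M borel)"
    and g: "integrable lborel g" and h: "integrable lborel h"
    and le: "\<And>x y. norm (F (x, y)) \<le> norm (g x :: real) * norm (h y :: real)"
  shows "integrable (lborel \<Otimes>\<^sub>M lborel) F"
proof -
  note [measurable] = borel_measurable_integrable[OF g] borel_measurable_integrable[OF h]
  have "integrable (lborel \<Otimes>\<^sub>M lborel) (\<lambda>(x, y). g x * h y)"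
  proof (rule lborel_pair.Fubini_integrable)
    show "integrable lborel (\<lambda>x. LINT y|lborel. norm (case (x, y) of (x, y) \<Rightarrow> g x * h y))"
      using g by (simp add: abs_mult integrable_abs)
    show "AE x in lborel. integrable lborel (\<lambda>y. case (x, y) of (x, y) \<Rightarrow> g x * h y)"
      using h by simp
  qed simp
  then show ?thesis
    by (rule Bochner_Integration.integrable_bound) (use le in \<open>auto simp: abs_mult\<close>)
qed

lemma fubini_product_bound:
  fixes F :: "'a::euclidean_space \<Rightarrow> 'b::euclidean_space \<Rightarrow> complex"
  assumes "case_prod F \<in> borel_measurable (borel \<Otimes>\<^sub>M borel)"
    and "integrable lborel g" and "integrable lborel h"
    and "\<And>x y. norm (F x y) \<le> norm (g x :: real) * norm (h y :: real)"
  shows "(LINT y|lborel. LINT x|lborel. F x y) = (LINT x|lborel. LINT y|lborel. F x y)"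
  by (rule lborel_pair.Fubini_integral) (use assms in \<open>auto intro!: integrable_product_bound[where g=g and h=h]\<close>)

lemma integral_lborel_affine:
  fixes f :: "'a::euclidean_space \<Rightarrow> complex"
  assumes [measurable]: "f \<in> borel_measurable borel" and c: "c > 0"
  shows "(LINT x|lborel. f x) = of_real (c ^ DIM('a)) * (LINT x|lborel. f (t + c *\<^sub>R x))"
proof -
  have "(LINT x|lborel. f x) = (LINT x|density (distr lborel borel (\<lambda>x. t + c *\<^sub>R x)) (\<lambda>_. ennreal (c ^ DIM('a))). f x)"
    using c by (subst lborel_affine[of c t]) auto
  also have "\<dots> = (LINT x|distr lborel borel (\<lambda>x. t + c *\<^sub>R x). c ^ DIM('a) *\<^sub>R f x)"
    using c by (subst integral_density) auto
  also have "\<dots> = (LINT x|lborel. c ^ DIM('a) *\<^sub>R f (t + c *\<^sub>R x))"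
    by (subst integral_distr) auto
  finally show ?thesis by (simp add: scaleR_conv_of_real)
qed

section \<open>Gaussians\<close>

definition gauss :: "'a::euclidean_space \<Rightarrow> real" where
  "gauss u = exp (- (u \<bullet> u) / 2)"

lemma gauss_measurable [measurable]: "gauss \<in> borel_measurable borel"
  unfolding gauss_def by measurable

lemma gauss_bounds [simp]: "0 < gauss u" "gauss u \<le> 1" "\<bar>gauss u\<bar> = gauss u"
  by (auto simp: gauss_def)

text \<open>The integral is the characteristic function of the standard normal distribution;
  \<open>sqrt (2 * pi)\<close> undoes the normalization of its density.\<close>

lemma gauss_fourier_real:
  "integrable lborel (\<lambda>x::real. complex_of_real (exp (- x\<^sup>2 / 2)) * cis (x * t))"
  "(LINT x|lborel. complex_of_real (exp (- x\<^sup>2 / 2)) * cis (x * t)) = of_real (sqrt (2 * pi) * exp (- t\<^sup>2 / 2))"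
proof -
  have eq: "complex_of_real (exp (- x\<^sup>2 / 2)) * cis (x * t)
      = of_real (sqrt (2 * pi)) * (std_normal_density x *\<^sub>R iexp (t * x))" for x
    by (simp add: std_normal_density_def cis_conv_exp scaleR_conv_of_real mult_ac)
  interpret N: real_distribution std_normal_distribution by (rule real_dist_normal_dist)
  have "integrable std_normal_distribution (\<lambda>x. iexp (t * x))"
    by (intro N.integrable_iexp) auto
  then have I: "integrable lborel (\<lambda>x. std_normal_density x *\<^sub>R iexp (t * x))"
    by (subst (asm) integrable_density) (auto simp: normal_density_nonneg)
  then show "integrable lborel (\<lambda>x::real. complex_of_real (exp (- x\<^sup>2 / 2)) * cis (x * t))"
    unfolding eq by (rule integrable_mult_right)
  have "(LINT x|lborel. std_normal_density x *\<^sub>R iexp (t * x)) = char std_normal_distribution t"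
    unfolding char_def by (subst integral_density) (auto simp: normal_density_nonneg)
  then show "(LINT x|lborel. complex_of_real (exp (- x\<^sup>2 / 2)) * cis (x * t)) = of_real (sqrt (2 * pi) * exp (- t\<^sup>2 / 2))"
    unfolding eq by (subst integral_mult_right_zero) (simp add: char_std_normal_distribution)
qed

lemma cis_sum: "finite I \<Longrightarrow> cis (\<Sum>i\<in>I. a i) = (\<Prod>i\<in>I. cis (a i))"
  by (induction I rule: finite_induct) (auto simp: cis_mult[symmetric])

lemma gauss_fourier:
  fixes v :: "'a::euclidean_space"
  shows "integrable lborel (\<lambda>u. complex_of_real (gauss u) * cis (u \<bullet> v))"
    and "(LINT u|lborel. complex_of_real (gauss u) * cis (u \<bullet> v)) = of_real (sqrt (2 * pi) ^ DIM('a) * gauss v)"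
proof -
  have eq: "complex_of_real (gauss u) * cis (u \<bullet> v)
      = (\<Prod>b\<in>Basis. complex_of_real (exp (- (u \<bullet> b)\<^sup>2 / 2)) * cis ((u \<bullet> b) * (v \<bullet> b)))" for u :: 'a
  proof -
    have "gauss u = (\<Prod>b\<in>Basis. exp (- (u \<bullet> b)\<^sup>2 / 2))"
      unfolding gauss_def euclidean_inner[of u u]
      by (simp add: exp_sum[symmetric] sum_negf sum_divide_distrib power2_eq_square)
    moreover have "cis (u \<bullet> v) = (\<Prod>b\<in>Basis. cis ((u \<bullet> b) * (v \<bullet> b)))"
      unfolding euclidean_inner[of u v] by (simp add: cis_sum)
    ultimately show ?thesis by (simp add: prod.distrib)
  qed
  show "integrable lborel (\<lambda>u. complex_of_real (gauss u) * cis (u \<bullet> v))"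
    unfolding eq by (rule integrable_lborel_prod[of "\<lambda>b x. complex_of_real (exp (- x\<^sup>2 / 2)) * cis (x * (v \<bullet> b))"])
      (rule gauss_fourier_real)
  have "(LINT u|lborel. complex_of_real (gauss u) * cis (u \<bullet> v))
      = (\<Prod>b\<in>Basis. LINT x|lborel. complex_of_real (exp (- x\<^sup>2 / 2)) * cis (x * (v \<bullet> b)))"
    unfolding eq
    by (rule integral_lborel_prod[of "\<lambda>b x. complex_of_real (exp (- x\<^sup>2 / 2)) * cis (x * (v \<bullet> b))"])
      (rule gauss_fourier_real)
  also have "\<dots> = (\<Prod>b\<in>Basis. of_real (sqrt (2 * pi) * exp (- (v \<bullet> b)\<^sup>2 / 2)))"
    by (simp only: gauss_fourier_real)
  also have "\<dots> = of_real (sqrt (2 * pi) ^ DIM('a) * (\<Prod>b\<in>Basis. exp (- (v \<bullet> b)\<^sup>2 / 2)))"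
    by (simp add: prod.distrib)
  also have "(\<Prod>b\<in>Basis. exp (- (v \<bullet> b)\<^sup>2 / 2)) = gauss v"
      unfolding gauss_def euclidean_inner[of v v]
      by (simp add: exp_sum[symmetric] sum_negf sum_divide_distrib power2_eq_square)
  finally show "(LINT u|lborel. complex_of_real (gauss u) * cis (u \<bullet> v)) = of_real (sqrt (2 * pi) ^ DIM('a) * gauss v)" .
qed

lemma gauss_integrable: "integrable lborel (gauss :: 'a::euclidean_space \<Rightarrow> real)"
proof -
  have "integrable lborel (\<lambda>u::'a. norm (complex_of_real (gauss u) * cis (u \<bullet> 0)))"
    by (rule integrable_norm[OF gauss_fourier(1)])
  then show ?thesis by (simp add: norm_mult)
qed

lemma gauss_integral: "integral\<^sup>L lborel (gauss :: 'a::euclidean_space \<Rightarrow> real) = sqrt (2 * pi) ^ DIM('a)"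
proof -
  have "complex_of_real (LINT u|lborel. gauss (u::'a)) = (LINT u|lborel. complex_of_real (gauss (u::'a)))"
    by (rule integral_complex_of_real[symmetric])
  also have "\<dots> = of_real (sqrt (2 * pi) ^ DIM('a))"
    using gauss_fourier(2)[of "0::'a"] by (simp add: gauss_def)
  finally show ?thesis by (simp only: of_real_eq_iff)
qed

section \<open>The Fourier transform and its inversion\<close>

lemma cnj_measurable [measurable]: "cnj \<in> borel_measurable borel"
  by (intro borel_measurable_continuous_onI continuous_intros)

definition fourier :: "('a::euclidean_space \<Rightarrow> complex) \<Rightarrow> 'a \<Rightarrow> complex" where
  "fourier h \<eta> = (LINT s|lborel. h s * cis (- (\<eta> \<bullet> s)))"

lemma cis_measurable [measurable]: "cis \<in> borel_measurable borel"
  by (intro borel_measurable_continuous_onI continuous_intros)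

lemma fourier_measurable:
  fixes h :: "'a::euclidean_space \<Rightarrow> complex"
  assumes [measurable]: "h \<in> borel_measurable borel"
  shows "fourier h \<in> borel_measurable borel"
  unfolding fourier_def by measurable

lemma continuous_on_LINT:
  fixes u :: "'a::euclidean_space \<Rightarrow> 'b::euclidean_space \<Rightarrow> complex"
  assumes "\<And>x. continuous_on UNIV (\<lambda>X. u X x)" and "\<And>X. u X \<in> borel_measurable borel"
    and "\<And>X x. norm (u X x) \<le> w x" and "integrable lborel w"
  shows "continuous_on UNIV (\<lambda>X. LINT x|lborel. u X x)"
proof (rule continuous_on_sequentiallyI)
  fix X :: "nat \<Rightarrow> 'a" and a assume "X \<longlonglongrightarrow> a"
  then have "(\<lambda>n. u (X n) x) \<longlonglongrightarrow> u a x" for x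
    by (intro continuous_on_tendsto_compose[OF assms(1)]) auto
  then show "(\<lambda>n. LINT x|lborel. u (X n) x) \<longlonglongrightarrow> (LINT x|lborel. u a x)"
    using assms(2-4) by (intro integral_dominated_convergence[where w = w]) auto
qed

lemma fourier_continuous:
  assumes h: "integrable lborel h" shows "continuous_on UNIV (fourier h)"
  unfolding fourier_def[abs_def]
proof (rule continuous_on_LINT[where w = "\<lambda>s. norm (h s)"])
  note [measurable] = borel_measurable_integrable[OF h]
  show "continuous_on UNIV (\<lambda>X. h x * cis (- (X \<bullet> x)))" for x by (intro continuous_intros)
  show "(\<lambda>x. h x * cis (- (X \<bullet> x))) \<in> borel_measurable borel" for X by measurable
qed (use h in \<open>auto simp: norm_mult intro: integrable_norm\<close>)

lemma fourier_bounded: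
  assumes h: "integrable lborel h"
  shows "norm (fourier h \<eta>) \<le> (LINT s|lborel. norm (h s))"
  unfolding fourier_def using integral_norm_bound[of lborel "\<lambda>s. h s * cis (- (\<eta> \<bullet> s))"] by (simp add: norm_mult)

text \<open>Gaussian summation. Inserting a wide Gaussian in \<eta> makes Fubini applicable, and the
  Fourier transform of that Gaussian turns the integral into an average of \<open>h\<close> around
  \<open>x\<close>. Letting the width grow, one side converges because \<open>fourier h\<close> is
  integrable and the other because \<open>h\<close> is bounded and continuous. The hypotheses stop
  short of Schwartz functions since \<open>weyl_injective\<close> uses products with a matrix
  coefficient that is merely continuous and bounded.\<close>

theorem fourier_inversion:
  fixes h :: "'a::euclidean_space \<Rightarrow> complex"
  assumes cont: "continuous_on UNIV h" and bd: "\<And>x. norm (h x) \<le> B"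
    and int: "integrable lborel h" and inth: "integrable lborel (fourier h)"
  shows "(LINT \<eta>|lborel. fourier h \<eta> * cis (\<eta> \<bullet> x)) = (2 * pi) ^ DIM('a) * h x"
proof -
  define n where "n = DIM('a)"
  define e where "e = (\<lambda>k. 1 / real (Suc k))"
  have e: "e k > 0" for k by (simp add: e_def)
  have e0: "e \<longlonglongrightarrow> 0" unfolding e_def by (rule LIMSEQ_Suc) (rule lim_1_over_n)
  have [measurable]: "h \<in> borel_measurable borel" using cont by (rule borel_measurable_continuous_onI)
  have [measurable]: "fourier h \<in> borel_measurable borel" by (rule fourier_measurable) simp
  define I where "I = (\<lambda>k. LINT \<eta>|lborel. fourier h \<eta> * cis (\<eta> \<bullet> x) * of_real (gauss (e k *\<^sub>R \<eta>)))"
  have lim1: "I \<longlonglongrightarrow> (LINT \<eta>|lborel. fourier h \<eta> * cis (\<eta> \<bullet> x))"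
    unfolding I_def
  proof (rule integral_dominated_convergence[where w = "\<lambda>\<eta>. norm (fourier h \<eta>)"])
    show "AE \<eta> in lborel. (\<lambda>k. fourier h \<eta> * cis (\<eta> \<bullet> x) * of_real (gauss (e k *\<^sub>R \<eta>))) \<longlonglongrightarrow> fourier h \<eta> * cis (\<eta> \<bullet> x)"
    proof (rule AE_I2)
      fix \<eta> :: 'a
      have "(\<lambda>k. gauss (e k *\<^sub>R \<eta>)) \<longlonglongrightarrow> exp (- ((0 *\<^sub>R \<eta>) \<bullet> (0 *\<^sub>R \<eta>)) / 2)"
        unfolding gauss_def by (intro tendsto_intros e0) auto
      then have "(\<lambda>k. fourier h \<eta> * cis (\<eta> \<bullet> x) * of_real (gauss (e k *\<^sub>R \<eta>))) \<longlonglongrightarrow> fourier h \<eta> * cis (\<eta> \<bullet> x) * of_real 1"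
        by (intro tendsto_intros) auto
      then show "(\<lambda>k. fourier h \<eta> * cis (\<eta> \<bullet> x) * of_real (gauss (e k *\<^sub>R \<eta>))) \<longlonglongrightarrow> fourier h \<eta> * cis (\<eta> \<bullet> x)"
        by simp
    qed
    show "AE \<eta> in lborel. norm (fourier h \<eta> * cis (\<eta> \<bullet> x) * of_real (gauss (e k *\<^sub>R \<eta>))) \<le> norm (fourier h \<eta>)" for k
      using gauss_bounds by (auto intro!: AE_I2 mult_left_le simp: norm_mult abs_of_pos)
  qed (use inth in \<open>auto intro: integrable_norm\<close>)
  \<comment> \<open>Substituting \<eta> = u / c reduces the dilated Gaussian to the standard one and
    produces the factor \<open>(1 / c)^n\<close>.\<close>
  have inner: "(LINT \<eta>|lborel. cis (\<eta> \<bullet> w) * of_real (gauss (c *\<^sub>R \<eta>)))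
      = of_real ((1 / c) ^ n * sqrt (2 * pi) ^ n * gauss ((1 / c) *\<^sub>R w))" if c: "c > 0" for c and w :: 'a
  proof -
    have "(LINT \<eta>|lborel. cis (\<eta> \<bullet> w) * of_real (gauss (c *\<^sub>R \<eta>)))
        = of_real ((1 / c) ^ n) * (LINT u|lborel. cis ((0 + (1 / c) *\<^sub>R u) \<bullet> w) * of_real (gauss (c *\<^sub>R (0 + (1 / c) *\<^sub>R u))))"
      unfolding n_def using c by (subst integral_lborel_affine[where t = 0 and c = "1 / c"]) auto
    also have "(LINT u|lborel. cis ((0 + (1 / c) *\<^sub>R u) \<bullet> w) * of_real (gauss (c *\<^sub>R (0 + (1 / c) *\<^sub>R u))))
        = (LINT u|lborel. complex_of_real (gauss u) * cis (u \<bullet> ((1 / c) *\<^sub>R w)))"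
      using c by (simp add: mult.commute)
    also have "\<dots> = of_real (sqrt (2 * pi) ^ n * gauss ((1 / c) *\<^sub>R w))"
      unfolding n_def by (rule gauss_fourier(2))
    finally show ?thesis by simp
  qed
  have I: "I k = of_real (sqrt (2 * pi) ^ n) * (LINT u|lborel. h (x + e k *\<^sub>R u) * of_real (gauss u))" for k
  proof -
    define c where "c = e k"
    have c: "c > 0" using e by (simp add: c_def)
    have gi: "integrable lborel (\<lambda>\<eta>::'a. gauss (c *\<^sub>R \<eta>))"
    proof -
      have "integrable (density (distr lborel borel (\<lambda>x::'a. 0 + c *\<^sub>R x)) (\<lambda>_. ennreal (\<bar>c\<bar> ^ DIM('a)))) gauss"
        using gauss_integrable c by (subst lborel_affine[of c 0, symmetric]) auto
      then have "integrable lborel (\<lambda>\<eta>::'a. \<bar>c\<bar> ^ DIM('a) *\<^sub>R gauss (c *\<^sub>R \<eta>))"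
        by (subst (asm) integrable_density; (subst (asm) integrable_distr_eq)?) auto
      then show ?thesis using c by simp
    qed
    have "I k = (LINT \<eta>|lborel. LINT s|lborel. h s * (cis (\<eta> \<bullet> (x - s)) * of_real (gauss (c *\<^sub>R \<eta>))))"
      unfolding I_def c_def[symmetric]
    proof (rule Bochner_Integration.integral_cong[OF refl])
      fix \<eta> :: 'a
      have "fourier h \<eta> * cis (\<eta> \<bullet> x) * of_real (gauss (c *\<^sub>R \<eta>))
          = (LINT s|lborel. h s * cis (- (\<eta> \<bullet> s)) * (cis (\<eta> \<bullet> x) * of_real (gauss (c *\<^sub>R \<eta>))))"
        unfolding fourier_def mult.assoc[of _ "cis (\<eta> \<bullet> x)"] by (rule integral_mult_left_zero[symmetric])
      also have "\<dots> = (LINT s|lborel. h s * (cis (\<eta> \<bullet> (x - s)) * of_real (gauss (c *\<^sub>R \<eta>))))"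
      proof (rule Bochner_Integration.integral_cong[OF refl])
        fix s
        have "cis (- (\<eta> \<bullet> s)) * cis (\<eta> \<bullet> x) = cis (\<eta> \<bullet> (x - s))"
          by (simp add: cis_mult inner_diff_right)
        then show "h s * cis (- (\<eta> \<bullet> s)) * (cis (\<eta> \<bullet> x) * of_real (gauss (c *\<^sub>R \<eta>)))
            = h s * (cis (\<eta> \<bullet> (x - s)) * of_real (gauss (c *\<^sub>R \<eta>)))"
          by (metis mult.assoc)
      qed
      finally show "fourier h \<eta> * cis (\<eta> \<bullet> x) * of_real (gauss (c *\<^sub>R \<eta>))
          = (LINT s|lborel. h s * (cis (\<eta> \<bullet> (x - s)) * of_real (gauss (c *\<^sub>R \<eta>))))" .
    qed
    also have "\<dots> = (LINT s|lborel. LINT \<eta>|lborel. h s * (cis (\<eta> \<bullet> (x - s)) * of_real (gauss (c *\<^sub>R \<eta>))))"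
      by (rule fubini_product_bound[where g = "\<lambda>s. norm (h s)" and h = "\<lambda>\<eta>. gauss (c *\<^sub>R \<eta>)"])
        (use int gi in \<open>auto simp: norm_mult intro: integrable_norm\<close>)
    also have "\<dots> = (LINT s|lborel. h s * of_real ((1 / c) ^ n * sqrt (2 * pi) ^ n * gauss ((1 / c) *\<^sub>R (x - s))))"
      by (simp add: inner[OF c])
    \<comment> \<open>The substitution \<open>s = x + c u\<close> turns the narrow kernel into a
      fixed Gaussian; its factor \<open>c^n\<close> cancels against
      \<open>(1 / c)^n\<close>.\<close>
    also have "\<dots> = of_real (c ^ n) * (LINT u|lborel. h (x + c *\<^sub>R u) * of_real ((1 / c) ^ n * sqrt (2 * pi) ^ n * gauss ((1 / c) *\<^sub>R (x - (x + c *\<^sub>R u)))))"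
      unfolding n_def using c by (subst integral_lborel_affine[where t = x and c = c]) auto
    also have "\<dots> = of_real (sqrt (2 * pi) ^ n) * (LINT u|lborel. h (x + c *\<^sub>R u) * of_real (gauss u))"
    proof -
      have "h (x + c *\<^sub>R u) * of_real ((1 / c) ^ n * sqrt (2 * pi) ^ n * gauss ((1 / c) *\<^sub>R (x - (x + c *\<^sub>R u))))
          = of_real ((1 / c) ^ n * sqrt (2 * pi) ^ n) * (h (x + c *\<^sub>R u) * of_real (gauss u))" for u
        using c by (simp add: gauss_def)
      then have "(LINT u|lborel. h (x + c *\<^sub>R u) * of_real ((1 / c) ^ n * sqrt (2 * pi) ^ n * gauss ((1 / c) *\<^sub>R (x - (x + c *\<^sub>R u)))))
          = of_real ((1 / c) ^ n * sqrt (2 * pi) ^ n) * (LINT u|lborel. h (x + c *\<^sub>R u) * of_real (gauss u))"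
        by (simp only: integral_mult_right_zero)
      then show ?thesis using c by (simp add: power_divide)
    qed
    finally show ?thesis by (simp add: c_def)
  qed
  have "(\<lambda>k. LINT u|lborel. h (x + e k *\<^sub>R u) * of_real (gauss u)) \<longlonglongrightarrow> (LINT u::'a|lborel. h x * of_real (gauss u))"
  proof (rule integral_dominated_convergence[where w = "\<lambda>u. B * gauss u"])
    show "AE u in lborel. (\<lambda>k. h (x + e k *\<^sub>R u) * of_real (gauss u)) \<longlonglongrightarrow> h x * of_real (gauss u)"
    proof (rule AE_I2)
      fix u
      have "(\<lambda>k. x + e k *\<^sub>R u) \<longlonglongrightarrow> x + 0 *\<^sub>R u" by (intro tendsto_intros e0)
      then have "(\<lambda>k. h (x + e k *\<^sub>R u)) \<longlonglongrightarrow> h (x + 0 *\<^sub>R u)"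
        by (rule continuous_on_tendsto_compose[OF cont]) auto
      then show "(\<lambda>k. h (x + e k *\<^sub>R u) * of_real (gauss u)) \<longlonglongrightarrow> h x * of_real (gauss u)"
        by (intro tendsto_mult) auto
    qed
    show "AE u in lborel. norm (h (x + e k *\<^sub>R u) * of_real (gauss u)) \<le> B * gauss u" for k
      using bd gauss_bounds by (auto intro!: AE_I2 mult_right_mono simp: norm_mult abs_of_pos less_imp_le)
  qed (use gauss_integrable in \<open>auto intro: integrable_mult_right\<close>)
  then have "I \<longlonglongrightarrow> of_real (sqrt (2 * pi) ^ n) * (LINT u::'a|lborel. h x * of_real (gauss u))"
    unfolding I by (rule tendsto_mult_left)
  moreover have "of_real (sqrt (2 * pi) ^ n) * (LINT u::'a|lborel. h x * of_real (gauss u)) = (2 * pi) ^ n * h x"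
  proof -
    have "(2 * pi) ^ n = sqrt (2 * pi) ^ n * sqrt (2 * pi) ^ n"
      unfolding power_mult_distrib[symmetric] by simp
    then have "complex_of_real ((2 * pi) ^ n) = of_real (sqrt (2 * pi) ^ n) * of_real (sqrt (2 * pi) ^ n)"
      by (simp only: of_real_mult)
    then show ?thesis by (simp add: gauss_integral n_def)
  qed
  ultimately have "I \<longlonglongrightarrow> (2 * pi) ^ n * h x" by (simp only:)
  then show ?thesis using lim1 LIMSEQ_unique unfolding n_def by blast
qed

section \<open>Derivatives and decay of Fourier transforms\<close>

lemma integral_weight_bound:
  fixes f :: "'a::euclidean_space \<Rightarrow> complex"
  assumes [measurable]: "f \<in> borel_measurable borel" and "\<And>x. norm (f x) \<le> K / (1 + norm x) ^ N" "N \<ge> 2 * DIM('a)"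
  shows "norm (LINT x|lborel. f x) \<le> K * (LINT x::'a|lborel. 1 / (1 + norm x) ^ N)"
proof -
  have "norm (LINT x|lborel. f x) \<le> (LINT x|lborel. norm (f x))" by (rule integral_norm_bound)
  also have "\<dots> \<le> (LINT x::'a|lborel. K * (1 / (1 + norm x) ^ N))"
  proof (rule integral_mono)
    show "integrable lborel (\<lambda>x. norm (f x))"
      by (rule integrable_norm, rule integrable_weight_bound) (use assms in auto)
    show "integrable lborel (\<lambda>x::'a. K * (1 / (1 + norm x) ^ N))"
      using integrable_weight[OF assms(3)] by (rule integrable_mult_right)
  qed (use assms in simp)
  also have "\<dots> = K * (LINT x::'a|lborel. 1 / (1 + norm x) ^ N)" by (rule integral_mult_right_zero)
  finally show ?thesis .
qed

lemma weight_integral_nonneg: "(LINT x|lborel. 1 / (1 + norm x) ^ N) \<ge> 0"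
  by (intro integral_nonneg_AE AE_I2) auto

lemma schwartz_line_derivative:
  fixes u :: "'a::euclidean_space \<Rightarrow> complex"
  assumes "u \<in> schwartz_space"
  shows "((\<lambda>t. u (x + t *\<^sub>R b)) has_derivative (\<lambda>h. h *\<^sub>R dir_deriv b u (x + t *\<^sub>R b))) (at t within S)"
proof -
  have "((\<lambda>t. x + t *\<^sub>R b) has_derivative (\<lambda>h. h *\<^sub>R b)) (at t within S)"
    by (auto intro!: derivative_eq_intros)
  from has_derivative_compose[OF this schwartz_has_derivative[OF assms]]
  have "((\<lambda>t. u (x + t *\<^sub>R b)) has_derivative (\<lambda>h. dir_deriv (h *\<^sub>R b) u (x + t *\<^sub>R b))) (at t within S)" .
  moreover have "dir_deriv (h *\<^sub>R b) u y = h *\<^sub>R dir_deriv b u y" for h y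
    using linear_scale[OF has_derivative_linear[OF schwartz_has_derivative[OF assms]]] .
  ultimately show ?thesis by simp
qed

text \<open>The mean value inequality twice, first for the derivative and then for \<open>u\<close>
  minus its linear part. The explicit quadratic remainder replaces theorems on differentiation under
  the integral: integrated remainders are still of order \<open>t^2\<close>.\<close>

lemma schwartz_taylor:
  fixes u :: "'a::euclidean_space \<Rightarrow> complex"
  assumes u: "u \<in> schwartz_space" and b: "b \<in> Basis" and t: "\<bar>t\<bar> \<le> 1"
    and M: "\<And>\<theta>. \<bar>\<theta>\<bar> \<le> 1 \<Longrightarrow> norm (dir_deriv b (dir_deriv b u) (x + \<theta> *\<^sub>R b)) \<le> M"
  shows "norm (u (x + t *\<^sub>R b) - u x - of_real t * dir_deriv b u x) \<le> M * t\<^sup>2"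
proof -
  let ?S = "{-\<bar>t\<bar>..\<bar>t\<bar>}"
  have du: "dir_deriv b u \<in> schwartz_space" by (rule schwartz_dir_deriv[OF u b])
  have M0: "M \<ge> 0" using order_trans[OF norm_ge_zero M[of 0]] by simp
  have on: "onorm (\<lambda>h. h *\<^sub>R (c::complex)) \<le> C" if "norm c \<le> C" for c C
  proof (rule onorm_bound)
    show "0 \<le> C" using that norm_ge_zero order_trans by blast
    show "norm (h *\<^sub>R c) \<le> C * norm h" for h :: real
      using mult_right_mono[OF that, of "\<bar>h\<bar>"] by (simp add: mult.commute)
  qed
  have first: "norm (dir_deriv b u (x + s *\<^sub>R b) - dir_deriv b u x) \<le> M * \<bar>t\<bar>" if s: "s \<in> ?S" for s
  proof -
    have "norm (dir_deriv b u (x + s *\<^sub>R b) - dir_deriv b u (x + 0 *\<^sub>R b)) \<le> M * norm (s - 0)"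
    proof (rule differentiable_bound[of ?S "\<lambda>t. dir_deriv b u (x + t *\<^sub>R b)"])
      show "onorm (\<lambda>h. h *\<^sub>R dir_deriv b (dir_deriv b u) (x + r *\<^sub>R b)) \<le> M" if "r \<in> ?S" for r
        using that t by (intro on M) auto
    qed (use s in \<open>auto intro: schwartz_line_derivative[OF du]\<close>)
    also have "\<dots> \<le> M * \<bar>t\<bar>" using s M0 by (intro mult_left_mono) auto
    finally show ?thesis by simp
  qed
  define g where "g = (\<lambda>r. u (x + r *\<^sub>R b) - r *\<^sub>R dir_deriv b u x)"
  have "norm (g t - g 0) \<le> (M * \<bar>t\<bar>) * norm (t - 0)"
  proof (rule differentiable_bound[of ?S g])
    fix r assume r: "r \<in> ?S"
    show "(g has_derivative (\<lambda>h. h *\<^sub>R (dir_deriv b u (x + r *\<^sub>R b) - dir_deriv b u x))) (at r within ?S)"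
      unfolding g_def
      by (auto intro!: derivative_eq_intros schwartz_line_derivative[OF u] simp: scaleR_diff_right)
    show "onorm (\<lambda>h. h *\<^sub>R (dir_deriv b u (x + r *\<^sub>R b) - dir_deriv b u x)) \<le> M * \<bar>t\<bar>"
      using first[OF r] by (rule on)
  qed auto
  then show ?thesis by (simp add: g_def scaleR_conv_of_real power2_eq_square algebra_simps flip: abs_mult)
qed

text \<open>The closing move of two later proofs: \<open>t * w\<close> is a remainder of order
  \<open>t^2\<close>, hence \<open>w\<close> is of order \<open>t\<close> for all small
  \<open>t\<close>.\<close>

lemma norm_le_linear_imp_zero:
  fixes w :: "'b::real_normed_vector"
  assumes "\<And>t. 0 < t \<Longrightarrow> t \<le> 1 \<Longrightarrow> norm w \<le> C * t"
  shows "w = 0"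
proof -
  have "norm w \<le> 0"
  proof (rule field_le_epsilon)
    fix e :: real assume e: "e > 0"
    define t where "t = min 1 (e / (\<bar>C\<bar> + 1))"
    have t: "0 < t" "t \<le> 1" "t \<le> e / (\<bar>C\<bar> + 1)" using e by (auto simp: t_def)
    have "C * t \<le> (\<bar>C\<bar> + 1) * (e / (\<bar>C\<bar> + 1))"
      using t e by (intro mult_mono) auto
    also have "\<dots> = e" using abs_ge_zero[of C] by (intro nonzero_mult_div_cancel_left[THEN trans[OF times_divide_eq_right]]) linarith
    finally show "norm w \<le> 0 + e" using assms[OF t(1,2)] by linarith
  qed
  then show ?thesis by simp
qed

text \<open>The integral of \<open>u (x + t *\<^sub>R b) - u x\<close> vanishes by translation
  invariance, so \<open>t\<close> times the integral of the derivative equals an integrated Taylor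
  remainder.\<close>

lemma integral_dir_deriv:
  fixes u :: "'a::euclidean_space \<Rightarrow> complex"
  assumes u: "u \<in> schwartz_space" and b: "b \<in> Basis"
  shows "(LINT x|lborel. dir_deriv b u x) = 0"
proof -
  define N where "N = 2 * DIM('a)"
  define W where "W = (LINT x::'a|lborel. 1 / (1 + norm x) ^ N)"
  have du: "dir_deriv b u \<in> schwartz_space" and ddu: "dir_deriv b (dir_deriv b u) \<in> schwartz_space"
    using u b by (auto intro: schwartz_dir_deriv)
  obtain K where K: "K > 0" "sbd N 0 K (dir_deriv b (dir_deriv b u))" using schwartz_sbd[OF ddu] by blast
  define C where "C = K * 2 ^ N"
  \<comment> \<open>Moving by at most one unit vector changes the weight by a factor of at most
    \<open>2^N\<close>; hence the remainder is bounded by an integrable function of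
    \<open>x\<close>, uniformly along the segment.\<close>
  have M: "norm (dir_deriv b (dir_deriv b u) (x + \<theta> *\<^sub>R b)) \<le> C / (1 + norm x) ^ N" if "\<bar>\<theta>\<bar> \<le> 1" for x \<theta>
  proof -
    have "norm (x - (x + \<theta> *\<^sub>R b)) \<le> 1" using that b by simp
    then have "(1 + norm (x - (x + \<theta> *\<^sub>R b))) ^ N \<le> 2 ^ N" by (intro power_mono) auto
    then have le: "(1 + norm x) ^ N \<le> (1 + norm (x + \<theta> *\<^sub>R b)) ^ N * 2 ^ N"
      using one_plus_norm_power_le[of x N "x + \<theta> *\<^sub>R b"]
      by (meson mult_left_mono order_trans weight_pos less_imp_le)
    have "norm (dir_deriv b (dir_deriv b u) (x + \<theta> *\<^sub>R b)) \<le> K / (1 + norm (x + \<theta> *\<^sub>R b)) ^ N"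
      by (rule sbd_D[OF K(2)])
    also have "\<dots> \<le> C / (1 + norm x) ^ N"
      using mult_left_mono[OF le less_imp_le[OF K(1)]] weight_pos[of x N] weight_pos[of "x + \<theta> *\<^sub>R b" N]
      unfolding C_def by (simp add: divide_simps mult_ac)
    finally show ?thesis .
  qed
  have "norm (LINT x|lborel. dir_deriv b u x) \<le> (C * W) * t" if t: "0 < t" "t \<le> 1" for t
  proof -
    note [measurable] = schwartz_measurable[OF u] schwartz_measurable[OF du]
    have iu: "integrable lborel u" and idu: "integrable lborel (dir_deriv b u)"
      using schwartz_integrable u du by auto
    let ?R = "\<lambda>x. u (x + t *\<^sub>R b) - u x - of_real t * dir_deriv b u x"
    have "(LINT x|lborel. ?R x) = (LINT x|lborel. u (x + t *\<^sub>R b)) - (LINT x|lborel. u x) - of_real t * (LINT x|lborel. dir_deriv b u x)"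
      using iu idu integrable_lborel_translate[OF iu] by simp
    also have "(LINT x|lborel. u (x + t *\<^sub>R b)) = (LINT x|lborel. u x)" by (rule integral_lborel_translate) simp
    finally have "t * norm (LINT x|lborel. dir_deriv b u x) = norm (LINT x|lborel. ?R x)"
      using t by (simp add: norm_mult)
    also have "\<dots> \<le> (C * t\<^sup>2) * W"
      unfolding W_def
    proof (rule integral_weight_bound)
      fix x
      show "norm (?R x) \<le> C * t\<^sup>2 / (1 + norm x) ^ N"
        using schwartz_taylor[OF u b _ M, of t x] t by simp
    qed (auto simp: N_def)
    also have "\<dots> = t * (C * W * t)" by (simp add: power2_eq_square)
    finally show ?thesis using t by simp
  qed
  then show ?thesis by (rule norm_le_linear_imp_zero)
qed

lemma fourier_eq_tf: "fourier h \<eta> = (LINT s|lborel. tf 0 (-\<eta>) h s)"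
  by (simp add: fourier_def tf_def mult.commute)

text \<open>Integration by parts, in the form of \<open>integral_dir_deriv\<close> applied to the
  product of \<open>h\<close> and the character.\<close>

lemma fourier_dir_deriv:
  fixes h :: "'a::euclidean_space \<Rightarrow> complex"
  assumes h: "h \<in> schwartz_space" and b: "b \<in> Basis"
  shows "fourier (dir_deriv b h) \<eta> = \<i> * of_real (\<eta> \<bullet> b) * fourier h \<eta>"
proof -
  have "0 = (LINT s|lborel. tf 0 (-\<eta>) (dir_deriv b h) s + \<i> * of_real (-\<eta> \<bullet> b) * tf 0 (-\<eta>) h s)"
    using integral_dir_deriv[OF schwartz_tf[OF h] b, of 0 "-\<eta>"] unfolding dir_deriv_tf[OF h] by simp
  also have "\<dots> = fourier (dir_deriv b h) \<eta> + \<i> * of_real (-\<eta> \<bullet> b) * fourier h \<eta>"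
    unfolding fourier_eq_tf
    using schwartz_integrable[OF schwartz_tf[OF h]] schwartz_integrable[OF schwartz_tf[OF schwartz_dir_deriv[OF h b]]]
    by simp
  finally show ?thesis by simp
qed

text \<open>Linear in \<open>K\<close> and uniform in \<open>h\<close>, because it will be applied
  to the family of products \<open>\<psi> s * cnj (\<phi> (s - y))\<close> with \<open>K\<close>
  depending on \<open>y\<close>. The weight \<open>2 * DIM('a)\<close> makes derivatives integrable,
  and \<open>N\<close> of them give decay of order \<open>N\<close>.\<close>

lemma fourier_decay:
  obtains C where "C \<ge> 0" "\<And>h K \<eta>. h \<in> schwartz_space \<Longrightarrow> sbd (2 * DIM('a)) N K h \<Longrightarrow>
    norm (fourier h (\<eta>::'a::euclidean_space)) \<le> C * K / (1 + norm \<eta>) ^ N"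
proof -
  define N0 where "N0 = 2 * DIM('a)"
  define W where "W = (LINT x::'a|lborel. 1 / (1 + norm x) ^ N0)"
  have W: "W \<ge> 0" unfolding W_def by (rule weight_integral_nonneg)
  have pow: "norm (fourier h \<eta>) * \<bar>\<eta> \<bullet> b\<bar> ^ j \<le> K * W"
    if "h \<in> schwartz_space" "sbd N0 j K h" "b \<in> Basis" for h :: "'a \<Rightarrow> complex" and j K \<eta> b
    using that
  proof (induction j arbitrary: h)
    case 0
    have "norm (fourier h \<eta>) \<le> K * W"
      unfolding fourier_eq_tf W_def
    proof (rule integral_weight_bound)
      show "tf 0 (-\<eta>) h \<in> borel_measurable borel"
        by (intro schwartz_measurable schwartz_tf 0)
      show "norm (tf 0 (-\<eta>) h x) \<le> K / (1 + norm x) ^ N0" for x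
        using sbd_D[OF 0(2), of x] by (simp add: norm_tf)
    qed (simp add: N0_def)
    then show ?case by simp
  next
    case (Suc j)
    have "norm (fourier h \<eta>) * \<bar>\<eta> \<bullet> b\<bar> ^ Suc j = norm (fourier (dir_deriv b h) \<eta>) * \<bar>\<eta> \<bullet> b\<bar> ^ j"
      unfolding fourier_dir_deriv[OF Suc.prems(1,3)] by (simp add: norm_mult)
    also have "\<dots> \<le> K * W"
      using Suc.prems by (intro Suc.IH schwartz_dir_deriv) (auto simp: sbd_Suc)
    finally show ?case .
  qed
  define C where "C = (1 + real DIM('a)) ^ N * W"
  have "norm (fourier h \<eta>) \<le> C * K / (1 + norm \<eta>) ^ N" if h: "h \<in> schwartz_space" and K: "sbd N0 N K h" for h K and \<eta> :: 'a
  proof -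
    \<comment> \<open>The largest of the coordinates and 1. The maximum is attained, so a single
      power bound controls \<open>A^N\<close>; the entry 1 takes care of small \<eta>, and
      \<open>1 + norm \<eta>\<close> is at most \<open>(1 + DIM('a)) * A\<close>.\<close>
    define A where "A = Max (insert 1 ((\<lambda>b. \<bar>\<eta> \<bullet> b\<bar>) ` Basis))"
    have A1: "1 \<le> A" and Ab: "b \<in> Basis \<Longrightarrow> \<bar>\<eta> \<bullet> b\<bar> \<le> A" for b
      unfolding A_def by (rule Max_ge; simp)+
    have "A \<in> insert 1 ((\<lambda>b. \<bar>\<eta> \<bullet> b\<bar>) ` Basis)" unfolding A_def by (rule Max_in) auto
    then have AN: "norm (fourier h \<eta>) * A ^ N \<le> K * W"
    proof
      assume "A = 1"
      have K': "sbd N0 0 K h" using sbd_less[OF K] by simp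
      obtain b :: 'a where "b \<in> Basis" using nonempty_Basis by blast
      from pow[OF h K' this, of \<eta>] show ?thesis using \<open>A = 1\<close> by simp
    next
      assume "A \<in> (\<lambda>b. \<bar>\<eta> \<bullet> b\<bar>) ` Basis"
      then show ?thesis using pow[OF h K] by auto
    qed
    have "norm \<eta> \<le> (\<Sum>b\<in>Basis. \<bar>\<eta> \<bullet> b\<bar>)" by (rule norm_le_l1)
    also have "\<dots> \<le> real DIM('a) * A" using sum_bounded_above[of Basis "\<lambda>b. \<bar>\<eta> \<bullet> b\<bar>" A] Ab by simp
    finally have "1 + norm \<eta> \<le> (1 + real DIM('a)) * A" using A1 by (simp add: algebra_simps)
    then have "(1 + norm \<eta>) ^ N \<le> (1 + real DIM('a)) ^ N * A ^ N"
      unfolding power_mult_distrib[symmetric] by (intro power_mono) auto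
    then have "norm (fourier h \<eta>) * (1 + norm \<eta>) ^ N \<le> norm (fourier h \<eta>) * ((1 + real DIM('a)) ^ N * A ^ N)"
      by (intro mult_left_mono) auto
    also have "\<dots> = (1 + real DIM('a)) ^ N * (norm (fourier h \<eta>) * A ^ N)" by simp
    also have "\<dots> \<le> (1 + real DIM('a)) ^ N * (K * W)" using AN by (intro mult_left_mono) auto
    finally show ?thesis using weight_pos[of \<eta> N] by (simp add: C_def pos_le_divide_eq mult_ac)
  qed
  moreover have "C \<ge> 0" using W by (simp add: C_def)
  ultimately show ?thesis using that unfolding N0_def by blast
qed

lemma fourier_integrable:
  fixes h :: "'a::euclidean_space \<Rightarrow> complex"
  assumes h: "h \<in> schwartz_space"
  shows "integrable lborel (fourier h)"
proof -
  let ?N = "2 * DIM('a)"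
  obtain C where C: "\<And>h K \<eta>. h \<in> schwartz_space \<Longrightarrow> sbd ?N ?N K h \<Longrightarrow>
    norm (fourier h (\<eta>::'a)) \<le> C * K / (1 + norm \<eta>) ^ ?N" using fourier_decay[of ?N] by metis
  obtain K where K: "sbd ?N ?N K h" using schwartz_sbd[OF h] by blast
  show ?thesis
    by (rule integrable_weight_bound[OF fourier_measurable[OF schwartz_measurable[OF h]] C[OF h K]]) simp
qed

lemma schwartz_fourier_inversion:
  fixes h :: "'a::euclidean_space \<Rightarrow> complex"
  assumes h: "h \<in> schwartz_space"
  shows "(LINT \<eta>|lborel. fourier h \<eta> * cis (\<eta> \<bullet> x)) = (2 * pi) ^ DIM('a) * h x"
proof -
  obtain K where K: "sbd 0 0 K h" using schwartz_sbd[OF h] by blast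
  show ?thesis
    using schwartz_continuous[OF h] _ schwartz_integrable[OF h] fourier_integrable[OF h]
    by (rule fourier_inversion) (use sbd_D[OF K] in simp)
qed

text \<open>One factor of the squared norm is written as an integral, and inversion is applied after
  exchanging the integrations. It fixes the normalization in \<open>predual_measure\<close>.\<close>

lemma schwartz_plancherel:
  fixes h :: "'a::euclidean_space \<Rightarrow> complex"
  assumes h: "h \<in> schwartz_space"
  shows "(LINT \<eta>|lborel. (norm (fourier h \<eta>))\<^sup>2) = (2 * pi) ^ DIM('a) * (LINT x|lborel. (norm (h x))\<^sup>2)"
proof -
  note [measurable] = schwartz_measurable[OF h] fourier_measurable[OF schwartz_measurable[OF h]]
  have "complex_of_real (LINT \<eta>|lborel. (norm (fourier h \<eta>))\<^sup>2) = (LINT \<eta>|lborel. fourier h \<eta> * cnj (fourier h \<eta>))"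
    unfolding complex_norm_square[symmetric] by (rule integral_complex_of_real[symmetric])
  also have "\<dots> = (LINT \<eta>|lborel. LINT s|lborel. fourier h \<eta> * (cnj (h s) * cis (\<eta> \<bullet> s)))"
  proof (rule Bochner_Integration.integral_cong[OF refl])
    fix \<eta> :: 'a
    have "cnj (fourier h \<eta>) = (LINT s|lborel. cnj (h s * cis (- (\<eta> \<bullet> s))))"
      unfolding fourier_def by (rule Bochner_Integration.integral_cnj[symmetric])
    then have "cnj (fourier h \<eta>) = (LINT s|lborel. cnj (h s) * cis (\<eta> \<bullet> s))"
      by (simp add: cis_cnj)
    then show "fourier h \<eta> * cnj (fourier h \<eta>) = (LINT s|lborel. fourier h \<eta> * (cnj (h s) * cis (\<eta> \<bullet> s)))"
      by (simp only: integral_mult_right_zero)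
  qed
  also have "\<dots> = (LINT s|lborel. LINT \<eta>|lborel. fourier h \<eta> * (cnj (h s) * cis (\<eta> \<bullet> s)))"
    by (rule fubini_product_bound[where g = "\<lambda>s. norm (h s)" and h = "\<lambda>\<eta>. norm (fourier h \<eta>)"])
      (use schwartz_integrable[OF h] fourier_integrable[OF h] in \<open>auto simp: norm_mult mult.commute intro: integrable_norm\<close>)
  also have "\<dots> = (LINT s|lborel. cnj (h s) * (LINT \<eta>|lborel. fourier h \<eta> * cis (\<eta> \<bullet> s)))"
    by (simp add: mult.left_commute)
  also have "\<dots> = (LINT s|lborel. of_real ((2 * pi) ^ DIM('a)) * of_real ((norm (h s))\<^sup>2))"
    unfolding complex_norm_square by (simp add: schwartz_fourier_inversion[OF h] mult_ac)
  also have "\<dots> = complex_of_real ((2 * pi) ^ DIM('a) * (LINT x|lborel. (norm (h x))\<^sup>2))"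
    by (simp only: of_real_mult[symmetric] integral_complex_of_real integral_mult_right_zero)
  finally show ?thesis by (simp only: of_real_eq_iff)
qed

section \<open>Integrals of Schwartz functions\<close>

lemma tail_integral_small:
  fixes G :: "'c::euclidean_space \<Rightarrow> real"
  assumes G: "integrable lborel G" and e: "e > 0"
  obtains a b where "\<bar>LINT z|lborel. indicator (- cbox a b) z * G z\<bar> < e"
proof -
  note [measurable] = borel_measurable_integrable[OF G]
  let ?C = "\<lambda>n::nat. cbox (- real n *\<^sub>R (One::'c)) (real n *\<^sub>R One)"
  have "(\<lambda>n. LINT z|lborel. indicator (- ?C n) z * G z) \<longlonglongrightarrow> (LINT z::'c|lborel. 0)"
  proof (rule integral_dominated_convergence[where w = "\<lambda>z. \<bar>G z\<bar>"])
    show "AE z in lborel. (\<lambda>n. indicator (- ?C n) z * G z) \<longlonglongrightarrow> 0"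
    proof (rule AE_I2)
      fix z :: 'c
      have "indicator (- ?C n) z * G z = 0" if "n \<ge> nat \<lceil>norm z\<rceil>" for n
      proof -
        have "norm z \<le> real n" using that by linarith
        then have "z \<in> ?C n" unfolding mem_box using Basis_le_norm[of _ z] by (force simp: abs_le_iff)
        then show ?thesis by simp
      qed
      then show "(\<lambda>n. indicator (- ?C n) z * G z) \<longlonglongrightarrow> 0"
        by (intro tendsto_eventually eventually_sequentiallyI)
    qed
    show "AE z in lborel. norm (indicator (- ?C n) z * G z) \<le> \<bar>G z\<bar>" for n
      by (auto simp: indicator_def)
  qed (use G in auto)
  then have "\<forall>\<^sub>F n in sequentially. \<bar>LINT z|lborel. indicator (- ?C n) z * G z\<bar> < e"
    using e by (auto dest!: tendstoD)
  then obtain n where "\<bar>LINT z|lborel. indicator (- ?C n) z * G z\<bar> < e"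
    by (auto simp: eventually_sequentially)
  then show ?thesis using that by blast
qed

text \<open>One tagged division serves all of \<open>U\<close>: the dominating function bounds every
  tail outside one box, and equicontinuity gives a gauge that does not depend on \<open>u\<close>.
  Since the modulus may vary with the point, a fine division is taken from Cousin's lemma.\<close>

lemma uniform_riemann_sum:
  fixes U :: "('c::euclidean_space \<Rightarrow> complex) set"
  assumes G: "integrable lborel G" and dom: "\<And>u z. u \<in> U \<Longrightarrow> norm (u z) \<le> G z"
    and equi: "\<And>z0 e. e > 0 \<Longrightarrow> \<exists>d>0. \<forall>u\<in>U. \<forall>z. dist z z0 < d \<longrightarrow> norm (u z - u z0) \<le> e"
    and e: "e > 0"
  obtains P :: "('c \<times> 'c set) set" where "finite P"
    "\<And>u. u \<in> U \<Longrightarrow> norm ((LINT z|lborel. u z) - (\<Sum>(z, K)\<in>P. of_real (measure lborel K) * u z)) \<le> e"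
proof -
  obtain a b where ab: "\<bar>LINT z|lborel. indicator (- cbox a b) z * G z\<bar> < e / 2"
    using tail_integral_small[OF G, of "e / 2"] e by auto
  \<comment> \<open>Half of \<open>e\<close> is spent on the box and half on the tail; adding 1
    covers boxes of volume zero.\<close>
  define e' where "e' = e / (2 * (measure lborel (cbox a b) + 1))"
  have e': "e' > 0" unfolding e'_def using e by (simp add: add_nonneg_pos)
  obtain d where d: "\<And>z0. d z0 > 0" "\<And>z0 u z. u \<in> U \<Longrightarrow> dist z z0 < d z0 \<Longrightarrow> norm (u z - u z0) \<le> e'"
    using equi[OF e'] by metis
  have "gauge (\<lambda>z. ball z (d z))" using d(1) by (rule gauge_ball_dependent[OF allI])
  then obtain P where P: "P tagged_division_of cbox a b" "(\<lambda>z. ball z (d z)) fine P"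
    by (rule fine_division_exists)
  have "norm ((LINT z|lborel. u z) - (\<Sum>(z, K)\<in>P. of_real (measure lborel K) * u z)) \<le> e" if u: "u \<in> U" for u
  proof -
    have cont: "continuous_on UNIV u"
      unfolding continuous_on_iff
    proof (intro ballI allI impI)
      fix x and r :: real assume "r > 0"
      then show "\<exists>d>0. \<forall>x'\<in>UNIV. dist x' x < d \<longrightarrow> dist (u x') (u x) < r"
        using equi[of "r / 2" x] u by (fastforce simp: dist_norm)
    qed
    have [measurable]: "u \<in> borel_measurable borel" using cont by (rule borel_measurable_continuous_onI)
    have iu: "integrable lborel u"
      by (rule Bochner_Integration.integrable_bound[OF G]) (auto intro!: AE_I2 order_trans[OF dom[OF u]])
    have box_int: "u integrable_on cbox a' b'" for a' b'
      by (rule integrable_continuous) (rule continuous_on_subset[OF cont], simp)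
    have si: "set_integrable lborel (cbox a b) u" "set_integrable lborel (- cbox a b) u"
      unfolding set_integrable_def using iu by (auto intro!: integrable_mult_indicator)
    have "(LINT z|lborel. u z) = (LINT z|lborel. indicator (cbox a b) z *\<^sub>R u z + indicator (- cbox a b) z *\<^sub>R u z)"
      by (intro Bochner_Integration.integral_cong) (auto simp: indicator_def)
    also have "\<dots> = (LINT z|lborel. indicator (cbox a b) z *\<^sub>R u z) + (LINT z|lborel. indicator (- cbox a b) z *\<^sub>R u z)"
      using si unfolding set_integrable_def by (rule Bochner_Integration.integral_add)
    also have "(LINT z|lborel. indicator (cbox a b) z *\<^sub>R u z) = integral (cbox a b) u"
      using set_borel_integral_eq_integral(2)[OF si(1)] by (simp add: set_lebesgue_integral_def)
    also have "integral (cbox a b) u = (\<Sum>(z, K)\<in>P. integral K u)"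
      by (rule integral_combine_tagged_division_topdown[OF box_int P(1)])
    finally have split: "(LINT z|lborel. u z) - (\<Sum>(z, K)\<in>P. of_real (measure lborel K) * u z)
        = (\<Sum>(z, K)\<in>P. integral K u - of_real (measure lborel K) * u z) + (LINT z|lborel. indicator (- cbox a b) z *\<^sub>R u z)"
      by (simp add: sum_subtractf case_prod_unfold)
    have "norm (\<Sum>(z, K)\<in>P. integral K u - of_real (measure lborel K) * u z) \<le> (\<Sum>(z, K)\<in>P. e' * measure lborel K)"
      unfolding case_prod_unfold
    proof (rule sum_norm_le)
      fix p assume p: "p \<in> P"
      obtain z K where zK: "p = (z, K)" by (cases p)
      obtain a' b' where K: "K = cbox a' b'" using tagged_division_ofD(4)[OF P(1)] p zK by blast
      have sub: "K \<subseteq> ball z (d z)" using P(2) p zK unfolding fine_def by blast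
      have "((\<lambda>x. u x - u z) has_integral (integral K u - measure lborel K *\<^sub>R u z)) (cbox a' b')"
        unfolding K by (intro has_integral_diff has_integral_const) (rule integrable_integral[OF box_int])
      then have "norm (integral K u - measure lborel K *\<^sub>R u z) \<le> e' * measure lborel (cbox a' b')"
        using e' sub d(2)[OF u, of _ z] unfolding K
        by (intro has_integral_bound[of e']) (auto simp: dist_commute subset_iff)
      then show "norm (integral (snd p) u - of_real (measure lborel (snd p)) * u (fst p)) \<le> e' * measure lborel (snd p)"
        by (simp add: zK K scaleR_conv_of_real)
    qed
    also have "\<dots> = e' * measure lborel (cbox a b)"
      using additive_content_tagged_division[OF P(1)] by (simp add: sum_distrib_left[symmetric] case_prod_unfold)
    also have "\<dots> \<le> e / 2"
    proof -
      have "e' * measure lborel (cbox a b) \<le> e' * (measure lborel (cbox a b) + 1)"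
        using e' by (intro mult_left_mono) auto
      also have "measure lborel (cbox a b) + 1 \<noteq> 0"
        using measure_nonneg[of lborel "cbox a b"] by linarith
      then have "e' * (measure lborel (cbox a b) + 1) = e / 2" by (simp add: e'_def divide_simps)
      finally show ?thesis .
    qed
    finally have 1: "norm (\<Sum>(z, K)\<in>P. integral K u - of_real (measure lborel K) * u z) \<le> e / 2" .
    have "norm (LINT z|lborel. indicator (- cbox a b) z *\<^sub>R u z) \<le> (LINT z|lborel. norm (indicator (- cbox a b) z *\<^sub>R u z))"
      by (rule integral_norm_bound)
    also have "\<dots> \<le> (LINT z|lborel. indicator (- cbox a b) z * G z)"
    proof (rule integral_mono)
      show "integrable lborel (\<lambda>z. norm (indicator (- cbox a b) z *\<^sub>R u z))"
        using si(2) unfolding set_integrable_def by (rule integrable_norm)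
      show "integrable lborel (\<lambda>z. indicator (- cbox a b) z * G z)"
        using integrable_mult_indicator[OF _ G, of "- cbox a b"] by simp
    qed (use dom[OF u] in \<open>auto simp: indicator_def\<close>)
    also have "\<dots> \<le> e / 2" using ab by linarith
    finally show ?thesis unfolding split using 1 norm_triangle_mono by fastforce
  qed
  moreover have "finite P" using P(1) by auto
  ultimately show ?thesis using that by blast
qed

text \<open>The evaluations \<open>g \<mapsto> (1 + |x|)\<^sup>m \<partial>\<^sup>\<alpha>g(x)\<close> and the distribution itself form a uniformly
  equicontinuous family, so their integrals are all approximated by one and the same Riemann sum.\<close>

lemma tempered_integral:
  fixes h :: "'c::euclidean_space \<Rightarrow> 'a::euclidean_space \<Rightarrow> complex"
  assumes f: "f \<in> tempered_distributions" and h: "\<And>z. h z \<in> schwartz_space" and J: "J \<in> schwartz_space"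
    and dom: "\<And>m. \<exists>G. integrable lborel G \<and> (\<forall>z. sbd m m (G z) (h z))"
    and equi: "\<And>m z0 e. e > 0 \<Longrightarrow> \<exists>d>0. \<forall>z. dist z z0 < d \<longrightarrow> sbd m m e (\<lambda>t. h z t - h z0 t)"
    and ptw: "\<And>vs x. vs \<in> lists Basis \<Longrightarrow> iter_deriv vs J x = (LINT z|lborel. iter_deriv vs (h z) x)"
  shows "f J = (LINT z|lborel. f (h z))"
proof -
  obtain C m where C: "C \<ge> 0" "\<And>g K. g \<in> schwartz_space \<Longrightarrow> sbd m m K g \<Longrightarrow> norm (f g) \<le> C * K"
    using tempered_bound[OF f] by blast
  \<comment> \<open>A common bound for the two kinds of functionals in \<open>\<Lambda>\<close>:
    evaluations are bounded by \<open>1 * K\<close>, and \<open>f\<close> by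
    \<open>C * K\<close>.\<close>
  define D where "D = max 1 C"
  have D: "D \<ge> 1" "D \<ge> C" by (auto simp: D_def)
  define \<Lambda> :: "(('a \<Rightarrow> complex) \<Rightarrow> complex) set" where "\<Lambda> = {l.
    (\<forall>g1\<in>schwartz_space. \<forall>g2\<in>schwartz_space. l (\<lambda>t. g1 t - g2 t) = l g1 - l g2) \<and>
    (\<forall>g\<in>schwartz_space. \<forall>K. sbd m m K g \<longrightarrow> norm (l g) \<le> D * K)}"
  have f_in: "f \<in> \<Lambda>"
    unfolding \<Lambda>_def
  proof (intro CollectI conjI ballI allI impI)
    show "f (\<lambda>t. g1 t - g2 t) = f g1 - f g2" if "g1 \<in> schwartz_space" "g2 \<in> schwartz_space" for g1 g2
      using tempered_diff[OF f that] .
    show "norm (f g) \<le> D * K" if "g \<in> schwartz_space" "sbd m m K g" for g K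
      using C(2)[OF that] mult_right_mono[OF D(2) sbd_nonneg[OF that(2)]] by linarith
  qed
  let ?ev = "\<lambda>vs x g. complex_of_real ((1 + norm x) ^ m) * iter_deriv vs g x"
  have ev_in: "?ev vs x \<in> \<Lambda>" if vs: "vs \<in> lists Basis" "length vs \<le> m" for vs x
    unfolding \<Lambda>_def
  proof (intro CollectI conjI ballI allI impI)
    fix g1 g2 :: "'a \<Rightarrow> complex" assume g: "g1 \<in> schwartz_space" "g2 \<in> schwartz_space"
    have "iter_deriv vs (\<lambda>t. g1 t + (- 1) * g2 t) = (\<lambda>x. iter_deriv vs g1 x + (- 1) * iter_deriv vs g2 x)"
      using g vs by (subst iter_deriv_add) (auto simp: schwartz_cmult iter_deriv_cmult[where c="-1", simplified] schwartz_cmult[where c="-1", simplified])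
    then show "?ev vs x (\<lambda>t. g1 t - g2 t) = ?ev vs x g1 - ?ev vs x g2" by (simp add: right_diff_distrib)
  next
    fix g :: "'a \<Rightarrow> complex" and K assume g: "g \<in> schwartz_space" "sbd m m K g"
    have "(1 + norm x) ^ m * norm (iter_deriv vs g x) \<le> K" by (rule sbd_iter[OF g(2) vs])
    also have "K \<le> D * K" using mult_right_mono[OF D(1) sbd_nonneg[OF g(2)]] by simp
    finally show "norm (?ev vs x g) \<le> D * K" unfolding norm_mult norm_of_real by simp
  qed
  obtain G where G: "integrable lborel G" "\<And>z. sbd m m (G z) (h z)" using dom[of m] by blast
  have bound: "norm (f J - (LINT z|lborel. f (h z))) \<le> e" if e: "e > 0" for e
  proof -
    \<comment> \<open>The distance of \<open>J\<close> from the Riemann sum \<open>S\<close> costs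
      \<open>D * e'\<close> after applying \<open>f\<close>, and the Riemann sum of
      \<open>f (h z)\<close> itself costs another \<open>e'\<close>.\<close>
    define e' where "e' = e / (D + 1)"
    have e': "e' > 0" using e D by (simp add: e'_def)
    have "\<exists>P :: ('c \<times> 'c set) set. finite P \<and> (\<forall>u\<in>(\<lambda>l z. l (h z)) ` \<Lambda>.
        norm ((LINT z|lborel. u z) - (\<Sum>(z, K)\<in>P. of_real (measure lborel K) * u z)) \<le> e')"
    proof (rule uniform_riemann_sum[OF integrable_mult_right[OF G(1), of D] _ _ e', of "(\<lambda>l z. l (h z)) ` \<Lambda>"])
      fix u z assume "u \<in> (\<lambda>l z. l (h z)) ` \<Lambda>"
      then show "norm (u z) \<le> D * G z" using h G(2) unfolding \<Lambda>_def by blast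
    next
      fix z0 and r :: real assume r: "r > 0"
      have "r / D > 0" using r D by simp
      then obtain d where d: "d > 0" "\<And>z. dist z z0 < d \<Longrightarrow> sbd m m (r / D) (\<lambda>t. h z t - h z0 t)"
        using equi by blast
      have "norm (l (h z) - l (h z0)) \<le> r" if l: "l \<in> \<Lambda>" and z: "dist z z0 < d" for l z
      proof -
        have "l (h z) - l (h z0) = l (\<lambda>t. h z t - h z0 t)" using l h unfolding \<Lambda>_def by simp
        moreover have "norm \<dots> \<le> D * (r / D)"
          using l d(2)[OF z] schwartz_diff[OF h h, of z z0] unfolding \<Lambda>_def by blast
        ultimately show ?thesis using D by simp
      qed
      then show "\<exists>d>0. \<forall>u\<in>(\<lambda>l z. l (h z)) ` \<Lambda>. \<forall>z. dist z z0 < d \<longrightarrow> norm (u z - u z0) \<le> r"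
        using d(1) by blast
    next
      fix P :: "('c \<times> 'c set) set"
      assume P: "finite P" "\<And>u. u \<in> (\<lambda>l z. l (h z)) ` \<Lambda> \<Longrightarrow>
        norm ((LINT z|lborel. u z) - (\<Sum>(z, K)\<in>P. of_real (measure lborel K) * u z)) \<le> e'"
      show "\<exists>P :: ('c \<times> 'c set) set. finite P \<and> (\<forall>u\<in>(\<lambda>l z. l (h z)) ` \<Lambda>.
        norm ((LINT z|lborel. u z) - (\<Sum>(z, K)\<in>P. of_real (measure lborel K) * u z)) \<le> e')"
      proof (intro exI[of _ P] conjI ballI)
        show "finite P" by (rule P(1))
        show "norm ((LINT z|lborel. u z) - (\<Sum>(z, K)\<in>P. of_real (measure lborel K) * u z)) \<le> e'"
          if "u \<in> (\<lambda>l z. l (h z)) ` \<Lambda>" for u by (rule P(2)[OF that])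
      qed
    qed
    then obtain P :: "('c \<times> 'c set) set" where P: "finite P" "\<And>u. u \<in> (\<lambda>l z. l (h z)) ` \<Lambda> \<Longrightarrow>
        norm ((LINT z|lborel. u z) - (\<Sum>(z, K)\<in>P. of_real (measure lborel K) * u z)) \<le> e'"
      by blast
    define S where "S = (\<lambda>t. \<Sum>p\<in>P. of_real (measure lborel (snd p)) * h (fst p) t)"
    have S: "S \<in> schwartz_space" unfolding S_def by (intro schwartz_sum P schwartz_cmult h)
    \<comment> \<open>Evaluations in \<open>\<Lambda>\<close> turn the scalar Riemann estimate into
      an estimate of every weighted derivative, hence closeness of \<open>S\<close> to
      \<open>J\<close> in the seminorm that controls \<open>f\<close>.\<close>
    have "sbd m m e' (\<lambda>t. J t - S t)"
      unfolding sbd_def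
    proof (intro ballI allI impI)
      fix vs :: "'a list" and x assume vs: "vs \<in> lists Basis" "length vs \<le> m"
      have "iter_deriv vs S x = (\<Sum>p\<in>P. of_real (measure lborel (snd p)) * iter_deriv vs (h (fst p)) x)"
        unfolding S_def using P(1)
      proof (induction P)
        case empty
        have "iter_deriv vs (\<lambda>x. 0 * (0::complex)) = (\<lambda>x. 0 * iter_deriv vs (\<lambda>x. 0) x)"
          by (rule iter_deriv_cmult[OF schwartz_zero vs(1)])
        then show ?case by (simp add: fun_eq_iff)
      next
        case (insert p P)
        have "iter_deriv vs (\<lambda>x. of_real (measure lborel (snd p)) * h (fst p) x + (\<Sum>p\<in>P. of_real (measure lborel (snd p)) * h (fst p) x)) x
            = of_real (measure lborel (snd p)) * iter_deriv vs (h (fst p)) x + iter_deriv vs (\<lambda>x. \<Sum>p\<in>P. of_real (measure lborel (snd p)) * h (fst p) x) x"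
          by (subst iter_deriv_add) (auto simp: iter_deriv_cmult h vs intro!: schwartz_cmult schwartz_sum insert.hyps)
        then show ?case using insert by simp
      qed
      then have evS: "?ev vs x S = (\<Sum>(z, K)\<in>P. of_real (measure lborel K) * ?ev vs x (h z))"
        by (simp add: sum_distrib_left case_prod_unfold mult_ac)
      have "?ev vs x J = (LINT z|lborel. ?ev vs x (h z))"
        unfolding ptw[OF vs(1)] by (rule integral_mult_right_zero[symmetric])
      then have "norm (?ev vs x J - ?ev vs x S) \<le> e'"
        unfolding evS using P(2)[OF imageI[OF ev_in[OF vs, of x]]] by (simp only:)
      moreover have "?ev vs x (\<lambda>t. J t - S t) = ?ev vs x J - ?ev vs x S"
        using ev_in[OF vs, of x] J S unfolding \<Lambda>_def by blast
      ultimately have "norm (?ev vs x (\<lambda>t. J t - S t)) \<le> e'" by (simp only:)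
      then show "(1 + norm x) ^ m * norm (iter_deriv vs (\<lambda>t. J t - S t) x) \<le> e'"
        unfolding norm_mult norm_of_real by simp
    qed
    then have "norm (f (\<lambda>t. J t - S t)) \<le> D * e'"
      using f_in schwartz_diff[OF J S] unfolding \<Lambda>_def by blast
    then have 1: "norm (f J - f S) \<le> D * e'" using tempered_diff[OF f J S] by simp
    have "f S = (\<Sum>(z, K)\<in>P. of_real (measure lborel K) * f (h z))"
      unfolding S_def case_prod_unfold
      by (subst tempered_sum[OF f P(1)]) (auto simp: schwartz_cmult h tempered_cmult[OF f])
    then have "norm ((LINT z|lborel. f (h z)) - f S) \<le> e'"
      using P(2)[OF imageI[OF f_in]] by simp
    then have "norm (f J - (LINT z|lborel. f (h z))) \<le> D * e' + e'"
      using norm_triangle_le_diff 1 by (smt (verit) norm_minus_commute norm_triangle_ineq diff_add_cancel add_diff_eq)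
    also have "\<dots> = (D + 1) * e'" by (simp add: distrib_right)
    also have "\<dots> = e" using D by (simp add: e'_def)
    finally show ?thesis .
  qed
  have "norm (f J - (LINT z|lborel. f (h z))) \<le> 0"
  proof (rule field_le_epsilon)
    fix e :: real assume "e > 0"
    then show "norm (f J - (LINT z|lborel. f (h z))) \<le> 0 + e" unfolding add_0_left by (rule bound)
  qed
  then show ?thesis by simp
qed

section \<open>Change of window\<close>

lemma integral_lborel_reflect:
  fixes f :: "'a::euclidean_space \<Rightarrow> complex"
  assumes [measurable]: "f \<in> borel_measurable borel"
  shows "(LINT y|lborel. f (t - y)) = (LINT y|lborel. f y)"
proof -
  have "(LINT y|lborel. f y) = (LINT y|density (distr lborel borel (\<lambda>x. t + (-1) *\<^sub>R x)) (\<lambda>_. ennreal (\<bar>-1\<bar> ^ DIM('a))). f y)"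
    by (subst lborel_affine[of "-1" t]) auto
  also have "\<dots> = (LINT y|distr lborel borel (\<lambda>x. t + (-1) *\<^sub>R x). f y)"
    by (subst integral_density) auto
  also have "\<dots> = (LINT y|lborel. f (t - y))"
    by (subst integral_distr) auto
  finally show ?thesis by simp
qed

text \<open>By continuity a nonzero window is nonzero on a nonempty open set. This makes \<kappa>
  invertible and the normalization of the predual measure unique.\<close>

lemma schwartz_norm_square_integral_pos:
  fixes \<phi> :: "'a::euclidean_space \<Rightarrow> complex"
  assumes \<phi>: "\<phi> \<in> schwartz_space" "\<phi> \<noteq> (\<lambda>_. 0)"
  shows "integrable lborel (\<lambda>x. (norm (\<phi> x))\<^sup>2)" "(LINT x|lborel. (norm (\<phi> x))\<^sup>2) > 0"
proof -
  have "integrable lborel (\<lambda>x. norm (\<phi> x * \<phi> x))"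
    by (intro integrable_norm schwartz_integrable schwartz_mult \<phi>)
  then show I: "integrable lborel (\<lambda>x. (norm (\<phi> x))\<^sup>2)" by (simp add: norm_mult power2_eq_square)
  have "(LINT x|lborel. (norm (\<phi> x))\<^sup>2) \<noteq> 0"
  proof
    assume "(LINT x|lborel. (norm (\<phi> x))\<^sup>2) = 0"
    then have "AE x in lborel. (norm (\<phi> x))\<^sup>2 = 0"
      by (subst (asm) integral_nonneg_eq_0_iff_AE[OF I]) auto
    then have "AE x in lborel. \<not> \<phi> x \<noteq> 0" by simp
    moreover have op: "open {x. \<phi> x \<noteq> 0}"
      using open_Collect_neq[OF schwartz_continuous[OF \<phi>(1)] continuous_on_const] by simp
    ultimately have "emeasure lborel {x. \<phi> x \<noteq> 0} = 0"
      by (subst (asm) AE_iff_measurable[OF _ refl]) auto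
    moreover have "{x. \<phi> x \<noteq> 0} \<noteq> {}" using \<phi>(2) by auto
    ultimately show False using open_emeasure_lborel_pos[OF op] by simp
  qed
  then show "(LINT x|lborel. (norm (\<phi> x))\<^sup>2) > 0"
    by (metis (no_types, lifting) AE_I2 integral_nonneg_AE less_le zero_le_power2)
qed

text \<open>The short-time Fourier transform of \<open>\<psi>\<close> with window
  \<open>\<phi>\<close>, as a function on phase space.\<close>

definition tf_coeff :: "('a::euclidean_space \<Rightarrow> complex) \<Rightarrow> ('a \<Rightarrow> complex) \<Rightarrow> 'a \<times> 'a \<Rightarrow> complex" where
  "tf_coeff \<psi> \<phi> z = (LINT s|lborel. \<psi> s * cnj (tf (fst z) (snd z) \<phi> s))"

lemma tf_coeff_fourier: "tf_coeff \<psi> \<phi> (y, \<eta>) = fourier (\<lambda>s. \<psi> s * cnj (\<phi> (s - y))) \<eta>"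
  unfolding tf_coeff_def fourier_def
  by (intro Bochner_Integration.integral_cong) (auto simp: tf_def cis_cnj)

lemma norm_Pair_weight:
  "(1 + norm z) ^ N \<le> (1 + norm (fst z)) ^ N * (1 + norm (snd z)) ^ N"
proof -
  have "norm z \<le> norm (fst z) + norm (snd z)" using norm_Pair_le[of "fst z" "snd z"] by simp
  moreover have "(1 + norm (fst z)) * (1 + norm (snd z)) = 1 + norm (fst z) + norm (snd z) + norm (fst z) * norm (snd z)"
    by (simp add: algebra_simps)
  moreover have "norm (fst z) * norm (snd z) \<ge> 0" by simp
  ultimately have "1 + norm z \<le> (1 + norm (fst z)) * (1 + norm (snd z))" by linarith
  then show ?thesis unfolding power_mult_distrib[symmetric] by (intro power_mono) auto
qed

lemma schwartz_translate:
  fixes g :: "'a::euclidean_space \<Rightarrow> complex"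
  assumes "g \<in> schwartz_space" shows "(\<lambda>s. g (s - y)) \<in> schwartz_space"
  using schwartz_tf[OF assms, of y 0] by (simp add: tf_def)

text \<open>Decay in \<open>y\<close> comes from \<open>sbd_mult_translate\<close> and decay in
  \<eta> from \<open>fourier_decay\<close>. The weights on the left are the growth allowed by
  \<open>sbd_tf\<close>; what is left on the right is integrable over phase space.\<close>

lemma tf_coeff_weight:
  fixes \<psi> \<phi> :: "'a::euclidean_space \<Rightarrow> complex"
  assumes \<psi>: "\<psi> \<in> schwartz_space" and \<phi>: "\<phi> \<in> schwartz_space"
  obtains C where "C \<ge> 0" "\<And>z. norm (tf_coeff \<psi> \<phi> z) * ((1 + norm (fst z)) ^ k * (1 + norm (snd z)) ^ k)
    \<le> C / (1 + norm z) ^ (2 * DIM('a \<times> 'a))"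
proof -
  define M where "M = 2 * DIM('a \<times> 'a)"
  \<comment> \<open>The \<open>k\<close> powers pay for the weights on the left and the
    \<open>M\<close> powers for integrability.\<close>
  define N where "N = M + k"
  obtain C1 where C1: "C1 \<ge> 0" "\<And>h K \<eta>. h \<in> schwartz_space \<Longrightarrow> sbd (2 * DIM('a)) N K h \<Longrightarrow>
    norm (fourier h (\<eta>::'a)) \<le> C1 * K / (1 + norm \<eta>) ^ N" using fourier_decay[of N] by metis
  obtain C2 where C2: "C2 \<ge> 0" "\<And>y. sbd (2 * DIM('a)) N (C2 / (1 + norm y) ^ N) (\<lambda>s. \<psi> s * cnj (\<phi> (s - y)))"
    using sbd_mult_translate[OF \<psi> schwartz_cnj[OF \<phi>], of "2 * DIM('a)" N N] by metis
  have "norm (tf_coeff \<psi> \<phi> z) * ((1 + norm (fst z)) ^ k * (1 + norm (snd z)) ^ k) \<le> (C1 * C2) / (1 + norm z) ^ M" for z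
  proof -
    obtain y \<eta> where z: "z = (y, \<eta>)" by (cases z)
    let ?a = "1 + norm y" and ?b = "1 + norm \<eta>"
    have S: "(\<lambda>s. \<psi> s * cnj (\<phi> (s - y))) \<in> schwartz_space"
      by (intro schwartz_mult \<psi> schwartz_cnj schwartz_translate \<phi>)
    have "norm (tf_coeff \<psi> \<phi> z) \<le> C1 * (C2 / ?a ^ N) / ?b ^ N"
      unfolding z tf_coeff_fourier by (rule C1(2)[OF S C2(2)])
    also have "\<dots> = C1 * C2 / (?a ^ M * ?b ^ M) / (?a ^ k * ?b ^ k)"
      by (simp add: N_def power_add mult_ac)
    finally have le: "norm (tf_coeff \<psi> \<phi> z) \<le> C1 * C2 / (?a ^ M * ?b ^ M) / (?a ^ k * ?b ^ k)" .
    have "0 < ?a ^ k * ?b ^ k" by (intro mult_pos_pos weight_pos)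
    from pos_le_divide_eq[OF this] le
    have "norm (tf_coeff \<psi> \<phi> z) * (?a ^ k * ?b ^ k) \<le> C1 * C2 / (?a ^ M * ?b ^ M)" by blast
    also have "\<dots> \<le> C1 * C2 / (1 + norm z) ^ M"
      using norm_Pair_weight[of z M] weight_pos[of z M] C1(1) C2(1) unfolding z
      by (intro divide_left_mono mult_nonneg_nonneg mult_pos_pos weight_pos) auto
    finally show ?thesis by (simp add: z)
  qed
  then show ?thesis using that[of "C1 * C2"] C1 C2 unfolding M_def by auto
qed

lemma norm_fst_snd_diff_le: "norm (fst z - fst z0) + norm (snd z - snd z0) \<le> 2 * dist z z0"
  using dist_fst_le[of z z0] dist_snd_le[of z z0] unfolding dist_norm by linarith

lemma sbd_tf_continuous:
  fixes \<phi> :: "'a::euclidean_space \<Rightarrow> complex" and z0 :: "'a \<times> 'a"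
  assumes "\<phi> \<in> schwartz_space" and e: "e > 0"
  obtains d where "d > 0" "\<And>z. dist z z0 < d \<Longrightarrow>
    sbd k m e (\<lambda>t. tf (fst z) (snd z) \<phi> t - tf (fst z0) (snd z0) \<phi> t)"
proof -
  obtain C where C: "C \<ge> 0" "\<And>y \<eta>. norm (y - fst z0) \<le> 1 \<Longrightarrow> norm (\<eta> - snd z0) \<le> 1 \<Longrightarrow>
    sbd k m (C * (norm (y - fst z0) + norm (\<eta> - snd z0))) (\<lambda>t. tf y \<eta> \<phi> t - tf (fst z0) (snd z0) \<phi> t)"
    using sbd_tf_diff[OF assms(1), where ?y0.0 = "fst z0" and ?\<eta>0.0 = "snd z0" and k = k and m = m] by metis
  \<comment> \<open>The two components of \<open>z - z0\<close> together have size at most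
    \<open>2 * d\<close>: the bound \<open>1 / 2\<close> meets the unit-distance condition of
    \<open>sbd_tf_diff\<close>, the other one makes the Lipschitz estimate at most
    \<open>e\<close>.\<close>
  define d where "d = min (1 / 2) (e / (2 * (C + 1)))"
  have Cp: "C + 1 > 0" using C by simp
  then have d: "d > 0" using e unfolding d_def by (intro min_less_iff_conj[THEN iffD2] conjI divide_pos_pos mult_pos_pos) auto
  have "sbd k m e (\<lambda>t. tf (fst z) (snd z) \<phi> t - tf (fst z0) (snd z0) \<phi> t)" if z: "dist z z0 < d" for z
  proof -
    have le: "norm (fst z - fst z0) + norm (snd z - snd z0) \<le> 2 * d"
      using norm_fst_snd_diff_le[of z z0] z by linarith
    have "d \<le> 1 / 2" "d \<le> e / (2 * (C + 1))" unfolding d_def by (rule min.cobounded1, rule min.cobounded2)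
    moreover have "2 * (e / (2 * (C + 1))) = e / (C + 1)"
      unfolding times_divide_eq_right by (rule mult_divide_mult_cancel_left) simp
    moreover have "2 * d \<le> 2 * (e / (2 * (C + 1)))" by (rule mult_left_mono[OF \<open>d \<le> e / (2 * (C + 1))\<close>]) simp
    ultimately have d1: "2 * d \<le> 1" "2 * d \<le> e / (C + 1)" by (linarith, simp only:)
    have "norm (fst z - fst z0) \<le> 1" "norm (snd z - snd z0) \<le> 1"
      using le d1 norm_ge_zero[of "fst z - fst z0"] norm_ge_zero[of "snd z - snd z0"] by linarith+
    moreover have "C * (norm (fst z - fst z0) + norm (snd z - snd z0)) \<le> (C + 1) * (e / (C + 1))"
      using le d1 C by (intro mult_mono order_trans[OF le d1(2)]) auto
    moreover have "(C + 1) * (e / (C + 1)) = e" using Cp by simp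
    ultimately show ?thesis by (intro sbd_le[OF C(2)]) simp_all
  qed
  then show ?thesis using that d by blast
qed

lemma tf_coeff_continuous:
  fixes \<psi> \<phi> :: "'a::euclidean_space \<Rightarrow> complex"
  assumes \<psi>: "\<psi> \<in> schwartz_space" and \<phi>: "\<phi> \<in> schwartz_space"
  shows "continuous_on UNIV (tf_coeff \<psi> \<phi>)"
  unfolding continuous_on_iff
proof (intro ballI allI impI)
  fix z0 :: "'a \<times> 'a" and e :: real assume e: "e > 0"
  define I where "I = (LINT s|lborel. norm (\<psi> s))"
  have I: "I \<ge> 0" unfolding I_def by (intro integral_nonneg_AE) auto
  have e1: "e / (2 * (I + 1)) > 0" using e I by simp
  obtain d where d: "d > 0" "\<And>z. dist z z0 < d \<Longrightarrow>
    sbd 0 0 (e / (2 * (I + 1))) (\<lambda>t. tf (fst z) (snd z) \<phi> t - tf (fst z0) (snd z0) \<phi> t)"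
    using sbd_tf_continuous[OF \<phi> e1] by metis
  have "dist (tf_coeff \<psi> \<phi> z) (tf_coeff \<psi> \<phi> z0) < e" if z: "dist z z0 < d" for z
  proof -
    have int: "integrable lborel (\<lambda>s. \<psi> s * cnj (tf y \<eta> \<phi> s))" for y \<eta>
      by (intro schwartz_integrable schwartz_mult \<psi> schwartz_cnj schwartz_tf \<phi>)
    have "tf_coeff \<psi> \<phi> z - tf_coeff \<psi> \<phi> z0
        = (LINT s|lborel. \<psi> s * cnj (tf (fst z) (snd z) \<phi> s) - \<psi> s * cnj (tf (fst z0) (snd z0) \<phi> s))"
      unfolding tf_coeff_def by (rule Bochner_Integration.integral_diff[symmetric]) (rule int)+
    also have "norm \<dots> \<le> (LINT s|lborel. norm (\<psi> s * cnj (tf (fst z) (snd z) \<phi> s) - \<psi> s * cnj (tf (fst z0) (snd z0) \<phi> s)))"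
      by (rule integral_norm_bound)
    also have "\<dots> \<le> (LINT s|lborel. (e / (2 * (I + 1))) * norm (\<psi> s))"
    proof (rule integral_mono)
      fix s
      have "\<psi> s * cnj (tf (fst z) (snd z) \<phi> s) - \<psi> s * cnj (tf (fst z0) (snd z0) \<phi> s)
          = cnj (tf (fst z) (snd z) \<phi> s - tf (fst z0) (snd z0) \<phi> s) * \<psi> s" by (simp add: algebra_simps)
      moreover have "norm (tf (fst z) (snd z) \<phi> s - tf (fst z0) (snd z0) \<phi> s) \<le> e / (2 * (I + 1))"
        using sbd_D[OF d(2)[OF z], of s] by simp
      ultimately show "norm (\<psi> s * cnj (tf (fst z) (snd z) \<phi> s) - \<psi> s * cnj (tf (fst z0) (snd z0) \<phi> s)) \<le> (e / (2 * (I + 1))) * norm (\<psi> s)"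
        by (simp only: norm_mult complex_mod_cnj) (rule mult_right_mono, simp_all)
    next
      show "integrable lborel (\<lambda>s. norm (\<psi> s * cnj (tf (fst z) (snd z) \<phi> s) - \<psi> s * cnj (tf (fst z0) (snd z0) \<phi> s)))"
        by (intro integrable_norm Bochner_Integration.integrable_diff int)
      show "integrable lborel (\<lambda>s. (e / (2 * (I + 1))) * norm (\<psi> s))"
        by (intro integrable_mult_right integrable_norm schwartz_integrable \<psi>)
    qed
    also have "\<dots> = (e / (2 * (I + 1))) * I" by (simp add: I_def)
    also have "\<dots> < e" using e I by (simp add: divide_simps)
    finally show ?thesis by (simp add: dist_norm)
  qed
  then show "\<exists>d>0. \<forall>z\<in>UNIV. dist z z0 < d \<longrightarrow> dist (tf_coeff \<psi> \<phi> z) (tf_coeff \<psi> \<phi> z0) < e"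
    using d(1) by blast
qed

lemma iter_deriv_tf_continuous:
  fixes \<phi> :: "'a::euclidean_space \<Rightarrow> complex"
  assumes \<phi>: "\<phi> \<in> schwartz_space" and vs: "vs \<in> lists Basis"
  shows "continuous_on UNIV (\<lambda>z. iter_deriv vs (tf (fst z) (snd z) \<phi>) x)"
  unfolding continuous_on_iff
proof (intro ballI allI impI)
  fix z0 :: "'a \<times> 'a" and e :: real assume e: "e > 0"
  obtain d where d: "d > 0" "\<And>z. dist z z0 < d \<Longrightarrow>
    sbd 0 (length vs) (e / 2) (\<lambda>t. tf (fst z) (snd z) \<phi> t - tf (fst z0) (snd z0) \<phi> t)"
    using sbd_tf_continuous[OF \<phi>, of "e / 2" z0 0 "length vs"] e by (metis half_gt_zero)
  have "dist (iter_deriv vs (tf (fst z) (snd z) \<phi>) x) (iter_deriv vs (tf (fst z0) (snd z0) \<phi>) x) < e" if z: "dist z z0 < d" for z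
  proof -
    have "iter_deriv vs (\<lambda>t. tf (fst z) (snd z) \<phi> t + (-1) * tf (fst z0) (snd z0) \<phi> t) x
        = iter_deriv vs (tf (fst z) (snd z) \<phi>) x + (-1) * iter_deriv vs (tf (fst z0) (snd z0) \<phi>) x"
      by (subst iter_deriv_add[OF schwartz_tf[OF \<phi>] schwartz_cmult[OF schwartz_tf[OF \<phi>]] vs],
          subst iter_deriv_cmult[OF schwartz_tf[OF \<phi>] vs]) (rule refl)
    then show ?thesis using sbd_iter[OF d(2)[OF z] vs, of x] e by (simp add: dist_norm)
  qed
  then show "\<exists>d>0. \<forall>z\<in>UNIV. dist z z0 < d \<longrightarrow> dist (iter_deriv vs (tf (fst z) (snd z) \<phi>) x) (iter_deriv vs (tf (fst z0) (snd z0) \<phi>) x) < e"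
    using d(1) by blast
qed

lemma tf_coeff_mult_integrable:
  fixes \<psi> \<phi> :: "'a::euclidean_space \<Rightarrow> complex"
  assumes \<psi>: "\<psi> \<in> schwartz_space" and \<phi>: "\<phi> \<in> schwartz_space"
    and w: "w \<in> borel_measurable borel" "\<And>z. norm (w z) \<le> D * (1 + norm (snd z)) ^ k"
  shows "integrable lborel (\<lambda>z. tf_coeff \<psi> \<phi> z * w z)"
proof -
  obtain C where C: "C \<ge> 0" "\<And>z. norm (tf_coeff \<psi> \<phi> z) * ((1 + norm (fst z)) ^ k * (1 + norm (snd z)) ^ k)
    \<le> C / (1 + norm z) ^ (2 * DIM('a \<times> 'a))" using tf_coeff_weight[OF \<psi> \<phi>] by metis
  have "0 \<le> D * (1 + norm (snd (0 :: 'a \<times> 'a))) ^ k" using order_trans[OF norm_ge_zero w(2)[of 0]] .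
  then have D: "D \<ge> 0" by simp
  show ?thesis
  proof (rule integrable_weight_bound)
    show "(\<lambda>z. tf_coeff \<psi> \<phi> z * w z) \<in> borel_measurable borel"
      using borel_measurable_continuous_onI[OF tf_coeff_continuous[OF \<psi> \<phi>]] w(1) by measurable
    fix z :: "'a \<times> 'a"
    have "norm (w z) \<le> D * ((1 + norm (fst z)) ^ k * (1 + norm (snd z)) ^ k)"
    proof -
      have "1 * (1 + norm (snd z)) ^ k \<le> (1 + norm (fst z)) ^ k * (1 + norm (snd z)) ^ k"
        by (intro mult_right_mono one_le_power) auto
      from mult_left_mono[OF this D] show ?thesis using w(2)[of z] by simp
    qed
    then have "norm (tf_coeff \<psi> \<phi> z * w z) \<le> norm (tf_coeff \<psi> \<phi> z) * (D * ((1 + norm (fst z)) ^ k * (1 + norm (snd z)) ^ k))"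
      unfolding norm_mult by (intro mult_left_mono) auto
    also have "\<dots> = D * (norm (tf_coeff \<psi> \<phi> z) * ((1 + norm (fst z)) ^ k * (1 + norm (snd z)) ^ k))" by simp
    also have "\<dots> \<le> D * (C / (1 + norm z) ^ (2 * DIM('a \<times> 'a)))" by (intro mult_left_mono C D)
    finally show "norm (tf_coeff \<psi> \<phi> z * w z) \<le> (D * C) / (1 + norm z) ^ (2 * DIM('a \<times> 'a))" by simp
  qed simp
qed

lemma iter_deriv_tf_bound:
  fixes \<phi> :: "'a::euclidean_space \<Rightarrow> complex"
  assumes \<phi>: "\<phi> \<in> schwartz_space"
  obtains C where "C \<ge> 0" "\<And>vs z x. vs \<in> lists Basis \<Longrightarrow> length vs \<le> m \<Longrightarrow>
    norm (iter_deriv vs (tf (fst z) (snd z) \<phi>) x) \<le> C * (1 + norm (snd z)) ^ m"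
proof -
  obtain C where C: "C \<ge> 0" "\<And>y \<eta>. sbd 0 m (C * (1 + norm y) ^ 0 * (1 + norm \<eta>) ^ m) (tf y \<eta> \<phi>)"
    using sbd_tf[OF \<phi>, of 0 m] by metis
  have "norm (iter_deriv vs (tf (fst z) (snd z) \<phi>) x) \<le> C * (1 + norm (snd z)) ^ m"
    if "vs \<in> lists Basis" "length vs \<le> m" for vs z x
    using sbd_iter[OF C(2) that, of x "fst z" "snd z"] by simp
  then show ?thesis using that C(1) by blast
qed

text \<open>Fourier inversion in \<open>\<eta>\<close> for \<open>s \<mapsto> \<psi>(s) \<phi>(s - y)\<^sup>*\<close>, then integration over \<open>y\<close>.\<close>

lemma tf_reconstruction:
  fixes \<psi> \<phi> :: "'a::euclidean_space \<Rightarrow> complex"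
  assumes \<psi>: "\<psi> \<in> schwartz_space" and \<phi>: "\<phi> \<in> schwartz_space"
  shows "of_real ((2 * pi) ^ DIM('a) * (LINT x|lborel. (norm (\<phi> x))\<^sup>2)) * \<psi> t
    = (LINT z|lborel. tf_coeff \<psi> \<phi> z * tf (fst z) (snd z) \<phi> t)"
proof -
  obtain C where C: "\<And>vs z x. vs \<in> lists Basis \<Longrightarrow> length vs \<le> 0 \<Longrightarrow>
    norm (iter_deriv vs (tf (fst z) (snd z) \<phi>) x) \<le> C * (1 + norm (snd z)) ^ 0"
    using iter_deriv_tf_bound[OF \<phi>, of 0] by metis
  have I: "integrable lborel (\<lambda>z. tf_coeff \<psi> \<phi> z * tf (fst z) (snd z) \<phi> t)"
  proof (rule tf_coeff_mult_integrable[OF \<psi> \<phi>])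
    show "(\<lambda>z. tf (fst z) (snd z) \<phi> t) \<in> borel_measurable borel"
      using iter_deriv_tf_continuous[OF \<phi>, of "[]" t] by (intro borel_measurable_continuous_onI) simp
    show "norm (tf (fst z) (snd z) \<phi> t) \<le> C * (1 + norm (snd z)) ^ 0" for z
      using C[of "[]" z t] by simp
  qed
  have "(LINT z|lborel. tf_coeff \<psi> \<phi> z * tf (fst z) (snd z) \<phi> t)
      = (LINT z|(lborel \<Otimes>\<^sub>M lborel). tf_coeff \<psi> \<phi> z * tf (fst z) (snd z) \<phi> t)"
    by (simp add: lborel_prod)
  also have "\<dots> = (LINT y|lborel. LINT \<eta>|lborel. tf_coeff \<psi> \<phi> (y, \<eta>) * tf y \<eta> \<phi> t)"
    using I by (subst lborel_pair.integral_fst'[symmetric]) (simp_all add: lborel_prod)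
  also have "\<dots> = (LINT y|lborel. of_real ((2 * pi) ^ DIM('a)) * \<psi> t * of_real ((norm (\<phi> (t - y)))\<^sup>2))"
  proof (rule Bochner_Integration.integral_cong[OF refl])
    fix y
    let ?g = "\<lambda>s. \<psi> s * cnj (\<phi> (s - y))"
    have g: "?g \<in> schwartz_space" by (intro schwartz_mult \<psi> schwartz_cnj schwartz_translate \<phi>)
    have "(LINT \<eta>|lborel. tf_coeff \<psi> \<phi> (y, \<eta>) * tf y \<eta> \<phi> t) = (LINT \<eta>|lborel. (fourier ?g \<eta> * cis (\<eta> \<bullet> t)) * \<phi> (t - y))"
      unfolding tf_coeff_fourier by (simp add: tf_def mult.assoc)
    also have "\<dots> = (LINT \<eta>|lborel. fourier ?g \<eta> * cis (\<eta> \<bullet> t)) * \<phi> (t - y)" by (rule integral_mult_left_zero)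
    also have "\<dots> = of_real ((2 * pi) ^ DIM('a)) * \<psi> t * of_real ((norm (\<phi> (t - y)))\<^sup>2)"
      unfolding schwartz_fourier_inversion[OF g] complex_norm_square by (simp add: mult_ac)
    finally show "(LINT \<eta>|lborel. tf_coeff \<psi> \<phi> (y, \<eta>) * tf y \<eta> \<phi> t)
      = of_real ((2 * pi) ^ DIM('a)) * \<psi> t * of_real ((norm (\<phi> (t - y)))\<^sup>2)" .
  qed
  also have "\<dots> = of_real ((2 * pi) ^ DIM('a)) * \<psi> t * (LINT y|lborel. complex_of_real ((norm (\<phi> (t - y)))\<^sup>2))"
    by (rule integral_mult_right_zero)
  also have "(LINT y|lborel. complex_of_real ((norm (\<phi> (t - y)))\<^sup>2)) = (LINT y|lborel. complex_of_real ((norm (\<phi> y))\<^sup>2))"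
    using schwartz_measurable[OF \<phi>] by (intro integral_lborel_reflect[of "\<lambda>y. complex_of_real ((norm (\<phi> y))\<^sup>2)"]) measurable
  also have "\<dots> = of_real (LINT y|lborel. (norm (\<phi> y))\<^sup>2)" by (rule integral_complex_of_real)
  finally show ?thesis by (simp add: mult_ac)
qed

text \<open>Differentiation under the integral, one derivative at a time. The difference quotients
  of both sides agree by induction, and both Taylor remainders are of order \<open>t^2\<close>,
  under the integral with a factor that is integrable against the coefficients.\<close>

lemma tf_reconstruction_deriv:
  fixes \<psi> \<phi> :: "'a::euclidean_space \<Rightarrow> complex"
  assumes \<psi>: "\<psi> \<in> schwartz_space" and \<phi>: "\<phi> \<in> schwartz_space" and "vs \<in> lists Basis"
  shows "of_real ((2 * pi) ^ DIM('a) * (LINT x|lborel. (norm (\<phi> x))\<^sup>2)) * iter_deriv vs \<psi> x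
    = (LINT z|lborel. tf_coeff \<psi> \<phi> z * iter_deriv vs (tf (fst z) (snd z) \<phi>) x)"
  using assms(3)
proof (induction vs arbitrary: x)
  case Nil
  show ?case using tf_reconstruction[OF \<psi> \<phi>] by simp
next
  case (Cons b vs)
  then have b: "b \<in> Basis" and vs: "vs \<in> lists Basis" by auto
  define \<kappa> where "\<kappa> = complex_of_real ((2 * pi) ^ DIM('a) * (LINT x|lborel. (norm (\<phi> x))\<^sup>2))"
  define D where "D = (\<lambda>z. iter_deriv vs (tf (fst z) (snd z) \<phi>))"
  let ?c = "tf_coeff \<psi> \<phi>"
  \<comment> \<open>The remainder involves two further derivatives in direction
    \<open>b\<close>.\<close>
  let ?m = "length vs + 2"
  have DS: "D z \<in> schwartz_space" for z unfolding D_def by (intro schwartz_iter_deriv schwartz_tf \<phi> vs)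
  obtain C where C: "C \<ge> 0" "\<And>vs z x. vs \<in> lists Basis \<Longrightarrow> length vs \<le> ?m \<Longrightarrow>
    norm (iter_deriv vs (tf (fst z) (snd z) \<phi>) x) \<le> C * (1 + norm (snd z)) ^ ?m"
    using iter_deriv_tf_bound[OF \<phi>, of ?m] by metis
  have int: "integrable lborel (\<lambda>z. ?c z * iter_deriv us (tf (fst z) (snd z) \<phi>) y)"
    if "us \<in> lists Basis" "length us \<le> ?m" for us y
  proof (rule tf_coeff_mult_integrable[OF \<psi> \<phi>])
    show "(\<lambda>z. iter_deriv us (tf (fst z) (snd z) \<phi>) y) \<in> borel_measurable borel"
      using iter_deriv_tf_continuous[OF \<phi> that(1)] by (rule borel_measurable_continuous_onI)
  qed (rule C(2)[OF that])
  have intD: "integrable lborel (\<lambda>z. ?c z * D z y)" for y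
    unfolding D_def using int[of vs] vs by simp
  have intD1: "integrable lborel (\<lambda>z. ?c z * dir_deriv b (D z) y)" for y
    unfolding D_def using int[of "b # vs"] vs b by simp
  have intW: "integrable lborel (\<lambda>z. ?c z * of_real (C * (1 + norm (snd z)) ^ ?m))"
  proof (rule tf_coeff_mult_integrable[OF \<psi> \<phi>])
    show "(\<lambda>z. complex_of_real (C * (1 + norm (snd z)) ^ ?m)) \<in> borel_measurable borel"
      by (intro borel_measurable_continuous_onI continuous_intros)
    show "norm (complex_of_real (C * (1 + norm (snd z)) ^ ?m)) \<le> C * (1 + norm (snd z)) ^ ?m" for z :: "'a \<times> 'a"
      unfolding norm_of_real using C(1) by simp
  qed
  define W where "W = (LINT z|lborel. norm (?c z * complex_of_real (C * (1 + norm (snd z)) ^ ?m)))"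
  define \<Psi> where "\<Psi> = iter_deriv vs \<psi>"
  have \<Psi>: "\<Psi> \<in> schwartz_space" unfolding \<Psi>_def by (intro schwartz_iter_deriv \<psi> vs)
  have IH: "\<kappa> * \<Psi> y = (LINT z|lborel. ?c z * D z y)" for y
    unfolding \<kappa>_def \<Psi>_def D_def using Cons.IH .
  obtain M where M: "M > 0" "sbd 0 0 M (dir_deriv b (dir_deriv b \<Psi>))"
    using schwartz_sbd[OF schwartz_dir_deriv[OF schwartz_dir_deriv[OF \<Psi> b] b]] by blast
  have "norm (\<kappa> * dir_deriv b \<Psi> x - (LINT z|lborel. ?c z * dir_deriv b (D z) x)) \<le> (norm \<kappa> * M + W) * t"
    if t: "0 < t" "t \<le> 1" for t
  proof -
    have Mt: "norm (\<Psi> (x + t *\<^sub>R b) - \<Psi> x - of_real t * dir_deriv b \<Psi> x) \<le> M * t\<^sup>2"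
    proof (rule schwartz_taylor[OF \<Psi> b])
      show "norm (dir_deriv b (dir_deriv b \<Psi>) (x + \<theta> *\<^sub>R b)) \<le> M" for \<theta>
        using sbd_D[OF M(2)] by simp
    qed (use t in simp)
    have Dt: "norm (D z (x + t *\<^sub>R b) - D z x - of_real t * dir_deriv b (D z) x) \<le> (C * (1 + norm (snd z)) ^ ?m) * t\<^sup>2" for z
    proof (rule schwartz_taylor[OF DS b])
      show "norm (dir_deriv b (dir_deriv b (D z)) (x + \<theta> *\<^sub>R b)) \<le> C * (1 + norm (snd z)) ^ ?m" for \<theta>
        using C(2)[of "b # b # vs" z] vs b unfolding D_def by simp
    qed (use t in simp)
    let ?R = "\<lambda>z. ?c z * (D z (x + t *\<^sub>R b) - D z x - of_real t * dir_deriv b (D z) x)"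
    have R: "?R z = ?c z * D z (x + t *\<^sub>R b) - ?c z * D z x - of_real t * (?c z * dir_deriv b (D z) x)" for z
      by (simp add: algebra_simps)
    have intR: "integrable lborel ?R"
      unfolding R by (intro Bochner_Integration.integrable_diff integrable_mult_right intD intD1)
    have "(LINT z|lborel. ?R z) = \<kappa> * \<Psi> (x + t *\<^sub>R b) - \<kappa> * \<Psi> x - of_real t * (LINT z|lborel. ?c z * dir_deriv b (D z) x)"
      unfolding R IH using intD intD1 by (simp add: Bochner_Integration.integral_diff)
    then have eq: "of_real t * (\<kappa> * dir_deriv b \<Psi> x - (LINT z|lborel. ?c z * dir_deriv b (D z) x))
        = (LINT z|lborel. ?R z) - \<kappa> * (\<Psi> (x + t *\<^sub>R b) - \<Psi> x - of_real t * dir_deriv b \<Psi> x)"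
      by (simp add: algebra_simps)
    have "norm (LINT z|lborel. ?R z) \<le> (LINT z|lborel. norm (?R z))" by (rule integral_norm_bound)
    also have "\<dots> \<le> (LINT z|lborel. t\<^sup>2 * norm (?c z * complex_of_real (C * (1 + norm (snd z)) ^ ?m)))"
    proof (rule integral_mono)
      show "integrable lborel (\<lambda>z. norm (?R z))" using intR by (rule integrable_norm)
      show "integrable lborel (\<lambda>z. t\<^sup>2 * norm (?c z * complex_of_real (C * (1 + norm (snd z)) ^ ?m)))"
        using intW by (intro integrable_mult_right integrable_norm)
      fix z :: "'a \<times> 'a"
      have "norm (?R z) \<le> norm (?c z) * ((C * (1 + norm (snd z)) ^ ?m) * t\<^sup>2)"
        unfolding norm_mult[of "?c z"] by (rule mult_left_mono[OF Dt]) simp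
      also have "\<dots> = t\<^sup>2 * norm (?c z * complex_of_real (C * (1 + norm (snd z)) ^ ?m))"
        unfolding norm_mult[of "?c z"] norm_of_real using C(1) by simp
      finally show "norm (?R z) \<le> t\<^sup>2 * norm (?c z * complex_of_real (C * (1 + norm (snd z)) ^ ?m))" .
    qed
    also have "\<dots> = t\<^sup>2 * W" unfolding W_def by (rule integral_mult_right_zero)
    finally have Rb: "norm (LINT z|lborel. ?R z) \<le> t\<^sup>2 * W" .
    have "t * norm (\<kappa> * dir_deriv b \<Psi> x - (LINT z|lborel. ?c z * dir_deriv b (D z) x))
        = norm ((LINT z|lborel. ?R z) - \<kappa> * (\<Psi> (x + t *\<^sub>R b) - \<Psi> x - of_real t * dir_deriv b \<Psi> x))"
      unfolding eq[symmetric] norm_mult norm_of_real using t by simp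
    also have "\<dots> \<le> t\<^sup>2 * W + norm \<kappa> * (M * t\<^sup>2)"
      using Rb mult_left_mono[OF Mt norm_ge_zero[of \<kappa>]]
      by (intro order_trans[OF norm_triangle_ineq4] add_mono) (simp_all add: norm_mult)
    also have "\<dots> = t * ((norm \<kappa> * M + W) * t)" by (simp add: power2_eq_square algebra_simps)
    finally show ?thesis using t by simp
  qed
  then have "\<kappa> * dir_deriv b \<Psi> x - (LINT z|lborel. ?c z * dir_deriv b (D z) x) = 0"
    by (rule norm_le_linear_imp_zero)
  then show ?case unfolding \<kappa>_def \<Psi>_def D_def by simp
qed

text \<open>The integrand is dominated in each seminorm because decay of the coefficients beats the
  growth of the shifts, and its equicontinuity is that of a product of a continuous scalar and a
  continuous family.\<close>

lemma tempered_tf_reconstruction: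
  fixes \<psi> \<phi> :: "'a::euclidean_space \<Rightarrow> complex"
  assumes f: "f \<in> tempered_distributions" and \<psi>: "\<psi> \<in> schwartz_space" and \<phi>: "\<phi> \<in> schwartz_space"
  shows "of_real ((2 * pi) ^ DIM('a) * (LINT x|lborel. (norm (\<phi> x))\<^sup>2)) * f \<psi>
    = (LINT z|lborel. tf_coeff \<psi> \<phi> z * f (tf (fst z) (snd z) \<phi>))"
proof -
  define \<kappa> where "\<kappa> = complex_of_real ((2 * pi) ^ DIM('a) * (LINT x|lborel. (norm (\<phi> x))\<^sup>2))"
  let ?c = "tf_coeff \<psi> \<phi>"
  let ?h = "\<lambda>z t. ?c z * tf (fst z) (snd z) \<phi> t"
  have h: "?h z \<in> schwartz_space" for z by (intro schwartz_cmult schwartz_tf \<phi>)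
  have "f (\<lambda>t. \<kappa> * \<psi> t) = (LINT z|lborel. f (?h z))"
  proof (rule tempered_integral[OF f h schwartz_cmult[OF \<psi>]])
    fix m
    obtain C1 where C1: "C1 \<ge> 0" "\<And>y \<eta>. sbd m m (C1 * (1 + norm y) ^ m * (1 + norm \<eta>) ^ m) (tf y \<eta> \<phi>)"
      using sbd_tf[OF \<phi>, of m m] by metis
    obtain C2 where C2: "C2 \<ge> 0" "\<And>z. norm (?c z) * ((1 + norm (fst z)) ^ m * (1 + norm (snd z)) ^ m)
      \<le> C2 / (1 + norm z) ^ (2 * DIM('a \<times> 'a))" using tf_coeff_weight[OF \<psi> \<phi>] by metis
    define G where "G = (\<lambda>z::'a \<times> 'a. (C1 * C2) * (1 / (1 + norm z) ^ (2 * DIM('a \<times> 'a))))"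
    have "integrable lborel G" unfolding G_def by (intro integrable_mult_right integrable_weight) simp
    moreover have "sbd m m (G z) (?h z)" for z
    proof (rule sbd_le[OF sbd_cmult[OF schwartz_tf[OF \<phi>] C1(2)]])
      have "norm (?c z) * (C1 * (1 + norm (fst z)) ^ m * (1 + norm (snd z)) ^ m)
          = C1 * (norm (?c z) * ((1 + norm (fst z)) ^ m * (1 + norm (snd z)) ^ m))" by simp
      also have "\<dots> \<le> C1 * (C2 / (1 + norm z) ^ (2 * DIM('a \<times> 'a)))" by (intro mult_left_mono C1 C2)
      finally show "norm (?c z) * (C1 * (1 + norm (fst z)) ^ m * (1 + norm (snd z)) ^ m) \<le> G z" by (simp add: G_def)
    qed
    ultimately show "\<exists>G. integrable lborel G \<and> (\<forall>z. sbd m m (G z) (?h z))" by blast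
  next
    fix m and z0 :: "'a \<times> 'a" and e :: real assume e: "e > 0"
    obtain K where K: "K > 0" "sbd m m K (tf (fst z0) (snd z0) \<phi>)" using schwartz_sbd[OF schwartz_tf[OF \<phi>]] by blast
    have c: "continuous (at z0) ?c"
      using tf_coeff_continuous[OF \<psi> \<phi>] continuous_on_eq_continuous_at[OF open_UNIV] by blast
    \<comment> \<open>Bounds the coefficient near \<open>z0\<close>. The difference of products is
      split into coefficient times difference of shifts and difference of coefficients times the
      shift at \<open>z0\<close>, with \<open>e / 2\<close> for each.\<close>
    define B where "B = norm (?c z0) + 1"
    have B: "B > 0" unfolding B_def by (intro add_nonneg_pos) auto
    obtain d1 where d1: "d1 > 0" "\<And>z. dist z z0 < d1 \<Longrightarrow> dist (?c z) (?c z0) < min 1 (e / (2 * K))"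
      using c e K unfolding continuous_at_eps_delta by (metis divide_pos_pos min_less_iff_conj mult_pos_pos zero_less_numeral zero_less_one)
    have "e / (2 * B) > 0" using e B by simp
    then obtain d2 where d2: "d2 > 0" "\<And>z. dist z z0 < d2 \<Longrightarrow>
      sbd m m (e / (2 * B)) (\<lambda>t. tf (fst z) (snd z) \<phi> t - tf (fst z0) (snd z0) \<phi> t)"
      using sbd_tf_continuous[OF \<phi>, of "e / (2 * B)" z0 m m] by metis
    have "sbd m m e (\<lambda>t. ?h z t - ?h z0 t)" if z: "dist z z0 < min d1 d2" for z
    proof -
      let ?u = "\<lambda>t. tf (fst z) (snd z) \<phi> t - tf (fst z0) (snd z0) \<phi> t"
      have u: "?u \<in> schwartz_space" by (intro schwartz_diff schwartz_tf \<phi>)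
      have cz: "norm (?c z - ?c z0) \<le> 1" "norm (?c z - ?c z0) \<le> e / (2 * K)"
        using d1(2)[of z] z by (auto simp: dist_norm)
      have "norm (?c z) \<le> norm (?c z - ?c z0) + norm (?c z0)" by (metis diff_add_cancel norm_triangle_ineq)
      then have cB: "norm (?c z) \<le> B" using cz(1) by (simp add: B_def)
      have "sbd m m (norm (?c z) * (e / (2 * B)) + norm (?c z - ?c z0) * K)
          (\<lambda>t. ?c z * ?u t + (?c z - ?c z0) * tf (fst z0) (snd z0) \<phi> t)"
        using d2(2)[of z] z by (intro sbd_add sbd_cmult schwartz_cmult u schwartz_tf \<phi> K) auto
      moreover have "(\<lambda>t. ?c z * ?u t + (?c z - ?c z0) * tf (fst z0) (snd z0) \<phi> t) = (\<lambda>t. ?h z t - ?h z0 t)"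
        by (simp add: algebra_simps)
      moreover have "norm (?c z) * (e / (2 * B)) + norm (?c z - ?c z0) * K \<le> e"
      proof -
        have "norm (?c z) * (e / (2 * B)) \<le> B * (e / (2 * B))" using cB e B by (intro mult_right_mono) auto
        moreover have "norm (?c z - ?c z0) * K \<le> e / (2 * K) * K" using cz(2) K by (intro mult_right_mono) auto
        moreover have "B * (e / (2 * B)) = e / 2" "e / (2 * K) * K = e / 2" using B K by auto
        ultimately show ?thesis by linarith
      qed
      ultimately show ?thesis by (metis (no_types, lifting) sbd_le)
    qed
    then show "\<exists>d>0. \<forall>z. dist z z0 < d \<longrightarrow> sbd m m e (\<lambda>t. ?h z t - ?h z0 t)"
      using d1(1) d2(1) by (intro exI[of _ "min d1 d2"]) auto
  next
    fix vs :: "'a list" and x assume vs: "vs \<in> lists Basis"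
    show "iter_deriv vs (\<lambda>t. \<kappa> * \<psi> t) x = (LINT z|lborel. iter_deriv vs (?h z) x)"
      unfolding iter_deriv_cmult[OF \<psi> vs] iter_deriv_cmult[OF schwartz_tf[OF \<phi>] vs] \<kappa>_def
      by (rule tf_reconstruction_deriv[OF \<psi> \<phi> vs])
  qed
  then show ?thesis
    unfolding tempered_cmult[OF f \<psi>] tempered_cmult[OF f schwartz_tf[OF \<phi>]] \<kappa>_def .
qed

lemma tempered_tf_continuous:
  fixes \<phi> :: "'a::euclidean_space \<Rightarrow> complex"
  assumes f: "f \<in> tempered_distributions" and \<phi>: "\<phi> \<in> schwartz_space"
  shows "continuous_on UNIV (\<lambda>z. f (tf (fst z) (snd z) \<phi>))"
  unfolding continuous_on_iff
proof (intro ballI allI impI)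
  fix z0 :: "'a \<times> 'a" and e :: real assume e: "e > 0"
  obtain C m where C: "C \<ge> 0" "\<And>g K. g \<in> schwartz_space \<Longrightarrow> sbd m m K g \<Longrightarrow> norm (f g) \<le> C * K"
    using tempered_bound[OF f] by blast
  have "e / (C + 1) > 0" using e C by simp
  then obtain d where d: "d > 0" "\<And>z. dist z z0 < d \<Longrightarrow>
    sbd m m (e / (C + 1)) (\<lambda>t. tf (fst z) (snd z) \<phi> t - tf (fst z0) (snd z0) \<phi> t)"
    using sbd_tf_continuous[OF \<phi>, of "e / (C + 1)" z0 m m] by metis
  have "dist (f (tf (fst z) (snd z) \<phi>)) (f (tf (fst z0) (snd z0) \<phi>)) < e" if z: "dist z z0 < d" for z
  proof -
    have "norm (f (tf (fst z) (snd z) \<phi>) - f (tf (fst z0) (snd z0) \<phi>)) \<le> C * (e / (C + 1))"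
      using C(2)[OF schwartz_diff[OF schwartz_tf[OF \<phi>] schwartz_tf[OF \<phi>]] d(2)[OF z]]
      by (simp add: tempered_diff[OF f] schwartz_tf[OF \<phi>])
    also have "\<dots> < e" using C e by (simp add: divide_simps)
    finally show ?thesis by (simp add: dist_norm)
  qed
  then show "\<exists>d>0. \<forall>z\<in>UNIV. dist z z0 < d \<longrightarrow> dist (f (tf (fst z) (snd z) \<phi>)) (f (tf (fst z0) (snd z0) \<phi>)) < e"
    using d(1) by blast
qed

text \<open>Covariance: shifting the analysed function shifts its transform, up to a phase because
  translations and modulations do not commute. Absolute values remove the phase and leave a
  convolution kernel.\<close>

lemma norm_tf_coeff_tf:
  fixes \<psi> \<phi> :: "'a::euclidean_space \<Rightarrow> complex"
  assumes \<psi>: "\<psi> \<in> schwartz_space" and \<phi>: "\<phi> \<in> schwartz_space"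
  shows "norm (tf_coeff (tf x w \<psi>) \<phi> (y + x, \<eta> + w)) = norm (tf_coeff \<psi> \<phi> (y, \<eta>))"
proof -
  have "tf_coeff (tf x w \<psi>) \<phi> (y + x, \<eta> + w) = (LINT s|lborel. tf x w \<psi> (s + x) * cnj (tf (y + x) (\<eta> + w) \<phi> (s + x)))"
    unfolding tf_coeff_def fst_conv snd_conv
    by (subst integral_lborel_translate[where a = x])
      (auto intro!: schwartz_measurable schwartz_mult schwartz_tf schwartz_cnj \<psi> \<phi>)
  also have "\<dots> = (LINT s|lborel. cis (- (\<eta> \<bullet> x)) * (\<psi> s * cnj (tf y \<eta> \<phi> s)))"
  proof (rule Bochner_Integration.integral_cong[OF refl])
    fix s
    have "cis (w \<bullet> (s + x)) * cnj (cis ((\<eta> + w) \<bullet> (s + x))) = cis (- (\<eta> \<bullet> x)) * cnj (cis (\<eta> \<bullet> s))"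
      by (simp add: cis_cnj cis_mult algebra_simps inner_add_left inner_add_right)
    then have "(cis (w \<bullet> (s + x)) * cnj (cis ((\<eta> + w) \<bullet> (s + x)))) * (\<psi> s * cnj (\<phi> (s - y)))
        = (cis (- (\<eta> \<bullet> x)) * cnj (cis (\<eta> \<bullet> s))) * (\<psi> s * cnj (\<phi> (s - y)))" by simp
    then show "tf x w \<psi> (s + x) * cnj (tf (y + x) (\<eta> + w) \<phi> (s + x)) = cis (- (\<eta> \<bullet> x)) * (\<psi> s * cnj (tf y \<eta> \<phi> s))"
      by (simp add: tf_def mult_ac)
  qed
  also have "\<dots> = cis (- (\<eta> \<bullet> x)) * tf_coeff \<psi> \<phi> (y, \<eta>)"
    unfolding tf_coeff_def fst_conv snd_conv by (rule integral_mult_right_zero)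
  finally show ?thesis by (simp add: norm_mult)
qed

text \<open>The constant is the L^1 norm of \<open>tf_coeff \<psi> \<phi>\<close> divided by
  \<kappa>; nonvanishing of \<open>\<phi>\<close> is what permits this division. The estimate also
  holds when the right side is infinite.\<close>

theorem window_change:
  fixes \<psi> \<phi> :: "'a::euclidean_space \<Rightarrow> complex"
  assumes \<psi>: "\<psi> \<in> schwartz_space" and \<phi>: "\<phi> \<in> schwartz_space" "\<phi> \<noteq> (\<lambda>_. 0)"
    and r: "1 \<le> r" and s: "1 \<le> s"
  obtains C :: real where "C \<ge> 0" "\<And>f. f \<in> tempered_distributions \<Longrightarrow>
    mixed_norm r s lborel (\<lambda>y \<eta>. f (tf y \<eta> \<psi>)) \<le> ennreal C * mixed_norm r s lborel (\<lambda>y \<eta>. f (tf y \<eta> \<phi>))"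
proof -
  define k where "k = (2 * pi) ^ DIM('a) * (LINT x|lborel. (norm (\<phi> x))\<^sup>2)"
  have k: "k > 0" unfolding k_def using schwartz_norm_square_integral_pos(2)[OF \<phi>] by simp
  define \<theta> where "\<theta> = (\<lambda>z. norm (tf_coeff \<psi> \<phi> z) / k)"
  have \<theta>m: "\<theta> \<in> borel_measurable borel"
    unfolding \<theta>_def using borel_measurable_continuous_onI[OF tf_coeff_continuous[OF \<psi> \<phi>(1)]] by measurable
  have "integrable lborel (\<lambda>z. tf_coeff \<psi> \<phi> z * 1)"
    by (rule tf_coeff_mult_integrable[OF \<psi> \<phi>(1), where D = 1 and k = 0]) auto
  then have \<theta>i: "integrable lborel \<theta>" unfolding \<theta>_def by (intro integrable_divide integrable_norm) simp
  have \<theta>0: "\<theta> z \<ge> 0" for z using k by (simp add: \<theta>_def)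
  define C where "C = (LINT z|lborel. \<theta> z)"
  have C: "(\<integral>\<^sup>+z. ennreal (\<theta> z) \<partial>lborel) = ennreal C" "C \<ge> 0"
    unfolding C_def using \<theta>i \<theta>0 by (auto intro!: nn_integral_eq_integral integral_nonneg_AE)
  have "mixed_norm r s lborel (\<lambda>y \<eta>. f (tf y \<eta> \<psi>)) \<le> ennreal C * mixed_norm r s lborel (\<lambda>y \<eta>. f (tf y \<eta> \<phi>))"
    if f: "f \<in> tempered_distributions" for f
    unfolding C(1)[symmetric]
  proof (rule mixed_norm_convolution_le)
    show "(\<lambda>p. f (tf (fst p) (snd p) \<phi>)) \<in> borel_measurable borel"
      using tempered_tf_continuous[OF f \<phi>(1)] by (rule borel_measurable_continuous_onI)
    show "(\<lambda>p. f (tf (fst p) (snd p) \<psi>)) \<in> borel_measurable borel"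
      using tempered_tf_continuous[OF f \<psi>] by (rule borel_measurable_continuous_onI)
    fix X Y :: 'a
    let ?c = "tf_coeff (tf X Y \<psi>) \<phi>"
    let ?u = "\<lambda>z. ?c z * f (tf (fst z) (snd z) \<phi>)"
    have um: "?u \<in> borel_measurable borel"
      using borel_measurable_continuous_onI[OF tf_coeff_continuous[OF schwartz_tf[OF \<psi>] \<phi>(1)]]
        borel_measurable_continuous_onI[OF tempered_tf_continuous[OF f \<phi>(1)]] by measurable
    have "ennreal (norm (of_real k * f (tf X Y \<psi>))) = ennreal (norm (LINT z|lborel. ?u z))"
      unfolding k_def tempered_tf_reconstruction[OF f schwartz_tf[OF \<psi>] \<phi>(1)] ..
    \<comment> \<open>In the non-integrable case the Bochner integral is zero by convention and the
      bound is trivial.\<close>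
    also have "\<dots> \<le> (\<integral>\<^sup>+z. ennreal (norm (?u z)) \<partial>lborel)"
      by (cases "integrable lborel ?u") (auto intro: integral_norm_bound_ennreal simp: not_integrable_integral_eq)
    also have "\<dots> = (\<integral>\<^sup>+z. ennreal (norm (?u (z + (X, Y)))) \<partial>lborel)"
      by (rule nn_integral_lborel_translate[symmetric], rule measurable_compose[OF um, of "\<lambda>c. ennreal (norm c)"]) measurable
    also have "\<dots> = (\<integral>\<^sup>+z. ennreal k * (ennreal (\<theta> z) * ennreal (norm (f (tf (X + fst z) (Y + snd z) \<phi>)))) \<partial>lborel)"
    proof (rule nn_integral_cong)
      fix z :: "'a \<times> 'a"
      have "?c (z + (X, Y)) = ?c (fst z + X, snd z + Y)" by (simp add: plus_prod_def)
      then have "norm (?c (z + (X, Y))) = k * \<theta> z"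
        using norm_tf_coeff_tf[OF \<psi> \<phi>(1), of X Y "fst z" "snd z"] k by (simp add: \<theta>_def)
      then show "ennreal (norm (?u (z + (X, Y)))) = ennreal k * (ennreal (\<theta> z) * ennreal (norm (f (tf (X + fst z) (Y + snd z) \<phi>))))"
        using k \<theta>0 by (simp add: norm_mult ennreal_mult add.commute mult.assoc)
    qed
    also have "\<dots> = ennreal k * (\<integral>\<^sup>+z. ennreal (\<theta> z) * ennreal (norm (f (tf (X + fst z) (Y + snd z) \<phi>))) \<partial>lborel)"
    proof (rule nn_integral_cmult)
      have "(\<lambda>z. f (tf (fst (z + (X, Y))) (snd (z + (X, Y))) \<phi>)) \<in> borel_measurable borel"
        using borel_measurable_continuous_onI[OF tempered_tf_continuous[OF f \<phi>(1)]] by measurable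
      then show "(\<lambda>z. ennreal (\<theta> z) * ennreal (norm (f (tf (X + fst z) (Y + snd z) \<phi>)))) \<in> borel_measurable lborel"
        using \<theta>m by (simp add: add.commute)
    qed
    finally have "ennreal k * ennreal (norm (f (tf X Y \<psi>))) \<le> ennreal k * (\<integral>\<^sup>+z. ennreal (\<theta> z) * ennreal (norm (f (tf (X + fst z) (Y + snd z) \<phi>))) \<partial>lborel)"
      using k by (simp add: norm_mult ennreal_mult)
    then show "ennreal (norm (f (tf X Y \<psi>))) \<le> (\<integral>\<^sup>+z. ennreal (\<theta> z) * ennreal (norm (f (tf (X + fst z) (Y + snd z) \<phi>))) \<partial>lborel)"
      using k by (subst (asm) ennreal_mult_le_mult_iff) auto
  qed (use \<theta>m \<theta>0 r s in auto)
  then show ?thesis using that C(2) by blast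
qed

section \<open>The coadjoint orbit\<close>

text \<open>An index type with \<open>DIM('a)\<close> elements turns \<open>form_det\<close> into the determinant of a matrix.\<close>

typedef (overloaded) 'a basis_index = "Basis :: 'a::euclidean_space set"
  by (rule nonempty_Basis[unfolded ex_in_conv[symmetric]])

instance basis_index :: (euclidean_space) finite
proof
  have "(UNIV :: 'a basis_index set) = Abs_basis_index ` Basis"
    by (rule type_definition.Abs_image[OF type_definition_basis_index, symmetric])
  then show "finite (UNIV :: 'a basis_index set)" by (metis finite_Basis finite_imageI)
qed

lemma bij_Rep_basis_index: "bij_betw (Rep_basis_index :: 'a::euclidean_space basis_index \<Rightarrow> 'a) UNIV Basis"
  unfolding bij_betw_def
  using type_definition.Rep_range[OF type_definition_basis_index] by (auto simp: inj_on_def Rep_basis_index_inject)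

lemma bij_Abs_basis_index: "bij_betw (Abs_basis_index :: 'a::euclidean_space \<Rightarrow> 'a basis_index) Basis UNIV"
  unfolding bij_betw_def
  using type_definition.Abs_image[OF type_definition_basis_index] by (auto simp: inj_on_def Abs_basis_index_inject)

text \<open>Permutations of \<open>Basis\<close> are transported along the bijection with the index
  type; signs are preserved and the products are reindexed.\<close>

lemma form_det_eq_det:
  fixes \<beta> :: "'a::euclidean_space \<Rightarrow> 'a \<Rightarrow> real"
  shows "form_det \<beta> = det (\<chi> i j :: 'a basis_index. \<beta> (Rep_basis_index i) (Rep_basis_index j))"
proof -
  let ?R = "Rep_basis_index :: 'a basis_index \<Rightarrow> 'a" and ?A = "Abs_basis_index :: 'a \<Rightarrow> 'a basis_index"
  note R = bij_Rep_basis_index[where 'a='a] and A = bij_Abs_basis_index[where 'a='a]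
  show ?thesis
    unfolding form_det_def det_def
  proof (rule sum.reindex_bij_witness[of _ "map_permutation UNIV ?R" "map_permutation Basis ?A"])
    fix \<sigma> :: "'a \<Rightarrow> 'a" assume "\<sigma> \<in> {\<sigma>. \<sigma> permutes Basis}"
    then have s: "\<sigma> permutes Basis" by simp
    have "map_permutation UNIV ?R (map_permutation Basis ?A \<sigma>) = map_permutation Basis (?R \<circ> ?A) \<sigma>"
      by (rule map_permutation_compose[OF A bij_betw_imp_inj_on[OF R]])
    also have "\<dots> = map_permutation Basis id \<sigma>"
      by (rule map_permutation_cong) (auto simp: s Abs_basis_index_inverse inj_on_def)
    finally show "map_permutation UNIV ?R (map_permutation Basis ?A \<sigma>) = \<sigma>" using s by simp
    show "map_permutation Basis ?A \<sigma> \<in> {p. p permutes UNIV}"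
      using map_permutation_permutes[OF A s] by simp
    have app: "map_permutation Basis ?A \<sigma> (?A b) = ?A (\<sigma> b)" if "b \<in> Basis" for b
      by (rule map_permutation_apply) (use A s that in \<open>auto simp: bij_betw_def\<close>)
    have "(\<Prod>i\<in>UNIV. (\<chi> i j :: 'a basis_index. \<beta> (?R i) (?R j)) $ i $ map_permutation Basis ?A \<sigma> i)
        = (\<Prod>b\<in>Basis. (\<chi> i j :: 'a basis_index. \<beta> (?R i) (?R j)) $ (?A b) $ map_permutation Basis ?A \<sigma> (?A b))"
      by (rule prod.reindex_bij_betw[OF A, symmetric])
    also have "\<dots> = (\<Prod>b\<in>Basis. \<beta> b (\<sigma> b))"
      using permutes_in_image[OF s] by (intro prod.cong) (auto simp: app Abs_basis_index_inverse)
    finally show "of_int (sign (map_permutation Basis ?A \<sigma>)) * (\<Prod>i\<in>UNIV. (\<chi> i j :: 'a basis_index. \<beta> (?R i) (?R j)) $ i $ map_permutation Basis ?A \<sigma> i)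
        = of_int (sign \<sigma>) * (\<Prod>b\<in>Basis. \<beta> b (\<sigma> b))"
      using A s by (simp add: sign_map_permutation bij_betw_def)
  next
    fix p :: "'a basis_index \<Rightarrow> 'a basis_index" assume "p \<in> {p. p permutes UNIV}"
    then have p: "p permutes UNIV" by simp
    have "map_permutation Basis ?A (map_permutation UNIV ?R p) = map_permutation UNIV (?A \<circ> ?R) p"
      by (rule map_permutation_compose[OF R bij_betw_imp_inj_on[OF A]])
    also have "?A \<circ> ?R = id" by (auto simp: Rep_basis_index_inverse)
    finally show "map_permutation Basis ?A (map_permutation UNIV ?R p) = p" using p by simp
    show "map_permutation UNIV ?R p \<in> {\<sigma>. \<sigma> permutes Basis}"
      using map_permutation_permutes[OF R p] by simp
  qed
qed

text \<open>A kernel vector of the matrix, read as coordinates of some \<open>w\<close>, makes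
  \<open>N w\<close> orthogonal to the whole basis; injectivity then gives
  \<open>w = 0\<close>.\<close>

lemma form_det_nonzero:
  fixes N :: "'a::euclidean_space \<Rightarrow> 'a"
  assumes "linear N" "inj N"
  shows "form_det (\<lambda>u v. u \<bullet> N v) \<noteq> 0"
proof -
  let ?R = "Rep_basis_index :: 'a basis_index \<Rightarrow> 'a"
  let ?M = "\<chi> i j :: 'a basis_index. ?R i \<bullet> N (?R j)"
  have "x = 0" if x: "?M *v x = 0" for x
  proof -
    define w where "w = (\<Sum>j\<in>UNIV. (x $ j) *\<^sub>R ?R j)"
    have "?R i \<bullet> N w = (?M *v x) $ i" for i
      unfolding w_def linear_sum[OF assms(1)] linear_scale[OF assms(1)] inner_sum_right inner_scaleR_right
      by (simp add: matrix_vector_mult_def mult.commute)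
    then have R0: "?R i \<bullet> N w = 0" for i using x by simp
    have "N w = 0"
    proof (rule euclidean_eqI)
      fix b :: 'a assume "b \<in> Basis"
      then show "N w \<bullet> b = 0 \<bullet> b" using R0[of "Abs_basis_index b"] by (simp add: Abs_basis_index_inverse inner_commute)
    qed
    then have w0: "w = 0" using assms by (metis injD linear_0)
    have "x $ i = 0" for i
    proof -
      have "w \<bullet> ?R i = (\<Sum>j\<in>UNIV. (x $ j) * (?R j \<bullet> ?R i))"
        by (simp add: w_def inner_sum_left)
      also have "\<dots> = (\<Sum>j\<in>UNIV. if j = i then x $ j else 0)"
        by (intro sum.cong) (auto simp: inner_Basis Rep_basis_index Rep_basis_index_inject)
      finally show ?thesis using w0 by simp
    qed
    then show ?thesis by (simp add: vec_eq_iff)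
  qed
  then have "invertible ?M"
    unfolding invertible_left_inverse matrix_left_invertible_ker by blast
  then show ?thesis by (simp add: form_det_eq_det invertible_det_nz)
qed

section \<open>Coordinates on the orbit\<close>

lemma functional_xi0: "blinfun_apply (functional_of (xi0 :: 'v::euclidean_space orbit)) X = snd (snd X)"
proof -
  have bl: "bounded_linear (\<lambda>X::'v heis. snd (snd X))"
    by (intro bounded_linear_compose[OF bounded_linear_snd bounded_linear_snd])
  then have "functional_of (xi0 :: 'v orbit) = Blinfun (\<lambda>X. snd (snd X))"
    unfolding xi0_def by (intro Abs_orbit_inverse) (simp add: bounded_linear_Blinfun_apply)
  then show ?thesis using bl by (simp add: bounded_linear_Blinfun_apply)
qed

lemma bounded_linear_covector: "bounded_linear (\<lambda>(q, p, t :: real). (y :: 'v::euclidean_space \<times> 'v) \<bullet> (q, p))"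
proof -
  have "linear (\<lambda>(q, p, t :: real). y \<bullet> (q, p))"
    by (rule linearI) (auto simp: inner_Pair_0 inner_prod_def inner_add_right algebra_simps)
  then show ?thesis by (simp add: linear_conv_bounded_linear)
qed

lemma covector_apply: "blinfun_apply (covector y) X = y \<bullet> (fst X, fst (snd X))"
  unfolding covector_def bounded_linear_Blinfun_apply[OF bounded_linear_covector] by (simp add: case_prod_unfold)

lemma functional_chart: "blinfun_apply (functional_of (chart y)) X = snd (snd X) + y \<bullet> (fst X, fst (snd X))"
proof -
  have "functional_of (chart y) = functional_of xi0 + covector y"
    unfolding chart_def by (rule Abs_orbit_inverse)
      (simp add: plus_blinfun.rep_eq functional_xi0 covector_apply zero_prod_def[symmetric])
  then show ?thesis by (simp add: plus_blinfun.rep_eq functional_xi0 covector_apply)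
qed

lemma pairing_chart: "pairing (chart y) (predual_vec X) = y \<bullet> X"
  by (simp add: pairing_def functional_chart predual_vec_def)

lemma pairing_central: "pairing (\<xi> :: 'v::euclidean_space orbit) (0, 0, s) = s"
proof -
  have "(0, 0, s) = s *\<^sub>R ((0, 0, 1) :: 'v heis)" by simp
  then have "pairing \<xi> (0, 0, s) = s * blinfun_apply (functional_of \<xi>) (0, 0, 1)"
    unfolding pairing_def by (simp only: blinfun.scaleR_right real_scaleR_def)
  then show ?thesis using functional_of[of \<xi>] by simp
qed

lemma inj_chart: "inj (chart :: 'v::euclidean_space \<times> 'v \<Rightarrow> 'v orbit)"
proof (rule injI)
  fix y y' :: "'v \<times> 'v" assume "chart y = chart y'"
  then have "y \<bullet> X = y' \<bullet> X" for X using pairing_chart by metis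
  then show "y = y'" by (metis vector_eq_rdot)
qed

lemma surj_chart: "surj (chart :: 'v::euclidean_space \<times> 'v \<Rightarrow> 'v orbit)"
proof (rule surjI)
  fix \<xi> :: "'v orbit"
  define l where "l = (\<lambda>V::'v \<times> 'v. blinfun_apply (functional_of \<xi>) (fst V, snd V, 0))"
  have l: "linear l"
  proof (rule linearI)
    show "l (V + W) = l V + l W" for V W
      unfolding l_def blinfun.add_right[symmetric] by simp
    show "l (c *\<^sub>R V) = c *\<^sub>R l V" for c V
      unfolding l_def blinfun.scaleR_right[symmetric] by simp
  qed
  \<comment> \<open>The vector representing the restriction of the functional to the predual. On the
    center all functionals of the orbit agree, so nothing else has to be matched.\<close>
  define y where "y = (\<Sum>b\<in>Basis. l b *\<^sub>R b)"
  have ly: "y \<bullet> V = l V" for V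
  proof -
    have "l V = l (\<Sum>b\<in>Basis. (V \<bullet> b) *\<^sub>R b)" by (simp add: euclidean_representation)
    also have "\<dots> = (\<Sum>b\<in>Basis. (V \<bullet> b) * l b)" by (simp add: linear_sum[OF l] linear_scale[OF l])
    also have "\<dots> = y \<bullet> V" unfolding y_def inner_sum_left inner_scaleR_left by (simp add: inner_commute mult.commute)
    finally show ?thesis by simp
  qed
  have "functional_of (chart y) = functional_of \<xi>"
  proof (rule blinfun_eqI)
    fix X :: "'v heis"
    obtain q p t where X: "X = (q, p, t)" by (cases X)
    have "blinfun_apply (functional_of \<xi>) X = blinfun_apply (functional_of \<xi>) ((q, p, 0) + (0, 0, t))" by (simp add: X)
    also have "\<dots> = l (q, p) + pairing \<xi> (0, 0, t)" unfolding blinfun.add_right by (simp add: l_def pairing_def)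
    finally show "blinfun_apply (functional_of (chart y)) X = blinfun_apply (functional_of \<xi>) X"
      by (simp add: functional_chart X ly pairing_central)
  qed
  then show "chart (SOME y. chart y = \<xi>) = \<xi>" by (metis (mono_tags) functional_of_inject someI)
qed

lemma inv_chart [simp]: "inv_into UNIV chart (chart y) = y"
  by (simp add: inj_chart)

lemma chart_inv [simp]: "chart (inv_into UNIV chart \<xi>) = \<xi>"
  by (simp add: surj_chart surj_f_inv_f)

lemma scale_measure_eq_density: "scale_measure (ennreal k) lborel = density lborel (\<lambda>_. ennreal k)"
  by (rule measure_eqI) (auto simp: emeasure_density_const)

lemma L2_measurable: "f \<in> L2_functions \<Longrightarrow> f \<in> borel_measurable borel"
  by (simp add: L2_functions_def)

text \<open>The elementary bound of a product by the sum of squares takes the place of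
  Cauchy-Schwarz: it involves no roots and does not change when \<open>f\<close> is replaced by a
  unitary translate.\<close>

lemma L2_mult_integrable:
  fixes f g :: "'a::euclidean_space \<Rightarrow> complex"
  assumes f: "f \<in> L2_functions" and g: "g \<in> L2_functions"
  shows "integrable lborel (\<lambda>x. f x * cnj (g x))"
    and "(LINT x|lborel. norm (f x * cnj (g x))) \<le> (LINT x|lborel. (norm (f x))\<^sup>2) + (LINT x|lborel. (norm (g x))\<^sup>2)"
proof -
  note [measurable] = L2_measurable[OF f] L2_measurable[OF g]
  have i: "integrable lborel (\<lambda>x. (norm (f x))\<^sup>2)" "integrable lborel (\<lambda>x. (norm (g x))\<^sup>2)"
    using f g by (auto simp: L2_functions_def)
  have le: "norm (f x * cnj (g x)) \<le> (norm (f x))\<^sup>2 + (norm (g x))\<^sup>2" for x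
  proof -
    have "0 \<le> norm (f x) * norm (g x)" by simp
    then show ?thesis using sum_squares_bound[of "norm (f x)" "norm (g x)"]
      unfolding norm_mult complex_mod_cnj by linarith
  qed
  show I: "integrable lborel (\<lambda>x. f x * cnj (g x))"
    by (rule Bochner_Integration.integrable_bound[OF Bochner_Integration.integrable_add[OF i]]) (use le in auto)
  have "(LINT x|lborel. norm (f x * cnj (g x))) \<le> (LINT x|lborel. (norm (f x))\<^sup>2 + (norm (g x))\<^sup>2)"
    by (rule integral_mono[OF integrable_norm[OF I] Bochner_Integration.integrable_add[OF i]]) (rule le)
  then show "(LINT x|lborel. norm (f x * cnj (g x))) \<le> (LINT x|lborel. (norm (f x))\<^sup>2) + (LINT x|lborel. (norm (g x))\<^sup>2)"
    by (simp add: Bochner_Integration.integral_add[OF i])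
qed

lemma gauss_L2: "(\<lambda>x::'a::euclidean_space. complex_of_real (gauss x)) \<in> L2_functions"
proof -
  have "integrable lborel (\<lambda>x::'a. (gauss x)\<^sup>2)"
    by (rule Bochner_Integration.integrable_bound[OF gauss_integrable])
      (auto simp: power2_eq_square intro!: mult_left_le less_imp_le)
  then show ?thesis by (simp add: L2_functions_def)
qed

context
  fixes B :: "'v::euclidean_space \<Rightarrow> 'v \<Rightarrow> real"
  assumes bilin: "bilinear B" and nondeg: "nondegenerate B"
begin

section \<open>Symplectic form, Liouville measure and predual measure\<close>

lemma omega_eq: "omega B V W = B (snd W) (fst V) - B (snd V) (fst W)"
  unfolding omega_def predual_vec_def heis_bracket_def by (simp add: pairing_central)

lemmas B_simps = bilinear_ladd[OF bilin] bilinear_radd[OF bilin] bilinear_lmul[OF bilin] bilinear_rmul[OF bilin]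
  bilinear_lneg[OF bilin] bilinear_rneg[OF bilin] bilinear_lsub[OF bilin] bilinear_rsub[OF bilin]
  bilinear_lzero[OF bilin] bilinear_rzero[OF bilin]

definition symp :: "'v \<times> 'v \<Rightarrow> 'v \<times> 'v" where
  "symp V = (\<Sum>b\<in>Basis. omega B V b *\<^sub>R b)"

lemma omega_simps:
  "omega B (V + V') W = omega B V W + omega B V' W" "omega B V (W + W') = omega B V W + omega B V W'"
  "omega B (c *\<^sub>R V) W = c * omega B V W" "omega B V (c *\<^sub>R W) = c * omega B V W"
  "omega B (- V) W = - omega B V W" "omega B V (- W) = - omega B V W"
  "omega B (V - V') W = omega B V W - omega B V' W" "omega B V (W - W') = omega B V W - omega B V W'"
  by (simp_all add: omega_eq B_simps algebra_simps)

lemma omega_skew: "omega B V W = - omega B W V"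
  by (simp add: omega_eq)

lemma symp_inner: "symp V \<bullet> W = omega B V W"
proof -
  have l: "linear (omega B V)" by (rule linearI) (simp_all add: omega_simps)
  have "omega B V W = omega B V (\<Sum>b\<in>Basis. (W \<bullet> b) *\<^sub>R b)" by (simp add: euclidean_representation)
  also have "\<dots> = (\<Sum>b\<in>Basis. (W \<bullet> b) * omega B V b)" by (simp add: linear_sum[OF l] linear_scale[OF l])
  also have "\<dots> = symp V \<bullet> W" unfolding symp_def inner_sum_left inner_scaleR_left by (simp add: inner_commute mult.commute)
  finally show ?thesis by simp
qed

lemma linear_symp: "linear symp"
  by (rule linearI; rule vector_eq_rdot[THEN iffD1]) (simp_all add: symp_inner inner_add_left omega_simps)

lemma bij_symp: "bij symp"
proof -
  have "V = 0" if "symp V = 0" for V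
  proof -
    have 0: "omega B V W = 0" for W using that symp_inner[of V W] by simp
    have "B p (fst V) = 0" for p using 0[of "(0, p)"] by (simp add: omega_eq B_simps)
    moreover have "B (snd V) q = 0" for q using 0[of "(q, 0)"] by (simp add: omega_eq B_simps)
    ultimately have "fst V = 0" "snd V = 0" using nondeg unfolding nondegenerate_def by blast+
    then show ?thesis by (simp add: prod_eq_iff)
  qed
  then have "inj symp" using linear_symp by (simp add: linear_injective_0)
  then show ?thesis using linear_symp by (simp add: bij_def linear_injective_imp_surjective)
qed

lemma orbit_map_eq: "orbit_map B V = chart (symp V)"
proof -
  have "(\<lambda>Z. pairing xi0 (heis_bracket B (predual_vec V) Z)) = (\<lambda>(q, p, t). symp V \<bullet> (q, p))"
    by (auto simp: fun_eq_iff symp_inner omega_eq heis_bracket_def predual_vec_def pairing_central)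
  then show ?thesis by (simp add: orbit_map_def chart_def covector_def)
qed

text \<open>On tangent vectors, \<open>ad X\<close> only sees the part of \<open>X\<close> off the
  center, and there the functional is the covector \<open>symp X\<close>. So \<open>X\<close> and
  \<open>Y\<close> are determined modulo the center, which the bracket ignores, and the description
  is well defined. The result does not depend on the base point.\<close>

lemma kks_form_eq:
  "kks_form B (chart y) (covector u) (covector v) = u \<bullet> inv_into UNIV symp v"
proof -
  let ?N = "inv_into UNIV symp"
  have N: "symp (?N v) = v" for v using bij_symp by (simp add: bij_is_surj surj_f_inv_f)
  have br: "pairing (chart y) (heis_bracket B X Z) = omega B (fst X, fst (snd X)) (fst Z, fst (snd Z))" for X Z
    by (simp add: heis_bracket_def case_prod_unfold pairing_central omega_eq)
  have iff: "(\<forall>Z. blinfun_apply (covector w) Z = pairing (chart y) (heis_bracket B X Z)) \<longleftrightarrow> w = symp (fst X, fst (snd X))" for w X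
  proof
    assume a: "\<forall>Z. blinfun_apply (covector w) Z = pairing (chart y) (heis_bracket B X Z)"
    have "w \<bullet> W = symp (fst X, fst (snd X)) \<bullet> W" for W
      using a[rule_format, of "(fst W, snd W, 0)"] by (simp add: covector_apply br symp_inner)
    then show "w = symp (fst X, fst (snd X))" by (metis vector_eq_rdot)
  qed (simp add: covector_apply br symp_inner)
  show ?thesis
    unfolding kks_form_def iff unfolding br
  proof (rule the_equality)
    show "\<exists>(X :: 'v heis) (Y :: 'v heis). u = symp (fst X, fst (snd X)) \<and> v = symp (fst Y, fst (snd Y)) \<and>
        u \<bullet> ?N v = omega B (fst X, fst (snd X)) (fst Y, fst (snd Y))"
      by (rule exI[of _ "(fst (?N u), snd (?N u), 0::real)"], rule exI[of _ "(fst (?N v), snd (?N v), 0::real)"])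
        (simp add: N flip: symp_inner)
  next
    fix c assume "\<exists>(X :: 'v heis) (Y :: 'v heis). u = symp (fst X, fst (snd X)) \<and> v = symp (fst Y, fst (snd Y)) \<and>
        c = omega B (fst X, fst (snd X)) (fst Y, fst (snd Y))"
    then obtain X Y :: "'v heis" where u: "u = symp (fst X, fst (snd X))" and v: "v = symp (fst Y, fst (snd Y))"
      and c: "c = omega B (fst X, fst (snd X)) (fst Y, fst (snd Y))" by blast
    have "?N v = (fst Y, fst (snd Y))" unfolding v using bij_symp by (simp add: bij_is_inj)
    then show "c = u \<bullet> ?N v" by (simp add: c u symp_inner)
  qed
qed

text \<open>The form is constant in the chart, so the Liouville measure is this multiple of Lebesgue
  measure. Only its positivity enters the comparison of norms.\<close>

definition liouville_density :: real where
  "liouville_density = sqrt \<bar>form_det (\<lambda>u v. u \<bullet> inv_into UNIV symp v)\<bar> / (2 * pi) ^ DIM('v)"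

lemma liouville_density_pos: "liouville_density > 0"
proof -
  have "form_det (\<lambda>u v. u \<bullet> inv_into UNIV symp v) \<noteq> 0"
    using bij_symp linear_symp
    by (intro form_det_nonzero) (auto simp: inj_linear_imp_inv_linear bij_is_inj bij_imp_bij_inv)
  then show ?thesis by (simp add: liouville_density_def)
qed

lemma integral_liouville:
  fixes g :: "'v orbit \<Rightarrow> 'b::{banach, second_countable_topology}"
  assumes [measurable]: "(\<lambda>y. g (chart y)) \<in> borel_measurable borel"
  shows "(LINT \<xi>|liouville B. g \<xi>) = liouville_density *\<^sub>R (LINT y|lborel. g (chart y))"
proof -
  let ?D = "density lborel (\<lambda>y::'v \<times> 'v. ennreal liouville_density)"
  have L: "liouville B = embed_measure ?D chart"
    unfolding liouville_def kks_form_eq liouville_density_def ..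
  have m: "g \<in> borel_measurable (embed_measure ?D chart)"
    by (rule measurable_embed_measure1) simp
  have "(LINT \<xi>|liouville B. g \<xi>) = (LINT \<xi>|distr ?D (embed_measure ?D chart) chart. g \<xi>)"
    unfolding L using embed_measure_eq_distr[OF inj_chart] by metis
  also have "\<dots> = (LINT y|?D. g (chart y))"
    by (rule integral_distr[OF _ m]) (rule measurable_embed_measure2[OF inj_chart])
  also have "\<dots> = (LINT y|lborel. liouville_density *\<^sub>R g (chart y))"
    using liouville_density_pos by (intro integral_density) auto
  finally show ?thesis by simp
qed

lemma orbit_fourier_eq:
  assumes "(\<lambda>y. a (chart y)) \<in> borel_measurable borel"
  shows "orbit_fourier B a X = of_real liouville_density * fourier (\<lambda>y. a (chart y)) X"
proof -
  note [measurable] = assms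
  have "orbit_fourier B a X = liouville_density *\<^sub>R (LINT y|lborel. cis (- pairing (chart y) (predual_vec X)) * a (chart y))"
    unfolding orbit_fourier_def
    by (rule integral_liouville) (simp add: pairing_chart)
  then show ?thesis
    by (simp add: pairing_chart fourier_def scaleR_conv_of_real inner_commute mult.commute)
qed

lemma schwartz_orbit_iff: "a \<in> schwartz_orbit \<longleftrightarrow> (\<lambda>y. a (chart y)) \<in> schwartz_space"
  by (simp add: schwartz_orbit_def o_def)

text \<open>Plancherel shows that some normalization makes the Fourier transform unitary; the
  nonzero symbol \<open>\<Phi>\<close>, having positive norm, shows that it is the only one.\<close>

lemma predual_measure_eq:
  fixes \<Phi> :: "'v orbit \<Rightarrow> complex"
  assumes \<Phi>: "\<Phi> \<in> schwartz_orbit" "\<Phi> \<noteq> (\<lambda>_. 0)"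
  obtains k where "k > 0" "predual_measure B = scale_measure (ennreal k) lborel"
proof -
  let ?P = "\<lambda>k::real. 0 < k \<and> (\<forall>a \<in> schwartz_orbit.
        (LINT \<xi>|liouville B. (norm (a \<xi>))\<^sup>2) = k * (LINT X|lborel. (norm (orbit_fourier B a X))\<^sup>2))"
  define c where "c = liouville_density"
  \<comment> \<open>Solves \<open>c * I = k * c^2 * (2 pi)^n * I\<close>: the density
    \<open>c\<close> occurs once in the norm on the orbit and squared in the norm of the
    transform.\<close>
  define k where "k = 1 / (c * (2 * pi) ^ DIM('v \<times> 'v))"
  have c: "c > 0" using liouville_density_pos by (simp add: c_def)
  have k0: "k > 0" using c by (simp add: k_def)
  have eq: "(LINT \<xi>|liouville B. (norm (a \<xi>))\<^sup>2) = c * (LINT y|lborel. (norm (a (chart y)))\<^sup>2)"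
    "(LINT X|lborel. (norm (orbit_fourier B a X))\<^sup>2) = c\<^sup>2 * ((2 * pi) ^ DIM('v \<times> 'v) * (LINT y|lborel. (norm (a (chart y)))\<^sup>2))"
    if a: "a \<in> schwartz_orbit" for a :: "'v orbit \<Rightarrow> complex"
  proof -
    have S: "(\<lambda>y. a (chart y)) \<in> schwartz_space" using a by (simp add: schwartz_orbit_iff)
    note [measurable] = schwartz_measurable[OF S]
    show "(LINT \<xi>|liouville B. (norm (a \<xi>))\<^sup>2) = c * (LINT y|lborel. (norm (a (chart y)))\<^sup>2)"
      by (subst integral_liouville) (auto simp: c_def)
    show "(LINT X|lborel. (norm (orbit_fourier B a X))\<^sup>2) = c\<^sup>2 * ((2 * pi) ^ DIM('v \<times> 'v) * (LINT y|lborel. (norm (a (chart y)))\<^sup>2))"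
      unfolding orbit_fourier_eq[OF schwartz_measurable[OF S]] norm_mult power_mult_distrib integral_mult_right_zero
        schwartz_plancherel[OF S] by (simp add: c_def)
  qed
  have Pk: "?P k"
  proof (intro conjI ballI k0)
    fix a :: "'v orbit \<Rightarrow> complex" assume a: "a \<in> schwartz_orbit"
    show "(LINT \<xi>|liouville B. (norm (a \<xi>))\<^sup>2) = k * (LINT X|lborel. (norm (orbit_fourier B a X))\<^sup>2)"
      unfolding eq[OF a] using c by (simp add: k_def power2_eq_square)
  qed
  have uniq: "k' = k" if "?P k'" for k'
  proof -
    define I where "I = (LINT X|lborel. (norm (orbit_fourier B \<Phi> X))\<^sup>2)"
    have S: "(\<lambda>y. \<Phi> (chart y)) \<in> schwartz_space" using \<Phi> by (simp add: schwartz_orbit_iff)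
    have "(\<lambda>y. \<Phi> (chart y)) \<noteq> (\<lambda>_. 0)"
    proof
      assume a: "(\<lambda>y. \<Phi> (chart y)) = (\<lambda>_. 0)"
      have "\<Phi> \<xi> = 0" for \<xi> using fun_cong[OF a, of "inv_into UNIV chart \<xi>"] by simp
      then show False using \<Phi>(2) by auto
    qed
    from schwartz_norm_square_integral_pos(2)[OF S this] have "I > 0"
      unfolding I_def eq(2)[OF \<Phi>(1)] using c by simp
    moreover have "k' * I = k * I" using that Pk \<Phi>(1) unfolding I_def by metis
    ultimately show ?thesis by simp
  qed
  have "(THE k. ?P k) = k" using Pk uniq by (rule the_equality)
  then show ?thesis using that[OF k0] unfolding predual_measure_def by simp
qed

section \<open>The Weyl calculus\<close>

lemma heis_mult: "X \<otimes>\<^bsub>heis_group B\<^esub> Y = X + Y + (1/2) *\<^sub>R heis_bracket B X Y"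
  by (simp add: heis_group_def)

lemma heis_inv: "inv\<^bsub>heis_group B\<^esub> X = - X"
  unfolding m_inv_def
proof (rule the_equality)
  show "- X \<in> carrier (heis_group B) \<and> X \<otimes>\<^bsub>heis_group B\<^esub> - X = \<one>\<^bsub>heis_group B\<^esub> \<and> - X \<otimes>\<^bsub>heis_group B\<^esub> X = \<one>\<^bsub>heis_group B\<^esub>"
    by (simp add: heis_group_def heis_bracket_def case_prod_unfold B_simps zero_prod_def)
next
  fix Y assume "Y \<in> carrier (heis_group B) \<and> X \<otimes>\<^bsub>heis_group B\<^esub> Y = \<one>\<^bsub>heis_group B\<^esub> \<and> Y \<otimes>\<^bsub>heis_group B\<^esub> X = \<one>\<^bsub>heis_group B\<^esub>"
  then have e: "X + Y + (1/2) *\<^sub>R heis_bracket B X Y = (0, 0, 0)"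
    by (simp add: heis_group_def)
  obtain q p t where X: "X = (q, p, t)" by (cases X)
  obtain q' p' t' where Y: "Y = (q', p', t')" by (cases Y)
  have "q' = - q" "p' = - p" using e by (auto simp: X Y heis_bracket_def add_eq_0_iff)
  then show "Y = - X" using e by (simp add: X Y heis_bracket_def B_simps)
qed

text \<open>\<open>pi_sharp\<close> uses the pair only through its first component and the product,
  so the second component can stay abstract. The product is the exponential of \<open>X + Y\<close>
  without a central correction.\<close>

lemma exp_semidirect_eq:
  obtains h where "exp_semidirect B (predual_vec X) (predual_vec Y) = (predual_vec X, h)"
    "predual_vec X \<otimes>\<^bsub>heis_group B\<^esub> h = predual_vec (X + Y)"
proof -
  have "predual_vec X \<otimes>\<^bsub>heis_group B\<^esub> (- predual_vec X \<otimes>\<^bsub>heis_group B\<^esub> (predual_vec X + predual_vec Y)) = predual_vec (X + Y)"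
    by (simp add: heis_mult heis_bracket_def predual_vec_def B_simps algebra_simps)
  then show ?thesis using that unfolding exp_semidirect_def heis_inv by blast
qed

lemma inv_predual_vec: "inv\<^bsub>heis_group B\<^esub> (predual_vec X) = predual_vec (- X)"
  by (simp add: heis_inv predual_vec_def)

abbreviation \<pi>\<^sub>S :: "'v \<times> 'v \<Rightarrow> ('v \<Rightarrow> complex) \<Rightarrow> 'v \<Rightarrow> complex" where
  "\<pi>\<^sub>S Z \<equiv> schroedinger B (predual_vec Z)"

lemma \<pi>\<^sub>S_eq: "\<pi>\<^sub>S Z f x = cis (B (snd Z) x + B (snd Z) (fst Z) / 2) * f (x + fst Z)"
  by (simp add: schroedinger_def predual_vec_def)

lemma B_continuous:
  assumes "continuous_on S f" "continuous_on S g"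
  shows "continuous_on S (\<lambda>x. B (f x) (g x))"
proof -
  have "bounded_bilinear B" using bilin by (simp add: bilinear_conv_bounded_bilinear)
  from bounded_bilinear.continuous_on[OF this assms] show ?thesis .
qed

lemma B_measurable [measurable]:
  assumes [measurable]: "f \<in> borel_measurable M" "g \<in> borel_measurable M"
  shows "(\<lambda>x. B (f x) (g x)) \<in> borel_measurable M"
proof -
  have c: "(\<lambda>p. B (fst p) (snd p)) \<in> borel_measurable borel"
    by (intro borel_measurable_continuous_onI B_continuous continuous_intros)
  have "(\<lambda>x. (f x, g x)) \<in> measurable M (borel \<Otimes>\<^sub>M borel)" by measurable
  then have "(\<lambda>x. (f x, g x)) \<in> borel_measurable M" by (simp add: borel_prod)
  from measurable_compose[OF this c] show ?thesis by simp
qed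

lemma L2_\<pi>\<^sub>S:
  assumes f: "f \<in> L2_functions" shows "\<pi>\<^sub>S Z f \<in> L2_functions"
proof -
  note [measurable] = L2_measurable[OF f]
  have "integrable lborel (\<lambda>x. (norm (f (x + fst Z)))\<^sup>2)"
    using f by (intro integrable_lborel_translate[of "\<lambda>x. (norm (f x))\<^sup>2"]) (simp add: L2_functions_def)
  moreover have "\<pi>\<^sub>S Z f \<in> borel_measurable borel" unfolding \<pi>\<^sub>S_eq[abs_def] by measurable
  ultimately show ?thesis by (simp add: L2_functions_def \<pi>\<^sub>S_eq norm_mult)
qed

lemma L2_inner_\<pi>\<^sub>S:
  assumes f: "f \<in> L2_functions" and g: "g \<in> L2_functions"
  shows "L2_inner (\<pi>\<^sub>S X f) g = L2_inner f (\<pi>\<^sub>S (- X) g)"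
proof -
  note [measurable] = L2_measurable[OF f] L2_measurable[OF g]
  have "L2_inner (\<pi>\<^sub>S X f) g = (LINT x|lborel. \<pi>\<^sub>S X f (x + - fst X) * cnj (g (x + - fst X)))"
    unfolding L2_inner_def
    by (rule integral_lborel_translate[symmetric]) (use L2_measurable[OF L2_\<pi>\<^sub>S[OF f]] in measurable)
  also have "\<dots> = L2_inner f (\<pi>\<^sub>S (- X) g)"
    unfolding L2_inner_def
  proof (rule Bochner_Integration.integral_cong[OF refl])
    fix x
    show "\<pi>\<^sub>S X f (x + - fst X) * cnj (g (x + - fst X)) = f x * cnj (\<pi>\<^sub>S (- X) g x)"
      by (simp add: \<pi>\<^sub>S_eq B_simps cis_cnj mult_ac)
  qed
  finally show ?thesis .
qed

lemma norm_square_\<pi>\<^sub>S: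
  assumes f: "f \<in> L2_functions"
  shows "(LINT x|lborel. (norm (\<pi>\<^sub>S Z f x))\<^sup>2) = (LINT x|lborel. (norm (f x))\<^sup>2)"
  using L2_measurable[OF f] integral_lborel_translate[of "\<lambda>x. (norm (f x))\<^sup>2" "fst Z"]
  by (simp add: \<pi>\<^sub>S_eq norm_mult)

lemma \<pi>\<^sub>S_pair_measurable:
  assumes [measurable]: "f \<in> borel_measurable borel"
  shows "(\<lambda>p. \<pi>\<^sub>S (fst p) f (snd p)) \<in> borel_measurable (borel \<Otimes>\<^sub>M borel)"
  unfolding \<pi>\<^sub>S_eq by measurable

text \<open>Licenses Fubini for the weak integral: by unitarity the integral of
  \<open>\<pi>\<^sub>S Z f x * cnj (g x)\<close> in absolute value is bounded uniformly in
  \<open>Z\<close>, and \<open>c\<close> is integrable.\<close>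

lemma weyl_integrable:
  fixes c :: "'v \<times> 'v \<Rightarrow> complex"
  assumes c: "integrable lborel c" and f: "f \<in> L2_functions" and g: "g \<in> L2_functions"
  shows "integrable (lborel \<Otimes>\<^sub>M lborel) (\<lambda>(Z, x). c Z * (\<pi>\<^sub>S Z f x * cnj (g x)))"
proof (rule lborel_pair.Fubini_integrable)
  note [measurable] = L2_measurable[OF f] L2_measurable[OF g] \<pi>\<^sub>S_pair_measurable[OF L2_measurable[OF f]]
    borel_measurable_integrable[OF c]
  define R where "R = (LINT x|lborel. (norm (f x))\<^sup>2) + (LINT x|lborel. (norm (g x))\<^sup>2)"
  show m: "(\<lambda>(Z, x). c Z * (\<pi>\<^sub>S Z f x * cnj (g x))) \<in> borel_measurable (lborel \<Otimes>\<^sub>M lborel)"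
    unfolding case_prod_unfold by measurable
  show "AE Z in lborel. integrable lborel (\<lambda>x. case (Z, x) of (Z, x) \<Rightarrow> c Z * (\<pi>\<^sub>S Z f x * cnj (g x)))"
    using L2_mult_integrable(1)[OF L2_\<pi>\<^sub>S[OF f] g] by (intro AE_I2) (simp add: integrable_mult_right)
  show "integrable lborel (\<lambda>Z. LINT x|lborel. norm (case (Z, x) of (Z, x) \<Rightarrow> c Z * (\<pi>\<^sub>S Z f x * cnj (g x))))"
  proof (rule Bochner_Integration.integrable_bound)
    show "integrable lborel (\<lambda>Z. norm (c Z) * R)" using c by (intro integrable_mult_left integrable_norm)
    show "(\<lambda>Z. LINT x|lborel. norm (case (Z, x) of (Z, x) \<Rightarrow> c Z * (\<pi>\<^sub>S Z f x * cnj (g x)))) \<in> borel_measurable lborel"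
      using m by (intro lborel.borel_measurable_lebesgue_integral) (simp add: case_prod_unfold)
    show "AE Z in lborel. norm (LINT x|lborel. norm (case (Z, x) of (Z, x) \<Rightarrow> c Z * (\<pi>\<^sub>S Z f x * cnj (g x)))) \<le> norm (norm (c Z) * R)"
    proof (rule AE_I2)
      fix Z
      have le: "(LINT x|lborel. norm (\<pi>\<^sub>S Z f x * cnj (g x))) \<le> R"
        using L2_mult_integrable(2)[OF L2_\<pi>\<^sub>S[OF f] g] unfolding norm_square_\<pi>\<^sub>S[OF f] R_def .
      have "(LINT x|lborel. norm (c Z * (\<pi>\<^sub>S Z f x * cnj (g x)))) = norm (c Z) * (LINT x|lborel. norm (\<pi>\<^sub>S Z f x * cnj (g x)))"
        unfolding norm_mult[of "c Z"] by (rule integral_mult_right_zero)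
      also have "\<dots> \<le> norm (c Z) * R" using le by (intro mult_left_mono) auto
      finally show "norm (LINT x|lborel. norm (case (Z, x) of (Z, x) \<Rightarrow> c Z * (\<pi>\<^sub>S Z f x * cnj (g x)))) \<le> norm (norm (c Z) * R)"
        using integral_nonneg_AE[of "\<lambda>x. norm (c Z * (\<pi>\<^sub>S Z f x * cnj (g x)))" lborel] by simp
    qed
  qed
qed

text \<open>The weak operator integral realized pointwise on representatives. It supplies the
  operator whose existence \<open>pi_sharp\<close> asks for.\<close>

definition weyl_op :: "('v \<times> 'v \<Rightarrow> complex) \<Rightarrow> ('v \<Rightarrow> complex) \<Rightarrow> 'v \<Rightarrow> complex" where
  "weyl_op c f x = (LINT Z|lborel. c Z * \<pi>\<^sub>S Z f x)"

lemma L2_inner_weyl_op: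
  assumes c: "integrable lborel c" and f: "f \<in> L2_functions" and g: "g \<in> L2_functions"
  shows "L2_inner (weyl_op c f) g = (LINT Z|lborel. c Z * L2_inner (\<pi>\<^sub>S Z f) g)"
proof -
  have "(LINT Z|lborel. c Z * L2_inner (\<pi>\<^sub>S Z f) g) = (LINT Z|lborel. LINT x|lborel. c Z * (\<pi>\<^sub>S Z f x * cnj (g x)))"
    unfolding L2_inner_def by (simp only: integral_mult_right_zero)
  also have "\<dots> = (LINT x|lborel. LINT Z|lborel. c Z * (\<pi>\<^sub>S Z f x * cnj (g x)))"
    by (rule lborel_pair.Fubini_integral[OF weyl_integrable[OF c f g], symmetric])
  also have "\<dots> = L2_inner (weyl_op c f) g"
    unfolding L2_inner_def weyl_op_def mult.assoc[symmetric] by (simp only: integral_mult_left_zero)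
  finally show ?thesis by simp
qed

text \<open>Cauchy-Schwarz with the modulus of \<open>c\<close> split into two square roots,
  followed by Tonelli, bounds the squared norm by the squared L^1 norm of \<open>c\<close> times
  that of \<open>f\<close>.\<close>

lemma weyl_op_L2:
  assumes c: "integrable lborel c" and f: "f \<in> L2_functions"
  shows "weyl_op c f \<in> L2_functions"
proof -
  note [measurable] = L2_measurable[OF f] \<pi>\<^sub>S_pair_measurable[OF L2_measurable[OF f]] borel_measurable_integrable[OF c]
  have m[measurable]: "weyl_op c f \<in> borel_measurable borel"
  proof -
    have "(\<lambda>(x, Z). c Z * \<pi>\<^sub>S Z f x) \<in> borel_measurable (borel \<Otimes>\<^sub>M lborel)"
      unfolding case_prod_unfold \<pi>\<^sub>S_eq by measurable
    then show ?thesis unfolding weyl_op_def[abs_def] by (rule lborel.borel_measurable_lebesgue_integral)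
  qed
  define C where "C = (\<integral>\<^sup>+Z. ennreal (norm (c Z)) \<partial>lborel)"
  have C: "C < \<infinity>" using c unfolding C_def by (simp add: integrable_iff_bounded)
  define R where "R = (\<integral>\<^sup>+x. ennreal ((norm (f x))\<^sup>2) \<partial>lborel)"
  have R: "R < \<infinity>" using f unfolding R_def L2_functions_def by (simp add: integrable_iff_bounded)
  have pt: "ennreal ((norm (weyl_op c f x))\<^sup>2) \<le> C * (\<integral>\<^sup>+Z. ennreal (norm (c Z)) * ennreal ((norm (f (x + fst Z)))\<^sup>2) \<partial>lborel)" for x
  proof -
    let ?a = "\<lambda>Z. ennreal (sqrt (norm (c Z)))" and ?b = "\<lambda>Z. ennreal (sqrt (norm (c Z)) * norm (f (x + fst Z)))"
    have "ennreal (norm (weyl_op c f x)) \<le> (\<integral>\<^sup>+Z. ennreal (norm (c Z * \<pi>\<^sub>S Z f x)) \<partial>lborel)"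
      unfolding weyl_op_def
      by (cases "integrable lborel (\<lambda>Z. c Z * \<pi>\<^sub>S Z f x)") (auto intro: integral_norm_bound_ennreal simp: not_integrable_integral_eq)
    also have "\<dots> = (\<integral>\<^sup>+Z. ?a Z * ?b Z \<partial>lborel)"
      by (intro nn_integral_cong) (simp add: norm_mult \<pi>\<^sub>S_eq mult.assoc[symmetric] flip: ennreal_mult)
    finally have "(ennreal (norm (weyl_op c f x)))\<^sup>2 \<le> (\<integral>\<^sup>+Z. ?a Z * ?b Z \<partial>lborel)\<^sup>2"
      by (intro power_mono) auto
    also have "\<dots> \<le> (\<integral>\<^sup>+Z. (?a Z)\<^sup>2 \<partial>lborel) * (\<integral>\<^sup>+Z. (?b Z)\<^sup>2 \<partial>lborel)"
      by (rule Cauchy_Schwarz_nn_integral) measurable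
    also have "\<dots> = C * (\<integral>\<^sup>+Z. ennreal (norm (c Z)) * ennreal ((norm (f (x + fst Z)))\<^sup>2) \<partial>lborel)"
      unfolding C_def by (simp add: ennreal_power power_mult_distrib ennreal_mult)
    finally show ?thesis by (simp add: ennreal_power)
  qed
  have "(\<integral>\<^sup>+x. ennreal ((norm (weyl_op c f x))\<^sup>2) \<partial>lborel)
      \<le> (\<integral>\<^sup>+x. C * (\<integral>\<^sup>+Z. ennreal (norm (c Z)) * ennreal ((norm (f (x + fst Z)))\<^sup>2) \<partial>lborel) \<partial>lborel)"
    by (rule nn_integral_mono) (rule pt)
  also have "\<dots> = C * (\<integral>\<^sup>+x. (\<integral>\<^sup>+Z. ennreal (norm (c Z)) * ennreal ((norm (f (x + fst Z)))\<^sup>2) \<partial>lborel) \<partial>lborel)"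
    by (rule nn_integral_cmult) measurable
  also have "(\<integral>\<^sup>+x. (\<integral>\<^sup>+Z. ennreal (norm (c Z)) * ennreal ((norm (f (x + fst Z)))\<^sup>2) \<partial>lborel) \<partial>lborel)
      = (\<integral>\<^sup>+Z. (\<integral>\<^sup>+x. ennreal (norm (c Z)) * ennreal ((norm (f (x + fst Z)))\<^sup>2) \<partial>lborel) \<partial>lborel)"
    by (rule lborel_pair.Fubini'[symmetric]) measurable
  also have "\<dots> = (\<integral>\<^sup>+Z. ennreal (norm (c Z)) * R \<partial>lborel)"
  proof (rule nn_integral_cong)
    fix Z :: "'v \<times> 'v"
    have "(\<integral>\<^sup>+x. ennreal ((norm (f (x + fst Z)))\<^sup>2) \<partial>lborel) = R"
      unfolding R_def by (rule nn_integral_lborel_translate) measurable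
    then show "(\<integral>\<^sup>+x. ennreal (norm (c Z)) * ennreal ((norm (f (x + fst Z)))\<^sup>2) \<partial>lborel) = ennreal (norm (c Z)) * R"
      by (subst nn_integral_cmult) auto
  qed
  also have "\<dots> = C * R" unfolding C_def by (rule nn_integral_multc) measurable
  finally have "(\<integral>\<^sup>+x. ennreal ((norm (weyl_op c f x))\<^sup>2) \<partial>lborel) < \<infinity>"
    using C R by (auto simp: ennreal_mult_less_top intro: le_less_trans)
  then show ?thesis unfolding L2_functions_def integrable_iff_bounded by simp
qed

text \<open>If \<open>\<integral> c(Z) \<langle>\<pi>(Z) f, g\<rangle> dZ\<close> vanishes for all \<open>f\<close> and \<open>g\<close>, then replacing them by
  \<open>\<pi>(X) f\<close> and \<open>\<pi>(X) g\<close> shows that the Fourier transform of \<open>c(Z) \<langle>\<pi>(Z) f, g\<rangle>\<close> vanishes.\<close>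

lemma weyl_injective:
  fixes c :: "'v \<times> 'v \<Rightarrow> complex"
  assumes ci: "integrable lborel c" and cc: "continuous_on UNIV c" and cb: "\<And>Z. norm (c Z) \<le> D"
    and zero: "\<And>f g. f \<in> L2_functions \<Longrightarrow> g \<in> L2_functions \<Longrightarrow>
      (LINT Z|lborel. c Z * L2_inner (\<pi>\<^sub>S Z f) g) = 0"
  shows "c Z0 = 0"
proof -
  \<comment> \<open>The choice of \<open>g\<close> makes the matrix coefficient at \<open>Z0\<close>
    the squared norm of a Gaussian, so that vanishing of \<open>h Z0\<close> forces
    \<open>c Z0 = 0\<close>.\<close>
  define f where "f = (\<lambda>x::'v. complex_of_real (gauss x))"
  define g where "g = \<pi>\<^sub>S Z0 f"
  have f: "f \<in> L2_functions" and g: "g \<in> L2_functions"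
    unfolding g_def f_def by (auto intro: L2_\<pi>\<^sub>S gauss_L2)
  note [measurable] = L2_measurable[OF f] L2_measurable[OF g] borel_measurable_integrable[OF ci]
  define A where "A = (\<lambda>Z. L2_inner (\<pi>\<^sub>S Z f) g)"
  have gi: "integrable lborel (\<lambda>x. norm (g x))"
    unfolding g_def \<pi>\<^sub>S_eq f_def norm_mult using integrable_lborel_translate[OF gauss_integrable, of "fst Z0"] by simp
  have Ac: "continuous_on UNIV A"
    unfolding A_def L2_inner_def
  proof (rule continuous_on_LINT[where w = "\<lambda>x. norm (g x)"])
    show "continuous_on UNIV (\<lambda>X. \<pi>\<^sub>S X f x * cnj (g x))" for x
      unfolding \<pi>\<^sub>S_eq f_def gauss_def by (intro continuous_intros B_continuous) auto
    show "(\<lambda>x. \<pi>\<^sub>S X f x * cnj (g x)) \<in> borel_measurable borel" for X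
      using L2_measurable[OF L2_\<pi>\<^sub>S[OF f]] by measurable
    show "norm (\<pi>\<^sub>S X f x * cnj (g x)) \<le> norm (g x)" for X x
      by (auto simp: \<pi>\<^sub>S_eq f_def norm_mult intro!: mult_left_le_one_le less_imp_le[OF gauss_bounds(1)])
  qed (rule gi)
  have Ab: "norm (A Z) \<le> (LINT x|lborel. norm (g x))" for Z
  proof -
    have "norm (A Z) \<le> (LINT x|lborel. norm (\<pi>\<^sub>S Z f x * cnj (g x)))"
      unfolding A_def L2_inner_def by (rule integral_norm_bound)
    also have "\<dots> \<le> (LINT x|lborel. norm (g x))"
    proof (rule integral_mono[OF _ gi])
      show "integrable lborel (\<lambda>x. norm (\<pi>\<^sub>S Z f x * cnj (g x)))"
        by (rule integrable_norm[OF L2_mult_integrable(1)[OF L2_\<pi>\<^sub>S[OF f] g]])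
      show "norm (\<pi>\<^sub>S Z f x * cnj (g x)) \<le> norm (g x)" for x
        by (auto simp: \<pi>\<^sub>S_eq f_def norm_mult intro!: mult_left_le_one_le less_imp_le[OF gauss_bounds(1)])
    qed
    finally show ?thesis .
  qed
  define h where "h = (\<lambda>Z. c Z * A Z)"
  have [measurable]: "A \<in> borel_measurable borel" using Ac by (rule borel_measurable_continuous_onI)
  have hi: "integrable lborel h"
  proof (rule Bochner_Integration.integrable_bound)
    show "integrable lborel (\<lambda>Z. norm (c Z) * (LINT x|lborel. norm (g x)))"
      using ci by (intro integrable_mult_left integrable_norm)
    show "AE Z in lborel. norm (h Z) \<le> norm (norm (c Z) * (LINT x|lborel. norm (g x)))"
      unfolding h_def norm_mult by (intro AE_I2 mult_mono) (auto simp: Ab)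
  qed (simp add: h_def)
  have "fourier h (symp X) = 0" for X
  proof -
    \<comment> \<open>Conjugation by \<open>\<pi>\<^sub>S X\<close> multiplies
      \<open>\<pi>\<^sub>S Z\<close> by a character in \<open>Z\<close>, the
      representation-theoretic form of the commutation relation.\<close>
    have "L2_inner (\<pi>\<^sub>S Z (\<pi>\<^sub>S X f)) (\<pi>\<^sub>S X g) = A Z * cis (- (symp X \<bullet> Z))" for Z
    proof -
      let ?u = "\<lambda>x. (\<pi>\<^sub>S Z f x * cnj (g x)) * cis (- (symp X \<bullet> Z))"
      have "\<pi>\<^sub>S Z (\<pi>\<^sub>S X f) x * cnj (\<pi>\<^sub>S X g x) = ?u (x + fst X)" for x
      proof -
        have "(cis (B (snd Z) x + B (snd Z) (fst Z) / 2) * cis (B (snd X) (x + fst Z) + B (snd X) (fst X) / 2))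
            * cnj (cis (B (snd X) x + B (snd X) (fst X) / 2))
          = cis (B (snd Z) (x + fst X) + B (snd Z) (fst Z) / 2) * cis (- (symp X \<bullet> Z))"
          by (simp add: cis_cnj cis_mult symp_inner omega_eq B_simps algebra_simps)
        then have "((cis (B (snd Z) x + B (snd Z) (fst Z) / 2) * cis (B (snd X) (x + fst Z) + B (snd X) (fst X) / 2))
            * cnj (cis (B (snd X) x + B (snd X) (fst X) / 2))) * (f (x + fst Z + fst X) * cnj (g (x + fst X)))
          = (cis (B (snd Z) (x + fst X) + B (snd Z) (fst Z) / 2) * cis (- (symp X \<bullet> Z))) * (f (x + fst X + fst Z) * cnj (g (x + fst X)))"
          by (simp add: add_ac)
        then show ?thesis by (simp only: \<pi>\<^sub>S_eq complex_cnj_mult mult_ac)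
      qed
      then have "L2_inner (\<pi>\<^sub>S Z (\<pi>\<^sub>S X f)) (\<pi>\<^sub>S X g) = (LINT x|lborel. ?u (x + fst X))"
        unfolding L2_inner_def by (simp only:)
      also have "\<dots> = (LINT x|lborel. ?u x)"
        by (rule integral_lborel_translate) (use L2_measurable[OF L2_\<pi>\<^sub>S[OF f]] in measurable)
      also have "\<dots> = A Z * cis (- (symp X \<bullet> Z))"
        unfolding A_def L2_inner_def by (rule integral_mult_left_zero)
      finally show ?thesis .
    qed
    then have "fourier h (symp X) = (LINT Z|lborel. c Z * L2_inner (\<pi>\<^sub>S Z (\<pi>\<^sub>S X f)) (\<pi>\<^sub>S X g))"
      unfolding fourier_def h_def by (simp add: mult.assoc)
    then show ?thesis using zero[OF L2_\<pi>\<^sub>S[OF f] L2_\<pi>\<^sub>S[OF g]] by simp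
  qed
  \<comment> \<open>As \<open>symp\<close> is onto, the vectors \<open>symp X\<close> exhaust all
    frequencies.\<close>
  then have four0: "fourier h = (\<lambda>_. 0)"
    using bij_symp by (metis (no_types) bij_pointE ext)
  have "(LINT \<eta>|lborel. fourier h \<eta> * cis (\<eta> \<bullet> Z0)) = (2 * pi) ^ DIM('v \<times> 'v) * h Z0"
  proof (rule fourier_inversion[OF _ _ hi])
    show "continuous_on UNIV h" unfolding h_def by (intro continuous_intros cc Ac)
    show "norm (h Z) \<le> D * (LINT x|lborel. norm (g x))" for Z
      unfolding h_def norm_mult using cb Ab order_trans[OF norm_ge_zero cb] by (intro mult_mono) auto
  qed (simp add: four0)
  then have "h Z0 = 0" by (simp add: four0)
  moreover have "A Z0 \<noteq> 0"
  proof -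
    have "A Z0 = (LINT x|lborel. complex_of_real ((norm (g x))\<^sup>2))"
      unfolding A_def L2_inner_def g_def[symmetric] complex_norm_square ..
    also have "\<dots> = complex_of_real (LINT x|lborel. (norm (g x))\<^sup>2)" by (rule integral_complex_of_real)
    also have "(LINT x|lborel. (norm (g x))\<^sup>2) = (LINT x|lborel. (gauss (x::'v))\<^sup>2)"
      unfolding g_def norm_square_\<pi>\<^sub>S[OF f] by (simp add: f_def)
    finally have A0: "A Z0 = complex_of_real (LINT x|lborel. (gauss (x::'v))\<^sup>2)" .
    have I: "integrable lborel (\<lambda>x::'v. (gauss x)\<^sup>2)" using gauss_L2 by (simp add: L2_functions_def)
    have "(LINT x|lborel. (gauss (x::'v))\<^sup>2) \<noteq> 0"
    proof
      assume "(LINT x|lborel. (gauss (x::'v))\<^sup>2) = 0"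
      then have "AE x::'v in lborel. (gauss x)\<^sup>2 = 0" by (subst (asm) integral_nonneg_eq_0_iff_AE[OF I]) auto
      then have "AE x::'v in lborel. False" by (rule AE_mp) (auto simp: less_imp_neq[OF gauss_bounds(1), symmetric])
      then show False by (simp add: AE_iff_measurable[OF _ refl])
    qed
    then show ?thesis unfolding A0 by simp
  qed
  ultimately show ?thesis by (simp add: h_def)
qed

text \<open>In the chart, the Liouville density and the factor of the predual measure combine into
  one nonzero constant, which cancels whenever two symbols are compared.\<close>

lemma is_Op_iff:
  assumes a: "a \<in> schwartz_orbit" and k: "k > 0" "predual_measure B = scale_measure (ennreal k) lborel"
  shows "is_Op B a T \<longleftrightarrow> (\<forall>f\<in>L2_functions. T f \<in> L2_functions) \<and>
    (\<forall>f\<in>L2_functions. \<forall>g\<in>L2_functions. L2_inner (T f) g =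
      of_real (k * liouville_density) * (LINT Z|lborel. fourier (\<lambda>y. a (chart y)) Z * L2_inner (\<pi>\<^sub>S Z f) g))"
proof -
  let ?h = "\<lambda>y. a (chart y)"
  have h: "?h \<in> schwartz_space" using a by (simp add: schwartz_orbit_iff)
  have "(LINT X|predual_measure B. orbit_fourier B a X * L2_inner (\<pi>\<^sub>S X f) g)
      = of_real (k * liouville_density) * (LINT Z|lborel. fourier ?h Z * L2_inner (\<pi>\<^sub>S Z f) g)"
    if f: "f \<in> L2_functions" and g: "g \<in> L2_functions" for f g
  proof -
    note [measurable] = L2_measurable[OF g] \<pi>\<^sub>S_pair_measurable[OF L2_measurable[OF f]]
      fourier_measurable[OF schwartz_measurable[OF h]]
    have [measurable]: "(\<lambda>Z. L2_inner (\<pi>\<^sub>S Z f) g) \<in> borel_measurable borel"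
      unfolding L2_inner_def
      by (rule lborel.borel_measurable_lebesgue_integral) (simp add: case_prod_unfold)
    have "(LINT X|predual_measure B. orbit_fourier B a X * L2_inner (\<pi>\<^sub>S X f) g)
        = (LINT X|lborel. k *\<^sub>R (orbit_fourier B a X * L2_inner (\<pi>\<^sub>S X f) g))"
      unfolding k(2) scale_measure_eq_density orbit_fourier_eq[OF schwartz_measurable[OF h]]
      using k(1) by (intro integral_density) auto
    also have "\<dots> = (LINT X|lborel. of_real (k * liouville_density) * (fourier ?h X * L2_inner (\<pi>\<^sub>S X f) g))"
      unfolding orbit_fourier_eq[OF schwartz_measurable[OF h]] by (simp add: scaleR_conv_of_real mult.assoc)
    also have "\<dots> = of_real (k * liouville_density) * (LINT Z|lborel. fourier ?h Z * L2_inner (\<pi>\<^sub>S Z f) g)"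
      by (rule integral_mult_right_zero)
    finally show ?thesis .
  qed
  then show ?thesis unfolding is_Op_def by simp
qed

lemma is_Op_weyl_op:
  assumes a: "a \<in> schwartz_orbit" and k: "k > 0" "predual_measure B = scale_measure (ennreal k) lborel"
  shows "is_Op B a (weyl_op (\<lambda>Z. of_real (k * liouville_density) * fourier (\<lambda>y. a (chart y)) Z))"
proof -
  have "(\<lambda>y. a (chart y)) \<in> schwartz_space" using a by (simp add: schwartz_orbit_iff)
  then have i: "integrable lborel (\<lambda>Z. of_real (k * liouville_density) * fourier (\<lambda>y. a (chart y)) Z)"
    by (intro integrable_mult_right fourier_integrable)
  show ?thesis
    unfolding is_Op_iff[OF assms] using weyl_op_L2[OF i] L2_inner_weyl_op[OF i]
    by (simp add: mult.assoc del: of_real_mult)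
qed

text \<open>With \<open>m = symp (X + Y/2)\<close>, so that \<open>m \<bullet> Z = \<langle>\<xi>\<^sub>0, [X + Y/2, Z]\<rangle>\<close>, the symbol of
  \<open>\<pi>(X + Y) Op(\<Phi>) \<pi>(X)\<^sup>-\<^sup>1\<close> is, in the chart and up to a phase, \<open>y \<mapsto> e\<^sup>i\<^sup>Y\<^sup>y \<Phi>(y + m)\<close>.\<close>

definition moved_symbol :: "'v \<times> 'v \<Rightarrow> 'v \<times> 'v \<Rightarrow> ('v orbit \<Rightarrow> complex) \<Rightarrow> 'v orbit \<Rightarrow> complex" where
  "moved_symbol X Y \<Phi> \<xi> = cis (omega B X Y / 2) *
     tf (- symp (X + (1/2) *\<^sub>R Y)) Y (\<lambda>y. \<Phi> (chart y)) (inv_into UNIV chart \<xi>)"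

lemma moved_symbol_chart:
  "(\<lambda>y. moved_symbol X Y \<Phi> (chart y)) = (\<lambda>y. cis (omega B X Y / 2) * tf (- symp (X + (1/2) *\<^sub>R Y)) Y (\<lambda>y. \<Phi> (chart y)) y)"
  by (simp add: moved_symbol_def)

lemma moved_symbol_schwartz: "\<Phi> \<in> schwartz_orbit \<Longrightarrow> moved_symbol X Y \<Phi> \<in> schwartz_orbit"
  unfolding schwartz_orbit_iff moved_symbol_chart by (intro schwartz_cmult schwartz_tf)

text \<open>Modulation by \<open>Y\<close> shifts the transform by \<open>Y\<close>, and translation
  multiplies it by a character. The phase in the definition of \<open>moved_symbol\<close> is chosen
  so that the total agrees with that of \<open>\<pi>\<^sub>S_conjugate\<close>.\<close>

lemma fourier_moved_symbol:
  assumes \<Phi>: "\<Phi> \<in> schwartz_orbit"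
  shows "fourier (\<lambda>y. moved_symbol X Y \<Phi> (chart y)) (Z + Y)
    = cis (omega B X Z + omega B Y Z / 2 + omega B X Y / 2) * fourier (\<lambda>y. \<Phi> (chart y)) Z"
proof -
  let ?h = "\<lambda>y. \<Phi> (chart y)"
  let ?m = "symp (X + (1/2) *\<^sub>R Y)"
  let ?u = "\<lambda>y. cis (omega B X Y / 2) * cis (Z \<bullet> ?m) * (?h y * cis (- (Z \<bullet> y)))"
  have h: "?h \<in> schwartz_space" using \<Phi> by (simp add: schwartz_orbit_iff)
  note [measurable] = schwartz_measurable[OF h]
  have "fourier (\<lambda>y. moved_symbol X Y \<Phi> (chart y)) (Z + Y) = (LINT y|lborel. ?u (y + ?m))"
    unfolding fourier_def moved_symbol_chart
  proof (rule Bochner_Integration.integral_cong[OF refl])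
    fix y
    have "cis (Y \<bullet> y) * cis (- ((Z + Y) \<bullet> y)) = cis (Z \<bullet> ?m) * cis (- (Z \<bullet> (y + ?m)))"
      by (simp add: cis_mult inner_add_left inner_add_right)
    then have "(cis (Y \<bullet> y) * cis (- ((Z + Y) \<bullet> y))) * (cis (omega B X Y / 2) * ?h (y + ?m))
        = (cis (Z \<bullet> ?m) * cis (- (Z \<bullet> (y + ?m)))) * (cis (omega B X Y / 2) * ?h (y + ?m))" by simp
    then show "cis (omega B X Y / 2) * tf (- ?m) Y ?h y * cis (- ((Z + Y) \<bullet> y)) = ?u (y + ?m)"
      unfolding tf_def by (simp add: mult_ac)
  qed
  also have "\<dots> = (LINT y|lborel. ?u y)" by (rule integral_lborel_translate) measurable
  also have "\<dots> = cis (omega B X Y / 2) * cis (Z \<bullet> ?m) * fourier ?h Z"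
    unfolding fourier_def by (rule integral_mult_right_zero)
  also have "cis (omega B X Y / 2) * cis (Z \<bullet> ?m) = cis (omega B X Z + omega B Y Z / 2 + omega B X Y / 2)"
    by (simp add: cis_mult inner_commute[of Z] symp_inner omega_simps algebra_simps)
  finally show ?thesis .
qed

text \<open>The group product of \<open>X + Y\<close>, \<open>Z\<close> and \<open>- X\<close> has
  predual part \<open>Z + Y\<close>, and the phase is its central coordinate.\<close>

lemma \<pi>\<^sub>S_conjugate:
  "\<pi>\<^sub>S (X + Y) (\<pi>\<^sub>S Z (\<pi>\<^sub>S (- X) f)) x
    = cis (omega B X Z + omega B Y Z / 2 + omega B X Y / 2) * \<pi>\<^sub>S (Z + Y) f x"
proof -
  obtain a b where X: "X = (a, b)" by (cases X)
  obtain c d where Y: "Y = (c, d)" by (cases Y)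
  obtain q p where Z: "Z = (q, p)" by (cases Z)
  have "cis (B (b + d) x + B (b + d) (a + c) / 2) * (cis (B p (x + (a + c)) + B p q / 2) * cis (B (- b) (x + (a + c) + q) + B (- b) (- a) / 2))
      = cis (omega B X Z + omega B Y Z / 2 + omega B X Y / 2) * cis (B (p + d) x + B (p + d) (q + c) / 2)"
    unfolding cis_mult by (rule arg_cong[where f = cis]) (simp add: X Y Z omega_eq B_simps field_simps)
  then have "(cis (B (b + d) x + B (b + d) (a + c) / 2) * (cis (B p (x + (a + c)) + B p q / 2) * cis (B (- b) (x + (a + c) + q) + B (- b) (- a) / 2))) * f (x + (a + c) + q + - a)
      = (cis (omega B X Z + omega B Y Z / 2 + omega B X Y / 2) * cis (B (p + d) x + B (p + d) (q + c) / 2)) * f (x + (q + c))"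
    by (simp add: algebra_simps)
  then show ?thesis unfolding \<pi>\<^sub>S_eq by (simp add: X Y Z mult.assoc)
qed

text \<open>The left factor is moved to \<open>g\<close> as its adjoint, both phases are matched,
  and the substitution of \<open>Z + Y\<close> by \<open>Z\<close> absorbs the shift.
  \<open>T\<close> is an arbitrary operator with symbol \<open>\<Phi>\<close>, as the uniqueness
  part of \<open>pi_sharp_eq\<close> demands.\<close>

lemma is_Op_conjugate:
  assumes \<Phi>: "\<Phi> \<in> schwartz_orbit" and k: "k > 0" "predual_measure B = scale_measure (ennreal k) lborel"
    and T: "is_Op B \<Phi> T"
  shows "is_Op B (moved_symbol X Y \<Phi>) (\<lambda>f. \<pi>\<^sub>S (X + Y) (T (\<pi>\<^sub>S (- X) f)))"
  unfolding is_Op_iff[OF moved_symbol_schwartz[OF \<Phi>] k]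
proof (intro conjI ballI)
  let ?h = "\<lambda>y. \<Phi> (chart y)" and ?h' = "\<lambda>y. moved_symbol X Y \<Phi> (chart y)"
  let ?K = "complex_of_real (k * liouville_density)"
  have T2: "T f \<in> L2_functions" if "f \<in> L2_functions" for f :: "'v \<Rightarrow> complex"
    using T that unfolding is_Op_iff[OF \<Phi> k] by blast
  fix f :: "'v \<Rightarrow> complex" assume f: "f \<in> L2_functions"
  have Tf: "T (\<pi>\<^sub>S (- X) f) \<in> L2_functions" by (intro T2 L2_\<pi>\<^sub>S f)
  show "\<pi>\<^sub>S (X + Y) (T (\<pi>\<^sub>S (- X) f)) \<in> L2_functions" by (intro L2_\<pi>\<^sub>S Tf)
  fix g :: "'v \<Rightarrow> complex" assume g: "g \<in> L2_functions"
  have g': "\<pi>\<^sub>S (- (X + Y)) g \<in> L2_functions" by (intro L2_\<pi>\<^sub>S g)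
  note [measurable] = L2_measurable[OF g] \<pi>\<^sub>S_pair_measurable[OF L2_measurable[OF f]]
      fourier_measurable[OF schwartz_measurable[OF moved_symbol_schwartz[OF \<Phi>, unfolded schwartz_orbit_iff]]]
  have [measurable]: "(\<lambda>Z. L2_inner (\<pi>\<^sub>S Z f) g) \<in> borel_measurable borel"
    unfolding L2_inner_def
    by (rule lborel.borel_measurable_lebesgue_integral) (simp add: case_prod_unfold)
  have "L2_inner (\<pi>\<^sub>S (X + Y) (T (\<pi>\<^sub>S (- X) f))) g = L2_inner (T (\<pi>\<^sub>S (- X) f)) (\<pi>\<^sub>S (- (X + Y)) g)"
    by (rule L2_inner_\<pi>\<^sub>S[OF Tf g])
  also have "\<dots> = ?K * (LINT Z|lborel. fourier ?h Z * L2_inner (\<pi>\<^sub>S Z (\<pi>\<^sub>S (- X) f)) (\<pi>\<^sub>S (- (X + Y)) g))"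
    using T L2_\<pi>\<^sub>S[OF f] g' unfolding is_Op_iff[OF \<Phi> k] by blast
  also have "(LINT Z|lborel. fourier ?h Z * L2_inner (\<pi>\<^sub>S Z (\<pi>\<^sub>S (- X) f)) (\<pi>\<^sub>S (- (X + Y)) g))
      = (LINT Z|lborel. fourier ?h' (Z + Y) * L2_inner (\<pi>\<^sub>S (Z + Y) f) g)"
  proof (rule Bochner_Integration.integral_cong[OF refl])
    fix Z
    let ?c = "cis (omega B X Z + omega B Y Z / 2 + omega B X Y / 2)"
    have "L2_inner (\<pi>\<^sub>S Z (\<pi>\<^sub>S (- X) f)) (\<pi>\<^sub>S (- (X + Y)) g) = L2_inner (\<pi>\<^sub>S (X + Y) (\<pi>\<^sub>S Z (\<pi>\<^sub>S (- X) f))) g"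
      by (rule L2_inner_\<pi>\<^sub>S[symmetric]) (intro L2_\<pi>\<^sub>S f g)+
    also have "\<dots> = ?c * L2_inner (\<pi>\<^sub>S (Z + Y) f) g"
      unfolding L2_inner_def \<pi>\<^sub>S_conjugate mult.assoc by (rule integral_mult_right_zero)
    finally show "fourier ?h Z * L2_inner (\<pi>\<^sub>S Z (\<pi>\<^sub>S (- X) f)) (\<pi>\<^sub>S (- (X + Y)) g)
        = fourier ?h' (Z + Y) * L2_inner (\<pi>\<^sub>S (Z + Y) f) g"
      unfolding fourier_moved_symbol[OF \<Phi>] by (simp only: mult_ac)
  qed
  also have "\<dots> = (LINT Z|lborel. fourier ?h' Z * L2_inner (\<pi>\<^sub>S Z f) g)"
    by (rule integral_lborel_translate[of "\<lambda>Z. fourier ?h' Z * L2_inner (\<pi>\<^sub>S Z f) g"]) measurable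
  finally show "L2_inner (\<pi>\<^sub>S (X + Y) (T (\<pi>\<^sub>S (- X) f))) g = ?K * (LINT Z|lborel. fourier ?h' Z * L2_inner (\<pi>\<^sub>S Z f) g)" .
qed

text \<open>The difference of the two symbols has Fourier transform zero by
  \<open>weyl_injective\<close>, and Fourier inversion carries this back to the symbols.\<close>

lemma is_Op_unique:
  assumes a: "a \<in> schwartz_orbit" "a' \<in> schwartz_orbit"
    and k: "k > 0" "predual_measure B = scale_measure (ennreal k) lborel"
    and T: "is_Op B a T" "is_Op B a' T"
  shows "a = a'"
proof -
  let ?h = "\<lambda>y. a (chart y)" and ?h' = "\<lambda>y. a' (chart y)"
  have h: "?h \<in> schwartz_space" "?h' \<in> schwartz_space" using a by (auto simp: schwartz_orbit_iff)
  let ?d = "\<lambda>y. ?h y - ?h' y"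
  have d: "?d \<in> schwartz_space" by (intro schwartz_diff h)
  have fd: "fourier ?d Z = fourier ?h Z - fourier ?h' Z" for Z
  proof -
    have i: "integrable lborel (\<lambda>s. u s * cis (- (Z \<bullet> s)))" if "u \<in> schwartz_space" for u
      using schwartz_integrable[OF schwartz_tf[OF that, of 0 "- Z"]] by (simp add: tf_def mult.commute)
    show ?thesis unfolding fourier_def left_diff_distrib
      by (rule Bochner_Integration.integral_diff[OF i[OF h(1)] i[OF h(2)]])
  qed
  have four0: "fourier ?d Z0 = 0" for Z0
  proof (rule weyl_injective[OF fourier_integrable[OF d] fourier_continuous[OF schwartz_integrable[OF d]]
      fourier_bounded[OF schwartz_integrable[OF d]]])
    fix f g :: "'v \<Rightarrow> complex" assume f: "f \<in> L2_functions" and g: "g \<in> L2_functions"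
    have i: "integrable lborel (\<lambda>Z. fourier u Z * L2_inner (\<pi>\<^sub>S Z f) g)" if u: "u \<in> schwartz_space" for u
    proof -
      have "integrable lborel (\<lambda>Z. LINT x|lborel. fourier u Z * (\<pi>\<^sub>S Z f x * cnj (g x)))"
        using lborel_pair.integrable_fst'[OF weyl_integrable[OF fourier_integrable[OF u] f g]] by simp
      then show ?thesis unfolding L2_inner_def by (simp only: integral_mult_right_zero)
    qed
    have "complex_of_real (k * liouville_density) \<noteq> 0" using k(1) liouville_density_pos by simp
    moreover have "of_real (k * liouville_density) * (LINT Z|lborel. fourier ?h Z * L2_inner (\<pi>\<^sub>S Z f) g)
        = of_real (k * liouville_density) * (LINT Z|lborel. fourier ?h' Z * L2_inner (\<pi>\<^sub>S Z f) g)"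
    proof -
      have "L2_inner (T f) g = of_real (k * liouville_density) * (LINT Z|lborel. fourier ?h Z * L2_inner (\<pi>\<^sub>S Z f) g)"
        using T(1) f g unfolding is_Op_iff[OF a(1) k] by blast
      moreover have "L2_inner (T f) g = of_real (k * liouville_density) * (LINT Z|lborel. fourier ?h' Z * L2_inner (\<pi>\<^sub>S Z f) g)"
        using T(2) f g unfolding is_Op_iff[OF a(2) k] by blast
      ultimately show ?thesis by (rule trans[OF sym])
    qed
    ultimately have "(LINT Z|lborel. fourier ?h Z * L2_inner (\<pi>\<^sub>S Z f) g) = (LINT Z|lborel. fourier ?h' Z * L2_inner (\<pi>\<^sub>S Z f) g)"
      by (rule mult_left_cancel[THEN iffD1])
    then show "(LINT Z|lborel. fourier ?d Z * L2_inner (\<pi>\<^sub>S Z f) g) = 0"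
      unfolding fd left_diff_distrib Bochner_Integration.integral_diff[OF i[OF h(1)] i[OF h(2)]] by simp
  qed
  have "a (chart x) = a' (chart x)" for x
  proof -
    have "(2 * pi) ^ DIM('v \<times> 'v) * (a (chart x) - a' (chart x)) = 0"
      unfolding schwartz_fourier_inversion[OF d, symmetric] four0 by simp
    then show ?thesis by simp
  qed
  then show "a = a'" by (intro ext) (metis chart_inv)
qed

text \<open>\<open>weyl_op\<close> provides the witness. Operators are functions on representatives,
  hence \<open>T\<close> is not unique; for whichever \<open>T\<close> a competitor
  \<open>\<Psi>\<close> uses, the moved symbol belongs to the same conjugated operator.\<close>

lemma pi_sharp_eq:
  assumes \<Phi>: "\<Phi> \<in> schwartz_orbit" "\<Phi> \<noteq> (\<lambda>_. 0)"
  shows "pi_sharp B (exp_semidirect B (predual_vec X) (predual_vec Y)) \<Phi> = moved_symbol X Y \<Phi>"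
proof -
  obtain k where k: "k > 0" "predual_measure B = scale_measure (ennreal k) lborel"
    using predual_measure_eq[OF \<Phi>] by blast
  obtain h where h: "exp_semidirect B (predual_vec X) (predual_vec Y) = (predual_vec X, h)"
    "predual_vec X \<otimes>\<^bsub>heis_group B\<^esub> h = predual_vec (X + Y)" using exp_semidirect_eq by blast
  note T0 = is_Op_weyl_op[OF \<Phi>(1) k]
  show ?thesis
    unfolding pi_sharp_def h(1) prod.case h(2) inv_predual_vec
  proof (rule the_equality)
    show "moved_symbol X Y \<Phi> \<in> schwartz_orbit \<and> (\<exists>T. is_Op B \<Phi> T \<and>
        is_Op B (moved_symbol X Y \<Phi>) (\<lambda>f. \<pi>\<^sub>S (X + Y) (T (\<pi>\<^sub>S (- X) f))))"
      using moved_symbol_schwartz[OF \<Phi>(1)] T0 is_Op_conjugate[OF \<Phi>(1) k T0] by blast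
  next
    fix \<Psi> assume "\<Psi> \<in> schwartz_orbit \<and> (\<exists>T. is_Op B \<Phi> T \<and> is_Op B \<Psi> (\<lambda>f. \<pi>\<^sub>S (X + Y) (T (\<pi>\<^sub>S (- X) f))))"
    then obtain T where \<Psi>: "\<Psi> \<in> schwartz_orbit" and T: "is_Op B \<Phi> T"
      "is_Op B \<Psi> (\<lambda>f. \<pi>\<^sub>S (X + Y) (T (\<pi>\<^sub>S (- X) f)))" by blast
    show "\<Psi> = moved_symbol X Y \<Phi>"
      by (rule is_Op_unique[OF \<Psi> moved_symbol_schwartz[OF \<Phi>(1)] k T(2) is_Op_conjugate[OF \<Phi>(1) k T(1)]])
  qed
qed

end

section \<open>Modulation spaces of symbols\<close>

lemma mixed_norm_cong:
  "(\<And>X Y. norm (F X Y) = norm (G X Y)) \<Longrightarrow> mixed_norm r s M F = mixed_norm r s M G"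
  by (simp add: mixed_norm_def)

lemma tempered_norm_unimodular:
  assumes "u \<in> tempered_distributions" "f \<in> schwartz_space" "norm c = 1"
  shows "norm (u (\<lambda>x. c * f x)) = norm (u f)"
  by (simp add: tempered_cmult[OF assms(1,2)] norm_mult assms(3))

text \<open>The reference norm of which all three modulation norms are positive multiples, each with
  its own window.\<close>

definition tf_norm :: "ennreal \<Rightarrow> ennreal \<Rightarrow> ('w::euclidean_space \<Rightarrow> complex) \<Rightarrow> (('w \<Rightarrow> complex) \<Rightarrow> complex) \<Rightarrow> ennreal" where
  "tf_norm r s \<gamma> f = mixed_norm r s lborel (\<lambda>y \<eta>. f (tf y \<eta> \<gamma>))"

lemma tempered_tf_measurable:
  assumes "f \<in> tempered_distributions" "\<gamma> \<in> schwartz_space"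
  shows "(\<lambda>p. f (tf (fst p) (snd p) \<gamma>)) \<in> borel_measurable borel"
  using tempered_tf_continuous[OF assms] by (rule borel_measurable_continuous_onI)

text \<open>Uses \<open>window_change\<close> in both directions, hence two nonzero windows; the
  positive factors are absorbed into the constant.\<close>

lemma comparable_norms:
  fixes \<gamma>\<^sub>1 \<gamma>\<^sub>2 :: "'w::euclidean_space \<Rightarrow> complex"
  assumes "\<gamma>\<^sub>1 \<in> schwartz_space" "\<gamma>\<^sub>1 \<noteq> (\<lambda>_. 0)" "\<gamma>\<^sub>2 \<in> schwartz_space" "\<gamma>\<^sub>2 \<noteq> (\<lambda>_. 0)"
    and r: "1 \<le> r" and s: "1 \<le> s" and K: "K\<^sub>1 > 0" "K\<^sub>2 > 0"
    and N: "\<And>f. f \<in> tempered_distributions \<Longrightarrow> N\<^sub>1 f = ennreal K\<^sub>1 * tf_norm r s \<gamma>\<^sub>1 f"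
      "\<And>f. f \<in> tempered_distributions \<Longrightarrow> N\<^sub>2 f = ennreal K\<^sub>2 * tf_norm r s \<gamma>\<^sub>2 f"
  obtains C :: real where "\<And>f. f \<in> tempered_distributions \<Longrightarrow> N\<^sub>1 f \<le> ennreal C * N\<^sub>2 f \<and> N\<^sub>2 f \<le> ennreal C * N\<^sub>1 f"
proof -
  have one: "\<exists>C\<ge>0. \<forall>f\<in>tempered_distributions. ennreal L\<^sub>1 * tf_norm r s \<phi> f \<le> ennreal C * (ennreal L\<^sub>2 * tf_norm r s \<psi> f)"
    if h: "\<phi> \<in> schwartz_space" "\<psi> \<in> schwartz_space" "\<psi> \<noteq> (\<lambda>_. 0)" "L\<^sub>1 > 0" "L\<^sub>2 > 0"
    for \<phi> \<psi> :: "'w \<Rightarrow> complex" and L\<^sub>1 L\<^sub>2 :: real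
  proof -
    obtain C where C: "C \<ge> 0" "\<And>f. f \<in> tempered_distributions \<Longrightarrow> tf_norm r s \<phi> f \<le> ennreal C * tf_norm r s \<psi> f"
      using window_change[OF h(1-3) r s] unfolding tf_norm_def by metis
    have "ennreal L\<^sub>1 * tf_norm r s \<phi> f \<le> ennreal (L\<^sub>1 * C / L\<^sub>2) * (ennreal L\<^sub>2 * tf_norm r s \<psi> f)"
      if f: "f \<in> tempered_distributions" for f
    proof -
      have "ennreal L\<^sub>1 * tf_norm r s \<phi> f \<le> ennreal L\<^sub>1 * (ennreal C * tf_norm r s \<psi> f)"
        by (intro mult_left_mono C f) simp
      also have "\<dots> = ennreal (L\<^sub>1 * C / L\<^sub>2 * L\<^sub>2) * tf_norm r s \<psi> f"
        using h(4,5) C by (simp add: ennreal_mult mult.assoc)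
      also have "\<dots> = ennreal (L\<^sub>1 * C / L\<^sub>2) * (ennreal L\<^sub>2 * tf_norm r s \<psi> f)"
        using h(4,5) C by (subst ennreal_mult) (auto simp: mult.assoc)
      finally show ?thesis .
    qed
    then show ?thesis using h(4,5) C by (intro exI[of _ "L\<^sub>1 * C / L\<^sub>2"]) auto
  qed
  obtain C1 where C1: "C1 \<ge> 0" "\<And>f. f \<in> tempered_distributions \<Longrightarrow> N\<^sub>1 f \<le> ennreal C1 * N\<^sub>2 f"
    using one[OF assms(1,3,4) K] N by auto
  obtain C2 where C2: "C2 \<ge> 0" "\<And>f. f \<in> tempered_distributions \<Longrightarrow> N\<^sub>2 f \<le> ennreal C2 * N\<^sub>1 f"
    using one[OF assms(3,1,2) K(2,1)] N by auto
  have "N\<^sub>1 f \<le> ennreal (max C1 C2) * N\<^sub>2 f \<and> N\<^sub>2 f \<le> ennreal (max C1 C2) * N\<^sub>1 f"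
    if "f \<in> tempered_distributions" for f
    using order_trans[OF C1(2)[OF that] mult_right_mono[OF ennreal_leI[OF max.cobounded1]]]
      order_trans[OF C2(2)[OF that] mult_right_mono[OF ennreal_leI[OF max.cobounded2]]] by simp
  then show ?thesis using that by blast
qed

context
  fixes B :: "'v::euclidean_space \<Rightarrow> 'v \<Rightarrow> real"
  assumes bilin: "bilinear B" and nondeg: "nondegenerate B"
begin

text \<open>The antiduality pairing conjugates the shifted window, so the effective window is the
  conjugate of \<open>\<phi>\<close>. The sign in the form \<open>- omega\<close> and the
  conjugation cancel, giving frequency \<open>symp B Y\<close>; the representation shifts by
  \<open>+ X\<close>, giving translation by \<open>- X\<close>.\<close>

lemma norm_ambiguity:
  assumes f: "f \<in> tempered_distributions" and \<phi>: "\<phi> \<in> schwartz_space"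
  shows "norm (ambiguity (\<lambda>V W. - omega B V W) \<phi> f X Y)
    = norm (f (tf (- X) (symp B Y) (\<lambda>x. cnj (\<phi> x))))"
proof -
  have "(\<lambda>x. cnj (schroedinger (\<lambda>V W. - omega B V W) (X, Y, 0) \<phi> x))
      = (\<lambda>x. cis (omega B Y X / 2) * tf (- X) (symp B Y) (\<lambda>x. cnj (\<phi> x)) x)"
  proof
    fix x
    have "cnj (cis (- omega B Y x + - omega B Y X / 2)) = cis (omega B Y X / 2) * cis (symp B Y \<bullet> x)"
      by (simp add: cis_cnj cis_mult symp_inner[OF bilin nondeg])
    then show "cnj (schroedinger (\<lambda>V W. - omega B V W) (X, Y, 0) \<phi> x)
      = cis (omega B Y X / 2) * tf (- X) (symp B Y) (\<lambda>x. cnj (\<phi> x)) x"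
      by (simp add: schroedinger_def tf_def)
  qed
  then show ?thesis
    unfolding ambiguity_def by (simp only: tempered_norm_unimodular[OF f schwartz_tf[OF schwartz_cnj[OF \<phi>]] norm_cis])
qed

lemma norm_ambiguity_sharp:
  assumes f: "f \<in> tempered_distributions" and \<Phi>: "\<Phi> \<in> schwartz_orbit" "\<Phi> \<noteq> (\<lambda>_. 0)"
  shows "norm (ambiguity_sharp B \<Phi> (comp_orbit_map_inverse B f) X Y)
    = norm (f (tf (- X + - (1/2) *\<^sub>R Y) (symp B Y) (\<lambda>V. cnj (\<Phi> (chart (symp B V))))))"
proof -
  note L = linear_symp[OF bilin nondeg]
  let ?\<gamma> = "\<lambda>V. cnj (\<Phi> (chart (symp B V)))"
  have \<gamma>: "?\<gamma> \<in> schwartz_space"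
    using \<Phi>(1) by (intro schwartz_cnj schwartz_linear_sbd(1)[OF L bij_symp[OF bilin nondeg], of "\<lambda>y. \<Phi> (chart y)"])
      (simp add: schwartz_orbit_iff[OF bilin nondeg])
  have "(\<lambda>\<xi>. cnj (moved_symbol B X Y \<Phi> \<xi>)) \<circ> orbit_map B
      = (\<lambda>V. cis (- (omega B X Y / 2)) * tf (- X + - (1/2) *\<^sub>R Y) (symp B Y) ?\<gamma> V)"
  proof
    fix V
    \<comment> \<open>Skew-symmetry of \<open>omega\<close> compensates for the conjugation, so the
      frequency is \<open>symp B Y\<close>, as for the Schroedinger representation.\<close>
    have "cnj (cis (Y \<bullet> symp B V)) = cis (symp B Y \<bullet> V)"
      using omega_skew[OF bilin nondeg, of Y V]
      by (simp add: cis_cnj inner_commute[of Y] symp_inner[OF bilin nondeg])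
    moreover have "symp B V - - symp B (X + (1/2) *\<^sub>R Y) = symp B (V - (- X + - (1/2) *\<^sub>R Y))"
      by (simp add: linear_add[OF L, symmetric] algebra_simps)
    ultimately show "((\<lambda>\<xi>. cnj (moved_symbol B X Y \<Phi> \<xi>)) \<circ> orbit_map B) V
      = cis (- (omega B X Y / 2)) * tf (- X + - (1/2) *\<^sub>R Y) (symp B Y) ?\<gamma> V"
      by (simp add: orbit_map_eq[OF bilin nondeg] moved_symbol_def[OF bilin nondeg] tf_def cis_cnj)
  qed
  then show ?thesis
    unfolding ambiguity_sharp_def comp_orbit_map_inverse_def pi_sharp_eq[OF bilin nondeg \<Phi>]
    by (simp only: tempered_norm_unimodular[OF f schwartz_tf[OF \<gamma>] norm_cis])
qed

text \<open>Both norms use the linear maps \<open>uminus\<close> and \<open>symp\<close>. They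
  differ in the shift, which is zero in one case and minus half of \<open>Y\<close> in the other,
  and in the measure, which contributes the factor \<open>K'\<close> on the symbol side.\<close>

lemma modulation_norms_eq:
  assumes r: "1 \<le> r" and s: "1 \<le> s" and \<phi>: "\<phi> \<in> schwartz_space"
    and \<Phi>: "\<Phi> \<in> schwartz_orbit" "\<Phi> \<noteq> (\<lambda>_. 0)"
  obtains K\<^sub>1 K\<^sub>2 :: real where "K\<^sub>1 > 0" "K\<^sub>2 > 0"
    "\<And>f. f \<in> tempered_distributions \<Longrightarrow>
      modulation_norm (\<lambda>V W. - omega B V W) \<phi> r s f = ennreal K\<^sub>1 * tf_norm r s (\<lambda>x. cnj (\<phi> x)) f"
    "\<And>f. f \<in> tempered_distributions \<Longrightarrow>
      modulation_norm_sharp B \<Phi> r s (comp_orbit_map_inverse B f)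
      = ennreal K\<^sub>2 * tf_norm r s (\<lambda>V. cnj (\<Phi> (chart (symp B V)))) f"
proof -
  note L = linear_symp[OF bilin nondeg] bij_symp[OF bilin nondeg]
  have u: "linear (uminus :: 'v \<times> 'v \<Rightarrow> _)" "bij (uminus :: 'v \<times> 'v \<Rightarrow> _)"
    by (auto intro!: linearI bij_uminus)
  show ?thesis
  proof (rule mixed_norm_linear[OF u L r s])
    fix K :: real
    assume K: "K > 0" "\<And>(F :: 'v \<times> 'v \<Rightarrow> 'v \<times> 'v \<Rightarrow> complex) a.
        (\<lambda>p. F (fst p) (snd p)) \<in> borel_measurable borel \<Longrightarrow>
        mixed_norm r s lborel (\<lambda>X Y. F (- X + a Y) (symp B Y)) = ennreal K * mixed_norm r s lborel F"
    obtain k where k: "k > 0" "predual_measure B = scale_measure (ennreal k) lborel"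
      using predual_measure_eq[OF bilin nondeg \<Phi>] by blast
    define K' where "K' = scale_factor r k * scale_factor s k"
    have K': "K' > 0" using k(1) by (simp add: K'_def scale_factor_pos)
    have 1: "modulation_norm (\<lambda>V W. - omega B V W) \<phi> r s f = ennreal K * tf_norm r s (\<lambda>x. cnj (\<phi> x)) f"
      if f: "f \<in> tempered_distributions" for f
    proof -
      have "modulation_norm (\<lambda>V W. - omega B V W) \<phi> r s f
          = mixed_norm r s lborel (\<lambda>X Y. f (tf (- X + 0) (symp B Y) (\<lambda>x. cnj (\<phi> x))))"
        unfolding modulation_norm_def by (rule mixed_norm_cong) (simp add: norm_ambiguity[OF f \<phi>])
      also have "\<dots> = ennreal K * tf_norm r s (\<lambda>x. cnj (\<phi> x)) f"
        unfolding tf_norm_def by (rule K(2)[OF tempered_tf_measurable[OF f schwartz_cnj[OF \<phi>]]])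
      finally show ?thesis .
    qed
    have 2: "modulation_norm_sharp B \<Phi> r s (comp_orbit_map_inverse B f)
        = ennreal (K' * K) * tf_norm r s (\<lambda>V. cnj (\<Phi> (chart (symp B V)))) f"
      if f: "f \<in> tempered_distributions" for f
    proof -
      let ?\<gamma> = "\<lambda>V. cnj (\<Phi> (chart (symp B V)))"
      have \<gamma>: "?\<gamma> \<in> schwartz_space"
        using \<Phi>(1) by (intro schwartz_cnj schwartz_linear_sbd(1)[OF L, of "\<lambda>y. \<Phi> (chart y)"])
          (simp add: schwartz_orbit_iff[OF bilin nondeg])
      note m = tempered_tf_measurable[OF f \<gamma>]
      let ?G = "\<lambda>X Y. f (tf (- X + - (1/2) *\<^sub>R Y) (symp B Y) ?\<gamma>)"
      have "modulation_norm_sharp B \<Phi> r s (comp_orbit_map_inverse B f) = mixed_norm r s (scale_measure (ennreal k) lborel) ?G"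
        unfolding modulation_norm_sharp_def k(2) by (rule mixed_norm_cong) (rule norm_ambiguity_sharp[OF f \<Phi>])
      also have "\<dots> = ennreal K' * mixed_norm r s lborel ?G"
        unfolding K'_def
      proof (rule mixed_norm_scale_measure[OF _ k(1) r s])
        note [measurable] = linear_borel_measurable[OF L(1)] fst_snd_borel
        show "(\<lambda>p. ?G (fst p) (snd p)) \<in> borel_measurable borel"
          by (rule slice_measurable[OF m]) measurable
      qed
      also have "mixed_norm r s lborel ?G = ennreal K * tf_norm r s ?\<gamma> f"
        unfolding tf_norm_def by (rule K(2)[OF m])
      finally show ?thesis using K K' by (simp add: ennreal_mult mult.assoc)
    qed
    show ?thesis using that[OF K(1) _ 1 2] K(1) K' by simp
  qed
qed

text \<open>In the chart the map \<open>A\<close> is \<open>symp\<close>; composition with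
  \<open>symp\<close> and with its inverse preserves temperedness, which gives the two
  inclusions.\<close>

lemma tempered_orbit_eq: "tempered_orbit = comp_orbit_map_inverse B ` tempered_distributions"
proof -
  note L = linear_symp[OF bilin nondeg] bij_symp[OF bilin nondeg]
  let ?L' = "inv_into UNIV (symp B)"
  have L': "linear ?L'" "bij ?L'" using L by (auto simp: inj_linear_imp_inv_linear bij_is_inj bij_imp_bij_inv)
  have LL': "symp B (?L' x) = x" for x using L(2) by (simp add: bij_is_surj surj_f_inv_f)
  have "F \<in> comp_orbit_map_inverse B ` tempered_distributions" if F: "F \<in> tempered_orbit" for F
  proof -
    let ?u = "\<lambda>\<psi>. F (\<psi> \<circ> inv_into UNIV chart)"
    have "?u \<in> tempered_distributions" using F by (simp add: tempered_orbit_def)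
    then have t: "(\<lambda>\<psi>. ?u (\<lambda>x. \<psi> (?L' x))) \<in> tempered_distributions" by (rule tempered_linear[OF L'])
    have "F = comp_orbit_map_inverse B (\<lambda>\<psi>. ?u (\<lambda>x. \<psi> (?L' x)))"
    proof
      fix \<Psi> :: "'v orbit \<Rightarrow> complex"
      have "(\<lambda>x. (\<Psi> \<circ> orbit_map B) (?L' x)) \<circ> inv_into UNIV chart = \<Psi>"
        by (rule ext) (simp add: orbit_map_eq[OF bilin nondeg] LL')
      then show "F \<Psi> = comp_orbit_map_inverse B (\<lambda>\<psi>. ?u (\<lambda>x. \<psi> (?L' x))) \<Psi>"
        by (simp add: comp_orbit_map_inverse_def)
    qed
    then show ?thesis using t by (rule image_eqI)
  qed
  moreover have "comp_orbit_map_inverse B f \<in> tempered_orbit" if f: "f \<in> tempered_distributions" for f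
  proof -
    have "\<psi> \<circ> inv_into UNIV chart \<circ> orbit_map B = (\<lambda>x. \<psi> (symp B x))" for \<psi> :: "'v \<times> 'v \<Rightarrow> complex"
      by (auto simp: orbit_map_eq[OF bilin nondeg])
    then show ?thesis using tempered_linear[OF L f] by (simp add: tempered_orbit_def comp_orbit_map_inverse_def)
  qed
  ultimately show ?thesis by blast
qed

lemma inj_comp_orbit_map_inverse: "inj (comp_orbit_map_inverse B)"
proof (rule injI)
  fix f g assume eq: "comp_orbit_map_inverse B f = comp_orbit_map_inverse B g"
  note L = bij_symp[OF bilin nondeg]
  show "f = g"
  proof
    fix \<psi> :: "'v \<times> 'v \<Rightarrow> complex"
    let ?\<Psi> = "\<lambda>\<xi>. \<psi> (inv_into UNIV (symp B) (inv_into UNIV chart \<xi>))"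
    have "?\<Psi> \<circ> orbit_map B = \<psi>" using L by (auto simp: orbit_map_eq[OF bilin nondeg] bij_is_inj)
    then show "f \<psi> = g \<psi>" using fun_cong[OF eq, of ?\<Psi>] by (simp add: comp_orbit_map_inverse_def)
  qed
qed

end

section \<open>Comparison with the classical modulation spaces\<close>

lemma classical_norm_eq:
  fixes \<psi> :: "'w::euclidean_space \<Rightarrow> complex"
  assumes r: "1 \<le> r" and s: "1 \<le> s" and \<psi>: "\<psi> \<in> schwartz_space"
  obtains K :: real where "K > 0" "\<And>f. f \<in> tempered_distributions \<Longrightarrow>
    classical_modulation_norm \<psi> r s f = ennreal K * tf_norm r s (\<lambda>x. cnj (\<psi> x)) f"
proof -
  let ?L = "\<lambda>w::'w. (- (2 * pi)) *\<^sub>R w"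
  have l: "linear ?L" by (intro linearI) (auto simp: algebra_simps)
  have "inj ?L" by (auto simp: inj_on_def)
  then have b: "bij ?L" using linear_injective_imp_surjective[OF l] by (simp add: bij_def)
  have i: "linear (\<lambda>x::'w. x)" "bij (\<lambda>x::'w. x)"
    by (auto intro: linearI bij_id[unfolded id_def])
  show ?thesis
  proof (rule mixed_norm_linear[OF i l b r s])
    fix K :: real
    assume K: "K > 0" "\<And>(F :: 'w \<Rightarrow> 'w \<Rightarrow> complex) a.
        (\<lambda>p. F (fst p) (snd p)) \<in> borel_measurable borel \<Longrightarrow>
        mixed_norm r s lborel (\<lambda>X Y. F (X + a Y) (?L Y)) = ennreal K * mixed_norm r s lborel F"
    have "classical_modulation_norm \<psi> r s f = ennreal K * tf_norm r s (\<lambda>x. cnj (\<psi> x)) f"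
      if f: "f \<in> tempered_distributions" for f
    proof -
      \<comment> \<open>Conjugation turns the classical frequency into \<open>- 2 pi w\<close>, a
        dilation that only contributes to the constant.\<close>
      have "stft \<psi> f x w = f (tf (x + 0) (?L w) (\<lambda>x. cnj (\<psi> x)))" for x w
        unfolding stft_def tf_def by (simp add: cis_cnj)
      then have "classical_modulation_norm \<psi> r s f = mixed_norm r s lborel (\<lambda>x w. f (tf (x + 0) (?L w) (\<lambda>x. cnj (\<psi> x))))"
        unfolding classical_modulation_norm_def by (intro mixed_norm_cong) (simp only:)
      also have "\<dots> = ennreal K * tf_norm r s (\<lambda>x. cnj (\<psi> x)) f"
        unfolding tf_norm_def by (rule K(2)[OF tempered_tf_measurable[OF f schwartz_cnj[OF \<psi>]]])
      finally show ?thesis .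
    qed
    then show ?thesis using that K(1) by blast
  qed
qed

theorem mainTheorem4:
  fixes B :: "'v::euclidean_space \<Rightarrow> 'v \<Rightarrow> real"
    and r s :: ennreal
    and \<phi> \<psi> :: "'v \<times> 'v \<Rightarrow> complex"
    and \<Phi> :: "'v orbit \<Rightarrow> complex"
  assumes "bilinear B" and "nondegenerate B"
    and "1 \<le> r" and "1 \<le> s"
    and "\<phi> \<in> schwartz_space" and "\<phi> \<noteq> (\<lambda>_. 0)"
    and "\<psi> \<in> schwartz_space" and "\<psi> \<noteq> (\<lambda>_. 0)"
    and "\<Phi> \<in> schwartz_orbit" and "\<Phi> \<noteq> (\<lambda>_. 0)"
  shows
    "normed_space_iso (comp_orbit_map_inverse B)
       (modulation_space (\<lambda>V W. - omega B V W) \<phi> r s)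
       (modulation_norm (\<lambda>V W. - omega B V W) \<phi> r s)
       (modulation_space_sharp B \<Phi> r s)
       (modulation_norm_sharp B \<Phi> r s)
     \<and> modulation_space (\<lambda>V W. - omega B V W) \<phi> r s = classical_modulation_space \<psi> r s
     \<and> normed_space_iso (\<lambda>f. f)
       (modulation_space (\<lambda>V W. - omega B V W) \<phi> r s)
       (modulation_norm (\<lambda>V W. - omega B V W) \<phi> r s)
       (classical_modulation_space \<psi> r s)
       (classical_modulation_norm \<psi> r s)"
proof -
  let ?\<beta> = "\<lambda>V W. - omega B V W" and ?T = "comp_orbit_map_inverse B"
  let ?\<phi>' = "\<lambda>x. cnj (\<phi> x)" and ?\<psi>' = "\<lambda>x. cnj (\<psi> x)" and ?\<Phi>' = "\<lambda>V. cnj (\<Phi> (chart (symp B V)))"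
  note L = linear_symp[OF assms(1,2)] bij_symp[OF assms(1,2)]
  have S: "?\<phi>' \<in> schwartz_space" "?\<psi>' \<in> schwartz_space" using assms by (auto intro: schwartz_cnj)
  have S': "?\<Phi>' \<in> schwartz_space"
    using assms(9) by (intro schwartz_cnj schwartz_linear_sbd(1)[OF L, of "\<lambda>y. \<Phi> (chart y)"])
      (simp add: schwartz_orbit_iff[OF assms(1,2)])
  have nz: "?\<phi>' \<noteq> (\<lambda>_. 0)" "?\<psi>' \<noteq> (\<lambda>_. 0)" using assms(6,8) by (auto simp: fun_eq_iff)
  have nz': "?\<Phi>' \<noteq> (\<lambda>_. 0)"
  proof
    assume a: "?\<Phi>' = (\<lambda>_. 0)"
    have "\<Phi> \<xi> = 0" for \<xi>
      using fun_cong[OF a, of "inv_into UNIV (symp B) (inv_into UNIV chart \<xi>)"] L(2)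
      by (simp add: bij_is_surj surj_f_inv_f)
    then show False using assms(10) by auto
  qed
  obtain K1 K2 where K: "K1 > 0" "K2 > 0"
    "\<And>f. f \<in> tempered_distributions \<Longrightarrow> modulation_norm ?\<beta> \<phi> r s f = ennreal K1 * tf_norm r s ?\<phi>' f"
    "\<And>f. f \<in> tempered_distributions \<Longrightarrow> modulation_norm_sharp B \<Phi> r s (?T f) = ennreal K2 * tf_norm r s ?\<Phi>' f"
    using modulation_norms_eq[OF assms(1-5,9,10)] by metis
  obtain K3 where K3: "K3 > 0"
    "\<And>f. f \<in> tempered_distributions \<Longrightarrow> classical_modulation_norm \<psi> r s f = ennreal K3 * tf_norm r s ?\<psi>' f"
    using classical_norm_eq[OF assms(3,4,7)] by metis
  \<comment> \<open>The two bounds hold for every tempered distribution, including those of infinite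
    norm. Finiteness therefore passes both ways, which identifies the spaces themselves and not only
    their norms.\<close>
  obtain C where C: "\<And>f. f \<in> tempered_distributions \<Longrightarrow>
      modulation_norm_sharp B \<Phi> r s (?T f) \<le> ennreal C * modulation_norm ?\<beta> \<phi> r s f \<and>
      modulation_norm ?\<beta> \<phi> r s f \<le> ennreal C * modulation_norm_sharp B \<Phi> r s (?T f)"
    using comparable_norms[OF S' nz' S(1) nz(1) assms(3,4) K(2,1,4,3)] by metis
  obtain D where D: "\<And>f. f \<in> tempered_distributions \<Longrightarrow>
      classical_modulation_norm \<psi> r s f \<le> ennreal D * modulation_norm ?\<beta> \<phi> r s f \<and>
      modulation_norm ?\<beta> \<phi> r s f \<le> ennreal D * classical_modulation_norm \<psi> r s f"
    using comparable_norms[OF S(2) nz(2) S(1) nz(1) assms(3,4) K3(1) K(1) K3(2) K(3)] by metis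
  have fin: "a < \<infinity>" if "a \<le> ennreal c * b" "b < \<infinity>" for a b :: ennreal and c
    using that by (auto simp: ennreal_mult_less_top intro: le_less_trans)
  have eq: "modulation_space ?\<beta> \<phi> r s = classical_modulation_space \<psi> r s"
    unfolding modulation_space_def classical_modulation_space_def using D fin by blast
  have img: "?T ` modulation_space ?\<beta> \<phi> r s = modulation_space_sharp B \<Phi> r s"
    unfolding modulation_space_def modulation_space_sharp_def tempered_orbit_eq[OF assms(1,2)]
    using C fin by blast
  have sub: "modulation_space ?\<beta> \<phi> r s \<subseteq> tempered_distributions" by (auto simp: modulation_space_def)
  have "bij_betw ?T (modulation_space ?\<beta> \<phi> r s) (modulation_space_sharp B \<Phi> r s)"
    unfolding bij_betw_def using img inj_on_subset[OF inj_comp_orbit_map_inverse[OF assms(1,2)]] by blast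
  then have 1: "normed_space_iso ?T (modulation_space ?\<beta> \<phi> r s) (modulation_norm ?\<beta> \<phi> r s)
       (modulation_space_sharp B \<Phi> r s) (modulation_norm_sharp B \<Phi> r s)"
    unfolding normed_space_iso_def using C sub by (auto simp: comp_orbit_map_inverse_def intro!: exI[of _ C])
  have 2: "normed_space_iso (\<lambda>f. f) (modulation_space ?\<beta> \<phi> r s) (modulation_norm ?\<beta> \<phi> r s)
       (classical_modulation_space \<psi> r s) (classical_modulation_norm \<psi> r s)"
    unfolding normed_space_iso_def using D sub eq by (auto simp: bij_betw_def intro!: exI[of _ D])
  show ?thesis using 1 2 eq by blast
qed

end
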